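(* Assume the Riemann hypothesis. Let $x\geq 2$ and set $c := \frac{1}{2} + \frac{2}{\log x}$. Then there is a prime in the open interval $(x-c\sqrt{x}\log x,\ x+c\sqrt{x}\log x)$, and there are at least $\sqrt{x}$ primes in the open interval $(x-(c+1)\sqrt{x}\log x,\ x+(c+1)\sqrt{x}\log x)$.
   Context: The Riemann hypothesis (RH) is the assertion that every nontrivial zero of the Riemann zeta function has real part $1/2$. $\log$ denotes the natural logarithm. *)

theory Defs
  imports "HOL-Complex_Analysis.Complex_Analysis" "HOL-Computational_Algebra.Primes"
begin

text \<open>
  The Riemann zeta function is the analytic continuation of the Dirichlet series to the complex
  plane without the point 1. The value 0 at the pole 1 is a dummy that only makes the total
  function unique. That the definite description below is proper is shown in
  \<open>is_riemann_zeta_riemann_zeta\<close>.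
\<close>

definition is_riemann_zeta :: "(complex \<Rightarrow> complex) \<Rightarrow> bool" where
  "is_riemann_zeta f \<longleftrightarrow>
     f holomorphic_on (- {1}) \<and>
     (\<forall>s. Re s > 1 \<longrightarrow> f s = (\<Sum>n. 1 / of_nat (Suc n) powr s)) \<and>
     f 1 = 0"

definition riemann_zeta :: "complex \<Rightarrow> complex" where
  "riemann_zeta = (THE f. is_riemann_zeta f)"

text \<open>The point 1 is excluded because it is the pole; the trivial zeros are -2, -4, -6, ...\<close>

definition nontrivial_zeta_zero :: "complex \<Rightarrow> bool" where
  "nontrivial_zeta_zero s \<longleftrightarrow>
     s \<noteq> 1 \<and> riemann_zeta s = 0 \<and> (\<forall>n::nat. n \<ge> 1 \<longrightarrow> s \<noteq> - 2 * of_nat n)"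

definition riemann_hypothesis :: bool where
  "riemann_hypothesis \<longleftrightarrow> (\<forall>s. nontrivial_zeta_zero s \<longrightarrow> Re s = 1 / 2)"

text \<open>
  Existence and uniqueness of the continuation. For Re s > 1, expanding the telescoping sum of
  (n + 2) powr (1 - s) - (n + 1) powr (1 - s) = sum over j from 1 to K of
  ((1 - s) gchoose j) (n + 1) powr (1 - s - j), plus the remainder \<open>zeta_rem K n s\<close>,
  expresses (s - 1) zeta(s) through the values zeta(s + j - 1) with j > 1, which extends it
  one unit to the left at a time.
\<close>

lemma norm_gbinomial_le:
  fixes a :: complex
  assumes "norm a \<le> M"
  shows "norm (a gchoose k) \<le> \<bar>(- M) gchoose k\<bar>"
proof -
  have M: "M \<ge> 0" using assms norm_ge_zero order_trans by blast
  have "norm (\<Prod>i<k. a - of_nat i) \<le> (\<Prod>i<k. M + real i)"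
    unfolding prod_norm[symmetric]
  proof (rule prod_mono, safe)
    fix i
    have "norm (a - of_nat i) \<le> norm a + norm (of_nat i :: complex)"
      by (rule norm_triangle_ineq4)
    thus "norm (a - of_nat i) \<le> M + real i" using assms by simp
  qed simp
  also have "\<dots> = \<bar>\<Prod>i<k. - M - real i\<bar>"
    unfolding abs_prod using M by (intro prod.cong) auto
  finally show ?thesis
    by (simp add: gbinomial_prod_rev norm_divide abs_divide divide_right_mono atLeast0LessThan)
qed

lemma gbinomial_tail_bound:
  fixes M :: real
  obtains C where "C \<ge> 0"
    "\<And>(a::complex) u. norm a \<le> M \<Longrightarrow> 0 \<le> u \<Longrightarrow> u \<le> 1 / 2 \<Longrightarrow>
       norm ((1 + of_real u) powr a - (\<Sum>j\<le>K. (a gchoose j) * of_real u ^ j)) \<le> C * u ^ (K + 1)"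
proof -
  define b where "b = (\<lambda>k. \<bar>(- M) gchoose k\<bar>)"
  define b2 where "b2 = (\<lambda>k. b k * (1 / 2) ^ k)"
  have sumb: "summable b2" if "M \<ge> 0"
  proof -
    have "summable (\<lambda>k. ((- M) gchoose k) * (- 1 / 2 :: real) ^ k)"
      by (rule sums_summable[OF gen_binomial_real]) simp
    moreover have "((- M) gchoose k) * (- 1 / 2 :: real) ^ k = b2 k" for k
    proof -
      have "(- M) gchoose k = (- 1) ^ k * ((M + real k - 1) gchoose k)"
        by (rule gbinomial_minus)
      moreover have "((M + real k - 1) gchoose k) \<ge> 0"
        unfolding gbinomial_prod_rev
        using that by (intro divide_nonneg_nonneg prod_nonneg) auto
      moreover have "(- 1 / 2 :: real) ^ k = (- 1) ^ k * (1 / 2) ^ k"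
        by (simp flip: power_mult_distrib)
      ultimately show ?thesis
        by (simp add: b2_def b_def abs_mult power_mult_distrib flip: mult.assoc)
    qed
    ultimately show ?thesis by simp
  qed
  define C where "C = (\<Sum>j. b2 (j + (K + 1))) * 2 ^ (K + 1)"
  have b2nn: "b2 k \<ge> 0" for k by (simp add: b2_def b_def)
  show ?thesis
  proof (cases "M \<ge> 0")
    case False
    show ?thesis
    proof (rule that[of 0])
      fix a :: complex and u :: real
      assume "norm a \<le> M"
      hence False using False norm_ge_zero order_trans by blast
      thus "norm ((1 + of_real u) powr a - (\<Sum>j\<le>K. (a gchoose j) * of_real u ^ j)) \<le> 0 * u ^ (K + 1)" ..
    qed simp
  next
    case True
    note sumb = sumb[OF True]
    show ?thesis
    proof (rule that[of C])
      show "C \<ge> 0" unfolding C_def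
        using sumb b2nn by (intro mult_nonneg_nonneg suminf_nonneg summable_ignore_initial_segment) auto
      fix a :: complex and u :: real
      assume a: "norm a \<le> M" and u: "0 \<le> u" "u \<le> 1 / 2"
      define t where "t = (\<lambda>j. (a gchoose j) * complex_of_real u ^ j)"
      have "t sums (1 + of_real u) powr a"
        unfolding t_def by (rule gen_binomial_complex) (use u in simp)
      hence "(\<lambda>j. t (j + (K + 1))) sums ((1 + of_real u) powr a - (\<Sum>j<K+1. t j))"
        by (rule sums_split_initial_segment)
      hence eq: "(1 + of_real u) powr a - (\<Sum>j\<le>K. t j) = (\<Sum>j. t (j + (K + 1)))"
        by (simp add: sums_iff lessThan_Suc_atMost)
      have le: "norm (t (j + (K + 1))) \<le> b2 (j + (K + 1)) * 2 ^ (K + 1) * u ^ (K + 1)" for j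
      proof -
        have "norm (t (j + (K + 1))) = norm (a gchoose (j + (K + 1))) * (u ^ j * u ^ (K + 1))"
          using u by (simp add: t_def norm_mult norm_power power_add)
        also have "\<dots> \<le> b (j + (K + 1)) * ((1 / 2) ^ j * u ^ (K + 1))"
          unfolding b_def using u a
          by (intro mult_mono norm_gbinomial_le power_mono order.refl) auto
        also have "\<dots> = b2 (j + (K + 1)) * 2 ^ (K + 1) * u ^ (K + 1)"
          by (simp add: b2_def power_add field_simps)
        finally show ?thesis .
      qed
      have s: "summable (\<lambda>j. b2 (j + (K + 1)) * 2 ^ (K + 1) * u ^ (K + 1))"
        using sumb by (intro summable_mult2 summable_ignore_initial_segment)
      have "norm (\<Sum>j. t (j + (K + 1))) \<le> (\<Sum>j. b2 (j + (K + 1)) * 2 ^ (K + 1) * u ^ (K + 1))"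
        by (rule norm_suminf_le[OF le s])
      also have "\<dots> = C * u ^ (K + 1)"
      proof -
        have "(\<lambda>j. b2 (j + (K + 1)) * 2 ^ (K + 1) * u ^ (K + 1)) sums (C * u ^ (K + 1))"
          unfolding C_def
          by (intro sums_mult2 summable_sums summable_ignore_initial_segment sumb)
        thus ?thesis by (simp only: sums_iff)
      qed
      finally show "norm ((1 + of_real u) powr a - (\<Sum>j\<le>K. (a gchoose j) * of_real u ^ j)) \<le> C * u ^ (K + 1)"
        using eq by (simp add: t_def)
    qed
  qed
qed

lemma summable_Suc_powr:
  assumes "p < - 1"
  shows "summable (\<lambda>n. real (Suc n) powr p)"
  using assms summable_real_powr_iff[of p] summable_Suc_iff[of "\<lambda>n. real n powr p"] by simp

lemma local_halfplane_bound:
  assumes "Re s0 > r"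
  obtains d where "d > 0" "d \<le> 1" "\<And>s. s \<in> ball s0 d \<Longrightarrow> Re s > r + d"
proof -
  define d where "d = min 1 ((Re s0 - r) / 2)"
  show ?thesis
  proof (rule that[of d])
    show "d > 0" "d \<le> 1" using assms by (auto simp: d_def)
    fix s assume "s \<in> ball s0 d"
    hence "\<bar>Re (s0 - s)\<bar> < d"
      using abs_Re_le_cmod[of "s0 - s"] by (simp add: dist_norm)
    moreover have "2 * d \<le> Re s0 - r" by (simp add: d_def min_def field_simps)
    ultimately show "Re s > r + d" by simp
  qed
qed

lemma dirichlet_series_holomorphic:
  shows "(\<lambda>s. \<Sum>n. 1 / of_nat (Suc n) powr s :: complex) holomorphic_on {s. Re s > 1}"
    and "Re s > 1 \<Longrightarrow> summable (\<lambda>n. 1 / of_nat (Suc n) powr s :: complex)"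
proof -
  have "\<exists>g. \<forall>x\<in>{s. Re s > 1}. (\<lambda>n. 1 / of_nat (Suc n) powr x :: complex) sums g x \<and> g field_differentiable at x"
  proof (rule series_differentiable_comparison_complex[where S = "{s. Re s > 1}" and
      f = "\<lambda>n s. 1 / of_nat (Suc n) powr s :: complex"])
    show "open {s. 1 < Re s}" by (rule open_halfspace_Re_gt)
    fix n x show "(\<lambda>s. 1 / of_nat (Suc n) powr s :: complex) field_differentiable at x"
      by (rule holomorphic_on_imp_differentiable_at[of _ UNIV])
         (auto intro!: holomorphic_intros simp del: of_nat_Suc)
  next
    fix x assume "x \<in> {s. 1 < Re s}"
    then obtain d where d: "d > 0" "d \<le> 1" "\<And>s. s \<in> ball x d \<Longrightarrow> Re s > 1 + d"
      using local_halfplane_bound[of 1 x] by auto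
    have b: "cmod (1 / of_nat (Suc n) powr y) \<le> real (Suc n) powr (-(1 + d))" if "y \<in> ball x d" for n y
    proof -
      have "cmod (1 / of_nat (Suc n) powr y) = real (Suc n) powr (- Re y)"
        using norm_powr_real_powr[of "of_nat (Suc n)" y] by (simp add: norm_divide powr_minus field_simps del: of_nat_Suc)
      also have "\<dots> \<le> real (Suc n) powr (-(1 + d))"
        using d(3)[OF that] by (intro powr_mono) auto
      finally show ?thesis .
    qed
    show "\<exists>d h. 0 < d \<and> summable h \<and> range h \<subseteq> \<real>\<^sub>\<ge>\<^sub>0 \<and>
        (\<forall>\<^sub>F n in sequentially. \<forall>y\<in>ball x d \<inter> {s. 1 < Re s}.
            cmod (1 / of_nat (Suc n) powr y) \<le> cmod (h n))"
      using d(1) b summable_of_real[OF summable_Suc_powr[of "-(1+d)"], where 'a=complex]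
      by (intro exI[of _ d] exI[of _ "\<lambda>n. of_real (real (Suc n) powr (-(1 + d)))"])
         (auto simp del: of_nat_Suc)
  qed blast
  then obtain g where g: "\<And>x. Re x > 1 \<Longrightarrow> (\<lambda>n. 1 / of_nat (Suc n) powr x :: complex) sums g x"
      "\<And>x. Re x > 1 \<Longrightarrow> g field_differentiable at x" by blast
  have "g holomorphic_on {s. Re s > 1}"
    using g(2) by (auto simp: holomorphic_on_def field_differentiable_at_within)
  thus "(\<lambda>s. \<Sum>n. 1 / of_nat (Suc n) powr s :: complex) holomorphic_on {s. Re s > 1}"
    by (rule holomorphic_transform) (use g(1) in \<open>auto simp: sums_iff\<close>)
  show "Re s > 1 \<Longrightarrow> summable (\<lambda>n. 1 / of_nat (Suc n) powr s :: complex)"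
    using g(1) by (auto simp: sums_iff)
qed

definition zeta_rem :: "nat \<Rightarrow> nat \<Rightarrow> complex \<Rightarrow> complex" where
  "zeta_rem K n s = of_nat (n + 2) powr (1 - s) -
     (\<Sum>j\<le>K. ((1 - s) gchoose j) * of_nat (Suc n) powr (1 - s - of_nat j))"

lemma zeta_rem_sums:
  obtains g where "g holomorphic_on {s. Re s > 1 - real K}"
    "\<And>s. Re s > 1 - real K \<Longrightarrow> (\<lambda>n. zeta_rem K n s) sums g s"
proof -
  have "\<exists>g. \<forall>x\<in>{s. Re s > 1 - real K}. (\<lambda>n. zeta_rem K n x) sums g x \<and> g field_differentiable at x"
  proof (rule series_differentiable_comparison_complex[where S = "{s. Re s > 1 - real K}" and
      f = "\<lambda>n s. zeta_rem K n s"])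
    show "open {s. 1 - real K < Re s}" by (rule open_halfspace_Re_gt)
    fix n x show "zeta_rem K n field_differentiable at x"
      unfolding zeta_rem_def gbinomial_prod_rev
      by (rule holomorphic_on_imp_differentiable_at[of _ UNIV])
         (auto intro!: holomorphic_intros simp del: of_nat_Suc of_nat_add)
  next
    fix x assume "x \<in> {s. 1 - real K < Re s}"
    then obtain d where d: "d > 0" "d \<le> 1" "\<And>s. s \<in> ball x d \<Longrightarrow> Re s > (1 - real K) + d"
      using local_halfplane_bound[of "1 - real K" x] by auto
    define M where "M = norm (1 - x) + d"
    obtain C where C: "C \<ge> 0" "\<And>(a::complex) u. norm a \<le> M \<Longrightarrow> 0 \<le> u \<Longrightarrow> u \<le> 1 / 2 \<Longrightarrow>
       norm ((1 + of_real u) powr a - (\<Sum>j\<le>K. (a gchoose j) * of_real u ^ j)) \<le> C * u ^ (K + 1)"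
      using gbinomial_tail_bound by metis
    have b: "cmod (zeta_rem K n y) \<le> C * real (Suc n) powr (-(1 + d))"
      if y: "y \<in> ball x d" and n: "n \<ge> 1" for n y
    proof -
      define N where "N = real (Suc n)"
      define a where "a = 1 - y"
      have N: "N \<ge> 2" using n by (simp add: N_def)
      have Nc: "complex_of_real N \<noteq> 0" using N by auto
      have "norm a = norm ((1 - x) + (x - y))" by (simp add: a_def)
      also have "\<dots> \<le> M" unfolding M_def using y
        by (intro order.trans[OF norm_triangle_ineq]) (auto simp: dist_norm)
      finally have aM: "norm a \<le> M" .
      have e1: "of_nat (n + 2) powr a = of_real N powr a * (1 + of_real (1 / N)) powr a"
      proof -
        have "N * (1 + 1 / N) = real (n + 2)" using N by (simp add: distrib_left) (simp add: N_def)
        hence "complex_of_nat (n + 2) = of_real N * of_real (1 + 1 / N)"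
          by (metis of_real_mult of_real_of_nat_eq)
        also have "\<dots> powr a = of_real N powr a * of_real (1 + 1 / N) powr a"
          by (rule powr_times_real) (use N in auto)
        finally show ?thesis by simp
      qed
      have e2: "of_real N powr (a - of_nat j) = of_real N powr a * of_real (1 / N) ^ j" for j
        using Nc by (simp add: powr_diff powr_nat' power_divide field_simps)
      have NN: "of_nat (Suc n) = complex_of_real N" by (simp add: N_def)
      have "zeta_rem K n y = of_real N powr a *
          ((1 + of_real (1 / N)) powr a - (\<Sum>j\<le>K. (a gchoose j) * of_real (1 / N) ^ j))"
        unfolding zeta_rem_def a_def[symmetric] e1 NN e2
        by (simp add: right_diff_distrib sum_distrib_left mult_ac)
      also have "norm \<dots> \<le> N powr (Re a) * (C * (1 / N) ^ (K + 1))"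
        unfolding norm_mult
      proof (intro mult_mono C(2) aM)
        show "cmod (complex_of_real N powr a) \<le> N powr Re a"
          using N norm_powr_real_powr[of "of_real N" a] by simp
      qed (use N in auto)
      also have "\<dots> = C * (N powr (Re a - real (K + 1)))"
      proof -
        have "N powr (real (K + 1)) = N ^ (K + 1)" by (rule powr_realpow) (use N in simp)
        thus ?thesis by (simp only: powr_diff power_one_over) (simp add: divide_inverse mult_ac)
      qed
      also have "\<dots> \<le> C * N powr (-(1 + d))"
        using d(3)[OF y] C(1) N by (intro mult_left_mono powr_mono) (auto simp: a_def)
      finally show ?thesis by (simp add: N_def)
    qed
    show "\<exists>d h. 0 < d \<and> summable h \<and> range h \<subseteq> \<real>\<^sub>\<ge>\<^sub>0 \<and>
        (\<forall>\<^sub>F n in sequentially. \<forall>y\<in>ball x d \<inter> {s. 1 - real K < Re s}.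
            cmod (zeta_rem K n y) \<le> cmod (h n))"
    proof (intro exI[of _ d] exI[of _ "\<lambda>n. of_real (C * real (Suc n) powr (-(1 + d)))"] conjI)
      show "summable (\<lambda>n. complex_of_real (C * real (Suc n) powr (-(1 + d))))"
        using d(1) by (intro summable_of_real summable_mult summable_Suc_powr) auto
      show "\<forall>\<^sub>F n in sequentially. \<forall>y\<in>ball x d \<inter> {s. 1 - real K < Re s}.
            cmod (zeta_rem K n y) \<le> cmod (of_real (C * real (Suc n) powr (-(1 + d))))"
        using eventually_ge_at_top[of 1]
      proof eventually_elim
        case (elim n)
        show ?case
        proof
          fix y assume "y \<in> ball x d \<inter> {s. 1 - real K < Re s}"
          hence "cmod (zeta_rem K n y) \<le> C * real (Suc n) powr (-(1 + d))" using elim b by blast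
          thus "cmod (zeta_rem K n y) \<le> cmod (of_real (C * real (Suc n) powr (-(1 + d))))"
            unfolding norm_of_real by linarith
        qed
      qed
    qed (use d C in \<open>auto simp del: of_nat_Suc\<close>)
  qed blast
  then obtain g where g: "\<And>x. Re x > 1 - real K \<Longrightarrow> (\<lambda>n. zeta_rem K n x) sums g x"
      "\<And>x. Re x > 1 - real K \<Longrightarrow> g field_differentiable at x" by blast
  have "g holomorphic_on {s. Re s > 1 - real K}"
    using g(2) by (auto simp: holomorphic_on_def field_differentiable_at_within)
  with g(1) show ?thesis using that by blast
qed

lemma zeta_rem_identity:
  fixes K :: nat and s :: complex
  defines "D \<equiv> \<lambda>s. \<Sum>n. 1 / of_nat (Suc n) powr s :: complex"
  assumes s: "Re s > 1" and K: "K \<ge> 1"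
  shows "(s - 1) * D s = 1 + (\<Sum>j\<in>{2..K}. ((1 - s) gchoose j) * D (s + of_nat j - 1)) + (\<Sum>n. zeta_rem K n s)"
proof -
  have D: "(\<lambda>n. of_nat (Suc n) powr (- z)) sums D z" if "Re z > 1" for z
    using dirichlet_series_holomorphic(2)[OF that]
    by (simp add: D_def sums_iff powr_minus_divide del: of_nat_Suc)
  have lim: "(\<lambda>n. complex_of_nat (Suc n) powr (1 - s)) \<longlonglongrightarrow> 0"
  proof (rule tendsto_norm_zero_cancel)
    have "(\<lambda>n. real (Suc n) powr (1 - Re s)) \<longlonglongrightarrow> 0"
      using s by (intro LIMSEQ_Suc tendsto_neg_powr filterlim_real_sequentially) auto
    moreover have "cmod (of_nat (Suc n) powr (1 - s)) = real (Suc n) powr (1 - Re s)" for n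
      using norm_powr_real_powr[of "of_nat (Suc n)" "1 - s"] by (simp del: of_nat_Suc)
    ultimately show "(\<lambda>n. cmod (complex_of_nat (Suc n) powr (1 - s))) \<longlonglongrightarrow> 0"
      by (simp del: of_nat_Suc)
  qed
  have tele: "(\<lambda>n. of_nat (Suc (Suc n)) powr (1 - s) - of_nat (Suc n) powr (1 - s)) sums (0 - of_nat (Suc 0) powr (1 - s))"
    by (rule telescope_sums[OF lim])
  have Dj: "(\<lambda>n. ((1 - s) gchoose j) * of_nat (Suc n) powr (1 - s - of_nat j)) sums
      (((1 - s) gchoose j) * D (s + of_nat j - 1))" if "j \<ge> 1" for j
  proof -
    have "Re (s + of_nat j - 1) > 1" using s that by simp
    from sums_mult[OF D[OF this], of "(1 - s) gchoose j"] show ?thesis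
      by (simp add: algebra_simps del: of_nat_Suc)
  qed
  have "(\<lambda>n. (of_nat (Suc (Suc n)) powr (1 - s) - of_nat (Suc n) powr (1 - s)) -
      (\<Sum>j\<in>{1..K}. ((1 - s) gchoose j) * of_nat (Suc n) powr (1 - s - of_nat j))) sums
      ((0 - of_nat (Suc 0) powr (1 - s)) - (\<Sum>j\<in>{1..K}. ((1 - s) gchoose j) * D (s + of_nat j - 1)))"
    by (intro sums_diff tele sums_sum Dj) auto
  also have "(\<lambda>n. (of_nat (Suc (Suc n)) powr (1 - s) - of_nat (Suc n) powr (1 - s)) -
      (\<Sum>j\<in>{1..K}. ((1 - s) gchoose j) * of_nat (Suc n) powr (1 - s - of_nat j))) = (\<lambda>n. zeta_rem K n s)"
  proof
    fix n
    have "{..K} = insert 0 {1..K}" by auto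
    thus "(of_nat (Suc (Suc n)) powr (1 - s) - of_nat (Suc n) powr (1 - s)) -
      (\<Sum>j\<in>{1..K}. ((1 - s) gchoose j) * of_nat (Suc n) powr (1 - s - of_nat j)) = zeta_rem K n s"
      unfolding zeta_rem_def by (simp del: of_nat_Suc)
  qed
  finally have "(\<Sum>n. zeta_rem K n s) = - 1 - (\<Sum>j\<in>{1..K}. ((1 - s) gchoose j) * D (s + of_nat j - 1))"
    by (simp add: sums_iff)
  moreover have "{1..K} = insert 1 {2..K}" using K by auto
  ultimately show ?thesis by (simp add: algebra_simps)
qed

lemma zeta_continuation_halfplane:
  "\<exists>Z. Z holomorphic_on {s. Re s > 1 - real m} \<and>
     (\<forall>s. Re s > 1 \<longrightarrow> Z s = (s - 1) * (\<Sum>n. 1 / of_nat (Suc n) powr s))"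
proof (induction m)
  case 0
  show ?case
    by (rule exI[of _ "\<lambda>s. (s - 1) * (\<Sum>n. 1 / of_nat (Suc n) powr s)"])
       (use dirichlet_series_holomorphic(1) in \<open>auto intro!: holomorphic_intros\<close>)
next
  case (Suc m)
  then obtain Z where Z: "Z holomorphic_on {s. Re s > 1 - real m}"
     "\<And>s. Re s > 1 \<Longrightarrow> Z s = (s - 1) * (\<Sum>n. 1 / of_nat (Suc n) powr s)" by blast
  define K where "K = Suc m"
  obtain g where g: "g holomorphic_on {s. Re s > 1 - real K}"
    "\<And>s. Re s > 1 - real K \<Longrightarrow> (\<lambda>n. zeta_rem K n s) sums g s"
    using zeta_rem_sums[of K] by blast
  define q :: "nat \<Rightarrow> complex \<Rightarrow> complex" where
    "q = (\<lambda>j s. - (\<Prod>i<j - 1. 1 - s - of_nat i) / fact j)"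
  have q: "(1 - s) gchoose j = q j s * (s + of_nat j - 2)" if "j \<ge> 2" for j s
  proof -
    from that obtain k where k: "j = Suc k" by (cases j) auto
    show ?thesis
    proof -
      have "(\<Prod>i=0..<j. 1 - s - of_nat i) = (\<Prod>i<j - 1. 1 - s - of_nat i) * (1 - s - of_nat k)"
        by (simp add: k atLeast0LessThan)
      also have "1 - s - of_nat k = - (s + of_nat j - 2)" by (simp add: k)
      finally show ?thesis
        unfolding q_def gbinomial_prod_rev by (simp only: mult_minus_right mult_minus_left minus_divide_left times_divide_eq_left)
    qed
  qed
  define Z' where "Z' = (\<lambda>s. 1 + (\<Sum>j\<in>{2..K}. q j s * Z (s + of_nat j - 1)) + g s)"
  show ?case
  proof (intro exI[of _ Z'] conjI allI impI)
    have "(\<lambda>s. Z (s + of_nat j - 1)) holomorphic_on {s. Re s > 1 - real K}" if "j \<ge> 2" for j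
    proof -
      have "(Z \<circ> (\<lambda>s. s + of_nat j - 1)) holomorphic_on {s. Re s > 1 - real K}"
        by (rule holomorphic_on_compose_gen[OF _ Z(1)])
           (use that in \<open>auto intro!: holomorphic_intros simp: K_def\<close>)
      thus ?thesis by (simp add: o_def)
    qed
    thus "Z' holomorphic_on {s. 1 - real (Suc m) < Re s}"
      using g(1) unfolding Z'_def q_def K_def[symmetric]
      by (auto intro!: holomorphic_intros)
  next
    fix s :: complex assume s: "1 < Re s"
    define D where "D = (\<lambda>s. \<Sum>n. 1 / of_nat (Suc n) powr s :: complex)"
    have "(\<Sum>n. zeta_rem K n s) = g s" using g(2)[of s] s by (simp add: sums_iff K_def)
    moreover have "(\<Sum>j\<in>{2..K}. ((1 - s) gchoose j) * D (s + of_nat j - 1)) =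
        (\<Sum>j\<in>{2..K}. q j s * Z (s + of_nat j - 1))"
    proof (rule sum.cong)
      fix j assume "j \<in> {2..K}"
      hence "j \<ge> 2" by simp
      moreover from this have "Re (s + of_nat j - 1) > 1" using s by simp
      ultimately show "((1 - s) gchoose j) * D (s + of_nat j - 1) = q j s * Z (s + of_nat j - 1)"
        using Z(2)[of "s + of_nat j - 1"] unfolding q[OF \<open>j \<ge> 2\<close>]
        by (simp add: D_def diff_add_eq del: of_nat_Suc)
    qed simp
    ultimately show "Z' s = (s - 1) * (\<Sum>n. 1 / of_nat (Suc n) powr s)"
      using zeta_rem_identity[OF s, of K] by (simp add: Z'_def D_def K_def del: of_nat_Suc)
  qed
qed

lemma is_riemann_zeta_unique:
  assumes "is_riemann_zeta f" "is_riemann_zeta g"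
  shows "f = g"
proof
  fix s
  show "f s = g s"
  proof (cases "s = 1")
    case False
    show ?thesis
    proof (rule analytic_continuation_open[of "{s. Re s > 1}" "- {1}" f g])
      have "(2::complex) \<in> {s. Re s > 1}" by simp
      thus "{s. Re s > 1} \<noteq> {}" by blast
      show "connected (- {1::complex})"
        by (rule connected_punctured_universe) simp
    qed (use assms False in \<open>auto simp: is_riemann_zeta_def open_halfspace_Re_gt\<close>)
  qed (use assms in \<open>simp add: is_riemann_zeta_def\<close>)
qed

lemma is_riemann_zeta_exists: "\<exists>f. is_riemann_zeta f"
proof -
  define D where "D = (\<lambda>s. \<Sum>n. 1 / of_nat (Suc n) powr s :: complex)"
  obtain Z where Z: "\<And>m. Z m holomorphic_on {s. Re s > 1 - real m}"
     "\<And>m s. Re s > 1 \<Longrightarrow> Z m s = (s - 1) * D s"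
    using zeta_continuation_halfplane unfolding D_def by metis
  have agree: "Z m s = Z k s" if "m \<le> k" "Re s > 1 - real m" for m k s
  proof (rule analytic_continuation_open[of "{s. Re s > 1}" "{s. Re s > 1 - real m}" "Z m" "Z k"])
    have "(2::complex) \<in> {s. Re s > 1}" by simp
    thus "{s. Re s > 1} \<noteq> {}" by blast
    show "connected {s. Re s > 1 - real m}"
      by (intro convex_connected convex_halfspace_Re_gt)
    show "Z k holomorphic_on {s. Re s > 1 - real m}"
      by (rule holomorphic_on_subset[OF Z(1)]) (use that in auto)
  qed (use that Z in \<open>auto simp: open_halfspace_Re_gt\<close>)
  define ix where "ix = (\<lambda>s. nat \<lceil>2 - Re s\<rceil>)"
  have ix: "Re s > 1 - real (ix s)" for s unfolding ix_def by linarith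
  define W where "W = (\<lambda>s. Z (ix s) s)"
  have W: "W s = Z m s" if "Re s > 1 - real m" for m s
    unfolding W_def using agree[of m "ix s" s] agree[of "ix s" m s] ix[of s] that
    by (metis nle_le)
  have holW: "W holomorphic_on UNIV"
  proof -
    have "W holomorphic_on (\<Union>m. {s. Re s > 1 - real m})"
    proof (rule holomorphic_on_UN_open)
      fix m
      show "W holomorphic_on {s. Re s > 1 - real m}"
        by (rule holomorphic_transform[OF Z(1)[of m]]) (simp add: W)
    qed (simp add: open_halfspace_Re_gt)
    thus ?thesis by (rule holomorphic_on_subset) (use ix in blast)
  qed
  define f where "f = (\<lambda>s. W s / (s - 1))"
  have "is_riemann_zeta f"
    unfolding is_riemann_zeta_def
  proof (intro conjI allI impI)
    show "f holomorphic_on - {1}"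
      unfolding f_def by (intro holomorphic_intros holomorphic_on_subset[OF holW]) auto
    show "f 1 = 0" by (simp add: f_def)
    fix s :: complex assume s: "1 < Re s"
    have "s \<noteq> 1" using s by auto
    moreover have "W s = (s - 1) * D s"
      using W[of 0 s] Z(2)[OF s, of 0] s by simp
    ultimately have "f s = D s" by (simp add: f_def)
    thus "f s = (\<Sum>n. 1 / of_nat (Suc n) powr s)" by (simp only: D_def)
  qed
  thus ?thesis by blast
qed

lemma is_riemann_zeta_riemann_zeta: "is_riemann_zeta riemann_zeta"
  unfolding riemann_zeta_def
  using is_riemann_zeta_exists is_riemann_zeta_unique by (metis theI)

end

theory Submission
  imports Defs "HOL-Number_Theory.Prime_Powers" "HOL-Real_Asymp.Real_Asymp"
begin

text \<open>
  Let \<open>\<xi>\<close> be the completed zeta function. Under the Riemann hypothesis \<open>|\<xi> (1/2 + s)|\<close> increases with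
  \<open>Re s \<ge> 0\<close>: by the functional equation the quotient \<open>\<xi> (1/2 + s - h) / \<xi> (1/2 + s + h)\<close> has modulus 1
  on \<open>Re s = 0\<close>, and the Phragmen-Lindeloef principle applies to it. Hence the logarithmic
  derivative of \<open>\<xi>\<close> has nonnegative real part to the right of the critical line. This replaces any
  knowledge about the zeros: integrate it there against the kernel \<open>|F|\<^sup>2 (2 - 2 cos (u t))\<close>, where \<open>|F|\<^sup>2\<close>
  is the Fejer kernel of width \<open>\<delta>\<close>, shift the contour to \<open>Re s = 1\<close> and integrate the Dirichlet series
  and the partial fractions of the Gamma factor term by term. With \<open>u = ln x\<close> this bounds the sum of
  \<open>\<Lambda>(n) / \<surd>n\<close>, weighted by the tent of half width \<open>\<delta>\<close> around \<open>u\<close>, from below by roughly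
  \<open>\<delta> (\<delta> \<surd>x + ln \<delta>)\<close>. Each prime contributes at most \<open>\<delta> ln x / \<surd>x\<close> and prime powers contribute
  little, which gives both claims for \<open>x \<ge> 10000\<close>. Explicit primes settle smaller \<open>x\<close>.
\<close>

section \<open>Analytic continuation of the zeta function to the half-plane Re s > -1\<close>

text \<open>Origin of the constants: for half length \<open>H * sqrt x\<close> the tent has a
  \<delta> of about \<open>H / sqrt x\<close>, so \<open>\<delta> * sqrt x + ln \<delta>\<close> is
  about \<open>H + ln H - ln x / 2\<close>. The summand 1/2 of \<open>c\<close> cancels
  \<open>ln x / 2\<close>; the summand \<open>2 / ln x\<close> leaves a margin of 2 in
  \<open>H\<close>, which together with \<open>ln H\<close> and the constants of the Gamma factor
  pays for prime powers and second order errors. A prime weighs at most \<open>ln x / sqrt x\<close>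
  per unit of \<delta>, so one more \<open>sqrt x * ln x\<close> of half length buys
  \<open>sqrt x\<close> primes.

  On the analytic side the obstacle is growth: the quotient of shifted values of \<xi> must be known
  to grow at most exponentially in every strip, which takes a polynomial upper bound for zeta and a
  lower bound right of the critical line. The trapezoidal series below is chosen because it yields
  both an explicit growth and, through a Mellin transform of its terms, the functional equation. On
  vertical lines a growth like \<open>sqrt |t|\<close> always meets the quadratic decay of the
  kernel, so \<open>(1 + |t|) powr (- 3 / 2)\<close> serves as common majorant.\<close>

text \<open>\<open>s - 1\<close> times the error of the trapezoidal rule for \<open>v powr (-s)\<close> on \<open>[n, n + 1]\<close>.\<close>

definition em_term :: "nat \<Rightarrow> complex \<Rightarrow> complex" where
  "em_term n s = (s - 1) / 2 * (of_nat n powr (-s) + of_nat (Suc n) powr (-s)) +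
     of_nat (Suc n) powr (1 - s) - of_nat n powr (1 - s)"

text \<open>With the endpoint \<open>n + z\<close> in place of \<open>n + 1\<close>, the error
  \<open>e\<close> and its derivative \<open>e1\<close> both vanish at \<open>z = 0\<close>, and the
  second derivative \<open>e2\<close> is small; the mean value inequality is applied twice. The two
  powers of \<open>n\<close> gained in this way make the series converge for
  \<open>Re s > - 1\<close>.\<close>

lemma norm_em_term_le:
  assumes n: "n \<ge> 1" and s: "Re s \<ge> - 2"
  shows "norm (em_term n s) \<le> norm ((s - 1) * s * (s + 1)) / 2 * real n powr (- Re s - 2)"
proof -
  define S where "S = closed_segment 0 (1::complex)"
  define M where "M = norm ((s - 1) * s * (s + 1)) / 2 * real n powr (- Re s - 2)"
  define N :: complex where "N = of_nat n"
  have S: "\<exists>t. z = of_real t \<and> 0 \<le> t \<and> t \<le> 1" if "z \<in> S" for z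
    using that by (auto simp: S_def closed_segment_def scaleR_conv_of_real)
  have conv: "convex S" and in01: "0 \<in> S" "1 \<in> S" by (auto simp: S_def)
  have pos: "N + z \<notin> \<real>\<^sub>\<le>\<^sub>0" if "z \<in> S" for z
    using S[OF that] n by (auto simp: N_def complex_nonpos_Reals_iff)
  define e where "e = (\<lambda>z. (s - 1) / 2 * z * (N powr (-s) + (N + z) powr (-s)) + (N + z) powr (1 - s) - N powr (1 - s))"
  define e1 where "e1 = (\<lambda>z. (s - 1) / 2 * (N powr (-s) - (N + z) powr (-s)) - (s - 1) * s / 2 * z * (N + z) powr (- s - 1))"
  define e2 where "e2 = (\<lambda>z. (s - 1) * s * (s + 1) / 2 * z * (N + z) powr (- s - 2))"
  have d1: "(e has_field_derivative e1 z) (at z within S)" if "z \<in> S" for z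
    unfolding e_def e1_def using pos[OF that]
    by (auto intro!: derivative_eq_intros simp: algebra_simps) (auto simp: field_simps)
  have d2: "(e1 has_field_derivative e2 z) (at z within S)" if "z \<in> S" for z
  proof -
    have "N + z \<noteq> 0" using pos[OF that] by auto
    hence "(N + z) powr (- s - 1) = (N + z) powr (- s - 2) * (N + z)"
      using powr_add[of "N + z" "- s - 2" 1] by (simp add: minus_diff_commute)
    thus ?thesis
      unfolding e1_def e2_def using pos[OF that]
      by (auto intro!: derivative_eq_intros simp: algebra_simps) (auto simp: field_simps)
  qed
  have b2: "norm (e2 z) \<le> M" if zS: "z \<in> S" for z
  proof -
    obtain t where t: "z = of_real t" "0 \<le> t" "t \<le> 1" using S[OF zS] by blast
    have "N + z = of_real (real n + t)" by (simp add: N_def t)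
    hence "norm ((N + z) powr (- s - 2)) = (real n + t) powr (- Re s - 2)"
      using norm_powr_real_powr[of "of_real (real n + t)" "- s - 2"] t n by simp
    also have "\<dots> \<le> real n powr (- Re s - 2)"
      using s t n by (intro powr_mono2') auto
    finally have *: "norm ((N + z) powr (- s - 2)) \<le> real n powr (- Re s - 2)" .
    have "norm (e2 z) = norm ((s - 1) * s * (s + 1)) / 2 * (norm z * norm ((N + z) powr (- s - 2)))"
      by (simp add: e2_def norm_mult norm_divide)
    also have "\<dots> \<le> norm ((s - 1) * s * (s + 1)) / 2 * (1 * real n powr (- Re s - 2))"
      using * t by (intro mult_left_mono mult_mono) auto
    finally show ?thesis by (simp add: M_def)
  qed
  have M0: "M \<ge> 0" by (simp add: M_def)
  have b1: "norm (e1 z) \<le> M" if zS: "z \<in> S" for z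
  proof -
    obtain t where t: "z = of_real t" "0 \<le> t" "t \<le> 1" using S[OF zS] by blast
    have "norm (e1 z - e1 0) \<le> M * norm (z - 0)"
      by (rule field_differentiable_bound[OF conv d2 b2]) (use zS in01 in auto)
    also have "\<dots> \<le> M * 1" using t M0 by (intro mult_left_mono) auto
    finally show ?thesis by (simp add: e1_def)
  qed
  have "norm (e 1 - e 0) \<le> M * norm (1 - 0 :: complex)"
    by (rule field_differentiable_bound[OF conv d1 b1]) (use in01 in auto)
  moreover have "e 1 - e 0 = em_term n s" by (simp add: e_def em_term_def N_def add_ac)
  ultimately show ?thesis by (simp add: M_def)
qed

text \<open>The value 1 is the residue of zeta at its pole, so \<open>zeta_reg\<close> is
  holomorphic there; \<open>riemann_zeta 1\<close> itself is only a dummy.\<close>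

definition zeta_reg :: "complex \<Rightarrow> complex" where
  "zeta_reg s = (if s = 1 then 1 else (s - 1) * riemann_zeta s)"

lemma open_halfplane [simp, intro]: "open {s. Re s > a}"
  by (rule open_halfspace_Re_gt)

lemma em_term_holomorphic: "n \<ge> 1 \<Longrightarrow> em_term n holomorphic_on A"
  unfolding em_term_def by (auto intro!: holomorphic_intros)

lemma em_series:
  obtains g where "g holomorphic_on {s. Re s > - 1}"
    "\<And>s. Re s > - 1 \<Longrightarrow> (\<lambda>n. em_term (Suc n) s) sums g s"
proof -
  have "\<exists>g. \<forall>x\<in>{s. Re s > - 1}. (\<lambda>n. em_term (Suc n) x) sums g x \<and> g field_differentiable at x"
  proof (rule series_differentiable_comparison_complex[where S = "{s. Re s > - 1}" and
      f = "\<lambda>n. em_term (Suc n)"])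
    fix n x show "em_term (Suc n) field_differentiable at x"
      by (rule holomorphic_on_imp_differentiable_at[OF em_term_holomorphic, of _ UNIV]) auto
  next
    fix x assume "x \<in> {s. - 1 < Re s}"
    then obtain d where d: "d > 0" "d \<le> 1" "\<And>s. s \<in> ball x d \<Longrightarrow> Re s > -1 + d"
      using local_halfplane_bound[of "-1" x] by auto
    define C where "C = (norm x + 2) * (norm x + 2) * (norm x + 2) / 2"
    have b: "cmod (em_term (Suc n) y) \<le> C * real (Suc n) powr (-(1 + d))" if y: "y \<in> ball x d" for n y
    proof -
      have "norm (y - x) \<le> 1" using y d by (auto simp: dist_norm norm_minus_commute)
      hence yx: "norm y \<le> norm x + 1" using norm_triangle_ineq[of x "y - x"] by simp
      have "cmod (em_term (Suc n) y) \<le> norm ((y - 1) * y * (y + 1)) / 2 * real (Suc n) powr (- Re y - 2)"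
        using d(3)[OF y] d(1) by (intro norm_em_term_le) auto
      also have "\<dots> \<le> C * real (Suc n) powr (-(1 + d))"
        unfolding C_def norm_mult
      proof (intro mult_mono divide_right_mono powr_mono)
        show "norm (y - 1) \<le> norm x + 2" using norm_triangle_ineq4[of y 1] yx by simp
        show "norm (y + 1) \<le> norm x + 2" using norm_triangle_ineq[of y 1] yx by simp
      qed (use yx d(3)[OF y] in auto)
      finally show ?thesis .
    qed
    have C0: "C \<ge> 0" by (simp add: C_def)
    show "\<exists>d h. 0 < d \<and> summable h \<and> range h \<subseteq> \<real>\<^sub>\<ge>\<^sub>0 \<and>
        (\<forall>\<^sub>F n in sequentially. \<forall>y\<in>ball x d \<inter> {s. - 1 < Re s}.
            cmod (em_term (Suc n) y) \<le> cmod (h n))"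
    proof (intro exI[of _ d] exI[of _ "\<lambda>n. of_real (C * real (Suc n) powr (-(1 + d)))"] conjI)
      show "summable (\<lambda>n. complex_of_real (C * real (Suc n) powr (-(1 + d))))"
        using d(1) by (intro summable_of_real summable_mult summable_Suc_powr) auto
      show "\<forall>\<^sub>F n in sequentially. \<forall>y\<in>ball x d \<inter> {s. - 1 < Re s}.
            cmod (em_term (Suc n) y) \<le> cmod (of_real (C * real (Suc n) powr (-(1 + d))))"
        using b C0 unfolding norm_of_real by (intro always_eventually) fastforce
    qed (use d C0 in \<open>auto simp del: of_nat_Suc\<close>)
  qed auto
  then obtain g where g: "\<And>x. Re x > - 1 \<Longrightarrow> (\<lambda>n. em_term (Suc n) x) sums g x"
      "\<And>x. Re x > - 1 \<Longrightarrow> g field_differentiable at x" by blast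
  have "g holomorphic_on {s. Re s > - 1}"
    using g(2) by (auto simp: holomorphic_on_def field_differentiable_at_within)
  with g(1) show ?thesis using that by blast
qed

lemma riemann_zeta_Dirichlet:
  assumes "Re s > 1"
  shows "(\<lambda>n. of_nat (Suc n) powr (- s)) sums riemann_zeta s"
proof -
  have "riemann_zeta s = (\<Sum>n. 1 / of_nat (Suc n) powr s)"
    using is_riemann_zeta_riemann_zeta assms by (simp add: is_riemann_zeta_def)
  thus ?thesis
    using dirichlet_series_holomorphic(2)[OF assms]
    by (simp add: sums_iff powr_minus_divide del: of_nat_Suc)
qed

text \<open>Every integer above 1 is an endpoint of two intervals and 1 of a single one, hence the
  correction \<open>(s - 1) / 2\<close>; the differences of \<open>powr (1 - s)\<close> telescope to
  - 1.\<close>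

lemma em_series_zeta:
  assumes s: "Re s > 1"
  shows "(\<lambda>n. em_term (Suc n) s) sums ((s - 1) * riemann_zeta s - (s - 1) / 2 - 1)"
proof -
  have lim: "(\<lambda>n. complex_of_nat (Suc n) powr (1 - s)) \<longlonglongrightarrow> 0"
  proof (rule tendsto_norm_zero_cancel)
    have "(\<lambda>n. real (Suc n) powr (1 - Re s)) \<longlonglongrightarrow> 0"
      using s by (intro LIMSEQ_Suc tendsto_neg_powr filterlim_real_sequentially) auto
    moreover have "cmod (of_nat (Suc n) powr (1 - s)) = real (Suc n) powr (1 - Re s)" for n
      using norm_powr_real_powr[of "of_nat (Suc n)" "1 - s"] by (simp del: of_nat_Suc)
    ultimately show "(\<lambda>n. cmod (complex_of_nat (Suc n) powr (1 - s))) \<longlonglongrightarrow> 0"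
      by (simp del: of_nat_Suc)
  qed
  have tele: "(\<lambda>n. of_nat (Suc (Suc n)) powr (1 - s) - of_nat (Suc n) powr (1 - s)) sums (- 1)"
    using telescope_sums[OF lim] by simp
  have z: "(\<lambda>n. of_nat (Suc n) powr (- s)) sums riemann_zeta s"
    by (rule riemann_zeta_Dirichlet[OF s])
  hence "(\<lambda>n. of_nat (Suc (Suc n)) powr (- s)) sums (riemann_zeta s - 1)"
    by (subst sums_Suc_iff) auto
  from sums_add[OF sums_mult[OF sums_add[OF z this], of "(s - 1) / 2"] tele]
  show ?thesis
    by (simp add: em_term_def algebra_simps add_divide_distrib diff_divide_distrib del: of_nat_Suc)
qed

text \<open>The series agrees with \<open>(s - 1) * riemann_zeta s\<close> for
  \<open>Re s > 1\<close>, hence on the punctured half-plane, which is still connected. The point 1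
  is checked by hand: every \<open>em_term (Suc n)\<close> vanishes there.\<close>

lemma zeta_reg_series:
  shows zeta_reg_sums: "Re s > - 1 \<Longrightarrow> (\<lambda>n. em_term (Suc n) s) sums (zeta_reg s - (s - 1) / 2 - 1)"
    and zeta_reg_holomorphic: "zeta_reg holomorphic_on {s. Re s > - 1}"
proof -
  obtain g where g: "g holomorphic_on {s. Re s > - 1}"
    "\<And>s. Re s > - 1 \<Longrightarrow> (\<lambda>n. em_term (Suc n) s) sums g s"
    using em_series by blast
  define W where "W = (\<lambda>s. g s + (s - 1) / 2 + 1)"
  have holW: "W holomorphic_on {s. Re s > - 1}"
    unfolding W_def by (intro holomorphic_intros g) auto
  have eq1: "W s = (s - 1) * riemann_zeta s" if "Re s > 1" for s
  proof -
    from that have "g s = (s - 1) * riemann_zeta s - (s - 1) / 2 - 1"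
      using sums_unique2[OF g(2) em_series_zeta] by auto
    thus ?thesis by (simp add: W_def)
  qed
  have zeta_hol: "riemann_zeta holomorphic_on - {1}"
    using is_riemann_zeta_riemann_zeta by (simp add: is_riemann_zeta_def)
  have eq2: "W s = zeta_reg s" if s: "Re s > -1" for s
  proof (cases "s = 1")
    case True
    have "(\<lambda>n. em_term (Suc n) 1) sums 0"
      by (simp add: em_term_def del: of_nat_Suc)
    hence "g 1 = 0" using sums_unique2[OF g(2)] by auto
    thus ?thesis using True by (simp add: W_def zeta_reg_def)
  next
    case False
    have "W s = (s - 1) * riemann_zeta s"
    proof (rule analytic_continuation_open[of "{s. Re s > 1}" "{s. Re s > - 1} - {1}" W "\<lambda>s. (s - 1) * riemann_zeta s"])
      have "(2::complex) \<in> {s. Re s > 1}" by simp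
      thus "{s. Re s > 1} \<noteq> {}" by blast
      show "connected ({s. Re s > - 1} - {1::complex})"
        by (intro connected_open_delete convex_connected convex_halfspace_Re_gt) auto
      show "W holomorphic_on {s. Re s > - 1} - {1}" by (rule holomorphic_on_subset[OF holW]) auto
      show "(\<lambda>s. (s - 1) * riemann_zeta s) holomorphic_on {s. Re s > - 1} - {1}"
        by (intro holomorphic_intros holomorphic_on_subset[OF zeta_hol]) auto
    qed (use s False eq1 in auto)
    thus ?thesis using False by (simp add: zeta_reg_def)
  qed
  show "Re s > - 1 \<Longrightarrow> (\<lambda>n. em_term (Suc n) s) sums (zeta_reg s - (s - 1) / 2 - 1)"
    using g(2)[of s] eq2[of s, symmetric] by (simp add: W_def)
  show "zeta_reg holomorphic_on {s. Re s > - 1}"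
    by (rule holomorphic_transform[OF holW]) (use eq2 in auto)
qed

text \<open>On \<open>Re s \<ge> - 1 / 2\<close> the series is dominated by a cubic in
  \<open>norm s\<close> times the fixed convergent series of
  \<open>n powr (- 3 / 2)\<close>.\<close>

lemma zeta_reg_growth:
  obtains C where "C \<ge> 1" "\<And>s. Re s \<ge> - 1 / 2 \<Longrightarrow> norm (zeta_reg s) \<le> C * (1 + norm s) ^ 3"
proof -
  define S where "S = (\<Sum>n. real (Suc n) powr (- 3 / 2))"
  have sumS: "summable (\<lambda>n. real (Suc n) powr (- 3 / 2))" by (rule summable_Suc_powr) auto
  have S0: "S \<ge> 0" unfolding S_def by (rule suminf_nonneg[OF sumS]) auto
  show ?thesis
  proof (rule that[of "2 + S"])
    fix s :: complex assume s: "Re s \<ge> - 1 / 2"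
    define M where "M = norm ((s - 1) * s * (s + 1)) / 2"
    define A where "A = 1 + norm s"
    have A1: "A \<ge> 1" by (simp add: A_def)
    have b: "norm (em_term (Suc n) s) \<le> M * real (Suc n) powr (- 3 / 2)" for n
    proof -
      have "norm (em_term (Suc n) s) \<le> M * real (Suc n) powr (- Re s - 2)"
        unfolding M_def using s by (intro norm_em_term_le) auto
      also have "\<dots> \<le> M * real (Suc n) powr (- 3 / 2)"
      proof (intro mult_left_mono powr_mono)
        show "- Re s - 2 \<le> - 3 / 2" using s by (simp add: field_simps)
      qed (auto simp: M_def)
      finally show ?thesis .
    qed
    have M3: "M \<le> A ^ 3"
    proof -
      define q where "q = norm (s - 1) * norm s * norm (s + 1)"
      have "q \<le> A * A * A" unfolding q_def
        using norm_triangle_ineq4[of s 1] norm_triangle_ineq[of s 1]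
        by (intro mult_mono) (auto simp: A_def)
      moreover have "q \<ge> 0" by (simp add: q_def)
      moreover have "M = q / 2" by (simp add: M_def q_def norm_mult)
      moreover have "A ^ 3 = A * A * A" by (simp add: power3_eq_cube)
      ultimately show ?thesis by argo
    qed
    have sm: "summable (\<lambda>n. M * real (Suc n) powr (- 3 / 2))" by (intro summable_mult sumS)
    have "zeta_reg s = (s - 1) / 2 + 1 + (\<Sum>n. em_term (Suc n) s)"
      using zeta_reg_sums[of s] s by (simp add: sums_iff)
    also have "norm \<dots> \<le> norm ((s - 1) / 2) + norm (1::complex) + norm (\<Sum>n. em_term (Suc n) s)"
      by (intro order.trans[OF norm_triangle_ineq] add_mono norm_triangle_ineq order.refl)
    also have "norm ((s - 1) / 2) \<le> A"
    proof -
      have "norm (s - 1) \<le> norm s + 1" using norm_triangle_ineq4[of s 1] by simp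
      moreover have "norm s \<ge> 0" by simp
      ultimately have "norm (s - 1) \<le> 2 * A" unfolding A_def by argo
      thus ?thesis by (simp add: norm_divide)
    qed
    also have "norm (\<Sum>n. em_term (Suc n) s) \<le> (\<Sum>n. M * real (Suc n) powr (- 3 / 2))"
      by (rule norm_suminf_le[OF b sm])
    also have "\<dots> = M * S" unfolding S_def by (rule suminf_mult[OF sumS])
    also have "M * S \<le> A ^ 3 * S" using M3 S0 by (rule mult_right_mono)
    also have "A + norm (1::complex) + A ^ 3 * S \<le> A ^ 3 + A ^ 3 + A ^ 3 * S"
      using A1 power_increasing[of 1 3 A] by simp
    finally show "norm (zeta_reg s) \<le> (2 + S) * (1 + norm s) ^ 3"
      using S0 by (simp add: A_def algebra_simps)
  qed (use S0 in auto)
qed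

text \<open>For \<open>r < 0\<close> the summand with \<open>n = 0\<close> is exactly the constant
  \<open>(r - 1) / 2 + 1\<close> missing in \<open>zeta_reg_sums\<close>, because
  \<open>0 powr (- r)\<close> and \<open>0 powr (1 - r)\<close> are 0. Starting at the interval from
  0 to 1 is what later turns the Mellin side into a full geometric series.\<close>

lemma zeta_reg_real_sums:
  assumes "- 1 < r" "r < 0"
  shows "(\<lambda>n. em_term n (of_real r)) sums zeta_reg (of_real r)"
proof -
  have "em_term 0 (of_real r) = (of_real r - 1) / 2 + 1" using assms by (simp add: em_term_def)
  moreover have "(\<lambda>n. em_term (Suc n) (of_real r)) sums (zeta_reg (of_real r) - (of_real r - 1) / 2 - 1)"
    using assms by (intro zeta_reg_sums) auto
  ultimately show ?thesis
    using sums_Suc_iff[of "\<lambda>n. em_term n (of_real r)" "zeta_reg (of_real r) - (of_real r - 1) / 2 - 1"]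
    by (simp add: algebra_simps)
qed

section \<open>The functional equation\<close>

lemma not_nonpos_Int_between:
  assumes "of_int k < (x::real)" "x < of_int k + 1"
  shows "x \<notin> \<int>\<^sub>\<le>\<^sub>0"
proof
  assume "x \<in> \<int>\<^sub>\<le>\<^sub>0"
  then obtain n where n: "x = of_int n" by (auto elim: nonpos_Ints_cases)
  hence "of_int n < (of_int (k + 1) :: real)" using assms by simp
  hence "n < k + 1" by (simp only: of_int_less_iff)
  thus False using assms n by simp
qed

section \<open>Mellin integrals that evaluate to Gamma values\<close>

lemma Gamma_nn_integral_scale:
  assumes z: "z > (0::real)" and v: "v > 0"
  shows "(\<integral>\<^sup>+x. ennreal (indicator {0<..} x * (x powr (z - 1) * exp (- (v * x)))) \<partial>lborel) =
    ennreal (Gamma z * v powr (- z))"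
proof -
  have "ennreal (Gamma z * v powr (- z)) = ennreal (v powr (- z)) * ennreal (Gamma z)"
    using z v by (simp add: ennreal_mult' mult.commute)
  also have "ennreal (Gamma z) = (\<integral>\<^sup>+t. ennreal (indicator {0..} t * t powr (z - 1) / exp t) \<partial>lborel)"
    by (rule Gamma_conv_nn_integral_real[OF z])
  also have "\<dots> = ennreal v * (\<integral>\<^sup>+t. ennreal (indicator {0..} (v * t) * (v * t) powr (z - 1) / exp (v * t)) \<partial>lborel)"
    by (subst nn_integral_real_affine[where t = 0 and c = v]) (use v in auto)
  also have "ennreal (v powr (- z)) * \<dots> =
      (\<integral>\<^sup>+t. ennreal (v powr (- z)) * (ennreal v * ennreal (indicator {0..} (v * t) * (v * t) powr (z - 1) / exp (v * t))) \<partial>lborel)"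
    by (simp add: nn_integral_cmult)
  also have "\<dots> = (\<integral>\<^sup>+x. ennreal (indicator {0<..} x * (x powr (z - 1) * exp (- (v * x)))) \<partial>lborel)"
  proof (rule nn_integral_cong)
    fix t :: real
    have "v powr (- z) * (v * (v powr (z - 1))) = 1"
      using v by (simp add: powr_diff powr_minus field_simps)
    hence "v powr (- z) * (v * (indicator {0..} (v * t) * (v * t) powr (z - 1) / exp (v * t))) =
      indicator {0<..} t * (t powr (z - 1) * exp (- (v * t)))"
      using v by (auto simp: indicator_def powr_mult exp_minus zero_le_mult_iff divide_inverse mult_ac)
    thus "ennreal (v powr (- z)) * (ennreal v * ennreal (indicator {0..} (v * t) * (v * t) powr (z - 1) / exp (v * t))) =
      ennreal (indicator {0<..} t * (t powr (z - 1) * exp (- (v * t))))"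
      using v by (simp flip: ennreal_mult')
  qed
  finally show ?thesis by simp
qed

lemma Gaussian_moment:
  assumes r: "r > (-1::real)" and y: "y > 0"
  shows "(\<integral>\<^sup>+x. ennreal (indicator {0<..} x * (2 * x powr r * exp (- (x\<^sup>2 * y)))) \<partial>lborel) =
    ennreal (Gamma ((1 + r) / 2) * y powr (- ((1 + r) / 2)))"
proof -
  define z where "z = (1 + r) / 2"
  have z: "z > 0" using r by (simp add: z_def)
  define f where "f = (\<lambda>t. t powr (z - 1) * exp (- (y * t)) :: real)"
  define c where "c = Gamma z * y powr (- z)"
  have c: "c \<ge> 0" using z by (simp add: c_def)
  have "((\<lambda>t. indicator {0<..} t * f t) has_integral c) UNIV"
    using Gamma_nn_integral_scale[OF z y]
    by (intro nn_integral_has_integral) (auto simp: f_def c_def z mult_ac)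
  also have "(\<lambda>t. indicator {0<..} t * f t) = (\<lambda>t. if t \<in> {0<..} then f t else 0)"
    by (auto simp: indicator_def)
  finally have f: "(f has_integral c) {0<..}" by (subst (asm) has_integral_restrict_UNIV)
  have nn: "f t \<ge> 0" for t by (simp add: f_def)
  have "f absolutely_integrable_on {0<..}"
    using f nn by (intro nonnegative_absolutely_integrable_1) auto
  moreover have img: "(\<lambda>x::real. x\<^sup>2) ` {0<..} = {0<..}"
  proof (intro equalityI subsetI)
    fix t :: real assume "t \<in> {0<..}"
    thus "t \<in> (\<lambda>x::real. x\<^sup>2) ` {0<..}" by (intro image_eqI[of _ _ "sqrt t"]) auto
  qed auto
  ultimately have "(\<lambda>x. \<bar>2 * x\<bar> * f (x\<^sup>2)) absolutely_integrable_on {0<..} \<and>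
      integral {0<..} (\<lambda>x. \<bar>2 * x\<bar> * f (x\<^sup>2)) = c"
    using f by (subst has_absolute_integral_change_of_variables_1')
      (auto intro!: derivative_eq_intros inj_onI simp: power2_eq_iff integral_unique)
  hence "((\<lambda>x. \<bar>2 * x\<bar> * f (x\<^sup>2)) has_integral c) {0<..}"
    using has_integral_integral set_lebesgue_integral_eq_integral(1) by metis
  hence "((\<lambda>x. 2 * x powr r * exp (- (x\<^sup>2 * y))) has_integral c) {0<..}"
  proof (rule has_integral_eq[rotated])
    fix x :: real assume x: "x \<in> {0<..}"
    have "x * (x\<^sup>2) powr (z - 1) = x powr 1 * x powr (2 * (z - 1))"
      using x by (simp add: powr_powr flip: powr_numeral)
    also have "\<dots> = x powr r" by (subst powr_add[symmetric]) (simp add: z_def field_simps)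
    finally show "\<bar>2 * x\<bar> * f (x\<^sup>2) = 2 * x powr r * exp (- (x\<^sup>2 * y))"
      using x by (simp add: f_def mult_ac)
  qed
  from nn_integral_has_integral_lebesgue[OF _ this] show ?thesis
    by (simp add: c_def z_def)
qed

text \<open>The factor \<open>1 / (x^2 + c^2)\<close> is the integral of
  \<open>exp (- ((x^2 + c^2) * y))\<close> over \<open>y > 0\<close>. After exchanging the
  integrals, the inner one is a Gaussian moment and the outer one a Gamma integral. The two Gamma
  values are kept apart because \<open>xi_functional_real\<close> uses each of them on its
  own.\<close>

lemma nn_integral_powr_over_quadratic:
  assumes r: "-1 < r" "r < 1" and c: "c > (0::real)"
  shows "(\<integral>\<^sup>+x. ennreal (indicator {0<..} x * (x powr (r - 1) * (2 * x / (x\<^sup>2 + c\<^sup>2)))) \<partial>lborel) =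
    ennreal (Gamma ((1 + r) / 2) * Gamma ((1 - r) / 2) * c powr (r - 1))"
proof -
  define g where "g = (\<lambda>x y :: real. indicator {0<..} x * indicator {0<..} y *
     (2 * x powr r * exp (- (x\<^sup>2 * y)) * exp (- (c\<^sup>2 * y))))"
  have [measurable]: "(\<lambda>(x, y). ennreal (g x y)) \<in> borel_measurable (lborel \<Otimes>\<^sub>M lborel)"
    unfolding g_def by measurable
  have "(\<integral>\<^sup>+x. ennreal (indicator {0<..} x * (x powr (r - 1) * (2 * x / (x\<^sup>2 + c\<^sup>2)))) \<partial>lborel) =
     (\<integral>\<^sup>+x. \<integral>\<^sup>+y. ennreal (g x y) \<partial>lborel \<partial>lborel)"
  proof (rule nn_integral_cong)
    fix x :: real
    show "ennreal (indicator {0<..} x * (x powr (r - 1) * (2 * x / (x\<^sup>2 + c\<^sup>2)))) = (\<integral>\<^sup>+y. ennreal (g x y) \<partial>lborel)"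
    proof (cases "x > 0")
      case True
      have v: "x\<^sup>2 + c\<^sup>2 > 0" using c by (simp add: add_nonneg_pos)
      have "(\<integral>\<^sup>+y. ennreal (g x y) \<partial>lborel) = (\<integral>\<^sup>+y. ennreal (2 * x powr r) *
          ennreal (indicator {0<..} y * (y powr (1 - 1) * exp (- ((x\<^sup>2 + c\<^sup>2) * y)))) \<partial>lborel)"
        using True by (intro nn_integral_cong)
          (auto simp: g_def indicator_def exp_add[symmetric] algebra_simps simp flip: ennreal_mult')
      also have "\<dots> = ennreal (2 * x powr r) * ennreal (Gamma 1 * (x\<^sup>2 + c\<^sup>2) powr (- 1))"
        by (subst nn_integral_cmult) (auto simp: Gamma_nn_integral_scale[OF zero_less_one v, simplified])
      also have "\<dots> = ennreal (2 * x powr r / (x\<^sup>2 + c\<^sup>2))"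
        using v by (simp add: powr_minus divide_inverse flip: ennreal_mult')
      also have "2 * x powr r / (x\<^sup>2 + c\<^sup>2) = indicator {0<..} x * (x powr (r - 1) * (2 * x / (x\<^sup>2 + c\<^sup>2)))"
        using True by (simp add: powr_diff)
      finally show ?thesis by simp
    qed (simp add: g_def)
  qed
  also have "\<dots> = (\<integral>\<^sup>+y. \<integral>\<^sup>+x. ennreal (g x y) \<partial>lborel \<partial>lborel)"
    by (rule lborel_pair.Fubini'[symmetric]) measurable
  also have "\<dots> = (\<integral>\<^sup>+y. ennreal (Gamma ((1 + r) / 2)) *
      ennreal (indicator {0<..} y * (y powr ((1 - r) / 2 - 1) * exp (- (c\<^sup>2 * y)))) \<partial>lborel)"
  proof (rule nn_integral_cong)
    fix y :: real
    show "(\<integral>\<^sup>+x. ennreal (g x y) \<partial>lborel) = ennreal (Gamma ((1 + r) / 2)) *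
      ennreal (indicator {0<..} y * (y powr ((1 - r) / 2 - 1) * exp (- (c\<^sup>2 * y))))"
    proof (cases "y > 0")
      case True
      have "(\<integral>\<^sup>+x. ennreal (g x y) \<partial>lborel) =
          (\<integral>\<^sup>+x. ennreal (exp (- (c\<^sup>2 * y))) * ennreal (indicator {0<..} x * (2 * x powr r * exp (- (x\<^sup>2 * y)))) \<partial>lborel)"
        using True by (intro nn_integral_cong) (auto simp: g_def mult_ac simp flip: ennreal_mult')
      also have "\<dots> = ennreal (exp (- (c\<^sup>2 * y))) * ennreal (Gamma ((1 + r) / 2) * y powr (- ((1 + r) / 2)))"
        by (subst nn_integral_cmult) (auto simp: Gaussian_moment[OF r(1) True])
      also have "- ((1 + r) / 2) = (1 - r) / 2 - 1" by (simp add: field_simps)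
      finally show ?thesis using True r by (simp add: mult_ac flip: ennreal_mult')
    qed (simp add: g_def)
  qed
  also have "\<dots> = ennreal (Gamma ((1 + r) / 2)) * ennreal (Gamma ((1 - r) / 2) * (c\<^sup>2) powr (- ((1 - r) / 2)))"
    using r c by (subst nn_integral_cmult) (auto simp: Gamma_nn_integral_scale)
  also have "(c\<^sup>2) powr (- ((1 - r) / 2)) = c powr (r - 1)"
  proof -
    have "(c\<^sup>2) powr (- ((1 - r) / 2)) = c powr (2 * (- ((1 - r) / 2)))"
      using c by (simp add: powr_powr flip: powr_numeral)
    also have "2 * (- ((1 - r) / 2)) = r - 1" by (simp add: field_simps)
    finally show ?thesis .
  qed
  finally show ?thesis using r by (simp add: mult_ac flip: ennreal_mult')
qed

text \<open>The next two integrals are the error of the trapezoidal rule on \<open>{n..n+1}\<close>, applied to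
  \<open>exp (-x v)\<close> and to \<open>v powr (-r)\<close>.\<close>

lemma trapezoid_exp:
  assumes x: "x > (0::real)"
  shows "((\<lambda>v. (v - real n) * (real n + 1 - v) / 2 * (x\<^sup>2 * exp (- (x * v)))) has_integral
     exp (- (x * real n)) * ((1 + exp (- x)) / 2 - (1 - exp (- x)) / x)) {real n..real n + 1}"
proof -
  define A where "A = (\<lambda>v. ((v - real n) * (real n + 1 - v) * (- x * exp (- (x * v))) -
      (2 * real n + 1 - 2 * v) * exp (- (x * v)) + 2 * exp (- (x * v)) / x) / 2)"
  have "((\<lambda>v. (v - real n) * (real n + 1 - v) / 2 * (x\<^sup>2 * exp (- (x * v)))) has_integral
      (A (real n + 1) - A (real n))) {real n..real n + 1}"
  proof (rule fundamental_theorem_of_calculus)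
    fix v assume "v \<in> {real n..real n + 1}"
    have "(A has_real_derivative (v - real n) * (real n + 1 - v) / 2 * (x\<^sup>2 * exp (- (x * v)))) (at v within {real n..real n + 1})"
      unfolding A_def using x
      by (auto intro!: derivative_eq_intros simp: power2_eq_square field_simps)
    thus "(A has_vector_derivative (v - real n) * (real n + 1 - v) / 2 * (x\<^sup>2 * exp (- (x * v)))) (at v within {real n..real n + 1})"
      by (simp add: has_real_derivative_iff_has_vector_derivative)
  qed simp
  also have "A (real n + 1) - A (real n) = exp (- (x * real n)) * ((1 + exp (- x)) / 2 - (1 - exp (- x)) / x)"
    using x by (simp add: A_def distrib_left exp_add exp_diff exp_minus field_simps)
  finally show ?thesis .
qed

definition em_real :: "real \<Rightarrow> nat \<Rightarrow> real" where
  "em_real r n = (r - 1) / 2 * (real n powr (- r) + (real n + 1) powr (- r)) +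
     (real n + 1) powr (1 - r) - real n powr (1 - r)"

lemma trapezoid_powr:
  assumes r: "-1 < r" "r < 0"
  shows "((\<lambda>v. (v - real n) * (real n + 1 - v) / 2 * v powr (- r - 2)) has_integral
     em_real r n / ((r - 1) * r * (r + 1))) {real n..real n + 1}"
proof -
  define m where "m = real n"
  have m: "m \<ge> 0" "m = 0 \<or> m > 0" by (auto simp: m_def)
  define q where "q = 1 / (1 - r)"
  have q: "(1 - r) * q = 1" using r by (simp add: q_def)
  define P0 where "P0 = (\<lambda>v. v powr (- r))"
  define P1 where "P1 = (\<lambda>v. v powr (- r - 1))"
  define P3 where "P3 = (\<lambda>v. v powr (1 - r))"
  \<comment> \<open>This antiderivative comes from integrating by parts. The product
    \<open>(v - m) * v powr (- r - 1)\<close> is written as \<open>P0 v - m * P1 v\<close>, which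
    stays continuous at \<open>v = 0\<close> in the case \<open>m = 0\<close>.\<close>
  define N where "N = (\<lambda>v. (m + 1 - v) * (- r) * (P0 v - m * P1 v) - (2 * m + 1 - 2 * v) * P0 v - 2 * (q * P3 v))"
  have "((\<lambda>v. r * (r + 1) * ((v - m) * (m + 1 - v) * v powr (- r - 2))) has_integral (N (m + 1) - N m)) {m..m + 1}"
  proof (rule fundamental_theorem_of_calculus_interior)
    have c: "continuous_on {m..m + 1} (\<lambda>v. m * P1 v)"
      unfolding P1_def using m(2) by (elim disjE) (simp, intro continuous_intros, auto)
    have c1: "continuous_on {m..m + 1} P0"
      unfolding P0_def by (intro continuous_on_powr' continuous_intros) (use r m in auto)
    have c2: "continuous_on {m..m + 1} P3"
      unfolding P3_def by (intro continuous_on_powr' continuous_intros) (use r m in auto)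
    show "continuous_on {m..m + 1} N"
      unfolding N_def by (intro continuous_intros c c1 c2)
    fix v assume v: "v \<in> {m<..<m + 1}"
    hence v0: "v > 0" using m(1) by auto
    define w where "w = v powr (- r - 2)"
    have w1: "P1 v = v * w"
    proof -
      have "- r - 2 + 1 = - r - 1" by simp
      thus ?thesis using powr_add[of v "- r - 2" 1] v0 by (simp only: P1_def w_def powr_one mult.commute)
    qed
    have w0: "P0 v = v * (v * w)"
      using powr_add[of v "- r - 1" 1] v0 w1 by (simp add: P1_def P0_def mult_ac)
    have d0: "(P0 has_real_derivative (- r) * P1 v) (at v)"
      using has_real_derivative_powr[OF v0, of "- r"] by (simp add: P0_def P1_def)
    have d1: "(P1 has_real_derivative (- r - 1) * w) (at v)"
    proof -
      have "- r - 1 - 1 = - r - 2" by simp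
      thus ?thesis using has_real_derivative_powr[OF v0, of "- r - 1"] by (simp only: P1_def w_def)
    qed
    have d3: "(P3 has_real_derivative (1 - r) * P0 v) (at v)"
      using has_real_derivative_powr[OF v0, of "1 - r"] by (simp add: P0_def P3_def)
    have "(N has_real_derivative
        ((m + 1 - v) * (- r) * ((- r) * P1 v - m * ((- r - 1) * w)) + (- 1) * (- r) * (P0 v - m * P1 v)
         - ((2 * m + 1 - 2 * v) * ((- r) * P1 v) + (- 2) * P0 v) - 2 * (q * ((1 - r) * P0 v)))) (at v)"
      unfolding N_def by (rule derivative_eq_intros d0 d1 d3 refl | simp)+
    also have "2 * (q * ((1 - r) * P0 v)) = 2 * P0 v" using q by (simp add: mult.assoc[symmetric] mult.commute)
    also have "(m + 1 - v) * (- r) * ((- r) * P1 v - m * ((- r - 1) * w)) + (- 1) * (- r) * (P0 v - m * P1 v)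
         - ((2 * m + 1 - 2 * v) * ((- r) * P1 v) + (- 2) * P0 v) - 2 * P0 v = r * (r + 1) * ((v - m) * (m + 1 - v) * w)"
      unfolding w0 w1 by algebra
    finally show "(N has_vector_derivative r * (r + 1) * ((v - m) * (m + 1 - v) * v powr (- r - 2))) (at v)"
      by (simp add: has_real_derivative_iff_has_vector_derivative w_def)
  qed simp
  also have "N (m + 1) - N m = 2 * (em_real r n / (r - 1))"
  proof -
    have z: "P0 m - m * P1 m = 0"
      using m(2) r by (elim disjE) (simp_all add: P0_def P1_def powr_diff)
    have "N (m + 1) - N m = P0 m + P0 (m + 1) - 2 * q * (P3 (m + 1) - P3 m)"
      unfolding N_def z by (simp add: algebra_simps)
    moreover have "em_real r n = (r - 1) * ((P0 m + P0 (m + 1) - 2 * q * (P3 (m + 1) - P3 m)) / 2)" (is "_ = ?X")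
    proof -
      have "em_real r n = (r - 1) / 2 * (P0 m + P0 (m + 1)) + (1 - r) * q * (P3 (m + 1) - P3 m)"
        by (simp add: q) (simp add: em_real_def P0_def P3_def m_def)
      also have "\<dots> = ?X" by (simp add: field_simps)
      finally show ?thesis .
    qed
    moreover have "2 * ((r - 1) * (Y / 2) / (r - 1)) = Y" for Y
    proof -
      have "r - 1 \<noteq> 0" using r by simp
      hence c: "(r - 1) * (Y / 2) / (r - 1) = Y / 2" by (rule nonzero_mult_div_cancel_left)
      show ?thesis unfolding c by simp
    qed
    ultimately show ?thesis by (simp only:)
  qed
  finally have H: "((\<lambda>v. r * (r + 1) * ((v - m) * (m + 1 - v) * v powr (- r - 2)) / (2 * (r * (r + 1)))) has_integral
     2 * (em_real r n / (r - 1)) / (2 * (r * (r + 1)))) {m..m + 1}"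
    by (rule has_integral_divide)
  have ne: "r * (r + 1) \<noteq> 0" using r by simp
  have e1: "r * (r + 1) * ((v - m) * (m + 1 - v) * v powr (- r - 2)) / (2 * (r * (r + 1))) =
      (v - m) * (m + 1 - v) / 2 * v powr (- r - 2)" for v using ne by simp
  have e2: "2 * (em_real r n / (r - 1)) / (2 * (r * (r + 1))) = em_real r n / ((r - 1) * r * (r + 1))"
    by (simp add: mult.assoc)
  show ?thesis using H unfolding e1 e2 unfolding m_def .
qed

text \<open>Since \<open>Gamma (r + 2) * v powr (- r - 2)\<close> is the integral of
  \<open>x powr (r + 1) * exp (- (x * v))\<close> over \<open>x > 0\<close>, both trapezoidal errors
  come from one double integral with nonnegative integrand: integrating over \<open>v\<close> first
  gives the error for \<open>exp\<close>, over \<open>x\<close> first the one for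
  \<open>powr\<close>. Three steps of the recursion of Gamma absorb the factor
  \<open>(r - 1) * r * (r + 1)\<close>.\<close>

lemma nn_integral_trapezoid:
  assumes r: "-1 < r" "r < 0"
  shows "(\<integral>\<^sup>+x. ennreal (indicator {0<..} x * (x powr (r - 1) *
      (exp (- (x * real n)) * ((1 + exp (- x)) / 2 - (1 - exp (- x)) / x)))) \<partial>lborel) =
    ennreal (Gamma (r - 1) * em_real r n)"
    and em_real_nonneg: "Gamma (r - 1) * em_real r n \<ge> 0"
proof -
  define p where "p = (\<lambda>v. (v - real n) * (real n + 1 - v) / 2)"
  define I where "I = {real n..real n + 1}"
  have p: "p v \<ge> 0" if "v \<in> I" for v using that by (auto simp: p_def I_def)
  define g where "g = (\<lambda>x v :: real. indicator {0<..} x * (indicator I v *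
     (p v * (x powr (r + 1) * exp (- (x * v))))))"
  have [measurable]: "I \<in> sets borel" by (simp add: I_def)
  have [measurable]: "(\<lambda>(x, y). ennreal (g x y)) \<in> borel_measurable (lborel \<Otimes>\<^sub>M lborel)"
    unfolding g_def p_def by measurable
  have Geq: "Gamma (r + 2) / ((r - 1) * r * (r + 1)) = Gamma (r - 1)"
  proof -
    have "Gamma (r - 1 + 1) = (r - 1) * Gamma (r - 1)"
      using r by (intro Gamma_plus1 not_nonpos_Int_between[of "-2"]) auto
    moreover have "Gamma (r + 1) = r * Gamma r"
      using r by (intro Gamma_plus1 not_nonpos_Int_between[of "-1"]) auto
    moreover have "Gamma (r + 1 + 1) = (r + 1) * Gamma (r + 1)"
      using r by (intro Gamma_plus1 not_nonpos_Int_between[of 0]) auto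
    ultimately have "Gamma (r + 2) = (r + 1) * (r * ((r - 1) * Gamma (r - 1)))"
      by (simp add: add_ac)
    moreover have "r \<noteq> 0" "r + 1 \<noteq> 0" "r - 1 \<noteq> 0" using r by auto
    ultimately show ?thesis by (simp add: divide_simps)
  qed
  define E where "E = em_real r n / ((r - 1) * r * (r + 1))"
  have E0: "E \<ge> 0"
    using trapezoid_powr[OF r, of n] unfolding E_def
    by (rule has_integral_nonneg) (use p in \<open>auto simp: p_def I_def\<close>)
  have GE: "Gamma (r + 2) * E = Gamma (r - 1) * em_real r n"
    unfolding E_def Geq[symmetric] by simp
  show "Gamma (r - 1) * em_real r n \<ge> 0"
    unfolding GE[symmetric] using r E0 by simp
  have "(\<integral>\<^sup>+x. ennreal (indicator {0<..} x * (x powr (r - 1) *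
      (exp (- (x * real n)) * ((1 + exp (- x)) / 2 - (1 - exp (- x)) / x)))) \<partial>lborel) =
      (\<integral>\<^sup>+x. \<integral>\<^sup>+v. ennreal (g x v) \<partial>lborel \<partial>lborel)"
  proof (rule nn_integral_cong)
    fix x :: real
    show "ennreal (indicator {0<..} x * (x powr (r - 1) *
      (exp (- (x * real n)) * ((1 + exp (- x)) / 2 - (1 - exp (- x)) / x)))) = (\<integral>\<^sup>+v. ennreal (g x v) \<partial>lborel)"
    proof (cases "x > 0")
      case True
      have "(\<integral>\<^sup>+v. ennreal (g x v) \<partial>lborel) = (\<integral>\<^sup>+v. ennreal (x powr (r - 1)) *
          ennreal (indicator I v * (p v * (x\<^sup>2 * exp (- (x * v))))) \<partial>lborel)"
      proof (rule nn_integral_cong)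
        fix v
        have "x powr (r + 1) = x powr (r - 1) * x\<^sup>2"
          using True by (simp add: powr_add powr_diff power2_eq_square)
        hence "g x v = x powr (r - 1) * (indicator I v * (p v * (x\<^sup>2 * exp (- (x * v)))))"
          using True by (simp add: g_def mult_ac)
        thus "ennreal (g x v) = ennreal (x powr (r - 1)) * ennreal (indicator I v * (p v * (x\<^sup>2 * exp (- (x * v)))))"
          by (simp add: ennreal_mult')
      qed
      also have "\<dots> = ennreal (x powr (r - 1)) * (\<integral>\<^sup>+v. ennreal (indicator I v * (p v * (x\<^sup>2 * exp (- (x * v))))) \<partial>lborel)"
        unfolding p_def by (subst nn_integral_cmult) auto
      also have "(\<integral>\<^sup>+v. ennreal (indicator I v * (p v * (x\<^sup>2 * exp (- (x * v))))) \<partial>lborel) =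
          ennreal (exp (- (x * real n)) * ((1 + exp (- x)) / 2 - (1 - exp (- x)) / x))"
        using trapezoid_exp[OF True, of n] p unfolding p_def I_def
        by (intro nn_integral_has_integral_lebesgue) auto
      finally show ?thesis using True by (simp add: ennreal_mult')
    qed (simp add: g_def)
  qed
  also have "\<dots> = (\<integral>\<^sup>+v. \<integral>\<^sup>+x. ennreal (g x v) \<partial>lborel \<partial>lborel)"
    by (rule lborel_pair.Fubini'[symmetric]) measurable
  also have "\<dots> = (\<integral>\<^sup>+v. ennreal (Gamma (r + 2)) * ennreal (indicator I v * (p v * v powr (- r - 2))) \<partial>lborel)"
  proof (rule nn_integral_cong)
    fix v :: real
    \<comment> \<open>At \<open>v = 0\<close> the integral over \<open>x\<close> would diverge, but
      0 lies in \<open>I\<close> only for \<open>n = 0\<close>, and there \<open>p\<close>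
      vanishes.\<close>
    consider "v \<notin> I" | "v \<in> I" "v = 0" | "v \<in> I" "v > 0"
    proof -
      have "v \<ge> 0" if "v \<in> I" using that of_nat_0_le_iff[of n] unfolding I_def by (meson atLeastAtMost_iff order_trans)
      thus ?thesis using that by fastforce
    qed
    thus "(\<integral>\<^sup>+x. ennreal (g x v) \<partial>lborel) = ennreal (Gamma (r + 2)) * ennreal (indicator I v * (p v * v powr (- r - 2)))"
    proof cases
      case 2
      hence "n = 0" by (auto simp: I_def)
      hence "p v = 0" using 2 by (simp add: p_def)
      thus ?thesis by (simp add: g_def)
    next
      case 3
      have "(\<integral>\<^sup>+x. ennreal (g x v) \<partial>lborel) =
        (\<integral>\<^sup>+x. ennreal (p v) * ennreal (indicator {0<..} x * (x powr (r + 2 - 1) * exp (- (v * x)))) \<partial>lborel)"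
        using 3 p by (intro nn_integral_cong) (auto simp: g_def mult_ac add_ac simp flip: ennreal_mult')
      also have "\<dots> = ennreal (p v) * ennreal (Gamma (r + 2) * v powr (- (r + 2)))"
        using 3 r by (subst nn_integral_cmult, simp, subst Gamma_nn_integral_scale) auto
      finally show ?thesis using 3 r p[of v] by (simp add: mult_ac flip: ennreal_mult')
    qed (simp add: g_def)
  qed
  also have "\<dots> = ennreal (Gamma (r + 2)) * (\<integral>\<^sup>+v. ennreal (indicator I v * (p v * v powr (- r - 2))) \<partial>lborel)"
    unfolding p_def by (subst nn_integral_cmult) auto
  also have "(\<integral>\<^sup>+v. ennreal (indicator I v * (p v * v powr (- r - 2))) \<partial>lborel) = ennreal E"
    using trapezoid_powr[OF r, of n] p unfolding p_def I_def E_def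
    by (intro nn_integral_has_integral_lebesgue) auto
  also have "ennreal (Gamma (r + 2)) * ennreal E = ennreal (Gamma (r - 1) * em_real r n)"
    using r E0 by (simp add: GE flip: ennreal_mult')
  finally show "(\<integral>\<^sup>+x. ennreal (indicator {0<..} x * (x powr (r - 1) *
      (exp (- (x * real n)) * ((1 + exp (- x)) / 2 - (1 - exp (- x)) / x)))) \<partial>lborel) =
    ennreal (Gamma (r - 1) * em_real r n)" .
qed

text \<open>The limit is \<open>coth (x / 2) / 2 - 1 / x\<close>, the logarithmic derivative of
  \<open>sinh (t / 2) / (t / 2)\<close> at \<open>t = x\<close>. It arises by taking the logarithm
  of the product for the sine at an imaginary argument and differentiating term by term.\<close>

lemma coth_partial_fractions:
  assumes x: "x > (0::real)"
  shows "(\<lambda>n. 2 * x / (x\<^sup>2 + (2 * pi * real (Suc n))\<^sup>2)) sums ((1 + exp (- x)) / (2 * (1 - exp (- x))) - 1 / x)"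
proof -
  define f where "f = (\<lambda>n t. ln (1 + t\<^sup>2 / (2 * pi * real (Suc n))\<^sup>2))"
  define f' where "f' = (\<lambda>n t. 2 * t / (t\<^sup>2 + (2 * pi * real (Suc n))\<^sup>2))"
  define S where "S = {0..x + 1}"
  have prod: "(\<lambda>N. \<Prod>k=1..N. 1 + t\<^sup>2 / (2 * pi * real k)\<^sup>2) \<longlonglongrightarrow> sinh (t / 2) / (t / 2)" if t: "t \<noteq> 0" for t :: real
  proof -
    define z where "z = \<i> * of_real (t / (2 * pi))"
    have z0: "complex_of_real pi * z \<noteq> 0" using t by (simp add: z_def)
    have "(\<lambda>N. of_real pi * z * (\<Prod>k=1..N. 1 - z\<^sup>2 / of_nat k ^ 2)) \<longlonglongrightarrow> sin (of_real pi * z)"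
      by (rule sin_product_formula_complex)
    from tendsto_divide[OF this tendsto_const[of "of_real pi * z"] z0]
    have "(\<lambda>N. (\<Prod>k=1..N. 1 - z\<^sup>2 / of_nat k ^ 2)) \<longlonglongrightarrow> sin (of_real pi * z) / (of_real pi * z)"
      using z0 by simp
    moreover have "(\<Prod>k=1..N. 1 - z\<^sup>2 / of_nat k ^ 2) = of_real (\<Prod>k=1..N. 1 + t\<^sup>2 / (2 * pi * real k)\<^sup>2)" for N
      unfolding of_real_prod by (intro prod.cong refl) (simp add: z_def power_mult_distrib power_divide)
    moreover have "sin (of_real pi * z) / (of_real pi * z) = of_real (sinh (t / 2) / (t / 2))"
    proof -
      have "of_real pi * z = \<i> * of_real (t / 2)" by (simp add: z_def)
      moreover have "sin (\<i> * of_real (t / 2)) = \<i> * of_real (sinh (t / 2))"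
        by (simp add: sin_exp_eq sinh_def exp_of_real[symmetric] scaleR_conv_of_real field_simps)
      ultimately show ?thesis using t by (simp only:) simp
    qed
    ultimately have "(\<lambda>N. complex_of_real (\<Prod>k=1..N. 1 + t\<^sup>2 / (2 * pi * real k)\<^sup>2)) \<longlonglongrightarrow> of_real (sinh (t / 2) / (t / 2))"
      by simp
    thus ?thesis by (simp only: tendsto_of_real_iff)
  qed
  have logsum: "(\<lambda>n. f n t) sums ln (sinh (t / 2) / (t / 2))" if t: "t > 0" for t
  proof -
    have pos: "1 + t\<^sup>2 / (2 * pi * real k)\<^sup>2 > 0" for k by (simp add: add_pos_nonneg)
    have "sinh (t / 2) / (t / 2) > 0" using t by simp
    hence "(\<lambda>N. ln (\<Prod>k=1..N. 1 + t\<^sup>2 / (2 * pi * real k)\<^sup>2)) \<longlonglongrightarrow> ln (sinh (t / 2) / (t / 2))"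
      using t by (intro tendsto_ln prod) auto
    moreover have "ln (\<Prod>k=1..N. 1 + t\<^sup>2 / (2 * pi * real k)\<^sup>2) = (\<Sum>n<N. f n t)" for N
    proof -
      have "ln (\<Prod>k=1..N. 1 + t\<^sup>2 / (2 * pi * real k)\<^sup>2) = (\<Sum>k=1..N. ln (1 + t\<^sup>2 / (2 * pi * real k)\<^sup>2))"
        using pos by (intro ln_prod) (auto simp: less_imp_neq[symmetric])
      also have "\<dots> = (\<Sum>n<N. f n t)"
        unfolding f_def by (rule sum.reindex_bij_witness[of _ Suc "\<lambda>k. k - 1"]) auto
      finally show ?thesis .
    qed
    ultimately show ?thesis by (simp add: sums_def)
  qed
  have "((\<lambda>t. \<Sum>n. f n t) has_field_derivative (\<Sum>n. f' n x)) (at x) \<and> summable (\<lambda>n. f' n x)"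
  proof
    have conv: "uniformly_convergent_on S (\<lambda>N t. \<Sum>n<N. f' n t)"
    proof (rule Weierstrass_m_test'_ev)
      have "f' n t \<le> 2 * (x + 1) * (inverse (real (Suc n) ^ 2))" "f' n t \<ge> 0" if t: "t \<in> S" for n t
      proof -
        have "f' n t \<le> 2 * (x + 1) / (real (Suc n))\<^sup>2"
          unfolding f'_def
        proof (rule frac_le)
          have "1 * real (Suc n) \<le> (2 * pi) * real (Suc n)"
            using pi_gt3 by (intro mult_right_mono) auto
          hence "(real (Suc n))\<^sup>2 \<le> (2 * pi * real (Suc n))\<^sup>2" by (intro power_mono) auto
          thus "(real (Suc n))\<^sup>2 \<le> t\<^sup>2 + (2 * pi * real (Suc n))\<^sup>2" by (simp add: add_increasing)
        qed (use t x in \<open>auto simp: S_def\<close>)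
        thus "f' n t \<le> 2 * (x + 1) * (inverse (real (Suc n) ^ 2))" by (simp add: divide_inverse)
        show "f' n t \<ge> 0" using t by (auto simp: f'_def S_def)
      qed
      thus "\<forall>\<^sub>F n in sequentially. \<forall>t\<in>S. norm (f' n t) \<le> 2 * (x + 1) * (inverse (real (Suc n) ^ 2))"
        by (intro always_eventually) auto
      have "summable (\<lambda>n. inverse (real (Suc n) ^ 2))"
        by (subst summable_Suc_iff) (rule inverse_power_summable, simp)
      thus "summable (\<lambda>n. 2 * (x + 1) * (inverse (real (Suc n) ^ 2)))" by (rule summable_mult)
    qed
    have der: "(f n has_field_derivative f' n t) (at t within S)" for n t
    proof -
      have "2 * pi * real (Suc n) \<noteq> 0" by simp
      hence c: "(2 * pi * real (Suc n))\<^sup>2 > 0" by (rule zero_less_power2[THEN iffD2])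
      moreover have "1 + t\<^sup>2 / (2 * pi * real (Suc n))\<^sup>2 > 0" by (simp add: add_pos_nonneg)
      ultimately show ?thesis
        unfolding f_def f'_def
        apply -
        apply (rule derivative_eq_intros refl | assumption | simp del: of_nat_Suc)+
        apply (simp add: divide_simps del: of_nat_Suc)
        done
    qed
    have sm: "summable (\<lambda>n. f n x)" using logsum[OF x] by (simp add: sums_iff)
    show "((\<lambda>t. \<Sum>n. f n t) has_field_derivative (\<Sum>n. f' n x)) (at x)"
      by (rule has_field_derivative_series'(2)[OF _ der conv _ sm]) (use x in \<open>auto simp: S_def\<close>)
    show "summable (\<lambda>n. f' n x)"
    proof -
      have "x \<in> S" using x by (simp add: S_def)
      with conv have "convergent (\<lambda>N. \<Sum>n<N. f' n x)"
        using uniformly_convergent_imp_convergent by fastforce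
      thus ?thesis by (simp add: summable_iff_convergent)
    qed
  qed
  hence d1: "((\<lambda>t. \<Sum>n. f n t) has_field_derivative (\<Sum>n. f' n x)) (at x)" and s1: "summable (\<lambda>n. f' n x)" by auto
  have sh: "sinh (x / 2) > 0" using x by simp
  have "((\<lambda>t. ln (sinh (t / 2)) - ln (t / 2)) has_field_derivative (cosh (x / 2) / 2 / sinh (x / 2) - 1 / x)) (at x)"
    using x sh by (auto intro!: derivative_eq_intros simp: field_simps)
  moreover have "((\<lambda>t. ln (sinh (t / 2)) - ln (t / 2)) has_field_derivative (\<Sum>n. f' n x)) (at x)"
  proof (rule DERIV_cong_ev[THEN iffD1, OF refl _ refl d1])
    have "\<forall>\<^sub>F t in nhds x. t > 0" using x eventually_nhds_in_open[of "{0<..}" x] by simp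
    thus "\<forall>\<^sub>F t in nhds x. (\<Sum>n. f n t) = ln (sinh (t / 2)) - ln (t / 2)"
    proof eventually_elim
      case (elim t)
      have "ln (sinh (t / 2) / (t / 2)) = ln (sinh (t / 2)) - ln (t / 2)"
        using elim by (intro ln_divide_pos) auto
      with logsum[OF elim] show ?case by (simp add: sums_iff)
    qed
  qed
  ultimately have "(\<Sum>n. f' n x) = cosh (x / 2) / 2 / sinh (x / 2) - 1 / x"
    using DERIV_unique by blast
  also have "cosh (x / 2) / 2 / sinh (x / 2) = (1 + exp (- x)) / (2 * (1 - exp (- x)))"
  proof -
    define a where "a = exp (x / 2)"
    define b where "b = exp (- (x / 2))"
    have ab: "a * b = 1" by (simp add: a_def b_def flip: exp_add)
    have "b < a" using x by (simp add: a_def b_def)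
    hence nz: "a - b \<noteq> 0" by simp
    have b0: "b \<noteq> 0" by (simp add: b_def)
    have e: "exp (- x) = b * b" by (simp add: b_def flip: exp_add)
    have "1 + b * b = b * (a + b)" "1 - b * b = b * (a - b)"
      using ab by (simp_all add: algebra_simps)
    hence "(1 + exp (- x)) / (2 * (1 - exp (- x))) = (a + b) / (2 * (a - b))"
      unfolding e using b0 by simp
    moreover have "cosh (x / 2) = (a + b) / 2" "sinh (x / 2) = (a - b) / 2"
      by (simp_all add: cosh_def sinh_def a_def b_def)
    moreover have "(a + b) / 2 / 2 / ((a - b) / 2) = (a + b) / (2 * (a - b))"
      using nz by (simp add: divide_simps) (simp add: algebra_simps)
    ultimately show ?thesis by (simp only:)
  qed
  finally show ?thesis using s1 by (simp add: sums_iff f'_def)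
qed


text \<open>One function, two expansions. The trapezoidal errors of \<open>exp (- (x * v))\<close>
  form a geometric series with sum \<open>coth (x / 2) / 2 - 1 / x\<close>, and their Mellin
  transforms add up to \<open>Gamma (r - 1) * E\<close>. The partial fractions of the same function
  have Mellin transforms proportional to \<open>(2 * pi * real (Suc n)) powr (r - 1)\<close>, which
  add up to a multiple of \<open>Z\<close>. All terms are nonnegative, so sums and integrals are
  exchanged in \<open>ennreal\<close>.\<close>

lemma zeta_reg_real_reflect:
  assumes r: "-1 < r" "r < 0"
  obtains E Z where "zeta_reg (of_real r) = of_real E" "riemann_zeta (of_real (1 - r)) = of_real Z"
    "Gamma (r - 1) * E = Gamma ((1 + r) / 2) * Gamma ((1 - r) / 2) * (2 * pi) powr (r - 1) * Z"
proof -
  have em: "em_term n (of_real r) = of_real (em_real r n)" for n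
  proof -
    have "complex_of_nat m powr of_real y = of_real (real m powr y)" for m y
      using powr_of_real[of "real m" y] by simp
    from this[of n "- r"] this[of "Suc n" "- r"] this[of n "1 - r"] this[of "Suc n" "1 - r"]
    show ?thesis by (simp add: em_term_def em_real_def add.commute)
  qed
  have sE': "(\<lambda>n. complex_of_real (em_real r n)) sums zeta_reg (of_real r)"
    using zeta_reg_real_sums[OF r] by (simp add: em)
  define E where "E = Re (zeta_reg (of_real r))"
  have sE: "em_real r sums E"
    using sums_Re[OF sE'] by (simp add: E_def)
  have "zeta_reg (of_real r) = of_real E"
    using sums_unique2[OF sE' sums_of_real[OF sE]] .
  define Z where "Z = (\<Sum>n. real (Suc n) powr (r - 1))"
  have sZ: "(\<lambda>n. real (Suc n) powr (r - 1)) sums Z"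
    unfolding Z_def using r by (intro summable_sums summable_Suc_powr) auto
  have "(\<lambda>n. complex_of_real (real (Suc n) powr (r - 1))) sums riemann_zeta (of_real (1 - r))"
  proof -
    have "complex_of_nat (Suc n) powr (- of_real (1 - r)) = of_real (real (Suc n) powr (r - 1))" for n
      using powr_of_real[of "real (Suc n)" "r - 1"] by simp
    thus ?thesis using riemann_zeta_Dirichlet[of "of_real (1 - r)"] r by simp
  qed
  hence zZ: "riemann_zeta (of_real (1 - r)) = of_real Z"
    using sums_unique2[OF _ sums_of_real[OF sZ]] by blast
  define K where "K = Gamma ((1 + r) / 2) * Gamma ((1 - r) / 2)"
  have K0: "K \<ge> 0" unfolding K_def using r by (intro mult_nonneg_nonneg less_imp_le Gamma_real_pos) auto
  define \<phi> where "\<phi> = (\<lambda>x n. exp (- (x * real n)) * ((1 + exp (- x)) / 2 - (1 - exp (- x)) / x))"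
  have \<phi>0: "\<phi> x n \<ge> 0" if "x > 0" for x n
    using trapezoid_exp[OF that, of n] unfolding \<phi>_def by (rule has_integral_nonneg) auto
  have s\<phi>: "\<phi> x sums ((1 + exp (- x)) / (2 * (1 - exp (- x))) - 1 / x)" if x: "x > 0" for x
  proof -
    have e: "exp (- x) < 1" using x by simp
    have "(\<lambda>n. exp (- x) ^ n * ((1 + exp (- x)) / 2 - (1 - exp (- x)) / x)) sums
        (1 / (1 - exp (- x)) * ((1 + exp (- x)) / 2 - (1 - exp (- x)) / x))"
      using e by (intro sums_mult2 geometric_sums) auto
    moreover have "exp (- x) ^ n = exp (- (x * real n))" for n
      by (simp add: exp_of_nat_mult[symmetric] mult.commute)
    moreover have "1 / (1 - exp (- x)) * ((1 + exp (- x)) / 2 - (1 - exp (- x)) / x) =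
        (1 + exp (- x)) / (2 * (1 - exp (- x))) - 1 / x"
    proof -
      have "1 - exp (- x) \<noteq> 0" using e by simp
      thus ?thesis using x by (simp add: divide_simps) (simp add: algebra_simps)
    qed
    ultimately show ?thesis by (simp add: \<phi>_def)
  qed
  have "ennreal (Gamma (r - 1) * E) = (\<Sum>n. ennreal (Gamma (r - 1) * em_real r n))"
    by (rule suminf_ennreal_eq[symmetric]) (use em_real_nonneg[OF r] sE in \<open>auto intro: sums_mult\<close>)
  also have "\<dots> = (\<Sum>n. \<integral>\<^sup>+x. ennreal (indicator {0<..} x * (x powr (r - 1) * \<phi> x n)) \<partial>lborel)"
    unfolding \<phi>_def by (simp only: nn_integral_trapezoid[OF r])
  also have "\<dots> = (\<integral>\<^sup>+x. (\<Sum>n. ennreal (indicator {0<..} x * (x powr (r - 1) * \<phi> x n))) \<partial>lborel)"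
    unfolding \<phi>_def by (rule nn_integral_suminf[symmetric]) measurable
  also have "\<dots> = (\<integral>\<^sup>+x. (\<Sum>n. ennreal (indicator {0<..} x * (x powr (r - 1) *
      (2 * x / (x\<^sup>2 + (2 * pi * real (Suc n))\<^sup>2))))) \<partial>lborel)"
  proof (rule nn_integral_cong)
    fix x :: real
    show "(\<Sum>n. ennreal (indicator {0<..} x * (x powr (r - 1) * \<phi> x n))) =
       (\<Sum>n. ennreal (indicator {0<..} x * (x powr (r - 1) * (2 * x / (x\<^sup>2 + (2 * pi * real (Suc n))\<^sup>2)))))"
    proof (cases "x > 0")
      case True
      define c where "c = indicator {0<..} x * x powr (r - 1) * ((1 + exp (- x)) / (2 * (1 - exp (- x))) - 1 / x)"
      have "(\<Sum>n. ennreal (indicator {0<..} x * (x powr (r - 1) * \<phi> x n))) = ennreal c"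
      proof (rule suminf_ennreal_eq)
        show "(\<lambda>n. indicator {0<..} x * (x powr (r - 1) * \<phi> x n)) sums c"
          unfolding c_def mult.assoc by (intro sums_mult s\<phi> True)
      qed (use \<phi>0[OF True] in auto)
      moreover have "(\<Sum>n. ennreal (indicator {0<..} x * (x powr (r - 1) * (2 * x / (x\<^sup>2 + (2 * pi * real (Suc n))\<^sup>2))))) = ennreal c"
      proof (rule suminf_ennreal_eq)
        show "(\<lambda>n. indicator {0<..} x * (x powr (r - 1) * (2 * x / (x\<^sup>2 + (2 * pi * real (Suc n))\<^sup>2)))) sums c"
          unfolding c_def mult.assoc by (intro sums_mult coth_partial_fractions[OF True, unfolded mult.assoc])
      qed (use True in \<open>auto intro!: mult_nonneg_nonneg divide_nonneg_nonneg\<close>)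
      ultimately show ?thesis by simp
    qed simp
  qed
  also have "\<dots> = (\<Sum>n. \<integral>\<^sup>+x. ennreal (indicator {0<..} x * (x powr (r - 1) *
      (2 * x / (x\<^sup>2 + (2 * pi * real (Suc n))\<^sup>2)))) \<partial>lborel)"
    by (rule nn_integral_suminf) measurable
  also have "\<dots> = (\<Sum>n. ennreal (K * (2 * pi * real (Suc n)) powr (r - 1)))"
    using r unfolding K_def by (subst nn_integral_powr_over_quadratic) auto
  also have "\<dots> = ennreal (K * (2 * pi) powr (r - 1) * Z)"
  proof (rule suminf_ennreal_eq)
    have "K * (2 * pi * real (Suc n)) powr (r - 1) = K * (2 * pi) powr (r - 1) * real (Suc n) powr (r - 1)" for n
      by (subst powr_mult) auto
    thus "(\<lambda>n. K * (2 * pi * real (Suc n)) powr (r - 1)) sums (K * (2 * pi) powr (r - 1) * Z)"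
      using sums_mult[OF sZ, of "K * (2 * pi) powr (r - 1)"] by (simp only:)
  qed (use K0 in auto)
  finally have eq: "ennreal (Gamma (r - 1) * E) = ennreal (K * (2 * pi) powr (r - 1) * Z)" .
  have "Gamma (r - 1) * E \<ge> 0"
    by (rule sums_le[OF _ sums_zero sums_mult[OF sE]]) (use em_real_nonneg[OF r] in auto)
  moreover have "Z \<ge> 0" by (rule sums_le[OF _ sums_zero sZ]) auto
  hence "K * (2 * pi) powr (r - 1) * Z \<ge> 0" using K0 by simp
  ultimately have "Gamma (r - 1) * E = K * (2 * pi) powr (r - 1) * Z"
    using eq by simp
  thus ?thesis using that[of E Z] zZ \<open>zeta_reg (of_real r) = of_real E\<close> by (simp add: K_def)
qed

text \<open>Riemann's \<xi>: \<open>Gamma (1 + s / 2)\<close> is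
  \<open>s / 2 * Gamma (s / 2)\<close>, so the customary factor \<open>s / 2\<close> is absorbed and
  the pole of Gamma at 0 disappears.\<close>

definition xi :: "complex \<Rightarrow> complex" where
  "xi s = zeta_reg s * of_real pi powr (- s / 2) * Gamma (1 + s / 2)"

lemma xi_holomorphic: "xi holomorphic_on {s. Re s > - 1}"
  unfolding xi_def
  by (intro holomorphic_intros zeta_reg_holomorphic)
     (auto simp: complex_nonpos_Reals_iff dest!: nonpos_Ints_subset_nonpos_Reals[THEN subsetD])

text \<open>Both sides are reduced to \<open>Z\<close> and Gamma values.
  \<open>Gamma (r - 1)\<close> is raised to \<open>Gamma (r + 1)\<close>, which Legendre duplication
  splits into \<open>Gamma ((1 + r) / 2) * Gamma (1 + r / 2)\<close>; what remains is bookkeeping of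
  the powers of 2 and pi, done in \<open>p2\<close> and \<open>pp\<close>.\<close>

lemma xi_functional_real:
  assumes r: "-1 < r" "r < 0"
  shows "xi (of_real r) = xi (1 - of_real r)"
proof -
  obtain E Z where EZ: "zeta_reg (of_real r) = of_real E" "riemann_zeta (of_real (1 - r)) = of_real Z"
    "Gamma (r - 1) * E = Gamma ((1 + r) / 2) * Gamma ((1 - r) / 2) * (2 * pi) powr (r - 1) * Z"
    using zeta_reg_real_reflect[OF r] .
  have zr: "zeta_reg (of_real (1 - r)) = of_real (- r * Z)"
    using EZ(2) r by (simp add: zeta_reg_def complex_eq_iff)
  have X: "xi (of_real t) = of_real (A * pi powr (- t / 2) * Gamma (1 + t / 2))"
    if "zeta_reg (of_real t) = of_real A" for t A
  proof -
    have "complex_of_real pi powr (- of_real t / 2) = of_real (pi powr (- t / 2))"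
      using powr_of_real[of pi "- t / 2"] by simp
    moreover have "Gamma (1 + of_real t / 2) = complex_of_real (Gamma (1 + t / 2))"
      using Gamma_complex_of_real[of "1 + t / 2"] by simp
    ultimately show ?thesis by (simp add: xi_def that)
  qed
  have G1: "Gamma (1 + (1 - r) / 2) = (1 - r) / 2 * Gamma ((1 - r) / 2)"
    using r Gamma_plus1[of "(1 - r) / 2"] not_nonpos_Int_between[of 0 "(1 - r) / 2"] by (simp add: add.commute)
  have "Gamma (r - 1 + 1) = (r - 1) * Gamma (r - 1)"
    using r by (intro Gamma_plus1 not_nonpos_Int_between[of "-2"]) auto
  moreover have "Gamma (r + 1) = r * Gamma r"
    using r by (intro Gamma_plus1 not_nonpos_Int_between[of "-1"]) auto
  ultimately have G2: "Gamma (r + 1) = r * (r - 1) * Gamma (r - 1)" by simp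
  have G0: "Gamma (r - 1) \<noteq> 0"
    using r Gamma_eq_zero_iff[of "r - 1"] not_nonpos_Int_between[of "-2" "r - 1"] by simp
  have G3: "Gamma ((1 + r) / 2) * Gamma (1 + r / 2) = 2 powr (- r) * sqrt pi * Gamma (r + 1)"
  proof -
    have n1: "(1 + r) / 2 \<notin> \<int>\<^sub>\<le>\<^sub>0" "(1 + r) / 2 + 1 / 2 \<notin> \<int>\<^sub>\<le>\<^sub>0"
      by (rule not_nonpos_Int_between[of 0]; use r in \<open>simp add: field_simps\<close>)+
    hence n2: "complex_of_real ((1 + r) / 2) \<notin> \<int>\<^sub>\<le>\<^sub>0" "complex_of_real ((1 + r) / 2) + 1 / 2 \<notin> \<int>\<^sub>\<le>\<^sub>0"
      using of_real_in_nonpos_Ints_iff[of "(1 + r) / 2", where 'a = complex]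
        of_real_in_nonpos_Ints_iff[of "(1 + r) / 2 + 1 / 2", where 'a = complex] by simp_all
    have "complex_of_real (Gamma ((1 + r) / 2) * Gamma ((1 + r) / 2 + 1 / 2)) =
        Gamma (complex_of_real ((1 + r) / 2)) * Gamma (complex_of_real ((1 + r) / 2) + 1 / 2)"
      using Gamma_complex_of_real[of "(1 + r) / 2"] Gamma_complex_of_real[of "(1 + r) / 2 + 1 / 2"] by simp
    also have "\<dots> = exp ((1 - 2 * complex_of_real ((1 + r) / 2)) * of_real (ln 2)) * of_real (sqrt pi) *
        Gamma (2 * complex_of_real ((1 + r) / 2))"
      by (rule Gamma_legendre_duplication[OF n2])
    also have "2 * complex_of_real ((1 + r) / 2) = of_real (1 + r)" by simp
    also have "exp ((1 - complex_of_real (1 + r)) * of_real (ln 2)) = of_real (exp ((- r) * ln 2))"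
      by (simp flip: exp_of_real)
    also have "exp ((- r) * ln 2) = 2 powr (- r)" by (simp add: powr_def)
    also have "complex_of_real (2 powr (- r)) * of_real (sqrt pi) * Gamma (of_real (1 + r)) =
        of_real (2 powr (- r) * sqrt pi * Gamma (1 + r))"
      by (simp only: of_real_mult Gamma_complex_of_real)
    finally have "Gamma ((1 + r) / 2) * Gamma ((1 + r) / 2 + 1 / 2) = 2 powr (- r) * sqrt pi * Gamma (1 + r)"
      by (simp only: of_real_eq_iff)
    moreover have "(1 + r) / 2 + 1 / 2 = 1 + r / 2" by (simp add: field_simps)
    ultimately show ?thesis by (simp add: add.commute)
  qed
  define w where "w = Gamma ((1 - r) / 2) * Z"
  have "Gamma (r - 1) * (E * Gamma (1 + r / 2)) =
      (Gamma ((1 + r) / 2) * Gamma (1 + r / 2)) * (w * (2 * pi) powr (r - 1))"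
    using EZ(3) by (simp add: w_def mult_ac)
  also have "\<dots> = Gamma (r - 1) * (2 powr (- r) * sqrt pi * (r * (r - 1)) * (w * (2 * pi) powr (r - 1)))"
    unfolding G3 G2 by (simp add: mult_ac)
  finally have EE: "E * Gamma (1 + r / 2) = 2 powr (- r) * sqrt pi * (r * (r - 1)) * (w * (2 * pi) powr (r - 1))"
    using G0 by simp
  have p2: "2 powr (- r) * 2 powr (r - 1) = (1 / 2 :: real)"
    by (simp flip: powr_add)
  have pp: "pi powr (- r / 2) * sqrt pi * pi powr (r - 1) = pi powr (- (1 - r) / 2)"
  proof -
    have "pi powr (- r / 2) * pi powr (1 / 2) * pi powr (r - 1) = pi powr (- r / 2 + 1 / 2 + (r - 1))"
      by (simp only: powr_add)
    also have "- r / 2 + 1 / 2 + (r - 1) = - (1 - r) / 2" by (simp add: field_simps)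
    finally show ?thesis by (simp add: powr_half_sqrt)
  qed
  have "E * pi powr (- r / 2) * Gamma (1 + r / 2) =
      (2 powr (- r) * 2 powr (r - 1)) * (pi powr (- r / 2) * sqrt pi * pi powr (r - 1)) * (r * (r - 1) * w)"
    using EE by (simp add: powr_mult mult_ac)
  also have "\<dots> = - r * Z * pi powr (- (1 - r) / 2) * Gamma (1 + (1 - r) / 2)"
    unfolding p2 pp G1 w_def by (simp add: algebra_simps)
  finally show ?thesis
    using X[OF EZ(1)] X[OF zr] by simp
qed

text \<open>Identity theorem starting from the real interval between - 1 and 0, which accumulates at
  - 1 / 2. The strip is symmetric about 1 / 2, so both sides are holomorphic on it.\<close>

theorem xi_functional_equation:
  assumes s: "-1 < Re s" "Re s < 2"
  shows "xi (1 - s) = xi s"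
proof -
  define S where "S = {s. Re s > - 1} \<inter> {s. Re s < 2}"
  define U where "U = complex_of_real ` {-1<..<0}"
  have hol1: "xi holomorphic_on S"
    by (rule holomorphic_on_subset[OF xi_holomorphic]) (auto simp: S_def)
  have "(xi \<circ> (\<lambda>s. 1 - s)) holomorphic_on S"
    by (rule holomorphic_on_compose_gen[OF _ xi_holomorphic]) (auto intro!: holomorphic_intros simp: S_def)
  hence hol2: "(\<lambda>s. xi (1 - s) - xi s) holomorphic_on S"
    using hol1 by (intro holomorphic_intros) (auto simp: o_def)
  have "xi (1 - s) - xi s = 0"
  proof (rule analytic_continuation[OF hol2])
    show "open S" unfolding S_def by (intro open_Int open_halfspace_Re_gt open_halfspace_Re_lt)
    show "connected S" unfolding S_def
      by (intro convex_connected convex_Int convex_halfspace_Re_gt convex_halfspace_Re_lt)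
    show "U \<subseteq> S" "- 1 / 2 \<in> S" "s \<in> S" using s by (auto simp: S_def U_def)
    show "(- 1 / 2) islimpt U"
      unfolding islimpt_approachable
    proof (intro allI impI)
      fix e :: real assume e: "e > 0"
      define d where "d = min (e / 2) (1 / 4)"
      have d: "d > 0" "d < e" "d \<le> 1 / 4" using e by (auto simp: d_def)
      have "of_real (- 1 / 2 + d) \<in> U" unfolding U_def by (rule imageI) (use d in auto)
      moreover have "complex_of_real (- 1 / 2 + d) - (- 1 / 2) = of_real d" by simp
      hence "of_real (- 1 / 2 + d) \<noteq> (- 1 / 2 :: complex)" "dist (of_real (- 1 / 2 + d)) (- 1 / 2 :: complex) < e"
        using d unfolding dist_norm by auto
      ultimately show "\<exists>x'\<in>U. x' \<noteq> - 1 / 2 \<and> dist x' (- 1 / 2) < e" by blast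
    qed
    fix z assume "z \<in> U"
    thus "xi (1 - z) - xi z = 0" using xi_functional_real by (auto simp: U_def)
  qed
  thus ?thesis by simp
qed

lemma zeta_reg_cnj: "Re s > - 1 \<Longrightarrow> zeta_reg (cnj s) = cnj (zeta_reg s)"
proof -
  assume s: "Re s > - 1"
  have "em_term (Suc n) (cnj s) = cnj (em_term (Suc n) s)" for n
    by (simp add: em_term_def cnj_powr del: of_nat_Suc)
  hence "(\<lambda>n. em_term (Suc n) (cnj s)) sums (cnj (zeta_reg s - (s - 1) / 2 - 1))"
    using zeta_reg_sums[OF s] by (simp only: sums_cnj)
  moreover have "(\<lambda>n. em_term (Suc n) (cnj s)) sums (zeta_reg (cnj s) - (cnj s - 1) / 2 - 1)"
    using s by (intro zeta_reg_sums) auto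
  ultimately show ?thesis using sums_unique2 by fastforce
qed

lemma xi_cnj: "Re s > - 1 \<Longrightarrow> xi (cnj s) = cnj (xi s)"
  using cnj_Gamma[of "1 + s / 2"] cnj_powr[of "of_real pi" "- s / 2"]
  by (simp add: xi_def zeta_reg_cnj)

section \<open>Consequences of the Riemann hypothesis for the completed zeta function\<close>

text \<open>An upper bound for \<open>norm f\<close> relative to the centre is an upper bound for
  the real part of a logarithm \<open>g\<close> with \<open>g c = 0\<close>; Borel-Caratheodory
  turns it into a bound for \<open>norm g\<close>, and this bounds \<open>norm f\<close> from below
  as well. The lower bound is the purpose.\<close>

lemma Borel_Caratheodory_log:
  fixes f :: "complex \<Rightarrow> complex"
  assumes f: "f holomorphic_on ball c R" and nz: "\<And>z. z \<in> ball c R \<Longrightarrow> f z \<noteq> 0"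
    and R: "R > 0" and M: "M > 1" and bound: "\<And>z. z \<in> ball c R \<Longrightarrow> norm (f z) < M * norm (f c)"
  obtains g where "g holomorphic_on ball c R" "\<And>z. z \<in> ball c R \<Longrightarrow> f z = f c * exp (g z)"
    "\<And>z. z \<in> ball c R \<Longrightarrow> norm (g z) * (R - norm (z - c)) \<le> 2 * ln M * norm (z - c)"
proof -
  have c: "c \<in> ball c R" using R by simp
  obtain g0 where g0: "g0 holomorphic_on ball c R" "\<And>z. z \<in> ball c R \<Longrightarrow> exp (g0 z) = f z"
    using holomorphic_logarithm_exists[OF convex_ball open_ball f nz c] by auto
  define g where "g = (\<lambda>z. g0 z - g0 c)"
  have hg: "g holomorphic_on ball c R" unfolding g_def by (intro holomorphic_intros g0)
  have eg: "f z = f c * exp (g z)" if "z \<in> ball c R" for z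
  proof -
    have "f c * exp (g z) = f c * (f z / f c)"
      using g0(2)[OF that] g0(2)[OF c] by (simp only: g_def exp_diff)
    thus ?thesis using nz[OF c] by simp
  qed
  define A where "A = ln M"
  have A: "A > 0" using M by (simp add: A_def)
  have Re_less: "Re (g z) < A" if z: "z \<in> ball c R" for z
  proof -
    have "norm (f c) * exp (Re (g z)) < norm (f c) * M"
      using bound[OF z] eg[OF z] by (simp add: norm_mult mult.commute)
    hence "exp (Re (g z)) < M" using nz[OF c] by simp
    hence "exp (Re (g z)) < exp A" using M by (simp add: A_def)
    thus ?thesis by (simp only: exp_less_cancel_iff)
  qed
  define h where "h = (\<lambda>w. g (c + of_real R * w))"
  have inb: "c + of_real R * w \<in> ball c R" if "norm w < 1" for w
    using that R by (simp add: dist_norm norm_mult)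
  have hh: "h holomorphic_on ball 0 1"
  proof -
    have "(g \<circ> (\<lambda>w. c + of_real R * w)) holomorphic_on ball 0 1"
      by (rule holomorphic_on_compose_gen[OF _ hg]) (auto intro!: holomorphic_intros inb simp del: mem_ball)
    thus ?thesis by (simp add: h_def o_def)
  qed
  have Reh: "Re (h w) < A" if "norm w < 1" for w using Re_less[OF inb[OF that]] by (simp add: h_def)
  have nzd: "2 * of_real A - h w \<noteq> 0" if "norm w < 1" for w
    using Reh[OF that] A by (auto simp: complex_eq_iff)
  have less: "norm (h w) < norm (2 * of_real A - h w)" if "norm w < 1" for w
  proof (rule power2_less_imp_less)
    have "(norm (2 * of_real A - h w))\<^sup>2 - (norm (h w))\<^sup>2 = 4 * (A * (A - Re (h w)))"
      by (simp add: cmod_power2) (simp add: power2_eq_square algebra_simps)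
    moreover have "A * (A - Re (h w)) > 0" using A Reh[OF that] by simp
    ultimately show "(norm (h w))\<^sup>2 < (norm (2 * of_real A - h w))\<^sup>2" by linarith
  qed simp
  \<comment> \<open>Maps the half-plane of real part below \<open>A\<close> into the unit disc and
    fixes 0, so that the Schwarz lemma applies.\<close>
  define \<phi> where "\<phi> = (\<lambda>w. h w / (2 * of_real A - h w))"
  have schwarz: "norm (\<phi> w) \<le> norm w" if "norm w < 1" for w
  proof (rule Schwarz_Lemma(1)[OF _ _ _ that])
    show "\<phi> holomorphic_on ball 0 1"
      unfolding \<phi>_def by (intro holomorphic_intros hh) (use nzd in auto)
    show "\<phi> 0 = 0" by (simp add: \<phi>_def h_def g_def)
    show "norm (\<phi> z) < 1" if "norm z < 1" for z
      using less[OF that] nzd[OF that] by (simp add: \<phi>_def norm_divide)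
  qed
  have hb: "norm (h w) * (1 - norm w) \<le> 2 * A * norm w" if w: "norm w < 1" for w
  proof -
    have "h w = \<phi> w * (2 * of_real A - h w)" using nzd[OF w] by (simp add: \<phi>_def)
    hence "norm (h w) = norm (\<phi> w) * norm (2 * of_real A - h w)" by (metis norm_mult)
    also have "\<dots> \<le> norm w * (2 * A + norm (h w))"
      using schwarz[OF w] norm_triangle_ineq4[of "2 * of_real A" "h w"] A
      by (intro mult_mono) (auto simp: norm_mult)
    finally show ?thesis by (simp add: algebra_simps)
  qed
  show ?thesis
  proof (rule that[OF hg eg])
    fix z assume z: "z \<in> ball c R"
    define w where "w = (z - c) / of_real R"
    have nw: "norm w = norm (z - c) / R" using R by (simp add: w_def norm_divide)
    have w: "norm w < 1" using z R by (simp add: nw dist_norm norm_minus_commute)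
    have "h w = g z" using R by (simp add: h_def w_def)
    with hb[OF w] have "norm (g z) * (1 - norm (z - c) / R) * R \<le> 2 * A * (norm (z - c) / R) * R"
      using R by (intro mult_right_mono) (auto simp: nw)
    thus "norm (g z) * (R - norm (z - c)) \<le> 2 * ln M * norm (z - c)"
      using R by (simp add: A_def algebra_simps)
  qed auto
qed

section \<open>Bounds for zeta to the right of the critical line\<close>

lemma riemann_zeta_bounds_ge2:
  assumes s: "Re s \<ge> 2"
  shows "norm (riemann_zeta s) \<ge> 3 / 10" "norm (riemann_zeta s) \<le> 17 / 10"
proof -
  have "(\<lambda>n. of_nat (Suc n) powr (- s)) sums riemann_zeta s"
    using s by (intro riemann_zeta_Dirichlet) auto
  hence sz: "(\<lambda>n. of_nat (Suc (Suc n)) powr (- s)) sums (riemann_zeta s - 1)"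
    by (subst sums_Suc_iff) auto
  have "(\<lambda>n. 1 / (real n + 1)\<^sup>2) sums (pi\<^sup>2 / 6)" using inverse_squares_sums by (simp add: add.commute)
  hence "(\<lambda>n. 1 / (real (Suc n) + 1)\<^sup>2) sums (pi\<^sup>2 / 6 - 1)"
    by (subst sums_Suc_iff) auto
  moreover have "1 / (real (Suc n) + 1)\<^sup>2 = real (Suc (Suc n)) powr (- 2)" for n
  proof -
    have a: "real (Suc (Suc n)) = real (Suc n) + 1" by simp
    have "(real (Suc n) + 1) powr (- 2) = inverse ((real (Suc n) + 1) powr 2)" by (rule powr_minus)
    also have "(real (Suc n) + 1) powr 2 = (real (Suc n) + 1)\<^sup>2" by (rule powr_numeral) simp
    finally show ?thesis by (simp only: a inverse_eq_divide)
  qed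
  ultimately have sp: "(\<lambda>n. real (Suc (Suc n)) powr (- 2)) sums (pi\<^sup>2 / 6 - 1)" by (simp only:)
  have b: "norm (of_nat (Suc (Suc n)) powr (- s) :: complex) \<le> real (Suc (Suc n)) powr (- 2)" for n
  proof -
    have "norm (of_nat (Suc (Suc n)) powr (- s) :: complex) = real (Suc (Suc n)) powr (- Re s)"
      using norm_powr_real_powr[of "of_nat (Suc (Suc n))" "- s"] by (simp del: of_nat_Suc)
    also have "\<dots> \<le> real (Suc (Suc n)) powr (- 2)" using s by (intro powr_mono) auto
    finally show ?thesis .
  qed
  have "norm (riemann_zeta s - 1) \<le> pi\<^sup>2 / 6 - 1"
    using norm_suminf_le[of "\<lambda>n. of_nat (Suc (Suc n)) powr (- s)", OF b] sz sp by (simp add: sums_iff)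
  also have "pi\<^sup>2 \<le> 3.15\<^sup>2" using pi_approx by (intro power_mono) auto
  hence "pi\<^sup>2 / 6 - 1 \<le> 7 / 10" by (simp add: power2_eq_square)
  finally have d: "norm (riemann_zeta s - 1) \<le> 7 / 10" .
  show "norm (riemann_zeta s) \<ge> 3 / 10"
    using norm_triangle_ineq2[of 1 "1 - riemann_zeta s"] d by (simp add: norm_minus_commute)
  show "norm (riemann_zeta s) \<le> 17 / 10"
    using norm_triangle_ineq[of 1 "riemann_zeta s - 1"] d by simp
qed

text \<open>Lets the lower bound 3 / 10 for \<open>norm (zeta_reg s)\<close> on
  \<open>Re s \<ge> 2\<close> be written as an exponential, like the bound inside the strip.\<close>

lemma exp_minus_2_le: "exp (- 2) \<le> (3 / 10 :: real)"
proof -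
  have "5 \<le> exp (2::real)" using exp_lower_Taylor_quadratic[of 2] by simp
  hence "inverse (exp (2::real)) \<le> inverse 5" by (intro le_imp_inverse_le) auto
  thus ?thesis by (simp add: exp_minus)
qed

lemma zeta_reg_ge2:
  assumes "Re s \<ge> 2"
  shows "norm (zeta_reg s) \<ge> 3 / 10"
proof -
  have "1 * (3 / 10) \<le> norm (s - 1) * norm (riemann_zeta s)"
    using riemann_zeta_bounds_ge2[OF assms] abs_Re_le_cmod[of "s - 1"] assms
    by (intro mult_mono) auto
  moreover have "s \<noteq> 1" using assms by auto
  ultimately show ?thesis by (simp add: zeta_reg_def norm_mult)
qed

lemma RH_zeta_reg_nonzero:
  assumes RH: "riemann_hypothesis" and s: "Re s > 1 / 2"
  shows "zeta_reg s \<noteq> 0"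
proof
  assume z: "zeta_reg s = 0"
  hence s1: "s \<noteq> 1" by (auto simp: zeta_reg_def)
  hence "riemann_zeta s = 0" using z by (simp add: zeta_reg_def)
  moreover have "s \<noteq> - 2 * of_nat n" for n using s by (auto simp: complex_eq_iff)
  ultimately have "nontrivial_zeta_zero s" using s1 by (auto simp: nontrivial_zeta_zero_def)
  thus False using RH s by (auto simp: riemann_hypothesis_def)
qed

text \<open>The disc of radius 3 / 2 around a point with real part 2 just touches the critical line,
  so \<open>zeta_reg\<close> has no zero in it, and at the centre it is bounded away from 0.
  Borel-Caratheodory bounds the logarithm on the points that stay \<eta> away from the boundary, and
  Cauchy's inequality on a disc of radius \<open>\<eta> / 2\<close> bounds its derivative.\<close>

lemma RH_zeta_reg_bounds:
  assumes RH: "riemann_hypothesis" and \<eta>: "0 < \<eta>" "\<eta> \<le> 1"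
  obtains K where "K > 0"
    "\<And>z. 1 / 2 + \<eta> \<le> Re z \<Longrightarrow> Re z \<le> 2 \<Longrightarrow> norm (zeta_reg z) \<ge> exp (- (K * sqrt (5 + \<bar>Im z\<bar>)))"
    "\<And>z. 1 / 2 + \<eta> \<le> Re z \<Longrightarrow> Re z \<le> 2 \<Longrightarrow> norm (deriv zeta_reg z / zeta_reg z) \<le> K * sqrt (5 + \<bar>Im z\<bar>)"
proof -
  obtain C where C: "C \<ge> 1" "\<And>s. Re s \<ge> - 1 / 2 \<Longrightarrow> norm (zeta_reg s) \<le> C * (1 + norm s) ^ 3"
    using zeta_reg_growth by blast
  define L where "L = 6 * (4 * C) powr (1 / 6)"
  have L0: "L > 0" using C(1) by (simp add: L_def)
  have key: "norm (zeta_reg z) \<ge> exp (- ((3 * L / \<eta> + 2) * sqrt (5 + \<bar>Im z\<bar>))) \<and>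
      norm (deriv zeta_reg z / zeta_reg z) \<le> 12 * L / \<eta>\<^sup>2 * sqrt (5 + \<bar>Im z\<bar>)"
    if z: "1 / 2 + \<eta> \<le> Re z" "Re z \<le> 2" for z
  proof -
    define t where "t = \<bar>Im z\<bar>"
    define c where "c = Complex 2 (Im z)"
    \<comment> \<open>The factor 4 exceeds the reciprocal of the lower bound 3 / 10 at the centre,
      which makes \<open>bound\<close> strict.\<close>
    define M where "M = 4 * C * (5 + t) ^ 3"
    define B where "B = ball c (3 / 2)"
    have t0: "t \<ge> 0" by (simp add: t_def)
    have M1: "M > 1"
    proof -
      have "1 * 1 \<le> C * (5 + t) ^ 3" using C(1) t0 by (intro mult_mono one_le_power) auto
      thus ?thesis by (simp add: M_def)
    qed
    have ReB: "Re w > 1 / 2" "norm w \<le> t + 4" if "w \<in> B" for w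
    proof -
      have "\<bar>Re (c - w)\<bar> < 3 / 2" using that abs_Re_le_cmod[of "c - w"] by (simp add: B_def dist_norm)
      thus "Re w > 1 / 2" by (simp add: c_def) (simp add: abs_if split: if_splits)
      have "norm c \<le> 2 + t" using cmod_le[of c] by (simp add: c_def t_def)
      moreover have "norm w \<le> norm c + norm (w - c)" using norm_triangle_ineq[of c "w - c"] by simp
      ultimately show "norm w \<le> t + 4" using that by (simp add: B_def dist_norm norm_minus_commute)
    qed
    have cge: "norm (zeta_reg c) \<ge> 3 / 10" by (rule zeta_reg_ge2) (simp add: c_def)
    have bound: "norm (zeta_reg w) < M * norm (zeta_reg c)" if w: "w \<in> B" for w
    proof -
      have "norm (zeta_reg w) \<le> C * (1 + norm w) ^ 3" using ReB(1)[OF w] by (intro C(2)) auto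
      also have "\<dots> \<le> C * (5 + t) ^ 3"
        using ReB(2)[OF w] C(1) by (intro mult_left_mono power_mono) auto
      also have "C * (5 + t) ^ 3 < M * (3 / 10)"
      proof -
        have "C * (5 + t) ^ 3 > 0" using C(1) t0 by simp
        thus ?thesis by (simp add: M_def)
      qed
      also have "M * (3 / 10) \<le> M * norm (zeta_reg c)" using cge M1 by (intro mult_left_mono) auto
      finally show ?thesis .
    qed
    have hol: "zeta_reg holomorphic_on B"
      by (rule holomorphic_on_subset[OF zeta_reg_holomorphic]) (use ReB(1) in force)
    have nzB: "zeta_reg w \<noteq> 0" if "w \<in> B" for w
      by (rule RH_zeta_reg_nonzero[OF RH ReB(1)[OF that]])
    obtain g where g: "g holomorphic_on B" "\<And>w. w \<in> B \<Longrightarrow> zeta_reg w = zeta_reg c * exp (g w)"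
      "\<And>w. w \<in> B \<Longrightarrow> norm (g w) * (3 / 2 - norm (w - c)) \<le> 2 * ln M * norm (w - c)"
      using Borel_Caratheodory_log[OF hol[unfolded B_def] nzB[unfolded B_def] _ M1 bound[unfolded B_def]]
      unfolding B_def by auto
    have lnM0: "ln M > 0" using M1 by simp
    \<comment> \<open>The exponent 1 / 6 turns the cube in \<open>M\<close> into a square root. Any
      power of \<open>5 + t\<close> below the first would do for integrability against the
      kernel.\<close>
    have lnM: "ln M \<le> L * sqrt (5 + t)"
    proof -
      have "ln M \<le> M powr (1 / 6) / (1 / 6)" using M1 by (intro ln_powr_bound) auto
      also have "M powr (1 / 6) = (4 * C) powr (1 / 6) * ((5 + t) ^ 3) powr (1 / 6)"
        unfolding M_def using C(1) t0 by (subst powr_mult) auto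
      also have "((5 + t) ^ 3) powr (1 / 6) = ((5 + t) powr 3) powr (1 / 6)"
        using t0 by (subst powr_realpow[symmetric]) auto
      also have "\<dots> = sqrt (5 + t)"
        using t0 by (simp only: powr_powr) (simp add: powr_half_sqrt)
      finally show ?thesis by (simp add: L_def)
    qed
    have gb: "norm (g w) \<le> 3 * ln M / e" if w: "w \<in> B" "norm (w - c) \<le> 3 / 2 - e" "e > 0" for w e
    proof -
      have "norm (g w) * e \<le> norm (g w) * (3 / 2 - norm (w - c))"
        using w by (intro mult_left_mono) auto
      also have "\<dots> \<le> 2 * ln M * norm (w - c)" by (rule g(3)[OF w(1)])
      also have "\<dots> \<le> 2 * ln M * (3 / 2)" using w lnM0 by (intro mult_left_mono) auto
      finally show ?thesis using w(3) by (simp add: field_simps)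
    qed
    have zc: "norm (z - c) \<le> 3 / 2 - \<eta>"
    proof -
      have "z - c = of_real (Re z - 2)" by (simp add: c_def complex_eq_iff)
      hence "norm (z - c) = \<bar>Re z - 2\<bar>" by (metis norm_of_real)
      thus ?thesis using z by simp
    qed
    hence zB: "z \<in> B" using \<eta> by (simp add: B_def dist_norm norm_minus_commute)
    have s1: "sqrt (5 + t) \<ge> 1" using t0 by simp
    have "exp (- ((3 * L / \<eta> + 2) * sqrt (5 + t))) \<le> exp (- 2 + (- (3 * ln M / \<eta>)))"
    proof -
      have "3 * ln M / \<eta> \<le> 3 * (L * sqrt (5 + t)) / \<eta>" using lnM \<eta> by (intro divide_right_mono) auto
      moreover have "(3 * L / \<eta> + 2) * sqrt (5 + t) = 3 * (L * sqrt (5 + t)) / \<eta> + 2 * sqrt (5 + t)"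
        by (simp add: algebra_simps)
      ultimately show ?thesis using s1 by (intro exp_mono) argo
    qed
    also have "\<dots> = exp (- 2) * exp (- (3 * ln M / \<eta>))" by (rule exp_add)
    also have "\<dots> \<le> norm (zeta_reg c) * exp (Re (g z))"
    proof (rule mult_mono)
      show "exp (- 2) \<le> norm (zeta_reg c)" using exp_minus_2_le cge by linarith
      have "\<bar>Re (g z)\<bar> \<le> 3 * ln M / \<eta>" using gb[OF zB zc \<eta>(1)] abs_Re_le_cmod[of "g z"] by linarith
      thus "exp (- (3 * ln M / \<eta>)) \<le> exp (Re (g z))" by (simp add: abs_le_iff)
    qed auto
    also have "\<dots> = norm (zeta_reg z)" using g(2)[OF zB] by (simp add: norm_mult)
    finally have 1: "exp (- ((3 * L / \<eta> + 2) * sqrt (5 + t))) \<le> norm (zeta_reg z)" .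
    have ballB: "w \<in> B \<and> norm (w - c) \<le> 3 / 2 - \<eta> / 2" if "norm (w - z) \<le> \<eta> / 2" for w
    proof -
      have "norm (w - c) \<le> norm (w - z) + norm (z - c)"
        using norm_triangle_ineq[of "w - z" "z - c"] by simp
      hence "norm (w - c) \<le> 3 / 2 - \<eta> / 2" using that zc by simp
      thus ?thesis using \<eta> by (simp add: B_def dist_norm norm_minus_commute)
    qed
    have "norm ((deriv ^^ 1) g z) \<le> fact 1 * (3 * ln M / (\<eta> / 2)) / (\<eta> / 2) ^ 1"
    proof (rule Cauchy_inequality)
      show "g holomorphic_on ball z (\<eta> / 2)"
        by (rule holomorphic_on_subset[OF g(1)]) (use ballB in \<open>auto simp: dist_norm norm_minus_commute\<close>)
      show "continuous_on (cball z (\<eta> / 2)) g"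
        by (rule continuous_on_subset[OF holomorphic_on_imp_continuous_on[OF g(1)]])
           (use ballB in \<open>auto simp: dist_norm norm_minus_commute\<close>)
      show "norm (g x) \<le> 3 * ln M / (\<eta> / 2)" if "norm (z - x) = \<eta> / 2" for x
        using gb[of x "\<eta> / 2"] ballB[of x] that \<eta> by (simp add: norm_minus_commute)
    qed (use \<eta> in auto)
    hence dg: "norm (deriv g z) \<le> 12 * ln M / \<eta>\<^sup>2" by (simp add: power2_eq_square)
    have opB: "open B" by (simp add: B_def)
    have "((\<lambda>w. zeta_reg c * exp (g w)) has_field_derivative (zeta_reg c * (exp (g z) * deriv g z))) (at z)"
      by (auto intro!: derivative_eq_intros holomorphic_derivI[OF g(1) opB zB])
    hence "(zeta_reg has_field_derivative (zeta_reg c * (exp (g z) * deriv g z))) (at z)"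
      by (rule has_field_derivative_transform_within_open[OF _ opB zB]) (use g(2) in auto)
    hence "deriv zeta_reg z = zeta_reg z * deriv g z"
      using DERIV_imp_deriv g(2)[OF zB] by (simp add: mult_ac)
    hence "norm (deriv zeta_reg z / zeta_reg z) = norm (deriv g z)" using nzB[OF zB] by simp
    also note dg
    also have "12 * ln M / \<eta>\<^sup>2 \<le> 12 * (L * sqrt (5 + t)) / \<eta>\<^sup>2" using lnM by (intro divide_right_mono) auto
    finally show ?thesis using 1 by (simp add: t_def)
  qed
  define K where "K = 3 * L / \<eta> + 2 + 12 * L / \<eta>\<^sup>2"
  have K: "K > 0" "3 * L / \<eta> + 2 \<le> K" "12 * L / \<eta>\<^sup>2 \<le> K"
    using L0 \<eta> by (auto simp: K_def intro!: add_pos_pos)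
  show ?thesis
  proof (rule that[OF K(1)])
    fix z assume z: "1 / 2 + \<eta> \<le> Re z" "Re z \<le> 2"
    have "exp (- (K * sqrt (5 + \<bar>Im z\<bar>))) \<le> exp (- ((3 * L / \<eta> + 2) * sqrt (5 + \<bar>Im z\<bar>)))"
      using K by (intro exp_mono le_imp_neg_le mult_right_mono) auto
    thus "norm (zeta_reg z) \<ge> exp (- (K * sqrt (5 + \<bar>Im z\<bar>)))" using key[OF z] by linarith
    have "12 * L / \<eta>\<^sup>2 * sqrt (5 + \<bar>Im z\<bar>) \<le> K * sqrt (5 + \<bar>Im z\<bar>)"
      using K by (intro mult_right_mono) auto
    thus "norm (deriv zeta_reg z / zeta_reg z) \<le> K * sqrt (5 + \<bar>Im z\<bar>)" using key[OF z] by linarith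
  qed
qed

text \<open>In Euler's limit for Gamma the powers of \<open>n\<close> cancel, and each remaining
  factor has the form \<open>A / sqrt (A^2 + t^2)\<close>, which increases with \<open>A\<close>.
  The lemma bounds a quotient of Gamma values of equal imaginary part by the quotient on the real
  axis.\<close>

lemma norm_Gamma_ratio_le:
  assumes a: "0 < a" "a \<le> b"
  shows "norm (Gamma (Complex a t)) * Gamma b \<le> Gamma a * norm (Gamma (Complex b t))"
proof (rule LIMSEQ_le)
  show "(\<lambda>n. norm (Gamma_series (Complex a t) n) * Gamma_series b n) \<longlonglongrightarrow> norm (Gamma (Complex a t)) * Gamma b"
    by (intro tendsto_intros)
  show "(\<lambda>n. Gamma_series a n * norm (Gamma_series (Complex b t) n)) \<longlonglongrightarrow> Gamma a * norm (Gamma (Complex b t))"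
    by (intro tendsto_intros)
  have "norm (Gamma_series (Complex a t) n) * Gamma_series b n \<le> Gamma_series a n * norm (Gamma_series (Complex b t) n)" for n
  proof -
    define P where "P = (\<lambda>x. \<Prod>i=0..n. x + real i)"
    define Q where "Q = (\<lambda>x. \<Prod>i=0..n. norm (Complex x t + of_nat i))"
    define F where "F = (\<lambda>x. fact n * exp (x * ln (real n)))"
    have P0: "P x > 0" if "x > 0" for x using that unfolding P_def by (intro prod_pos) auto
    have Q0: "Q x > 0" if "x > 0" for x
      using that unfolding Q_def by (intro prod_pos) (auto simp: complex_eq_iff)
    have gs: "Gamma_series x n = F x / P x" for x :: real
      by (simp add: Gamma_series_def F_def P_def pochhammer_prod atLeast0AtMost lessThan_Suc_atMost atLeast0LessThan)
    have gc: "norm (Gamma_series (Complex x t) n) = F x / Q x" for x :: real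
    proof -
      have "norm (Gamma_series (Complex x t) n) = norm (fact n :: complex) * norm (exp (Complex x t * of_real (ln (real n)))) / norm (pochhammer (Complex x t) (n + 1))"
        by (simp add: Gamma_series_def norm_mult norm_divide)
      also have "norm (pochhammer (Complex x t) (n + 1)) = Q x"
        by (simp add: pochhammer_prod Q_def prod_norm atLeast0LessThan atLeast0AtMost lessThan_Suc_atMost)
      also have "norm (exp (Complex x t * of_real (ln (real n)))) = exp (x * ln (real n))" by simp
      also have "norm (fact n :: complex) = fact n" by simp
      finally show ?thesis by (simp add: F_def)
    qed
    have "P a * Q b \<le> Q a * P b"
      unfolding P_def Q_def prod.distrib[symmetric]
    proof (rule prod_mono, safe)
      fix i
      define A where "A = a + real i"
      define B where "B = b + real i"
      have AB: "0 < A" "A \<le> B" using a by (auto simp: A_def B_def)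
      have nA: "norm (Complex a t + of_nat i) = sqrt (A\<^sup>2 + t\<^sup>2)" "norm (Complex b t + of_nat i) = sqrt (B\<^sup>2 + t\<^sup>2)"
        by (simp_all add: cmod_def A_def B_def)
      have "A * sqrt (B\<^sup>2 + t\<^sup>2) = sqrt (A\<^sup>2 * (B\<^sup>2 + t\<^sup>2))" using AB by (simp add: real_sqrt_mult)
      also have "\<dots> \<le> sqrt (B\<^sup>2 * (A\<^sup>2 + t\<^sup>2))"
      proof (rule real_sqrt_le_mono)
        have "A\<^sup>2 * t\<^sup>2 \<le> B\<^sup>2 * t\<^sup>2" using AB by (intro mult_right_mono power_mono) auto
        thus "A\<^sup>2 * (B\<^sup>2 + t\<^sup>2) \<le> B\<^sup>2 * (A\<^sup>2 + t\<^sup>2)" by (simp add: algebra_simps)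
      qed
      also have "\<dots> = sqrt (A\<^sup>2 + t\<^sup>2) * B" using AB by (simp add: real_sqrt_mult)
      finally show "(a + real i) * norm (Complex b t + of_nat i) \<le> norm (Complex a t + of_nat i) * (b + real i)"
        by (simp add: nA A_def[symmetric] B_def[symmetric])
    qed (use a in auto)
    moreover have "F a * F b \<ge> 0" by (simp add: F_def)
    ultimately have "F a * F b * (P a * Q b) \<le> F a * F b * (Q a * P b)" by (rule mult_left_mono)
    thus ?thesis unfolding gs gc using P0[of a] P0[of b] Q0[of a] Q0[of b] a
      by (simp add: divide_simps)
  qed
  thus "\<exists>N. \<forall>n\<ge>N. norm (Gamma_series (Complex a t) n) * Gamma_series b n \<le> Gamma_series a n * norm (Gamma_series (Complex b t) n)"
    by blast
qed

text \<open>The three lines theorem for functions that are only known to grow exponentially in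
  \<open>|Im s|\<close>. The left line carries the bound 1; if \<open>C\<close> can be kept fixed
  while \<open>R\<close> tends to infinity, the bound becomes 1 everywhere.\<close>

lemma three_lines_exp_growth:
  fixes f :: "complex \<Rightarrow> complex"
  assumes R: "R > 0" and C: "C \<ge> 1"
    and hol: "f holomorphic_on U" "open U" "{s. 0 \<le> Re s \<and> Re s \<le> R} \<subseteq> U"
    and left: "\<And>s. Re s = 0 \<Longrightarrow> norm (f s) \<le> 1"
    and right: "\<And>s. Re s = R \<Longrightarrow> norm (f s) \<le> C"
    and growth: "\<And>s. 0 \<le> Re s \<Longrightarrow> Re s \<le> R \<Longrightarrow> norm (f s) \<le> A * exp (D * \<bar>Im s\<bar>)"
    and s: "0 \<le> Re s" "Re s \<le> R"
  shows "norm (f s) \<le> C powr (Re s / R)"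
proof -
  define c where "c = ln C / R"
  have c0: "c \<ge> 0" using C R by (simp add: c_def)
  have A1: "A \<ge> 0"
    using growth[of 0] R by (simp add: order_trans[OF norm_ge_zero])
  have main: "norm (f s) \<le> exp (c * Re s) * exp (\<epsilon> * (R\<^sup>2 + (Im s)\<^sup>2))" if e: "\<epsilon> > 0" for \<epsilon>
  proof -
    \<comment> \<open>The factor with \<open>c\<close> equalises the bounds on the two vertical
      lines. The factor with \<epsilon> decays like a Gaussian in \<open>Im z\<close> and beats the
      growth, at the price of \<open>exp (\<epsilon> * R^2)\<close>, which disappears as \<epsilon>
      tends to 0.\<close>
    define F where "F = (\<lambda>z. f z * exp (- (of_real c * z)) * exp (of_real \<epsilon> * z\<^sup>2))"
    have nF: "norm (F z) = norm (f z) * exp (- (c * Re z)) * exp (\<epsilon> * ((Re z)\<^sup>2 - (Im z)\<^sup>2))" for z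
      by (simp add: F_def norm_mult Re_power2)
    obtain T0 where T0: "\<And>T. T \<ge> T0 \<Longrightarrow> A * exp (D * T) * exp (- (\<epsilon> * T\<^sup>2)) \<le> 1"
    proof -
      \<comment> \<open>Makes \<open>A + |D| \<le> \<epsilon> * T\<close>; after
        \<open>A \<le> exp A\<close> the three exponents then add up to at most 0.\<close>
      define T0 where "T0 = max 1 ((A + \<bar>D\<bar>) / \<epsilon>)"
      have "A * exp (D * T) * exp (- (\<epsilon> * T\<^sup>2)) \<le> 1" if T: "T \<ge> T0" for T
      proof -
        have T1: "T \<ge> 1" "(A + \<bar>D\<bar>) / \<epsilon> \<le> T" using T by (auto simp: T0_def)
        hence "A + \<bar>D\<bar> \<le> \<epsilon> * T" using e by (simp add: field_simps)
        hence "(A + \<bar>D\<bar>) * T \<le> \<epsilon> * T * T" using T1 by (intro mult_right_mono) auto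
        moreover have "A * 1 \<le> A * T" using A1 T1 by (intro mult_left_mono) auto
        moreover have "D * T \<le> \<bar>D\<bar> * T" using T1 by (intro mult_right_mono) auto
        ultimately have le: "A + (D * T + (- (\<epsilon> * T\<^sup>2))) \<le> 0" by (simp add: power2_eq_square algebra_simps)
        have "A \<le> exp A" using exp_ge_add_one_self[of A] by linarith
        hence "A * (exp (D * T) * exp (- (\<epsilon> * T\<^sup>2))) \<le> exp A * (exp (D * T) * exp (- (\<epsilon> * T\<^sup>2)))"
          by (intro mult_right_mono) auto
        also have "\<dots> = exp (A + (D * T + (- (\<epsilon> * T\<^sup>2))))" by (simp only: exp_add)
        also have "\<dots> \<le> 1" using le by simp
        finally show ?thesis by (simp only: mult.assoc)
      qed
      thus ?thesis using that by blast
    qed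
    define T where "T = max T0 (\<bar>Im s\<bar> + 1)"
    have T: "T \<ge> T0" "\<bar>Im s\<bar> \<le> T" "T > 0" by (auto simp: T_def)
    define Q where "Q = cbox (Complex 0 (- T)) (Complex R T)"
    have Qiff: "z \<in> Q \<longleftrightarrow> 0 \<le> Re z \<and> Re z \<le> R \<and> \<bar>Im z\<bar> \<le> T" for z
      by (auto simp: Q_def in_cbox_complex_iff abs_le_iff)
    have QU: "Q \<subseteq> U" using hol(3) by (auto simp: Qiff)
    have holF: "F holomorphic_on Q"
      unfolding F_def by (intro holomorphic_intros holomorphic_on_subset[OF hol(1) QU])
    have "norm (F s) \<le> exp (\<epsilon> * R\<^sup>2)"
    proof (rule maximum_modulus_frontier[of F Q])
      show "F holomorphic_on interior Q" by (rule holomorphic_on_subset[OF holF interior_subset])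
      have "closure Q = Q" by (simp add: Q_def)
      thus "continuous_on (closure Q) F" using holomorphic_on_imp_continuous_on[OF holF] by simp
      show "bounded Q" by (simp add: Q_def)
      show "s \<in> Q" using s T by (simp add: Qiff)
      fix z assume "z \<in> frontier Q"
      hence z: "z \<in> Q" "z \<notin> box (Complex 0 (- T)) (Complex R T)"
        by (auto simp: Q_def frontier_cbox)
      have Rez: "0 \<le> Re z" "Re z \<le> R" using z(1) by (auto simp: Qiff)
      hence "(Re z)\<^sup>2 \<le> R\<^sup>2" by (intro power_mono) auto
      hence e2: "exp (\<epsilon> * ((Re z)\<^sup>2 - (Im z)\<^sup>2)) \<le> exp (\<epsilon> * R\<^sup>2) * exp (- (\<epsilon> * (Im z)\<^sup>2))"
        using e by (simp add: right_diff_distrib flip: exp_add)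
      have e3: "exp (- (\<epsilon> * (Im z)\<^sup>2)) \<le> 1" using e by simp
      have e1: "exp (- (c * Re z)) \<le> 1" using c0 Rez by simp
      consider "Re z = 0" | "Re z = R" | "\<bar>Im z\<bar> = T"
        using z by (auto simp: Q_def in_cbox_complex_iff in_box_complex_iff)
      hence "norm (f z) * exp (- (c * Re z)) * exp (- (\<epsilon> * (Im z)\<^sup>2)) \<le> 1"
      proof cases
        case 1
        hence "norm (f z) * exp (- (c * Re z)) * exp (- (\<epsilon> * (Im z)\<^sup>2)) \<le> 1 * 1 * 1"
          using left[OF 1] e3 by (intro mult_mono) auto
        thus ?thesis by simp
      next
        case 2
        have "exp (- (c * Re z)) = 1 / C" using C R by (simp add: 2 c_def exp_minus field_simps)
        hence "norm (f z) * exp (- (c * Re z)) \<le> C * (1 / C)"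
          using right[OF 2] C by (intro mult_mono) auto
        hence "norm (f z) * exp (- (c * Re z)) \<le> 1" using C by simp
        hence "norm (f z) * exp (- (c * Re z)) * exp (- (\<epsilon> * (Im z)\<^sup>2)) \<le> 1 * 1"
          using e3 by (intro mult_mono) auto
        thus ?thesis by simp
      next
        case 3
        have "norm (f z) * exp (- (c * Re z)) * exp (- (\<epsilon> * (Im z)\<^sup>2)) \<le>
            (A * exp (D * \<bar>Im z\<bar>)) * 1 * exp (- (\<epsilon> * (Im z)\<^sup>2))"
          using growth[OF Rez] e1 A1 by (intro mult_mono) auto
        also have "\<dots> = A * exp (D * T) * exp (- (\<epsilon> * T\<^sup>2))"
        proof -
          have "(Im z)\<^sup>2 = T\<^sup>2" using 3 by (metis power2_abs)
          thus ?thesis by (simp only: 3 mult_1_right)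
        qed
        also have "\<dots> \<le> 1" by (rule T0[OF T(1)])
        finally show ?thesis .
      qed
      hence "norm (f z) * exp (- (c * Re z)) * exp (- (\<epsilon> * (Im z)\<^sup>2)) * exp (\<epsilon> * R\<^sup>2) \<le> 1 * exp (\<epsilon> * R\<^sup>2)"
        by (rule mult_right_mono) simp
      moreover have "norm (F z) \<le> norm (f z) * exp (- (c * Re z)) * (exp (\<epsilon> * R\<^sup>2) * exp (- (\<epsilon> * (Im z)\<^sup>2)))"
        unfolding nF by (intro mult_left_mono e2) auto
      moreover have "norm (f z) * exp (- (c * Re z)) * (exp (\<epsilon> * R\<^sup>2) * exp (- (\<epsilon> * (Im z)\<^sup>2))) =
          norm (f z) * exp (- (c * Re z)) * exp (- (\<epsilon> * (Im z)\<^sup>2)) * exp (\<epsilon> * R\<^sup>2)"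
        by (simp only: mult_ac)
      ultimately show "norm (F z) \<le> exp (\<epsilon> * R\<^sup>2)" by linarith
    qed
    hence "norm (f s) * (exp (- (c * Re s)) * exp (\<epsilon> * ((Re s)\<^sup>2 - (Im s)\<^sup>2))) \<le> exp (\<epsilon> * R\<^sup>2)"
      by (simp add: nF mult_ac)
    hence "norm (f s) * exp (- (c * Re s) + \<epsilon> * ((Re s)\<^sup>2 - (Im s)\<^sup>2)) \<le> exp (\<epsilon> * R\<^sup>2)"
      by (simp only: exp_add)
    hence "norm (f s) \<le> exp (\<epsilon> * R\<^sup>2) / exp (- (c * Re s) + \<epsilon> * ((Re s)\<^sup>2 - (Im s)\<^sup>2))"
      by (simp only: pos_le_divide_eq exp_gt_zero)
    also have "\<dots> = exp (\<epsilon> * R\<^sup>2 - (- (c * Re s) + \<epsilon> * ((Re s)\<^sup>2 - (Im s)\<^sup>2)))" by (simp only: exp_diff)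
    also have "\<dots> \<le> exp (c * Re s + \<epsilon> * (R\<^sup>2 + (Im s)\<^sup>2))"
      using e by (intro exp_mono) (simp add: algebra_simps)
    finally show ?thesis by (simp only: exp_add)
  qed
  have "((\<lambda>\<epsilon>. exp (c * Re s) * exp (\<epsilon> * (R\<^sup>2 + (Im s)\<^sup>2))) \<longlongrightarrow> exp (c * Re s) * exp (0 * (R\<^sup>2 + (Im s)\<^sup>2))) (at_right 0)"
    by (intro tendsto_intros)
  moreover have "\<forall>\<^sub>F \<epsilon> in at_right 0. norm (f s) \<le> exp (c * Re s) * exp (\<epsilon> * (R\<^sup>2 + (Im s)\<^sup>2))"
    using main by (auto simp: eventually_at_right_field intro!: exI[of _ 1])
  ultimately have "norm (f s) \<le> exp (c * Re s) * exp (0 * (R\<^sup>2 + (Im s)\<^sup>2))"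
    by (intro tendsto_lowerbound) auto
  also have "\<dots> = C powr (Re s / R)" using C by (simp add: c_def powr_def mult.commute)
  finally show ?thesis .
qed


section \<open>Monotonicity of \<xi> and the sign of its logarithmic derivative\<close>

lemma xi_nonzero:
  assumes RH: "riemann_hypothesis" and s: "Re s > 1 / 2"
  shows "xi s \<noteq> 0"
  using RH_zeta_reg_nonzero[OF RH s] s
  by (auto simp: xi_def Gamma_eq_zero_iff complex_nonpos_Reals_iff dest!: nonpos_Ints_subset_nonpos_Reals[THEN subsetD])

lemma norm_pi_powr: "norm (complex_of_real pi powr z) = pi powr Re z"
  using norm_powr_real_powr[of "of_real pi" z] by simp

lemma cube_le_exp: "y \<ge> 0 \<Longrightarrow> (y::real) ^ 3 \<le> 6 * exp y"
proof -
  assume y: "y \<ge> 0"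
  have "(\<Sum>k<4. y ^ k / fact k) \<le> exp y"
    unfolding exp_def using y sum_le_suminf[OF summable_exp_generic[of y], of "{..<4}"]
    by (simp add: divide_inverse mult.commute)
  moreover have "(\<Sum>k<4. y ^ k / fact k) = 1 + y + y ^ 2 / 2 + y ^ 3 / 6"
    by (simp add: eval_nat_numeral fact_numeral)
  moreover have "0 \<le> 1 + y + y\<^sup>2 / 2" using y by simp
  ultimately show ?thesis by argo
qed

text \<open>On \<open>Re s = 0\<close> the functional equation and conjugation carry the numerator
  of \<open>B\<close> to the conjugate of its denominator. On far lines \<open>Re s = R\<close> the
  bound for \<open>B\<close> does not depend on \<open>R\<close>, so the three lines bound tends to
  1. The shift \<open>h > 0\<close> keeps the denominator at distance at least \<open>h\<close> from
  the critical line, where \<open>RH_zeta_reg_bounds\<close> bounds it from below.\<close>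

theorem RH_xi_mono:
  assumes RH: "riemann_hypothesis" and h: "0 < h" "h \<le> 1 / 2" and s: "0 \<le> Re s"
  shows "norm (xi (1 / 2 + s - of_real h)) \<le> norm (xi (1 / 2 + s + of_real h))"
proof -
  define B where "B = (\<lambda>s. xi (1 / 2 + s - of_real h) / xi (1 / 2 + s + of_real h))"
  define U where "U = {s. Re s > - h}"
  have nz: "xi (1 / 2 + z + of_real h) \<noteq> 0" if "z \<in> U" for z
    using that by (intro xi_nonzero[OF RH]) (auto simp: U_def)
  have holB: "B holomorphic_on U"
  proof -
    have "(xi \<circ> (\<lambda>s. 1 / 2 + s - of_real h)) holomorphic_on U"
      by (rule holomorphic_on_compose_gen[OF _ xi_holomorphic]) (use h in \<open>auto intro!: holomorphic_intros simp: U_def\<close>)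
    moreover have "(xi \<circ> (\<lambda>s. 1 / 2 + s + of_real h)) holomorphic_on U"
      by (rule holomorphic_on_compose_gen[OF _ xi_holomorphic]) (use h in \<open>auto intro!: holomorphic_intros simp: U_def\<close>)
    ultimately show ?thesis
      unfolding B_def using nz by (intro holomorphic_intros) (auto simp: o_def)
  qed
  have left: "norm (B z) \<le> 1" if "Re z = 0" for z
  proof -
    have "xi (1 / 2 + z - of_real h) = xi (1 - (1 / 2 + z - of_real h))"
      by (rule xi_functional_equation[symmetric]) (use that h in auto)
    also have "1 - (1 / 2 + z - of_real h) = cnj (1 / 2 + z + of_real h)"
      using that by (simp add: complex_eq_iff)
    also have "xi (cnj (1 / 2 + z + of_real h)) = cnj (xi (1 / 2 + z + of_real h))"
      by (rule xi_cnj) (use that h in auto)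
    finally show ?thesis by (simp add: B_def norm_divide)
  qed
  define a where "a = (\<lambda>z. 5 / 4 + Re z / 2 - h / 2)"
  define b where "b = (\<lambda>z. 5 / 4 + Re z / 2 + h / 2)"
  have Bsplit: "norm (B z) \<le> norm (zeta_reg (1 / 2 + z - of_real h)) / norm (zeta_reg (1 / 2 + z + of_real h)) *
      4 * (Gamma (a z) / Gamma (b z))" if z: "Re z \<ge> 0" for z
  proof -
    have ab: "0 < a z" "a z \<le> b z" using z h by (auto simp: a_def b_def)
    have G: "norm (Gamma (Complex (a z) (Im z / 2))) / norm (Gamma (Complex (b z) (Im z / 2))) \<le> Gamma (a z) / Gamma (b z)"
    proof -
      have "Gamma (Complex (b z) (Im z / 2)) \<noteq> 0"
        using ab by (auto simp: Gamma_eq_zero_iff complex_nonpos_Reals_iff dest!: nonpos_Ints_subset_nonpos_Reals[THEN subsetD])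
      moreover have "Gamma (b z) > 0" using ab by (intro Gamma_real_pos) auto
      ultimately show ?thesis using norm_Gamma_ratio_le[OF ab, of "Im z / 2"] by (simp add: divide_simps)
    qed
    have e: "1 + (1 / 2 + z - of_real h) / 2 = Complex (a z) (Im z / 2)"
      "1 + (1 / 2 + z + of_real h) / 2 = Complex (b z) (Im z / 2)"
      by (simp_all add: complex_eq_iff a_def b_def field_simps)
    have p: "pi powr Re (- (1 / 2 + z - of_real h) / 2) / pi powr Re (- (1 / 2 + z + of_real h) / 2) \<le> 4"
    proof -
      have "pi powr Re (- (1 / 2 + z - of_real h) / 2) / pi powr Re (- (1 / 2 + z + of_real h) / 2) =
        pi powr (Re (- (1 / 2 + z - of_real h) / 2) - Re (- (1 / 2 + z + of_real h) / 2))"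
        by (simp only: powr_diff)
      also have "Re (- (1 / 2 + z - of_real h) / 2) - Re (- (1 / 2 + z + of_real h) / 2) = h" by (simp add: field_simps)
      also have "pi powr h \<le> pi powr 1" using h pi_gt3 by (intro powr_mono) auto
      finally show ?thesis using pi_less_4 by simp
    qed
    have "norm (B z) = norm (zeta_reg (1 / 2 + z - of_real h)) / norm (zeta_reg (1 / 2 + z + of_real h)) *
       (pi powr Re (- (1 / 2 + z - of_real h) / 2) / pi powr Re (- (1 / 2 + z + of_real h) / 2)) *
       (norm (Gamma (Complex (a z) (Im z / 2))) / norm (Gamma (Complex (b z) (Im z / 2))))"
      unfolding B_def xi_def e norm_divide norm_mult norm_pi_powr by (simp only: times_divide_times_eq)
    also have "\<dots> \<le> norm (zeta_reg (1 / 2 + z - of_real h)) / norm (zeta_reg (1 / 2 + z + of_real h)) *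
      4 * (Gamma (a z) / Gamma (b z))"
      by (intro mult_mono G p order.refl) auto
    finally show ?thesis .
  qed
  obtain K where K: "K > 0"
    "\<And>z. 1 / 2 + h \<le> Re z \<Longrightarrow> Re z \<le> 2 \<Longrightarrow> norm (zeta_reg z) \<ge> exp (- (K * sqrt (5 + \<bar>Im z\<bar>)))"
  proof -
    have h1: "h \<le> 1" using h by simp
    show ?thesis using RH_zeta_reg_bounds[OF RH h(1) h1] that by blast
  qed
  obtain C where C: "C \<ge> 1" "\<And>s. Re s \<ge> - 1 / 2 \<Longrightarrow> norm (zeta_reg s) \<le> C * (1 + norm s) ^ 3"
    using zeta_reg_growth by blast
  \<comment> \<open>24 is 6 * 4 * 1: the quotient of zeta values is at most 17 / 3, which is below
    6, the powers of pi contribute \<open>pi powr h\<close>, which is below 4, and Gamma increases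
    from 3 / 2 on. \<open>R \<ge> 3\<close> puts all arguments into these ranges.\<close>
  have strip: "norm (B s) \<le> 24 powr (Re s / R)" if R: "R \<ge> 3" "R \<ge> Re s" for R
  proof -
    define S where "S = {0..R}"
    define q where "q = (\<lambda>x::real. Gamma (5 / 4 + x / 2 - h / 2) / Gamma (5 / 4 + x / 2 + h / 2))"
    \<comment> \<open>Inside the strip the Gamma quotient matters only up to a constant that may
      depend on \<open>R\<close>, so compactness suffices.\<close>
    have "compact S" by (simp add: S_def)
    moreover have "continuous_on S q"
    proof -
      have pos: "5 / 4 + x / 2 - h / 2 > 0" "5 / 4 + x / 2 + h / 2 > 0" if "x \<in> S" for x
        using that h by (auto simp: S_def)
      have np: "y \<notin> \<int>\<^sub>\<le>\<^sub>0" if "y > 0" for y :: real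
        using that by (auto elim!: nonpos_Ints_cases)
      have cG: "continuous_on S (\<lambda>x. Gamma (g x))" if "continuous_on S g" "\<And>x. x \<in> S \<Longrightarrow> g x > 0" for g :: "real \<Rightarrow> real"
        by (rule continuous_on_compose2[OF continuous_on_Gamma[of "{0<..}"] that(1)]) (use that(2) np in auto)
      show ?thesis unfolding q_def
      proof (intro continuous_on_divide cG continuous_intros)
        show "\<forall>x\<in>S. Gamma (5 / 4 + x / 2 + h / 2) \<noteq> 0"
          using pos(2) Gamma_real_pos by (metis less_irrefl)
      qed (use pos in auto)
    qed
    moreover have "S \<noteq> {}" using R by (simp add: S_def)
    ultimately obtain x0 where x0: "\<forall>x\<in>S. q x \<le> q x0"
      using continuous_attains_sup[of S q] by blast
    define Q where "Q = \<bar>q x0\<bar>"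
    have Q: "Gamma (a z) / Gamma (b z) \<le> Q" if "0 \<le> Re z" "Re z \<le> R" for z
    proof -
      have "q (Re z) \<le> q x0" using x0 that by (auto simp: S_def)
      also have "q x0 \<le> Q" unfolding Q_def by (rule abs_ge_self)
      finally show ?thesis by (simp only: q_def a_def b_def)
    qed
    show ?thesis
    proof (rule three_lines_exp_growth[OF _ _ holB _ _ left])
      show "open U" by (simp add: U_def)
      show "{s. 0 \<le> Re s \<and> Re s \<le> R} \<subseteq> U" using h by (auto simp: U_def)
      show "norm (B z) \<le> 24" if z: "Re z = R" for z
      proof -
        define u where "u = 1 / 2 + z - of_real h"
        define v where "v = 1 / 2 + z + of_real h"
        have u: "Re u \<ge> 2" and v: "Re v \<ge> 2" using z R h by (auto simp: u_def v_def)
        have n1: "u \<noteq> 1" "v \<noteq> 1" using u v by auto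
        have "norm (u - 1) \<le> norm (v - 1)"
        proof -
          have "(Re (u - 1))\<^sup>2 \<le> (Re (v - 1))\<^sup>2" using u h by (intro power_mono) (auto simp: u_def v_def)
          moreover have "Im (u - 1) = Im (v - 1)" by (simp add: u_def v_def)
          ultimately show ?thesis unfolding cmod_def by (intro real_sqrt_le_mono) auto
        qed
        hence r1: "norm (u - 1) / norm (v - 1) \<le> 1" using n1 by (simp add: divide_simps)
        have r2: "norm (riemann_zeta u) / norm (riemann_zeta v) \<le> (17 / 10) / (3 / 10)"
          using riemann_zeta_bounds_ge2[OF u] riemann_zeta_bounds_ge2[OF v] by (intro frac_le) auto
        have "norm (zeta_reg u) / norm (zeta_reg v) =
           norm (u - 1) / norm (v - 1) * (norm (riemann_zeta u) / norm (riemann_zeta v))"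
          using n1 by (simp add: zeta_reg_def norm_mult)
        also have "\<dots> \<le> 1 * ((17 / 10) / (3 / 10))" using r1 r2 by (intro mult_mono) auto
        finally have r: "norm (zeta_reg u) / norm (zeta_reg v) \<le> 6" by argo
        have "a z \<ge> 3 / 2" "a z < b z" using z R h by (auto simp: a_def b_def)
        hence "Gamma (a z) < Gamma (b z)" "Gamma (a z) > 0" by (auto intro: Gamma_real_strict_mono Gamma_real_pos)
        hence "Gamma (a z) / Gamma (b z) \<le> 1" "Gamma (a z) / Gamma (b z) \<ge> 0" by (auto simp: divide_simps)
        hence "norm (zeta_reg u) / norm (zeta_reg v) * 4 * (Gamma (a z) / Gamma (b z)) \<le> 6 * 4 * 1"
          using r by (intro mult_mono) auto
        moreover have "Re z \<ge> 0" using z R by simp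
        ultimately show ?thesis using Bsplit[of z] by (simp add: u_def v_def)
      qed
      show "norm (B z) \<le> (6 * C * exp (2 + R + (5 * K + 2)) * 4 * Q) * exp ((1 + K) * \<bar>Im z\<bar>)"
        if z: "0 \<le> Re z" "Re z \<le> R" for z
      proof -
        define u where "u = 1 / 2 + z - of_real h"
        define v where "v = 1 / 2 + z + of_real h"
        define t where "t = \<bar>Im z\<bar>"
        have t: "t \<ge> 0" by (simp add: t_def)
        have "norm u \<le> \<bar>Re u\<bar> + \<bar>Im u\<bar>" by (rule cmod_le)
        also have "\<dots> \<le> 1 + R + t" using z h by (auto simp: u_def t_def)
        finally have nu: "norm u \<le> 1 + R + t" .
        have "norm (zeta_reg u) \<le> C * (1 + norm u) ^ 3" using z h by (intro C(2)) (auto simp: u_def)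
        also have "(1 + norm u) ^ 3 \<le> 6 * exp (1 + norm u)" by (rule cube_le_exp) simp
        also have "exp (1 + norm u) \<le> exp (2 + R + t)" using nu by simp
        finally have nu2: "norm (zeta_reg u) \<le> C * (6 * exp (2 + R + t))" using C(1) by simp
        have nv: "norm (zeta_reg v) \<ge> exp (- (5 * K + 2 + K * t))"
        proof (cases "Re v \<le> 2")
          case True
          have "sqrt (5 + t) \<le> 5 + t"
            using t by (intro real_le_lsqrt) (auto simp: power2_eq_square algebra_simps)
          hence "K * sqrt (5 + t) \<le> K * (5 + t)" using K(1) by (intro mult_left_mono) auto
          hence "exp (- (5 * K + 2 + K * t)) \<le> exp (- (K * sqrt (5 + t)))" by (simp add: algebra_simps)
          also have "\<dots> \<le> norm (zeta_reg v)"
            using K(2)[of v] True z h by (simp add: v_def t_def)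
          finally show ?thesis .
        next
          case False
          have "0 \<le> 5 * K + K * t" using K(1) t by simp
          hence "exp (- (5 * K + 2 + K * t)) \<le> exp (- 2)" by simp
          also have "\<dots> \<le> norm (zeta_reg v)" using zeta_reg_ge2[of v] False exp_minus_2_le by linarith
          finally show ?thesis .
        qed
        have Q0: "Gamma (a z) / Gamma (b z) \<ge> 0"
          using z h by (intro divide_nonneg_nonneg less_imp_le Gamma_real_pos) (auto simp: a_def b_def)
        have "norm (B z) \<le> norm (zeta_reg u) / norm (zeta_reg v) * 4 * (Gamma (a z) / Gamma (b z))"
          using Bsplit[OF z(1)] by (simp add: u_def v_def)
        also have "\<dots> \<le> (C * (6 * exp (2 + R + t))) / exp (- (5 * K + 2 + K * t)) * 4 * Q"
          using nu2 nv Q[OF z] Q0 C(1) by (intro mult_mono frac_le) auto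
        also have "\<dots> = (6 * C * exp (2 + R + (5 * K + 2)) * 4 * Q) * exp ((1 + K) * t)"
        proof -
          have "exp (2 + R + t) / exp (- (5 * K + 2 + K * t)) = exp (2 + R + t - (- (5 * K + 2 + K * t)))"
            by (rule exp_diff[symmetric])
          also have "2 + R + t - (- (5 * K + 2 + K * t)) = 2 + R + (5 * K + 2) + (1 + K) * t"
            by (simp add: algebra_simps)
          finally have x: "exp (2 + R + t) / exp (- (5 * K + 2 + K * t)) = exp (2 + R + (5 * K + 2)) * exp ((1 + K) * t)"
            by (simp only: exp_add)
          have "C * (6 * exp (2 + R + t)) / exp (- (5 * K + 2 + K * t)) * 4 * Q =
              C * 6 * (exp (2 + R + t) / exp (- (5 * K + 2 + K * t))) * 4 * Q" by simp
          thus ?thesis unfolding x by (simp only: mult_ac)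
        qed
        finally show ?thesis by (simp add: t_def)
      qed
    qed (use R s in auto)
  qed
  have "((\<lambda>R. 24 powr (Re s / R)) \<longlongrightarrow> 24 powr 0) at_top"
    by (intro tendsto_intros tendsto_divide_0[OF tendsto_const] filterlim_at_top_imp_at_infinity filterlim_ident) auto
  moreover have "\<forall>\<^sub>F R in at_top. norm (B s) \<le> 24 powr (Re s / R)"
    using eventually_ge_at_top[of "max 3 (Re s)"] by eventually_elim (use strip in auto)
  ultimately have "norm (B s) \<le> 24 powr 0" by (intro tendsto_lowerbound) auto
  moreover have "xi (1 / 2 + s + of_real h) \<noteq> 0" using nz[of s] s h by (simp add: U_def)
  ultimately show ?thesis by (simp add: B_def norm_divide divide_le_eq)
qed

definition logderiv_xi :: "complex \<Rightarrow> complex" where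
  "logderiv_xi s = deriv xi (1 / 2 + s) / xi (1 / 2 + s)"

text \<open>First order expansion: the squared modulus of \<open>xi (p - h) / xi (p + h)\<close> is
  1 at \<open>h = 0\<close> and has derivative \<open>- 4 * Re (logderiv_xi s)\<close> there. A
  negative real part would let it rise above 1, against the monotonicity.\<close>

theorem RH_Re_logderiv_xi_nonneg:
  assumes RH: "riemann_hypothesis" and s: "Re s > 0"
  shows "Re (logderiv_xi s) \<ge> 0"
proof (rule ccontr)
  assume neg: "\<not> Re (logderiv_xi s) \<ge> 0"
  define p where "p = 1 / 2 + s"
  have nz: "xi p \<noteq> 0" using s by (intro xi_nonzero[OF RH]) (simp add: p_def)
  have opn: "open {s. Re s > - 1}" by simp
  have pin: "p \<in> {s. Re s > - 1}" using s by (simp add: p_def)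
  have dxi: "(xi has_field_derivative deriv xi p) (at p)"
    by (rule holomorphic_derivI[OF xi_holomorphic opn pin])
  define q where "q = (\<lambda>z. xi (p - z) / xi (p + z))"
  have "((\<lambda>z. xi (p + z)) has_field_derivative deriv xi p * 1) (at 0)"
    by (rule DERIV_chain2) (auto intro!: derivative_eq_intros dxi)
  moreover have "((\<lambda>z. xi (p - z)) has_field_derivative deriv xi p * (- 1)) (at 0)"
    by (rule DERIV_chain2) (auto intro!: derivative_eq_intros dxi)
  ultimately have "(q has_field_derivative
     (deriv xi p * (- 1) * xi (p + 0) - xi (p - 0) * (deriv xi p * 1)) / (xi (p + 0) * xi (p + 0))) (at 0)"
    unfolding q_def using nz by (intro DERIV_divide) auto
  also have "(deriv xi p * (- 1) * xi (p + 0) - xi (p - 0) * (deriv xi p * 1)) / (xi (p + 0) * xi (p + 0)) =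
      - 2 * logderiv_xi s"
    using nz by (simp add: logderiv_xi_def p_def field_simps)
  finally have dq: "(q has_field_derivative - 2 * logderiv_xi s) (at 0)" .
  have "((\<lambda>t. q (of_real t)) has_vector_derivative 1 * (- 2 * logderiv_xi s)) (at 0)"
  proof -
    have "(complex_of_real has_vector_derivative 1) (at 0)"
      using bounded_linear.has_vector_derivative[OF bounded_linear_of_real has_vector_derivative_id] by auto
    thus ?thesis
      using field_vector_diff_chain_at[of complex_of_real 1 0 q "- 2 * logderiv_xi s"] dq by (simp add: o_def)
  qed
  hence vd: "((\<lambda>t. q (of_real t)) has_vector_derivative - 2 * logderiv_xi s) (at 0)" by simp
  have q0: "q 0 = 1" using nz by (simp add: q_def)
  have dR: "((\<lambda>t. Re (q (of_real t))) has_real_derivative - 2 * Re (logderiv_xi s)) (at 0)"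
    using bounded_linear.has_vector_derivative[OF bounded_linear_Re vd]
    by (simp add: has_real_derivative_iff_has_vector_derivative)
  have dI: "((\<lambda>t. Im (q (of_real t))) has_real_derivative - 2 * Im (logderiv_xi s)) (at 0)"
    using bounded_linear.has_vector_derivative[OF bounded_linear_Im vd]
    by (simp add: has_real_derivative_iff_has_vector_derivative)
  define u where "u = (\<lambda>t. (Re (q (of_real t)))\<^sup>2 + (Im (q (of_real t)))\<^sup>2)"
  have "(u has_real_derivative - 4 * Re (logderiv_xi s)) (at 0)"
    unfolding u_def using DERIV_add[OF DERIV_power[OF dR, of 2] DERIV_power[OF dI, of 2]] q0 by simp
  moreover have "- 4 * Re (logderiv_xi s) > 0" using neg by simp
  ultimately obtain d where d: "d > 0" "\<And>h. 0 < h \<Longrightarrow> h < d \<Longrightarrow> u 0 < u (0 + h)"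
    using DERIV_pos_inc_right by blast
  define h where "h = min (d / 2) (1 / 2)"
  have h: "0 < h" "h < d" "h \<le> 1 / 2" using d by (auto simp: h_def)
  have "u h > 1" using d(2)[OF h(1,2)] q0 by (simp add: u_def)
  hence "1\<^sup>2 < (norm (q (of_real h)))\<^sup>2" by (simp add: u_def cmod_power2)
  hence lt: "norm (q (of_real h)) > 1" by (rule power2_less_imp_less) simp
  have "norm (xi (p - of_real h)) \<le> norm (xi (p + of_real h))"
    using RH_xi_mono[OF RH h(1,3), of s] s by (simp add: p_def)
  hence "norm (q (of_real h)) \<le> 1" by (simp add: q_def norm_divide divide_le_eq_1)
  thus False using lt by simp
qed

section \<open>Vertical line integrals\<close>

text \<open>Cauchy's theorem for a rectangle in the form of Fubini: the double integral of the
  derivative is evaluated in both orders by the fundamental theorem of calculus.\<close>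

lemma rectangle_integral_difference:
  fixes f :: "complex \<Rightarrow> complex"
  assumes hol: "f holomorphic_on U" and U: "open U" "{s. a \<le> Re s \<and> Re s \<le> b} \<subseteq> U" and ab: "a \<le> b" and T: "T \<ge> 0"
  shows "\<i> * integral {-T..T} (\<lambda>t. f (Complex b t) - f (Complex a t)) =
    integral {a..b} (\<lambda>x. f (Complex x T) - f (Complex x (-T)))"
proof -
  have inU: "Complex x t \<in> U" if "x \<in> {a..b}" for x t using U(2) that by auto
  define f' where "f' = deriv f"
  have der: "(f has_field_derivative f' z) (at z)" if "z \<in> U" for z
    unfolding f'_def by (rule holomorphic_derivI[OF hol U(1) that])
  have cf': "continuous_on U f'"
    unfolding f'_def by (intro holomorphic_on_imp_continuous_on holomorphic_deriv hol U)
  have C: "Complex x t = of_real x + \<i> * of_real t" for x t by (simp add: complex_eq_iff)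
  have dx: "((\<lambda>x. f (Complex x t)) has_vector_derivative f' (Complex x t)) (at x within {a..b})" if "x \<in> {a..b}" for x t
  proof -
    have "((\<lambda>x. Complex x t) has_vector_derivative 1) (at x within {a..b})"
      unfolding C by (auto intro!: derivative_eq_intros)
    from field_vector_diff_chain_within[OF this, of f "f' (Complex x t)"] der[OF inU[OF that]]
    show ?thesis by (simp add: o_def has_field_derivative_at_within)
  qed
  have dt: "((\<lambda>t. f (Complex x t)) has_vector_derivative \<i> * f' (Complex x t)) (at t within {-T..T})" if "x \<in> {a..b}" for x t
  proof -
    have "((\<lambda>t. Complex x t) has_vector_derivative \<i>) (at t within {-T..T})"
      unfolding C by (auto intro!: derivative_eq_intros)
    from field_vector_diff_chain_within[OF this, of f "f' (Complex x t)"] der[OF inU[OF that]]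
    show ?thesis by (simp add: o_def has_field_derivative_at_within)
  qed
  have ix: "integral {a..b} (\<lambda>x. \<i> * f' (Complex x t)) = \<i> * (f (Complex b t) - f (Complex a t))" for t
    using has_integral_mult_right[OF fundamental_theorem_of_calculus[OF ab dx], of \<i> t]
    by (intro integral_unique) auto
  have it: "integral {-T..T} (\<lambda>t. \<i> * f' (Complex x t)) = f (Complex x T) - f (Complex x (-T))" if "x \<in> {a..b}" for x
    by (intro integral_unique fundamental_theorem_of_calculus dt that) (use T in auto)
  have cont: "continuous_on (cbox (a, -T) (b, T)) (\<lambda>(x, t). \<i> * f' (Complex x t))"
  proof -
    have "continuous_on (cbox (a, -T) (b, T)) (\<lambda>p. \<i> * f' (Complex (fst p) (snd p)))"
    proof -
      have cC: "continuous_on (cbox (a, -T) (b, T)) (\<lambda>p. Complex (fst p) (snd p))"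
        unfolding C by (intro continuous_intros)
      show ?thesis
        by (intro continuous_on_mult continuous_on_const continuous_on_compose2[OF cf' cC])
           (auto intro!: inU simp: cbox_Pair_eq)
    qed
    thus ?thesis by (simp add: case_prod_unfold)
  qed
  have "\<i> * integral {-T..T} (\<lambda>t. f (Complex b t) - f (Complex a t)) =
      integral {-T..T} (\<lambda>t. \<i> * (f (Complex b t) - f (Complex a t)))"
    by simp
  also have "\<dots> = integral {-T..T} (\<lambda>t. integral {a..b} (\<lambda>x. \<i> * f' (Complex x t)))" by (simp only: ix)
  also have "\<dots> = integral {a..b} (\<lambda>x. integral {-T..T} (\<lambda>t. \<i> * f' (Complex x t)))"
    using integral_swap_continuous[OF cont] by simp
  also have "\<dots> = integral {a..b} (\<lambda>x. f (Complex x T) - f (Complex x (-T)))"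
    by (intro integral_cong it)
  finally show ?thesis .
qed

text \<open>Behaves like \<open>sqrt |t| / t^2\<close> for large \<open>|t|\<close>, the product of
  the growth of \<open>logderiv_xi\<close> and the decay of the kernel, but is regular at 0.\<close>

definition dec :: "real \<Rightarrow> real" where "dec t = (1 + \<bar>t\<bar>) powr (- 3 / 2)"

lemma dec_pos [simp]: "dec t > 0" and dec_nonneg [simp]: "dec t \<ge> 0"
  by (simp_all add: dec_def add_pos_nonneg)

lemma dec_measurable [measurable]: "dec \<in> borel_measurable borel"
  unfolding dec_def by measurable

lemma dec_integrable: "integrable lborel dec"
proof -
  have F: "((\<lambda>t. - 2 * (1 + t) powr (- 1 / 2)) has_real_derivative (1 + t) powr (- 3 / 2)) (at t)" if "t \<ge> 0" for t :: real
  proof -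
    have "((\<lambda>t. (1 + t) powr (- 1 / 2)) has_real_derivative (- 1 / 2) * (1 + t) powr (- 1 / 2 - 1) * 1) (at t)"
      by (rule DERIV_chain2[OF has_real_derivative_powr]) (use that in \<open>auto intro!: derivative_eq_intros\<close>)
    from DERIV_cmult[OF this, of "- 2"] show ?thesis by simp
  qed
  have "((\<lambda>t::real. (1 + t) powr (- 1 / 2)) \<longlongrightarrow> 0) at_top"
    by (intro tendsto_neg_powr filterlim_tendsto_add_at_top[OF tendsto_const] filterlim_ident) auto
  from tendsto_mult[OF tendsto_const[of "- 2"] this]
  have "((\<lambda>t::real. - 2 * (1 + t) powr (- 1 / 2)) \<longlongrightarrow> 0) at_top" by simp
  hence "(\<integral>\<^sup>+t. ennreal ((1 + t) powr (- 3 / 2)) * indicator {0..} t \<partial>lborel) = ennreal (0 - (- 2 * (1 + 0) powr (- 1 / 2)))"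
    by (intro nn_integral_FTC_atLeast F) auto
  hence I: "(\<integral>\<^sup>+t. ennreal (dec t * indicator {0..} t) \<partial>lborel) < \<infinity>"
  proof -
    assume a: "(\<integral>\<^sup>+t. ennreal ((1 + t) powr (- 3 / 2)) * indicator {0..} t \<partial>lborel) = ennreal (0 - (- 2 * (1 + 0) powr (- 1 / 2)))"
    have "(\<integral>\<^sup>+t. ennreal (dec t * indicator {0..} t) \<partial>lborel) = (\<integral>\<^sup>+t. ennreal ((1 + t) powr (- 3 / 2)) * indicator {0..} t \<partial>lborel)"
      by (intro nn_integral_cong) (auto simp: dec_def indicator_def)
    thus ?thesis unfolding a by simp
  qed
  have 1: "integrable lborel (\<lambda>t. dec t * indicator {0..} t)"
    using I by (intro integrableI_nonneg) auto
  have 2: "integrable lborel (\<lambda>t. dec (0 + (- 1) * t) * indicator {0..} (0 + (- 1) * t))"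
    using lborel_integrable_real_affine[OF 1, of "- 1" 0] by simp
  show ?thesis
    by (rule Bochner_Integration.integrable_bound[OF Bochner_Integration.integrable_add[OF 1 2]])
       (auto simp: dec_def indicator_def)
qed

lemma dec_tendsto: "(dec \<longlongrightarrow> 0) at_top"
proof -
  have "((\<lambda>t::real. (1 + t) powr (- 3 / 2)) \<longlongrightarrow> 0) at_top"
    by (intro tendsto_neg_powr filterlim_tendsto_add_at_top[OF tendsto_const] filterlim_ident) auto
  moreover have "\<forall>\<^sub>F t in at_top. (1 + t) powr (- 3 / 2) = dec t"
    using eventually_ge_at_top[of 0] by eventually_elim (simp add: dec_def)
  ultimately show ?thesis by (rule Lim_transform_eventually)
qed

lemma inverse_square_le_dec: "\<bar>t\<bar> \<ge> 1 \<Longrightarrow> 1 / t\<^sup>2 \<le> 4 * dec t"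
proof -
  assume t: "\<bar>t\<bar> \<ge> 1"
  define u where "u = \<bar>t\<bar>"
  have u: "u \<ge> 1" using t by (simp add: u_def)
  have "(2 * u) powr (- 3 / 2) \<le> (1 + u) powr (- 3 / 2)" using u by (intro powr_mono2') auto
  moreover have "(2 * u) powr (- 3 / 2) = 2 powr (- 3 / 2) * u powr (- 3 / 2)" using u by (simp add: powr_mult)
  moreover have "u powr (- 2) \<le> u powr (- 3 / 2)" using u by (intro powr_mono) auto
  moreover have "2 powr (- 2) \<le> (2::real) powr (- 3 / 2)" by (intro powr_mono) auto
  moreover have "2 powr (- 2) = (1 / 4 :: real)" by (simp add: powr_minus powr_numeral)
  moreover have "u powr (- 2) = 1 / t\<^sup>2" using u by (simp add: powr_minus powr_numeral u_def divide_inverse)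
  ultimately have "1 / 4 * (1 / t\<^sup>2) \<le> (1 + u) powr (- 3 / 2)"
    by (smt (verit) mult_mono powr_ge_zero)
  thus ?thesis by (simp add: dec_def u_def)
qed

text \<open>Estimates with \<open>(Im s)^2\<close> in a denominator hold for
  \<open>|Im s| \<ge> 1\<close> only; the rest of the strip is compact. The factor 3 appears because
  \<open>dec\<close> is at least \<open>2 powr (- 3 / 2)\<close> there, which exceeds 1 / 3.\<close>

lemma strip_decay_extend:
  fixes f :: "complex \<Rightarrow> complex"
  assumes cont: "continuous_on {s. a \<le> Re s \<and> Re s \<le> b} f"
    and C: "\<And>s. a \<le> Re s \<Longrightarrow> Re s \<le> b \<Longrightarrow> \<bar>Im s\<bar> \<ge> 1 \<Longrightarrow> norm (f s) \<le> C * dec (Im s)"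
  obtains C' where "C' \<ge> 0" "\<And>s. a \<le> Re s \<Longrightarrow> Re s \<le> b \<Longrightarrow> norm (f s) \<le> C' * dec (Im s)"
proof -
  define S where "S = cbox (Complex a (- 1)) (Complex b 1)"
  have S: "z \<in> S \<longleftrightarrow> a \<le> Re z \<and> Re z \<le> b \<and> \<bar>Im z\<bar> \<le> 1" for z
    by (auto simp: S_def in_cbox_complex_iff abs_le_iff)
  have "compact (f ` S)"
    by (intro compact_continuous_image continuous_on_subset[OF cont]) (auto simp: S S_def[symmetric], simp add: S_def)
  then obtain M where M: "\<And>z. z \<in> S \<Longrightarrow> norm (f z) \<le> M"
    using compact_imp_bounded bounded_iff by (metis imageI)
  define C' where "C' = \<bar>C\<bar> + \<bar>M\<bar> * 3"
  show ?thesis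
  proof (rule that[of C'])
    show "C' \<ge> 0" by (simp add: C'_def)
    fix s assume s: "a \<le> Re s" "Re s \<le> b"
    show "norm (f s) \<le> C' * dec (Im s)"
    proof (cases "\<bar>Im s\<bar> \<ge> 1")
      case True
      have "norm (f s) \<le> C * dec (Im s)" by (rule C[OF s True])
      also have "\<dots> \<le> C' * dec (Im s)" by (intro mult_right_mono) (auto simp: C'_def)
      finally show ?thesis .
    next
      case False
      hence "norm (f s) \<le> M" using s by (intro M) (auto simp: S)
      also have "M \<le> \<bar>M\<bar> * 3 * dec (Im s)"
      proof -
        have "2 powr (- 3 / 2) \<le> dec (Im s)" unfolding dec_def using False by (intro powr_mono2') auto
        moreover have "1 / 3 \<le> (2::real) powr (- 3 / 2)"
        proof -
          have "(2::real) powr (3 / 2) = 2 powr (1 + 1 / 2)" by simp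
          also have "\<dots> = 2 * sqrt 2" by (subst powr_add) (simp add: powr_half_sqrt)
          also have "\<dots> \<le> 3"
          proof -
            have "sqrt 2 \<le> 3 / 2" by (rule real_le_lsqrt) (auto simp: power2_eq_square)
            thus ?thesis by simp
          qed
          finally have "inverse 3 \<le> inverse ((2::real) powr (3 / 2))" by (intro le_imp_inverse_le) auto
          thus ?thesis by (simp add: powr_minus inverse_eq_divide)
        qed
        ultimately have "1 \<le> 3 * dec (Im s)" by linarith
        hence "\<bar>M\<bar> * 1 \<le> \<bar>M\<bar> * (3 * dec (Im s))" by (intro mult_left_mono) auto
        thus ?thesis by simp
      qed
      also have "\<dots> \<le> C' * dec (Im s)" by (intro mult_right_mono) (auto simp: C'_def)
      finally show ?thesis .
    qed
  qed
qed

lemma vertical_integrable: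
  fixes f :: "complex \<Rightarrow> complex"
  assumes cont: "continuous_on {s. Re s = a} f"
    and C: "\<And>s. Re s = a \<Longrightarrow> norm (f s) \<le> C * dec (Im s)"
  shows "integrable lborel (\<lambda>t. f (Complex a t))"
proof (rule Bochner_Integration.integrable_bound[of lborel "\<lambda>t. C * dec t"])
  have "continuous_on UNIV (\<lambda>t. f (Complex a t))"
    by (rule continuous_on_compose2[OF cont]) (auto simp: Complex_eq intro!: continuous_intros)
  thus "(\<lambda>t. f (Complex a t)) \<in> borel_measurable lborel"
    by (simp add: borel_measurable_continuous_onI)
  show "AE t in lborel. norm (f (Complex a t)) \<le> norm (C * dec t)"
  proof (intro AE_I2)
    fix t
    have "norm (f (Complex a t)) \<le> C * dec t" using C[of "Complex a t"] by simp
    thus "norm (f (Complex a t)) \<le> norm (C * dec t)" by simp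
  qed
qed (intro integrable_mult_right dec_integrable)

lemma integral_symmetric_limit:
  fixes g :: "real \<Rightarrow> complex"
  assumes g: "integrable lborel g" and cont: "continuous_on UNIV g"
  shows "((\<lambda>T. integral {-T..T} g) \<longlongrightarrow> (LINT t|lborel. g t)) at_top"
proof -
  have "((\<lambda>T. LINT t|lborel. indicator {-T..T} t *\<^sub>R g t) \<longlongrightarrow> (LINT t|lborel. g t)) at_top"
  proof (rule integral_dominated_convergence_at_top[where w = "\<lambda>t. norm (g t)"])
    show "AE x in lborel. ((\<lambda>T. indicator {-T..T} x *\<^sub>R g x) \<longlongrightarrow> g x) at_top"
    proof (intro AE_I2)
      fix x
      have "\<forall>\<^sub>F T in at_top. indicator {-T..T} x *\<^sub>R g x = g x"
        using eventually_ge_at_top[of "\<bar>x\<bar>"] by eventually_elim (auto simp: indicator_def)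
      thus "((\<lambda>T. indicator {-T..T} x *\<^sub>R g x) \<longlongrightarrow> g x) at_top" by (rule tendsto_eventually)
    qed
  qed (use g in \<open>auto simp: indicator_def intro!: always_eventually\<close>)
  moreover have "(LINT t|lborel. indicator {-T..T} t *\<^sub>R g t) = integral {-T..T} g" for T
  proof -
    have "set_integrable lborel {-T..T} g"
      by (rule borel_integrable_atLeastAtMost') (rule continuous_on_subset[OF cont], simp)
    thus ?thesis using set_borel_integral_eq_integral(2)[of "{-T..T}" g] by (simp add: set_lebesgue_integral_def)
  qed
  ultimately show ?thesis by simp
qed

text \<open>The horizontal sides at height \<open>T\<close> contribute at most
  \<open>2 * C * (b - a) * dec T\<close>, which tends to 0, and absolute integrability allows the
  symmetric truncation on the vertical sides.\<close>

theorem vertical_line_shift: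
  fixes f :: "complex \<Rightarrow> complex"
  assumes hol: "f holomorphic_on U" and U: "open U" "{s. a \<le> Re s \<and> Re s \<le> b} \<subseteq> U" and ab: "a \<le> b"
    and C: "\<And>s. a \<le> Re s \<Longrightarrow> Re s \<le> b \<Longrightarrow> norm (f s) \<le> C * dec (Im s)"
  shows "(LINT t|lborel. f (Complex a t)) = (LINT t|lborel. f (Complex b t))"
proof -
  have contU: "continuous_on U f" by (rule holomorphic_on_imp_continuous_on[OF hol])
  have int: "integrable lborel (\<lambda>t. f (Complex x t))" "continuous_on UNIV (\<lambda>t. f (Complex x t))"
    if "x \<in> {a, b}" for x
  proof -
    show "integrable lborel (\<lambda>t. f (Complex x t))"
      by (rule vertical_integrable[OF continuous_on_subset[OF contU] C]) (use that ab U in auto)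
    show "continuous_on UNIV (\<lambda>t. f (Complex x t))"
      by (rule continuous_on_compose2[OF contU]) (use that ab U(2) in \<open>auto simp: Complex_eq intro!: continuous_intros\<close>)
  qed
  have C0: "C \<ge> 0"
  proof -
    have "norm (f (of_real a)) \<le> C * dec 0" using C[of "of_real a"] ab by simp
    hence "0 \<le> C * dec 0" by (rule order_trans[OF norm_ge_zero])
    thus ?thesis by (simp add: zero_le_mult_iff dec_def)
  qed
  have lim: "((\<lambda>T. integral {-T..T} (\<lambda>t. f (Complex b t) - f (Complex a t))) \<longlongrightarrow>
      (LINT t|lborel. f (Complex b t) - f (Complex a t))) at_top"
    by (intro integral_symmetric_limit Bochner_Integration.integrable_diff int continuous_intros) auto
  have "((\<lambda>T. integral {-T..T} (\<lambda>t. f (Complex b t) - f (Complex a t))) \<longlongrightarrow> 0) at_top"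
  proof (rule Lim_null_comparison)
    show "\<forall>\<^sub>F T in at_top. norm (integral {-T..T} (\<lambda>t. f (Complex b t) - f (Complex a t))) \<le> 2 * C * (b - a) * dec T"
      using eventually_ge_at_top[of 0]
    proof eventually_elim
      case (elim T)
      have "norm (integral {-T..T} (\<lambda>t. f (Complex b t) - f (Complex a t))) =
          norm (\<i> * integral {-T..T} (\<lambda>t. f (Complex b t) - f (Complex a t)))" by (simp add: norm_mult)
      also have "\<dots> = norm (integral {a..b} (\<lambda>x. f (Complex x T) - f (Complex x (-T))))"
        by (simp only: rectangle_integral_difference[OF hol U ab elim])
      also have "\<dots> \<le> (2 * C * dec T) * (b - a)"
      proof (rule integral_bound[OF ab])
        show "continuous_on {a..b} (\<lambda>x. f (Complex x T) - f (Complex x (- T)))"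
          by (intro continuous_intros continuous_on_compose2[OF contU])
             (use U(2) in \<open>auto simp: Complex_eq intro!: continuous_intros\<close>)
        fix x assume x: "x \<in> {a..b}"
        have "norm (f (Complex x T)) \<le> C * dec T" "norm (f (Complex x (-T))) \<le> C * dec T"
          using C[of "Complex x T"] C[of "Complex x (-T)"] x by (auto simp: dec_def)
        thus "norm (f (Complex x T) - f (Complex x (- T))) \<le> 2 * C * dec T"
          using norm_triangle_ineq4[of "f (Complex x T)" "f (Complex x (-T))"] by linarith
      qed
      finally show ?case by (simp add: mult_ac)
    qed
    show "((\<lambda>T. 2 * C * (b - a) * dec T) \<longlongrightarrow> 0) at_top"
      using tendsto_mult[OF tendsto_const[of "2 * C * (b - a)"] dec_tendsto] by simp
  qed
  with lim have "(LINT t|lborel. f (Complex b t) - f (Complex a t)) = 0"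
    using tendsto_unique trivial_limit_at_top_linorder by blast
  thus ?thesis using int by (subst (asm) Bochner_Integration.integral_diff) auto
qed

section \<open>Perron integrals with the quadratic denominator\<close>

lemma integral_Poisson:
  assumes c: "c > (0::real)"
  shows "integrable lborel (\<lambda>t. 1 / (c\<^sup>2 + t\<^sup>2))" "(LINT t|lborel. 1 / (c\<^sup>2 + t\<^sup>2)) = pi / c"
proof -
  have F: "((\<lambda>t. arctan (t / c) / c) has_real_derivative 1 / (c\<^sup>2 + t\<^sup>2)) (at t)" for t
  proof -
    have "((\<lambda>t. arctan (t / c) / c) has_real_derivative inverse (1 + (t / c)\<^sup>2) * (1 / c) / c) (at t)"
      using c by (auto intro!: derivative_eq_intros)
    also have "inverse (1 + (t / c)\<^sup>2) * (1 / c) / c = 1 / (c\<^sup>2 + t\<^sup>2)"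
    proof -
      have "c\<^sup>2 * (1 + (t / c)\<^sup>2) = c\<^sup>2 + t\<^sup>2" using c by (simp add: power_divide algebra_simps)
      moreover have "inverse (1 + (t / c)\<^sup>2) * (1 / c) / c = 1 / (c\<^sup>2 * (1 + (t / c)\<^sup>2))"
        by (simp add: divide_inverse power2_eq_square)
      ultimately show ?thesis by simp
    qed
    finally show ?thesis .
  qed
  have lim: "((\<lambda>t. arctan (t / c) / c) \<longlongrightarrow> (pi / 2) / c) at_top"
  proof -
    have "filterlim (\<lambda>t. t / c) at_top at_top"
      using filterlim_tendsto_pos_mult_at_top[OF tendsto_const[of "1 / c"] _ filterlim_ident] c by simp
    thus ?thesis using filterlim_compose[OF tendsto_arctan_at_top] by (intro tendsto_divide tendsto_const) (use c in auto)
  qed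
  have pos: "0 \<le> 1 / (c\<^sup>2 + t\<^sup>2)" for t by simp
  have I: "(\<integral>\<^sup>+t. ennreal (1 / (c\<^sup>2 + t\<^sup>2)) * indicator {0..} t \<partial>lborel) = ennreal (pi / 2 / c)"
    using nn_integral_FTC_atLeast[OF _ F pos lim, of 0] by simp
  have h1: "has_bochner_integral lborel (\<lambda>t. 1 / (c\<^sup>2 + t\<^sup>2) * indicator {0..} t) (pi / 2 / c)"
  proof (rule has_bochner_integral_nn_integral)
    show "(\<integral>\<^sup>+t. ennreal (1 / (c\<^sup>2 + t\<^sup>2) * indicator {0..} t) \<partial>lborel) = ennreal (pi / 2 / c)"
      unfolding I[symmetric] by (intro nn_integral_cong) (auto simp: indicator_def)
  qed (use c in auto)
  have h2: "has_bochner_integral lborel (\<lambda>t. 1 / (c\<^sup>2 + (0 + (- 1) * t)\<^sup>2) * indicator {0..} (0 + (- 1) * t)) (pi / 2 / c)"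
    using lborel_has_bochner_integral_real_affine_iff[of "- 1" "\<lambda>t. 1 / (c\<^sup>2 + t\<^sup>2) * indicator {0..} t" "pi / 2 / c" 0] h1
    by simp
  have "has_bochner_integral lborel (\<lambda>t. 1 / (c\<^sup>2 + t\<^sup>2)) (pi / c)"
  proof -
    have h3: "has_bochner_integral lborel (\<lambda>t. 1 / (c\<^sup>2 + t\<^sup>2) * indicator {0..} t +
        1 / (c\<^sup>2 + (0 + (- 1) * t)\<^sup>2) * indicator {0..} (0 + (- 1) * t)) (pi / 2 / c + pi / 2 / c)"
      by (rule has_bochner_integral_add[OF h1 h2])
    have "AE t in lborel. t \<noteq> (0::real)" by (rule AE_lborel_singleton)
    hence "AE t in lborel. 1 / (c\<^sup>2 + t\<^sup>2) = 1 / (c\<^sup>2 + t\<^sup>2) * indicator {0..} t +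
        1 / (c\<^sup>2 + (0 + (- 1) * t)\<^sup>2) * indicator {0..} (0 + (- 1) * t)"
      by eventually_elim (auto simp: indicator_def)
    hence "has_bochner_integral lborel (\<lambda>t. 1 / (c\<^sup>2 + t\<^sup>2)) (pi / 2 / c + pi / 2 / c)"
      using h3 by (subst has_bochner_integral_cong_AE) auto
    thus ?thesis using c by (simp add: field_simps)
  qed
  thus "integrable lborel (\<lambda>t. 1 / (c\<^sup>2 + t\<^sup>2))" "(LINT t|lborel. 1 / (c\<^sup>2 + t\<^sup>2)) = pi / c"
    by (auto simp: has_bochner_integral_iff)
qed

lemma Poisson_bound:
  fixes g :: "real \<Rightarrow> complex"
  assumes c: "c > 0" and cont: "continuous_on UNIV g" and b: "\<And>t. norm (g t) \<le> C / (c\<^sup>2 + t\<^sup>2)"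
  shows "integrable lborel g" "norm (LINT t|lborel. g t) \<le> C * pi / c"
proof -
  have int: "integrable lborel (\<lambda>t. C * (1 / (c\<^sup>2 + t\<^sup>2)))"
    by (intro integrable_mult_right integral_Poisson c)
  show 1: "integrable lborel g"
  proof (rule Bochner_Integration.integrable_bound[OF int])
    show "g \<in> borel_measurable lborel" using cont by (simp add: borel_measurable_continuous_onI)
    show "AE t in lborel. norm (g t) \<le> norm (C * (1 / (c\<^sup>2 + t\<^sup>2)))"
    proof (intro AE_I2)
      fix t
      have "norm (g t) \<le> C * (1 / (c\<^sup>2 + t\<^sup>2))" using b[of t] by simp
      also have "\<dots> \<le> norm (C * (1 / (c\<^sup>2 + t\<^sup>2)))" by (simp only: real_norm_def abs_ge_self)
      finally show "norm (g t) \<le> norm (C * (1 / (c\<^sup>2 + t\<^sup>2)))" .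
    qed
  qed
  have "norm (LINT t|lborel. g t) \<le> (LINT t|lborel. norm (g t))" by (rule integral_norm_bound)
  also have "\<dots> \<le> (LINT t|lborel. C * (1 / (c\<^sup>2 + t\<^sup>2)))"
    by (intro integral_mono integrable_norm 1 int) (use b in auto)
  also have "\<dots> = C * (pi / c)" by (simp only: integral_mult_right_zero integral_Poisson(2)[OF c])
  also have "\<dots> = C * pi / c" by simp
  finally show "norm (LINT t|lborel. g t) \<le> C * pi / c" .
qed

lemma Complex_continuous [continuous_intros]: "continuous_on A (\<lambda>t. Complex c t)"
  unfolding Complex_eq by (intro continuous_intros)

lemma norm_Complex_sq: "(norm (Complex c t))\<^sup>2 = c\<^sup>2 + t\<^sup>2"
  by (simp add: cmod_power2)

text \<open>The line is moved to the right without bound: on \<open>Re s = x\<close> the decay makes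
  the integral at most \<open>C * pi / x\<close>.\<close>

lemma vertical_line_vanish:
  fixes f :: "complex \<Rightarrow> complex"
  assumes a: "a > 0" and hol: "f holomorphic_on {s. Re s > 0}"
    and b: "\<And>s. Re s \<ge> a \<Longrightarrow> norm (f s) \<le> C / (norm s)\<^sup>2"
  shows "(LINT t|lborel. f (Complex a t)) = 0"
proof -
  have contf: "continuous_on {s. Re s > 0} f" by (rule holomorphic_on_imp_continuous_on[OF hol])
  have C0: "C \<ge> 0"
  proof -
    have "0 \<le> C / (norm (of_real a :: complex))\<^sup>2" using b[of "of_real a"] by (simp add: order_trans[OF norm_ge_zero])
    thus ?thesis using a by (simp add: zero_le_divide_iff)
  qed
  have le: "norm (LINT t|lborel. f (Complex a t)) \<le> C * pi / x" if x: "x \<ge> a" for x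
  proof -
    have C1: "norm (f s) \<le> (4 * C) * dec (Im s)" if "a \<le> Re s" "Re s \<le> x" "\<bar>Im s\<bar> \<ge> 1" for s
    proof -
      have "norm (f s) \<le> C / (norm s)\<^sup>2" using b that by auto
      also have "\<dots> \<le> C / (Im s)\<^sup>2"
      proof (intro divide_left_mono C0 mult_pos_pos)
        show "(Im s)\<^sup>2 \<le> (norm s)\<^sup>2" by (simp add: cmod_power2)
        show "0 < (Im s)\<^sup>2" using that by auto
        show "0 < (norm s)\<^sup>2" using that a by auto
      qed
      also have "\<dots> = C * (1 / (Im s)\<^sup>2)" by simp
      also have "\<dots> \<le> C * (4 * dec (Im s))" by (intro mult_left_mono inverse_square_le_dec that C0)
      finally show ?thesis by simp
    qed
    have "continuous_on {s. a \<le> Re s \<and> Re s \<le> x} f"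
      by (rule continuous_on_subset[OF contf]) (use a in auto)
    then obtain C' where C': "\<And>s. a \<le> Re s \<Longrightarrow> Re s \<le> x \<Longrightarrow> norm (f s) \<le> C' * dec (Im s)"
      using strip_decay_extend[OF _ C1] by blast
    have "(LINT t|lborel. f (Complex a t)) = (LINT t|lborel. f (Complex x t))"
      by (rule vertical_line_shift[OF hol _ _ x C']) (use a in auto)
    also have "norm \<dots> \<le> C * pi / x"
    proof (rule Poisson_bound)
      show "x > 0" using a x by simp
      show "continuous_on UNIV (\<lambda>t. f (Complex x t))"
        by (rule continuous_on_compose2[OF contf]) (use a x in \<open>auto intro!: continuous_intros\<close>)
      show "norm (f (Complex x t)) \<le> C / (x\<^sup>2 + t\<^sup>2)" for t
        using b[of "Complex x t"] x by (simp add: norm_Complex_sq)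
    qed
    finally show ?thesis .
  qed
  have "((\<lambda>x. C * pi / x) \<longlongrightarrow> 0) at_top"
    by (intro tendsto_divide_0[OF tendsto_const] filterlim_at_top_imp_at_infinity filterlim_ident)
  moreover have "\<forall>\<^sub>F x in at_top. norm (LINT t|lborel. f (Complex a t)) \<le> C * pi / x"
    using eventually_ge_at_top[of a] by eventually_elim (rule le)
  ultimately have "norm (LINT t|lborel. f (Complex a t)) \<le> 0"
    by (intro tendsto_lowerbound) auto
  thus ?thesis by simp
qed

lemma perron_integrable:
  assumes c: "c \<noteq> 0"
  shows "integrable lborel (\<lambda>t. exp (Complex c t * of_real y) / (Complex c t)\<^sup>2)"
    and "norm (LINT t|lborel. exp (Complex c t * of_real y) / (Complex c t)\<^sup>2) \<le> exp (c * y) * pi / \<bar>c\<bar>"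
proof -
  have nz: "Complex c t \<noteq> 0" for t using c by (simp add: complex_eq_iff)
  have cont: "continuous_on UNIV (\<lambda>t. exp (Complex c t * of_real y) / (Complex c t)\<^sup>2)"
    by (intro continuous_intros) (use nz in simp)
  have b: "norm (exp (Complex c t * of_real y) / (Complex c t)\<^sup>2) \<le> exp (c * y) / (\<bar>c\<bar>\<^sup>2 + t\<^sup>2)" for t
    by (simp add: norm_divide norm_power norm_Complex_sq)
  show "integrable lborel (\<lambda>t. exp (Complex c t * of_real y) / (Complex c t)\<^sup>2)"
    and "norm (LINT t|lborel. exp (Complex c t * of_real y) / (Complex c t)\<^sup>2) \<le> exp (c * y) * pi / \<bar>c\<bar>"
    using Poisson_bound[OF _ cont b] c by auto
qed

lemma perron_neg:
  assumes c: "c > 0" and y: "y \<le> 0"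
  shows "(LINT t|lborel. exp (Complex c t * of_real y) / (Complex c t)\<^sup>2) = 0"
proof (rule vertical_line_vanish[OF c, of "\<lambda>s. exp (s * of_real y) / s\<^sup>2" 1])
  show "(\<lambda>s. exp (s * complex_of_real y) / s\<^sup>2) holomorphic_on {s. 0 < Re s}"
    by (intro holomorphic_intros) auto
  fix s assume "c \<le> Re s"
  hence "Re s * y \<le> 0" using c y by (intro mult_nonneg_nonpos) auto
  thus "norm (exp (s * complex_of_real y) / s\<^sup>2) \<le> 1 / (norm s)\<^sup>2"
    by (simp add: norm_divide norm_power divide_right_mono)
qed

text \<open>The simple pole at 0 is compensated by a second one on the left, which restores
  quadratic decay; in \<open>perron_pos\<close> this difference carries the residue.\<close>

lemma perron_reciprocal_difference:
  assumes c: "c > 0" and m: "m > 0"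
  shows "(LINT t|lborel. 1 / Complex c t - 1 / (Complex c t + of_real m)) = 0"
proof (rule vertical_line_vanish[OF c, of "\<lambda>s. 1 / s - 1 / (s + of_real m)" m])
  have nz: "s + complex_of_real m \<noteq> 0" "s \<noteq> 0" if "Re s > 0" for s
    using that m by (auto simp: complex_eq_iff)
  show "(\<lambda>s. 1 / s - 1 / (s + complex_of_real m)) holomorphic_on {s. 0 < Re s}"
    by (intro holomorphic_intros) (use nz in auto)
  fix s assume "c \<le> Re s"
  hence s: "Re s > 0" using c by simp
  have "1 / s - 1 / (s + of_real m) = of_real m / (s * (s + of_real m))"
    using nz[OF s] by (simp add: divide_simps)
  hence "norm (1 / s - 1 / (s + of_real m)) = m / (norm s * norm (s + of_real m))"
    using m by (simp add: norm_divide norm_mult)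
  also have "\<dots> \<le> m / (norm s)\<^sup>2"
  proof -
    have "(Re s)\<^sup>2 \<le> (Re s + m)\<^sup>2" using s m by (intro power_mono) auto
    hence "norm s \<le> norm (s + of_real m)" unfolding cmod_def by (intro real_sqrt_le_mono) auto
    hence "norm s * norm s \<le> norm s * norm (s + of_real m)" by (intro mult_left_mono) auto
    thus ?thesis using nz[OF s] m unfolding power2_eq_square by (intro divide_left_mono) auto
  qed
  finally show "norm (1 / s - 1 / (s + of_real m)) \<le> m / (norm s)\<^sup>2" .
qed

lemma removable_quotient:
  fixes g :: "complex \<Rightarrow> complex"
  assumes "g holomorphic_on UNIV" "g 0 = 0"
  obtains h where "h holomorphic_on UNIV" "\<And>s. s \<noteq> 0 \<Longrightarrow> h s = g s / s" "h 0 = deriv g 0"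
proof -
  define h where "h = (\<lambda>s. if s = 0 then deriv g 0 else g s / s)"
  have "h holomorphic_on UNIV"
    by (rule pole_theorem_open_0[OF assms(1), of 0]) (use assms in \<open>auto simp: h_def\<close>)
  thus ?thesis using that by (auto simp: h_def)
qed

text \<open>The double pole at 0 is handled by subtraction: minus an explicit singular part, the
  integrand has no pole between the lines \<open>- c\<close> and \<open>c\<close> and can be
  shifted. On the left line the exponential contributes at most \<open>pi / c\<close>. The integral
  does not depend on \<open>c\<close>, so \<open>c\<close> may tend to infinity.\<close>

lemma perron_pos:
  assumes c: "c > 0" and y: "y \<ge> 0"
  shows "(LINT t|lborel. exp (Complex c t * of_real y) / (Complex c t)\<^sup>2) = of_real (2 * pi * y)"
proof -
  define X where "X = (\<lambda>c. LINT t|lborel. exp (Complex c t * of_real y) / (Complex c t)\<^sup>2)"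
  have close: "norm (X c - of_real (2 * pi * y)) \<le> pi / c" if c: "c > 0" for c
  proof -
    have hg: "(\<lambda>s. exp (s * complex_of_real y) - 1 - s * of_real y) holomorphic_on UNIV"
      by (intro holomorphic_intros)
    have g0: "exp (0 * complex_of_real y) - 1 - 0 * of_real y = 0" by simp
    obtain h1 where h1: "h1 holomorphic_on UNIV" "\<And>s. s \<noteq> 0 \<Longrightarrow> h1 s = (exp (s * of_real y) - 1 - s * of_real y) / s"
      "h1 0 = deriv (\<lambda>s. exp (s * of_real y) - 1 - s * of_real y) 0"
      using removable_quotient[OF hg g0] by blast
    have "((\<lambda>s. exp (s * complex_of_real y) - 1 - s * of_real y) has_field_derivative 0) (at 0)"
      by (auto intro!: derivative_eq_intros)
    hence "h1 0 = 0" using h1(3) DERIV_imp_deriv by simp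
    then obtain h2 where h2: "h2 holomorphic_on UNIV" "\<And>s. s \<noteq> 0 \<Longrightarrow> h2 s = h1 s / s"
      using removable_quotient[OF h1(1)] by blast
    \<comment> \<open>Away from 0 this is the integrand minus \<open>1 / s^2\<close> and minus
      \<open>y * (1 / s - 1 / (s + 2 * c))\<close>. The reciprocal \<open>1 / s\<close> alone would
      not be integrable on vertical lines; its companion has its pole at \<open>- 2 * c\<close>,
      outside the strip.\<close>
    define f where "f = (\<lambda>s. h2 s + of_real y / (s + of_real (2 * c)))"
    define U where "U = {s. Re s > - 2 * c}"
    have nzU: "s + of_real (2 * c) \<noteq> 0" if "Re s > - 2 * c" for s using that by (auto simp: complex_eq_iff)
    have hf: "f holomorphic_on U"
      unfolding f_def by (intro holomorphic_intros holomorphic_on_subset[OF h2(1)]) (use nzU in \<open>auto simp: U_def\<close>)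
    have feq: "f s = exp (s * of_real y) / s\<^sup>2 - exp (s * of_real 0) / s\<^sup>2 - of_real y * (1 / s - 1 / (s + of_real (2 * c)))"
      if "s \<noteq> 0" for s
      using that by (simp add: f_def h2(2) h1(2) power2_eq_square diff_divide_distrib right_diff_distrib)
    define D where "D = exp (c * y) + 1 + 2 * c * y"
    have D0: "D \<ge> 0" using c y by (simp add: D_def)
    have fb: "norm (f s) \<le> 4 * D * dec (Im s)" if s: "- c \<le> Re s" "Re s \<le> c" "\<bar>Im s\<bar> \<ge> 1" for s
    proof -
      have s0: "s \<noteq> 0" using s(3) by auto
      have s1: "s + of_real (2 * c) \<noteq> 0" using nzU[of s] s c by auto
      have I: "0 < (Im s)\<^sup>2" "\<bar>Im s\<bar> > 0" using s(3) by auto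
      have n1: "\<bar>Im s\<bar> \<le> norm s" by (rule abs_Im_le_cmod)
      have n2: "\<bar>Im s\<bar> \<le> norm (s + of_real (2 * c))" using abs_Im_le_cmod[of "s + of_real (2 * c)"] by simp
      have n3: "(Im s)\<^sup>2 \<le> (norm s)\<^sup>2" by (simp add: cmod_power2)
      have n4: "(Im s)\<^sup>2 \<le> norm s * norm (s + of_real (2 * c))"
      proof -
        have "\<bar>Im s\<bar> * \<bar>Im s\<bar> \<le> norm s * norm (s + of_real (2 * c))" by (intro mult_mono n1 n2) auto
        thus ?thesis by (simp add: power2_eq_square)
      qed
      have "Re s * y \<le> c * y" using s y by (intro mult_right_mono) auto
      hence a1: "norm (exp (s * of_real y) / s\<^sup>2) \<le> exp (c * y) / (Im s)\<^sup>2"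
        using I n3 by (simp add: norm_divide norm_power) (intro frac_le, auto)
      have a2: "norm (exp (s * of_real 0) / s\<^sup>2) \<le> 1 / (Im s)\<^sup>2"
        using I n3 by (simp add: norm_divide norm_power) (intro frac_le, auto)
      have "1 / s - 1 / (s + of_real (2 * c)) = of_real (2 * c) / (s * (s + of_real (2 * c)))"
        using s0 s1 by (simp add: divide_simps)
      hence "norm (of_real y * (1 / s - 1 / (s + of_real (2 * c)))) = 2 * c * y / (norm s * norm (s + of_real (2 * c)))"
        using c y by (simp add: norm_divide norm_mult)
      also have "\<dots> \<le> 2 * c * y / (Im s)\<^sup>2"
        using c y I n4 by (intro divide_left_mono mult_pos_pos) (auto simp: s0 s1)
      finally have a3: "norm (of_real y * (1 / s - 1 / (s + of_real (2 * c)))) \<le> 2 * c * y / (Im s)\<^sup>2" .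
      have "norm (f s) \<le> norm (exp (s * of_real y) / s\<^sup>2) + norm (exp (s * of_real 0) / s\<^sup>2) +
          norm (of_real y * (1 / s - 1 / (s + of_real (2 * c))))"
        unfolding feq[OF s0] by (intro order_trans[OF norm_triangle_ineq4] add_mono norm_triangle_ineq4 order.refl)
      also have "\<dots> \<le> exp (c * y) / (Im s)\<^sup>2 + 1 / (Im s)\<^sup>2 + 2 * c * y / (Im s)\<^sup>2"
        by (intro add_mono a1 a2 a3)
      also have "\<dots> = D * (1 / (Im s)\<^sup>2)" by (simp add: D_def add_divide_distrib distrib_right)
      also have "\<dots> \<le> D * (4 * dec (Im s))" by (intro mult_left_mono inverse_square_le_dec s D0)
      finally show ?thesis by simp
    qed
    have stripU: "{s. - c \<le> Re s \<and> Re s \<le> c} \<subseteq> U" using c by (auto simp: U_def)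
    obtain C' where C': "\<And>s. - c \<le> Re s \<Longrightarrow> Re s \<le> c \<Longrightarrow> norm (f s) \<le> C' * dec (Im s)"
      using strip_decay_extend[OF continuous_on_subset[OF holomorphic_on_imp_continuous_on[OF hf] stripU] fb] by blast
    have opU: "open U" by (simp add: U_def)
    have shift: "(LINT t|lborel. f (Complex (- c) t)) = (LINT t|lborel. f (Complex c t))"
      by (rule vertical_line_shift[OF hf opU stripU _ C']) (use c in auto)
    have nz: "Complex x t \<noteq> 0" if "x \<noteq> 0" for x t using that by (auto simp: complex_eq_iff)
    define Dp where "Dp = (\<lambda>x t. of_real y * (1 / Complex x t - 1 / (Complex x t + of_real (2 * c))))"
    have fsplit: "f (Complex x t) = exp (Complex x t * of_real y) / (Complex x t)\<^sup>2 -
        exp (Complex x t * of_real 0) / (Complex x t)\<^sup>2 - Dp x t" if "x \<noteq> 0" for x t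
      unfolding Dp_def by (rule feq[OF nz[OF that]])
    have iDp: "integrable lborel (\<lambda>t. 1 / Complex c t - 1 / (Complex c t + of_real (2 * c)))"
    proof (rule Poisson_bound(1)[OF c, of _ "2 * c"])
      have nz2: "Complex c t + of_real (2 * c) \<noteq> 0" for t using c by (auto simp: complex_eq_iff)
      show "continuous_on UNIV (\<lambda>t. 1 / Complex c t - 1 / (Complex c t + of_real (2 * c)))"
        by (intro continuous_intros) (use nz nz2 c in auto)
      fix t
      have "1 / Complex c t - 1 / (Complex c t + of_real (2 * c)) = of_real (2 * c) / (Complex c t * (Complex c t + of_real (2 * c)))"
        using nz[of c t] nz2[of t] c by (simp add: divide_simps)
      hence "norm (1 / Complex c t - 1 / (Complex c t + of_real (2 * c))) = 2 * c / (norm (Complex c t) * norm (Complex c t + of_real (2 * c)))"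
        using c by (simp add: norm_divide norm_mult)
      also have "\<dots> \<le> 2 * c / (norm (Complex c t) * norm (Complex c t))"
      proof (intro divide_left_mono mult_left_mono mult_pos_pos)
        show "norm (Complex c t) \<le> norm (Complex c t + of_real (2 * c))"
          unfolding cmod_def using c by (intro real_sqrt_le_mono) (auto intro!: power_mono)
      qed (use c nz[of c t] nz2[of t] in auto)
      also have "norm (Complex c t) * norm (Complex c t) = c\<^sup>2 + t\<^sup>2"
        using norm_Complex_sq[of c t] by (simp only: power2_eq_square)
      finally show "norm (1 / Complex c t - 1 / (Complex c t + of_real (2 * c))) \<le> 2 * c / (c\<^sup>2 + t\<^sup>2)" .
    qed
    \<comment> \<open>On \<open>Re s = - c\<close> the product \<open>s * (s + 2 * c)\<close> is the
      real number \<open>- (c^2 + t^2)\<close>, so the subtracted part becomes a Poisson integral;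
      it supplies the value \<open>2 * pi * y\<close>.\<close>
    have Dm: "Dp (- c) t = of_real (- (2 * c * y) * (1 / (c\<^sup>2 + t\<^sup>2)))" for t
    proof -
      have n: "Complex (- c) t \<noteq> 0" "Complex c t \<noteq> 0" using c by (auto simp: complex_eq_iff)
      have e: "Complex (- c) t + of_real (2 * c) = Complex c t" by (simp add: complex_eq_iff)
      have m: "Complex (- c) t * Complex c t = - of_real (c\<^sup>2 + t\<^sup>2)" by (simp add: complex_eq_iff power2_eq_square)
      have "1 / Complex (- c) t - 1 / Complex c t = (Complex c t - Complex (- c) t) / (Complex (- c) t * Complex c t)"
        using n by (simp add: divide_simps)
      also have "Complex c t - Complex (- c) t = of_real (2 * c)" by (simp add: complex_eq_iff)
      finally have "1 / Complex (- c) t - 1 / Complex c t = of_real (- (2 * c / (c\<^sup>2 + t\<^sup>2)))"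
        unfolding m by (simp only: of_real_divide of_real_minus divide_minus_right)
      thus ?thesis unfolding Dp_def e by (simp only: of_real_mult[symmetric]) simp
    qed
    have intDm: "integrable lborel (Dp (- c))" "(LINT t|lborel. Dp (- c) t) = of_real (- (2 * pi * y))"
    proof -
      have "integrable lborel (\<lambda>t. - (2 * c * y) * (1 / (c\<^sup>2 + t\<^sup>2)))"
        by (intro integrable_mult_right integral_Poisson c)
      thus "integrable lborel (Dp (- c))" unfolding Dm by (simp only: complex_of_real_integrable_eq)
      have "(LINT t|lborel. Dp (- c) t) = of_real (LINT t|lborel. - (2 * c * y) * (1 / (c\<^sup>2 + t\<^sup>2)))"
        unfolding Dm by (rule integral_complex_of_real)
      also have "(LINT t|lborel. - (2 * c * y) * (1 / (c\<^sup>2 + t\<^sup>2))) = - (2 * c * y) * (pi / c)"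
        using integral_Poisson[OF c] by (simp only: integral_mult_right_zero)
      finally show "(LINT t|lborel. Dp (- c) t) = of_real (- (2 * pi * y))" using c by simp
    qed
    \<comment> \<open>The reflection of \<open>t\<close> to \<open>- t\<close> carries this integral
      to the line \<open>Re s = c\<close>, where it vanishes by \<open>perron_neg\<close>.\<close>
    have Bm: "(LINT t|lborel. exp (Complex (- c) t * of_real 0) / (Complex (- c) t)\<^sup>2) = 0"
    proof -
      have "(LINT t|lborel. exp (Complex (- c) t * of_real 0) / (Complex (- c) t)\<^sup>2) =
         \<bar>- 1\<bar> *\<^sub>R (LINT t|lborel. exp (Complex (- c) (0 + (- 1) * t) * of_real 0) / (Complex (- c) (0 + (- 1) * t))\<^sup>2)"
        by (rule lborel_integral_real_affine) simp
      also have "(\<lambda>t. exp (Complex (- c) (0 + (- 1) * t) * of_real 0) / (Complex (- c) (0 + (- 1) * t))\<^sup>2) =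
          (\<lambda>t. exp (Complex c t * of_real 0) / (Complex c t)\<^sup>2)"
      proof
        fix t
        have "Complex (- c) (0 + (- 1) * t) = - Complex c t" by (simp add: complex_eq_iff)
        thus "exp (Complex (- c) (0 + (- 1) * t) * of_real 0) / (Complex (- c) (0 + (- 1) * t))\<^sup>2 =
          exp (Complex c t * of_real 0) / (Complex c t)\<^sup>2" by simp
      qed
      also have "(LINT t|lborel. exp (Complex c t * of_real 0) / (Complex c t)\<^sup>2) = 0"
        by (rule perron_neg[OF c]) simp
      finally show ?thesis by simp
    qed
    have "(LINT t|lborel. f (Complex c t)) = X c - 0 - 0"
    proof -
      have "(LINT t|lborel. f (Complex c t)) = (LINT t|lborel. exp (Complex c t * of_real y) / (Complex c t)\<^sup>2) -
          (LINT t|lborel. exp (Complex c t * of_real 0) / (Complex c t)\<^sup>2) - (LINT t|lborel. Dp c t)"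
      proof -
        have i1: "integrable lborel (\<lambda>t. exp (Complex c t * of_real z) / (Complex c t)\<^sup>2)" for z
          by (rule perron_integrable) (use c in simp)
        have i2: "integrable lborel (Dp c)"
          unfolding Dp_def by (intro integrable_mult_right iDp)
        have cn: "c \<noteq> 0" using c by simp
        show ?thesis
          by (simp only: fsplit[OF cn] Bochner_Integration.integral_diff Bochner_Integration.integrable_diff i1 i2)
      qed
      also have "(LINT t|lborel. Dp c t) = 0"
        unfolding Dp_def using perron_reciprocal_difference[OF c, of "2 * c"] c by simp
      also have "(LINT t|lborel. exp (Complex c t * of_real 0) / (Complex c t)\<^sup>2) = 0"
        by (rule perron_neg[OF c]) simp
      finally show ?thesis by (simp add: X_def)
    qed
    moreover have "(LINT t|lborel. f (Complex (- c) t)) = X (- c) - 0 - of_real (- (2 * pi * y))"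
    proof -
      have "(LINT t|lborel. f (Complex (- c) t)) = (LINT t|lborel. exp (Complex (- c) t * of_real y) / (Complex (- c) t)\<^sup>2) -
          (LINT t|lborel. exp (Complex (- c) t * of_real 0) / (Complex (- c) t)\<^sup>2) - (LINT t|lborel. Dp (- c) t)"
      proof -
        have i1: "integrable lborel (\<lambda>t. exp (Complex (- c) t * of_real z) / (Complex (- c) t)\<^sup>2)" for z
          by (rule perron_integrable) (use c in simp)
        have cn: "- c \<noteq> 0" using c by simp
        show ?thesis
          by (simp only: fsplit[OF cn] Bochner_Integration.integral_diff Bochner_Integration.integrable_diff i1 intDm(1))
      qed
      thus ?thesis unfolding X_def intDm(2) Bm .
    qed
    ultimately have "X c - of_real (2 * pi * y) = X (- c)" using shift by simp
    also have "norm (X (- c)) \<le> exp (- c * y) * pi / c"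
      unfolding X_def using perron_integrable(2)[of "- c" y] c by simp
    also have "\<dots> \<le> 1 * pi / c"
      using c y by (intro divide_right_mono mult_right_mono) auto
    finally show ?thesis by simp
  qed
  have same: "X c = X x" if x: "x \<ge> c" for x
  proof -
    define f where "f = (\<lambda>s. exp (s * complex_of_real y) / s\<^sup>2)"
    have hf: "f holomorphic_on {s. Re s > 0}" unfolding f_def by (intro holomorphic_intros) auto
    have C1: "norm (f s) \<le> (4 * exp (x * y)) * dec (Im s)" if "c \<le> Re s" "Re s \<le> x" "\<bar>Im s\<bar> \<ge> 1" for s
    proof -
      have I: "(Im s)\<^sup>2 > 0" using that by auto
      have "Re s * y \<le> x * y" using that y by (intro mult_right_mono) auto
      hence "norm (f s) \<le> exp (x * y) / (Im s)\<^sup>2"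
        unfolding f_def using I by (simp add: norm_divide norm_power) (intro frac_le, auto simp: cmod_power2)
      also have "\<dots> = exp (x * y) * (1 / (Im s)\<^sup>2)" by simp
      also have "\<dots> \<le> exp (x * y) * (4 * dec (Im s))" by (intro mult_left_mono inverse_square_le_dec that) auto
      finally show ?thesis by simp
    qed
    have "continuous_on {s. c \<le> Re s \<and> Re s \<le> x} f"
      by (rule continuous_on_subset[OF holomorphic_on_imp_continuous_on[OF hf]]) (use c in auto)
    then obtain C' where C': "\<And>s. c \<le> Re s \<Longrightarrow> Re s \<le> x \<Longrightarrow> norm (f s) \<le> C' * dec (Im s)"
      using strip_decay_extend[OF _ C1] by blast
    have "(LINT t|lborel. f (Complex c t)) = (LINT t|lborel. f (Complex x t))"
      by (rule vertical_line_shift[OF hf _ _ x C']) (use c in auto)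
    thus ?thesis by (simp add: X_def f_def)
  qed
  have "((\<lambda>x. pi / x) \<longlongrightarrow> 0) at_top"
    by (intro tendsto_divide_0[OF tendsto_const] filterlim_at_top_imp_at_infinity filterlim_ident)
  moreover have "\<forall>\<^sub>F x in at_top. norm (X c - of_real (2 * pi * y)) \<le> pi / x"
    using eventually_ge_at_top[of c]
  proof eventually_elim
    case (elim x)
    thus ?case using close[of x] same[of x] c by simp
  qed
  ultimately have "norm (X c - of_real (2 * pi * y)) \<le> 0"
    by (intro tendsto_lowerbound) auto
  thus ?thesis by (simp add: X_def)
qed

lemma perron:
  assumes c: "c > 0"
  shows "has_bochner_integral lborel (\<lambda>t. exp (Complex c t * of_real y) / (Complex c t)\<^sup>2) (of_real (2 * pi * max y 0))"
  using perron_integrable(1)[of c y] perron_neg[of c y] perron_pos[of c y] c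
  by (auto simp: has_bochner_integral_iff max_def)

section \<open>The Fejer kernel and its transform\<close>

definition expq :: "complex \<Rightarrow> complex" where
  "expq s = (if s = 0 then 1 else (exp s - 1) / s)"

lemma expq_holomorphic: "expq holomorphic_on A"
proof -
  have g: "(\<lambda>s::complex. exp s - 1) holomorphic_on UNIV" "exp (0::complex) - 1 = 0"
    by (auto intro!: holomorphic_intros)
  obtain h where h: "h holomorphic_on UNIV" "\<And>s. s \<noteq> 0 \<Longrightarrow> h s = (exp s - 1) / s"
      "h 0 = deriv (\<lambda>s::complex. exp s - 1) 0"
    using removable_quotient[OF g] by blast
  have "((\<lambda>s::complex. exp s - 1) has_field_derivative 1) (at 0)"
    by (auto intro!: derivative_eq_intros)
  hence "h 0 = 1" using h(3) DERIV_imp_deriv by simp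
  hence "h s = expq s" for s using h(2) by (auto simp: expq_def)
  hence "h = expq" by auto
  thus ?thesis using h(1) holomorphic_on_subset by blast
qed

lemma expq_cnj: "expq (cnj s) = cnj (expq s)"
  by (auto simp: expq_def exp_cnj)

text \<open>On the imaginary axis \<open>kern \<delta>\<close> is the Fejer kernel \<open>(2 sin (\<delta> t / 2) / t)\<^sup>2\<close>, the Fourier transform of
  the tent function \<open>tri \<delta>\<close> below.\<close>

definition kern :: "real \<Rightarrow> complex \<Rightarrow> complex" where
  "kern \<delta> s = of_real (\<delta>\<^sup>2) * (expq (of_real \<delta> * s) * expq (- (of_real \<delta> * s)))"

lemma kern_eq:
  assumes "s \<noteq> 0" "\<delta> \<noteq> 0"
  shows "kern \<delta> s = (exp (of_real \<delta> * s) - 2 + exp (- (of_real \<delta> * s))) / s\<^sup>2"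
proof -
  define w where "w = of_real \<delta> * s"
  have w: "w \<noteq> 0" using assms by (simp add: w_def)
  have e: "exp w * exp (- w) = 1" by (simp flip: exp_add)
  have m: "- X / - Y = X / Y" for X Y :: complex by simp
  have "expq w * expq (- w) = (exp w - 1) * (exp (- w) - 1) / (w * (- w))"
    using w by (simp add: expq_def)
  also have "(exp w - 1) * (exp (- w) - 1) = - (exp w - 2 + exp (- w))" using e by (simp add: algebra_simps)
  also have "w * (- w) = - w\<^sup>2" by (simp add: power2_eq_square)
  also have "- (exp w - 2 + exp (- w)) / - w\<^sup>2 = (exp w - 2 + exp (- w)) / w\<^sup>2" by (rule m)
  finally have "kern \<delta> s = of_real (\<delta>\<^sup>2) * ((exp w - 2 + exp (- w)) / w\<^sup>2)"
    by (simp only: kern_def w_def)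
  also have "\<dots> = (exp w - 2 + exp (- w)) / s\<^sup>2"
    using assms by (simp add: w_def power_mult_distrib)
  finally show ?thesis by (simp add: w_def)
qed

text \<open>The two exponentials translate the tent to \<open>u\<close> and \<open>- u\<close>, and
  the 2 keeps the factor nonnegative on the imaginary axis. Their minus sign decides the direction
  of the final estimate: prime powers near \<open>exp u\<close> enter so that their weighted sum is
  bounded from below.\<close>

definition qkern :: "real \<Rightarrow> real \<Rightarrow> complex \<Rightarrow> complex" where
  "qkern \<delta> u s = kern \<delta> s * (2 - exp (of_real u * s) - exp (- (of_real u * s)))"

lemma qkern_holomorphic: "qkern \<delta> u holomorphic_on A"
proof -
  have 1: "(\<lambda>s. expq (of_real \<delta> * s)) holomorphic_on UNIV"
    using holomorphic_on_compose_gen[OF _ expq_holomorphic[of UNIV], of "\<lambda>s. of_real \<delta> * s" UNIV]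
    by (auto intro!: holomorphic_intros simp: o_def)
  have 2: "(\<lambda>s. expq (- (of_real \<delta> * s))) holomorphic_on UNIV"
    using holomorphic_on_compose_gen[OF _ expq_holomorphic[of UNIV], of "\<lambda>s. - (of_real \<delta> * s)" UNIV]
    by (auto intro!: holomorphic_intros simp: o_def)
  have "qkern \<delta> u holomorphic_on UNIV"
    unfolding qkern_def kern_def by (intro holomorphic_intros 1 2)
  thus ?thesis using holomorphic_on_subset by blast
qed

lemma qkern_continuous: "continuous_on A (qkern \<delta> u)"
  by (rule holomorphic_on_imp_continuous_on[OF qkern_holomorphic])

text \<open>On the imaginary axis the arguments of the two \<open>expq\<close> factors are
  conjugate, so \<open>kern\<close> is a squared modulus; the other factor is
  \<open>2 - 2 * cos (u * t)\<close>.\<close>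

lemma qkern_imaginary:
  obtains r where "qkern \<delta> u (Complex 0 t) = of_real r" "r \<ge> 0"
proof -
  define s where "s = Complex 0 t"
  have "- (of_real \<delta> * s) = cnj (of_real \<delta> * s)" by (simp add: s_def complex_eq_iff)
  hence "kern \<delta> s = of_real (\<delta>\<^sup>2) * (expq (of_real \<delta> * s) * cnj (expq (of_real \<delta> * s)))"
    by (simp only: kern_def expq_cnj)
  also have "\<dots> = of_real (\<delta>\<^sup>2 * (norm (expq (of_real \<delta> * s)))\<^sup>2)"
    by (simp only: complex_norm_square[symmetric] of_real_mult)
  finally have k: "kern \<delta> s = of_real (\<delta>\<^sup>2 * (norm (expq (of_real \<delta> * s)))\<^sup>2)" .
  have a: "of_real u * s = \<i> * of_real (u * t)" by (simp add: s_def complex_eq_iff)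
  have "exp (\<i> * of_real (u * t)) + exp (- \<i> * of_real (u * t)) = 2 * complex_of_real (cos (u * t))"
    unfolding cos_of_real[symmetric] cos_exp_eq by simp
  hence e: "2 - exp (of_real u * s) - exp (- (of_real u * s)) = of_real (2 - 2 * cos (u * t))"
    unfolding a by (simp add: diff_diff_eq)
  show ?thesis
  proof (rule that)
    show "qkern \<delta> u (Complex 0 t) = of_real (\<delta>\<^sup>2 * (norm (expq (of_real \<delta> * s)))\<^sup>2 * (2 - 2 * cos (u * t)))"
      using k e by (simp only: qkern_def s_def of_real_mult)
    show "\<delta>\<^sup>2 * (norm (expq (of_real \<delta> * s)))\<^sup>2 * (2 - 2 * cos (u * t)) \<ge> 0" by simp
  qed
qed

lemma qkern_bound:
  assumes \<delta>: "\<delta> > 0" and u: "u \<ge> 0"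
  obtains D where "D \<ge> 0" "\<And>s. 0 \<le> Re s \<Longrightarrow> Re s \<le> 1 \<Longrightarrow> \<bar>Im s\<bar> \<ge> 1 \<Longrightarrow> norm (qkern \<delta> u s) \<le> D / (Im s)\<^sup>2"
proof (rule that[of "(exp \<delta> + 2 + 1) * (2 + exp u + 1)"])
  show "(exp \<delta> + 2 + 1) * (2 + exp u + 1) \<ge> 0" by (simp add: add_nonneg_nonneg)
  fix s :: complex assume s: "0 \<le> Re s" "Re s \<le> 1" "\<bar>Im s\<bar> \<ge> 1"
  have s0: "s \<noteq> 0" using s by auto
  have e: "norm (exp (of_real a * s)) \<le> exp a" "norm (exp (- (of_real a * s))) \<le> 1" if "a \<ge> 0" for a :: real
    using that s mult_left_mono[of "Re s" 1 a] by auto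
  have n2: "norm (2::complex) = 2" by simp
  have 1: "norm (exp (of_real \<delta> * s) - 2 + exp (- (of_real \<delta> * s))) \<le> exp \<delta> + 2 + 1"
    using e(1)[of \<delta>] e(2)[of \<delta>] \<delta> norm_triangle_ineq[of "exp (of_real \<delta> * s) - 2" "exp (- (of_real \<delta> * s))"]
      norm_triangle_ineq4[of "exp (of_real \<delta> * s)" 2] n2 by linarith
  have 2: "norm (2 - exp (of_real u * s) - exp (- (of_real u * s))) \<le> 2 + exp u + 1"
    using e(1)[of u] e(2)[of u] u norm_triangle_ineq4[of "2 - exp (of_real u * s)" "exp (- (of_real u * s))"]
      norm_triangle_ineq4[of 2 "exp (of_real u * s)"] n2 by linarith
  have "norm (qkern \<delta> u s) = norm (exp (of_real \<delta> * s) - 2 + exp (- (of_real \<delta> * s))) / (norm s)\<^sup>2 *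
      norm (2 - exp (of_real u * s) - exp (- (of_real u * s)))"
    using s0 \<delta> by (simp add: qkern_def kern_eq norm_mult norm_divide norm_power)
  also have "\<dots> \<le> (exp \<delta> + 2 + 1) / (Im s)\<^sup>2 * (2 + exp u + 1)"
  proof (intro mult_mono frac_le 1 2)
    show "(Im s)\<^sup>2 \<le> (norm s)\<^sup>2" by (simp add: cmod_power2)
    show "0 < (Im s)\<^sup>2" using s by auto
  qed (auto intro!: add_nonneg_nonneg divide_nonneg_nonneg)
  finally show "norm (qkern \<delta> u s) \<le> (exp \<delta> + 2 + 1) * (2 + exp u + 1) / (Im s)\<^sup>2" by simp
qed

section \<open>Tent functions and the transform of the kernel\<close>

definition tri :: "real \<Rightarrow> real \<Rightarrow> real" where "tri \<delta> v = max 0 (\<delta> - \<bar>v\<bar>)"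

definition qtri :: "real \<Rightarrow> real \<Rightarrow> real \<Rightarrow> real" where
  "qtri \<delta> u w = 2 * tri \<delta> w - tri \<delta> (w - u) - tri \<delta> (w + u)"

text \<open>The tent as a second difference of \<open>max v 0\<close>, the function produced by the
  Perron integrals.\<close>

lemma tri_alt: "\<delta> \<ge> 0 \<Longrightarrow> tri \<delta> v = max (v + \<delta>) 0 - 2 * max v 0 + max (v - \<delta>) 0"
  by (auto simp: tri_def max_def abs_if)

lemma tri_minus: "tri \<delta> (- v) = tri \<delta> v" by (simp add: tri_def)

lemma tri_continuous [continuous_intros]: "continuous_on A f \<Longrightarrow> continuous_on A (\<lambda>x. tri \<delta> (f x))"
  unfolding tri_def by (intro continuous_intros)

lemma tri_le: "\<delta> \<ge> 0 \<Longrightarrow> tri \<delta> v \<le> \<delta>" and tri_nonneg [simp]: "tri \<delta> v \<ge> 0"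
  by (auto simp: tri_def)

text \<open>Multiplied out, the kernel is a combination of nine Perron integrands; their values form
  three second differences, the tents at 0, \<open>u\<close> and \<open>- u\<close>.\<close>

lemma qkern_transform:
  assumes c: "c > 0" and \<delta>: "\<delta> > 0"
  shows "has_bochner_integral lborel (\<lambda>t. qkern \<delta> u (Complex c t) * exp (- (Complex c t * of_real w)))
    (of_real (2 * pi * qtri \<delta> u w))"
proof -
  define P where "P = (\<lambda>y t. exp (Complex c t * of_real y) / (Complex c t)\<^sup>2)"
  define V where "V = (\<lambda>y. complex_of_real (2 * pi * max y 0))"
  have P: "has_bochner_integral lborel (P y) (V y)" for y
    unfolding P_def V_def by (rule perron[OF c])
  define g where "g = (\<lambda>t. 2 * (P (\<delta> - w) t - 2 * P (- w) t + P (- \<delta> - w) t)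
      - (P (u + \<delta> - w) t - 2 * P (u - w) t + P (u - \<delta> - w) t)
      - (P (- u + \<delta> - w) t - 2 * P (- u - w) t + P (- u - \<delta> - w) t))"
  have "has_bochner_integral lborel g
     (2 * (V (\<delta> - w) - 2 * V (- w) + V (- \<delta> - w))
      - (V (u + \<delta> - w) - 2 * V (u - w) + V (u - \<delta> - w))
      - (V (- u + \<delta> - w) - 2 * V (- u - w) + V (- u - \<delta> - w)))"
    unfolding g_def
    by (intro has_bochner_integral_diff has_bochner_integral_add has_bochner_integral_mult_right P)
  also have "2 * (V (\<delta> - w) - 2 * V (- w) + V (- \<delta> - w))
      - (V (u + \<delta> - w) - 2 * V (u - w) + V (u - \<delta> - w))
      - (V (- u + \<delta> - w) - 2 * V (- u - w) + V (- u - \<delta> - w)) = of_real (2 * pi * qtri \<delta> u w)"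
  proof -
    have t: "tri \<delta> v = max (\<delta> + v) 0 - 2 * max v 0 + max (- \<delta> + v) 0" for v
      using tri_alt[of \<delta> v] \<delta> by (simp add: add.commute)
    have "qtri \<delta> u w = 2 * tri \<delta> (- w) - tri \<delta> (u - w) - tri \<delta> (- u - w)"
    proof -
      have "u - w = - (w - u)" "- u - w = - (w + u)" by simp_all
      thus ?thesis by (simp only: qtri_def tri_minus)
    qed
    also have "\<dots> = 2 * (max (\<delta> - w) 0 - 2 * max (- w) 0 + max (- \<delta> - w) 0)
      - (max (u + \<delta> - w) 0 - 2 * max (u - w) 0 + max (u - \<delta> - w) 0)
      - (max (- u + \<delta> - w) 0 - 2 * max (- u - w) 0 + max (- u - \<delta> - w) 0)"
      unfolding t by (simp add: algebra_simps)
    finally have q: "qtri \<delta> u w = \<dots>" .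
    show ?thesis unfolding q V_def by (simp add: algebra_simps)
  qed
  also have "g = (\<lambda>t. qkern \<delta> u (Complex c t) * exp (- (Complex c t * of_real w)))"
  proof
    fix t
    define s where "s = Complex c t"
    have s0: "s \<noteq> 0" using c by (simp add: s_def complex_eq_iff)
    define A where "A = exp (of_real \<delta> * s)"
    define A' where "A' = exp (- (of_real \<delta> * s))"
    define B where "B = exp (of_real u * s)"
    define B' where "B' = exp (- (of_real u * s))"
    define E where "E = exp (- (s * of_real w))"
    have ex: "exp (s * of_real (a + b + d)) = exp (s * of_real a) * exp (s * of_real b) * exp (s * of_real d)" for a b d :: real
      by (simp add: distrib_left exp_add)
    have Pq: "P (a + b + (- w)) t = exp (s * of_real a) * exp (s * of_real b) * E / s\<^sup>2" for a b
      unfolding P_def s_def[symmetric] ex by (simp add: E_def)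
    have es: "exp (s * of_real \<delta>) = A" "exp (s * of_real (- \<delta>)) = A'" "exp (s * of_real u) = B" "exp (s * of_real (- u)) = B'"
      "exp (s * of_real 0) = 1"
      by (simp_all add: A_def A'_def B_def B'_def mult.commute)
    have "P (\<delta> - w) t = A * E / s\<^sup>2" "P (- w) t = E / s\<^sup>2" "P (- \<delta> - w) t = A' * E / s\<^sup>2"
      "P (u + \<delta> - w) t = B * A * E / s\<^sup>2" "P (u - w) t = B * E / s\<^sup>2" "P (u - \<delta> - w) t = B * A' * E / s\<^sup>2"
      "P (- u + \<delta> - w) t = B' * A * E / s\<^sup>2" "P (- u - w) t = B' * E / s\<^sup>2" "P (- u - \<delta> - w) t = B' * A' * E / s\<^sup>2"
      using Pq[of \<delta> 0] Pq[of 0 0] Pq[of "- \<delta>" 0] Pq[of u \<delta>] Pq[of u 0] Pq[of u "- \<delta>"]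
        Pq[of "- u" \<delta>] Pq[of "- u" 0] Pq[of "- u" "- \<delta>"] unfolding es by simp_all
    hence "g t = (A - 2 + A') / s\<^sup>2 * (2 - B - B') * E"
      unfolding g_def by (simp add: algebra_simps add_divide_distrib diff_divide_distrib)
    also have "\<dots> = qkern \<delta> u s * E"
      using kern_eq[OF s0, of \<delta>] \<delta> by (simp add: qkern_def A_def A'_def B_def B'_def)
    finally show "g t = qkern \<delta> u (Complex c t) * exp (- (Complex c t * of_real w))"
      by (simp add: E_def s_def)
  qed
  finally show ?thesis .
qed

lemma sqrt_over_square_le_dec: "\<bar>t\<bar> \<ge> 1 \<Longrightarrow> sqrt (5 + \<bar>t\<bar>) / t\<^sup>2 \<le> 8 * dec t"
proof -
  assume t: "\<bar>t\<bar> \<ge> 1"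
  define u where "u = \<bar>t\<bar>"
  have u: "u \<ge> 1" using t by (simp add: u_def)
  have "(2 * u) powr (- 3 / 2) \<le> (1 + u) powr (- 3 / 2)" using u by (intro powr_mono2') auto
  hence d: "(2 * u) powr (- 3 / 2) \<le> dec t" by (simp add: dec_def u_def)
  have "(2 * u) powr (- 3 / 2) = (2 * u) powr (1 / 2) * (2 * u) powr (- 2)"
    by (simp flip: powr_add)
  also have "(2 * u) powr (1 / 2) = sqrt (2 * u)" using u by (simp add: powr_half_sqrt)
  also have "(2 * u) powr (- 2) = 1 / (4 * u\<^sup>2)"
    using u by (simp add: powr_minus powr_numeral inverse_eq_divide power_mult_distrib)
  finally have e: "8 * ((2 * u) powr (- 3 / 2)) = 2 * sqrt (2 * u) / u\<^sup>2" by simp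
  have "sqrt (5 + u) \<le> sqrt (4 * (2 * u))" using u by (intro real_sqrt_le_mono) auto
  also have "sqrt (4 * (2 * u)) = 2 * sqrt (2 * u)" by (simp only: real_sqrt_mult real_sqrt_four)
  finally have "sqrt (5 + u) / u\<^sup>2 \<le> 2 * sqrt (2 * u) / u\<^sup>2" by (intro divide_right_mono) auto
  also have "\<dots> \<le> 8 * dec t" using d unfolding e[symmetric] by simp
  finally show ?thesis by (simp add: u_def)
qed

lemma qkern_line_integrable:
  assumes \<delta>: "\<delta> > 0" and u: "u \<ge> 0" and c: "0 < c" "c \<le> 1"
    and cont: "continuous_on {s. Re s = c} h"
    and h: "\<And>s. Re s = c \<Longrightarrow> norm (h s) \<le> C * sqrt (5 + \<bar>Im s\<bar>)"
  shows "integrable lborel (\<lambda>t. h (Complex c t) * qkern \<delta> u (Complex c t))"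
proof -
  obtain D where D: "D \<ge> 0" "\<And>s. 0 \<le> Re s \<Longrightarrow> Re s \<le> 1 \<Longrightarrow> \<bar>Im s\<bar> \<ge> 1 \<Longrightarrow> norm (qkern \<delta> u s) \<le> D / (Im s)\<^sup>2"
    using qkern_bound[OF \<delta> u] by blast
  have cont': "continuous_on {s. Re s = c} (\<lambda>s. h s * qkern \<delta> u s)"
    by (intro continuous_intros cont qkern_continuous)
  have "norm (h s * qkern \<delta> u s) \<le> (\<bar>C\<bar> * D * 8) * dec (Im s)" if s: "Re s = c" "\<bar>Im s\<bar> \<ge> 1" for s
  proof -
    have "norm (h s * qkern \<delta> u s) \<le> (\<bar>C\<bar> * sqrt (5 + \<bar>Im s\<bar>)) * (D / (Im s)\<^sup>2)"
      unfolding norm_mult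
    proof (rule mult_mono)
      have "norm (h s) \<le> C * sqrt (5 + \<bar>Im s\<bar>)" by (rule h[OF s(1)])
      also have "\<dots> \<le> \<bar>C\<bar> * sqrt (5 + \<bar>Im s\<bar>)" by (intro mult_right_mono) auto
      finally show "norm (h s) \<le> \<bar>C\<bar> * sqrt (5 + \<bar>Im s\<bar>)" .
    qed (use D c s in auto)
    also have "\<dots> = \<bar>C\<bar> * D * (sqrt (5 + \<bar>Im s\<bar>) / (Im s)\<^sup>2)" by simp
    also have "\<dots> \<le> \<bar>C\<bar> * D * (8 * dec (Im s))"
      by (intro mult_left_mono sqrt_over_square_le_dec s) (use D in auto)
    finally show ?thesis by simp
  qed
  hence "\<exists>C'. \<forall>s. Re s = c \<longrightarrow> norm (h s * qkern \<delta> u s) \<le> C' * dec (Im s)"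
    using strip_decay_extend[of c c "\<lambda>s. h s * qkern \<delta> u s" "\<bar>C\<bar> * D * 8"] cont'
    by (metis (mono_tags, lifting) Collect_cong order.refl order_antisym)
  then obtain C' where C': "\<And>s. Re s = c \<Longrightarrow> norm (h s * qkern \<delta> u s) \<le> C' * dec (Im s)" by blast
  show ?thesis by (rule vertical_integrable[OF cont' C'])
qed

lemma exp_integral_atLeast:
  assumes a: "Re a > 0"
  shows "has_bochner_integral lborel (\<lambda>w. indicator {0..} w *\<^sub>R exp (- (a * of_real w))) (1 / a)"
proof -
  define f where "f = (\<lambda>w. indicator {0..} w *\<^sub>R exp (- (a * of_real w)))"
  have F: "((\<lambda>w. - exp (- (Re a * w)) / Re a) has_real_derivative exp (- (Re a * w))) (at w)" for w
    using a by (auto intro!: derivative_eq_intros)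
  have "((\<lambda>w. exp (- (Re a * w))) \<longlongrightarrow> 0) at_top"
    by (intro filterlim_compose[OF exp_at_bot] filterlim_compose[OF filterlim_uminus_at_bot_at_top]
          filterlim_tendsto_pos_mult_at_top[OF tendsto_const a filterlim_ident])
  hence lim0: "((\<lambda>w. - exp (- (Re a * w)) / Re a) \<longlongrightarrow> - 0 / Re a) at_top"
    using a by (intro tendsto_intros) auto
  have "(\<integral>\<^sup>+w. ennreal (exp (- (Re a * w))) * indicator {0..} w \<partial>lborel) = ennreal (- 0 / Re a - (- exp (- (Re a * 0)) / Re a))"
    by (rule nn_integral_FTC_atLeast[OF _ F _ lim0]) auto
  hence fin: "(\<integral>\<^sup>+w. ennreal (norm (f w)) \<partial>lborel) < \<infinity>"
  proof -
    assume a: "(\<integral>\<^sup>+w. ennreal (exp (- (Re a * w))) * indicator {0..} w \<partial>lborel) = ennreal (- 0 / Re a - (- exp (- (Re a * 0)) / Re a))"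
    have "(\<integral>\<^sup>+w. ennreal (norm (f w)) \<partial>lborel) = (\<integral>\<^sup>+w. ennreal (exp (- (Re a * w))) * indicator {0..} w \<partial>lborel)"
      by (intro nn_integral_cong) (auto simp: f_def indicator_def)
    thus ?thesis unfolding a by simp
  qed
  have meas: "f \<in> borel_measurable lborel" unfolding f_def by measurable
  have int: "integrable lborel f" using fin meas by (simp add: integrable_iff_bounded)
  have lim1: "((\<lambda>y. LINT w|lborel. indicator {..y} w *\<^sub>R f w) \<longlongrightarrow> (LINT w|lborel. f w)) at_top"
    by (rule tendsto_integral_at_top[OF _ int]) simp
  have a0: "a \<noteq> 0" using a by auto
  have ev: "\<forall>\<^sub>F y in at_top. (LINT w|lborel. indicator {..y} w *\<^sub>R f w) = (1 - exp (- (a * of_real y))) / a"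
    using eventually_ge_at_top[of 0]
  proof eventually_elim
    case (elim y)
    have "(LINT w|lborel. indicator {..y} w *\<^sub>R f w) = (LINT w:{0..y}|lborel. exp (- (a * of_real w)))"
      unfolding set_lebesgue_integral_def by (intro Bochner_Integration.integral_cong) (auto simp: f_def indicator_def)
    also have "\<dots> = integral {0..y} (\<lambda>w. exp (- (a * of_real w)))"
      by (intro set_borel_integral_eq_integral borel_integrable_atLeastAtMost' continuous_intros)
    also have "\<dots> = - exp (- (a * of_real y)) / a - (- exp (- (a * of_real 0)) / a)"
    proof (intro integral_unique fundamental_theorem_of_calculus elim)
      fix x :: real assume "x \<in> {0..y}"
      have "((\<lambda>w. - exp (- (a * w)) / a) has_field_derivative exp (- (a * of_real x))) (at (of_real x))"
        using a0 by (auto intro!: derivative_eq_intros)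
      thus "((\<lambda>w. - exp (- (a * of_real w)) / a) has_vector_derivative exp (- (a * of_real x))) (at x within {0..y})"
        by (rule has_vector_derivative_real_field[THEN has_vector_derivative_at_within])
    qed
    finally show ?case by (simp add: diff_divide_distrib)
  qed
  have "((\<lambda>y. (1 - exp (- (a * of_real y))) / a) \<longlongrightarrow> (1 - 0) / a) at_top"
  proof (intro tendsto_intros a0)
    show "((\<lambda>y. exp (- (a * complex_of_real y))) \<longlongrightarrow> 0) at_top"
    proof (rule tendsto_norm_zero_cancel)
      show "((\<lambda>y. norm (exp (- (a * complex_of_real y)))) \<longlongrightarrow> 0) at_top"
        using \<open>((\<lambda>w. exp (- (Re a * w))) \<longlongrightarrow> 0) at_top\<close> by simp
    qed
  qed
  hence "((\<lambda>y. LINT w|lborel. indicator {..y} w *\<^sub>R f w) \<longlongrightarrow> (1 - 0) / a) at_top"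
    using tendsto_cong[OF ev] by blast
  hence "(LINT w|lborel. f w) = 1 / a"
    using lim1 tendsto_unique trivial_limit_at_top_linorder by fastforce
  thus ?thesis using int by (simp add: has_bochner_integral_iff f_def)
qed

text \<open>\<open>1 / (s + \<beta>)\<close> is the integral of
  \<open>exp (- ((s + \<beta>) * w))\<close> over \<open>w \<ge> 0\<close>, absolutely convergent
  because \<open>c + \<beta> > 0\<close>. After exchanging the integrals,
  \<open>qkern_transform\<close> evaluates the inner one for each \<open>w\<close>.\<close>

lemma qkern_partial_fraction_transform:
  assumes \<delta>: "\<delta> > 0" and u: "u \<ge> 0" and c: "0 < c" "c \<le> 1" and \<beta>: "c + \<beta> > 0"
  shows "has_bochner_integral lborel (\<lambda>t. qkern \<delta> u (Complex c t) / (Complex c t + of_real \<beta>))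
    (of_real (2 * pi * (LINT w|lborel. indicator {0..} w * (exp (- (\<beta> * w)) * qtri \<delta> u w))))"
    and "integrable lborel (\<lambda>w. indicator {0..} w * (exp (- (\<beta> * w)) * qtri \<delta> u w))"
proof -
  define f where "f = (\<lambda>t w. indicator {0..} w *\<^sub>R (qkern \<delta> u (Complex c t) * exp (- ((Complex c t + of_real \<beta>) * of_real w))))"
  have nz: "Complex c t + of_real \<beta> \<noteq> 0" for t using \<beta> by (simp add: complex_eq_iff)
  have intq: "integrable lborel (\<lambda>t. qkern \<delta> u (Complex c t))"
    using qkern_transform[OF c(1) \<delta>, of u 0] by (simp add: has_bochner_integral_iff)
  have cq: "continuous_on UNIV (\<lambda>t. qkern \<delta> u (Complex c t))"
    by (rule continuous_on_compose2[OF qkern_continuous]) (auto intro!: continuous_intros)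
  have [measurable]: "(\<lambda>t. qkern \<delta> u (Complex c t)) \<in> borel_measurable borel"
    by (rule borel_measurable_continuous_onI[OF cq])
  have [measurable]: "(\<lambda>t. Complex c t) \<in> borel_measurable borel"
    by (rule borel_measurable_continuous_onI) (intro continuous_intros)
  have inner: "has_bochner_integral lborel (f t) (qkern \<delta> u (Complex c t) / (Complex c t + of_real \<beta>))" for t
  proof -
    have "Re (Complex c t + of_real \<beta>) > 0" using \<beta> by simp
    from has_bochner_integral_mult_right[OF exp_integral_atLeast[OF this], of "qkern \<delta> u (Complex c t)"]
    show ?thesis by (simp add: f_def)
  qed
  define R where "R = (\<lambda>w. indicator {0..} w * exp (- ((c + \<beta>) * w)))"
  have R: "has_bochner_integral lborel R (1 / (c + \<beta>))"
  proof -
    have "has_bochner_integral lborel (\<lambda>w. indicator {0..} w *\<^sub>R exp (- (complex_of_real (c + \<beta>) * of_real w))) (1 / complex_of_real (c + \<beta>))"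
      by (rule exp_integral_atLeast) (use \<beta> in simp)
    from has_bochner_integral_bounded_linear[OF bounded_linear_Re this]
    have "has_bochner_integral lborel (\<lambda>w. Re (indicator {0..} w *\<^sub>R exp (- (complex_of_real (c + \<beta>) * of_real w)))) (Re (1 / complex_of_real (c + \<beta>)))" .
    also have "(\<lambda>w. Re (indicator {0..} w *\<^sub>R exp (- (complex_of_real (c + \<beta>) * of_real w)))) = R"
      by (rule ext) (simp add: R_def Re_exp)
    also have "Re (1 / complex_of_real (c + \<beta>)) = 1 / (c + \<beta>)" by (simp flip: of_real_add)
    finally show ?thesis .
  qed
  have nf: "norm (f t w) = norm (qkern \<delta> u (Complex c t)) * R w" for t w
    by (simp add: f_def R_def norm_mult indicator_def)
  have int2: "integrable (lborel \<Otimes>\<^sub>M lborel) (case_prod f)"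
  proof (rule lborel_pair.Fubini_integrable)
    show "case_prod f \<in> borel_measurable (lborel \<Otimes>\<^sub>M lborel)"
      unfolding f_def by measurable
    have "(\<lambda>t. LINT w|lborel. norm (case_prod f (t, w))) = (\<lambda>t. norm (qkern \<delta> u (Complex c t)) * (1 / (c + \<beta>)))"
      using R by (simp add: nf has_bochner_integral_iff)
    thus "integrable lborel (\<lambda>t. LINT w|lborel. norm (case_prod f (t, w)))"
      using intq by simp
    show "AE t in lborel. integrable lborel (\<lambda>w. case_prod f (t, w))"
      using inner by (intro AE_I2) (simp add: has_bochner_integral_iff)
  qed
  have outer: "(LINT t|lborel. f t w) = of_real (2 * pi * (indicator {0..} w * (exp (- (\<beta> * w)) * qtri \<delta> u w)))" for w
  proof -
    have "f t w = of_real (indicator {0..} w * exp (- (\<beta> * w))) * (qkern \<delta> u (Complex c t) * exp (- (Complex c t * of_real w)))" for t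
    proof -
      have "exp (- ((Complex c t + of_real \<beta>) * of_real w)) = exp (- (Complex c t * of_real w)) * of_real (exp (- (\<beta> * w)))"
        by (simp add: distrib_right exp_add exp_diff exp_minus divide_inverse exp_of_real[symmetric])
      thus ?thesis by (simp add: f_def scaleR_conv_of_real)
    qed
    hence "(LINT t|lborel. f t w) = of_real (indicator {0..} w * exp (- (\<beta> * w))) *
       (LINT t|lborel. qkern \<delta> u (Complex c t) * exp (- (Complex c t * of_real w)))"
      by (simp only: integral_mult_right_zero)
    also have "(LINT t|lborel. qkern \<delta> u (Complex c t) * exp (- (Complex c t * of_real w))) = of_real (2 * pi * qtri \<delta> u w)"
      using qkern_transform[OF c(1) \<delta>, of u w] by (simp add: has_bochner_integral_iff)
    finally show ?thesis by simp
  qed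
  have "integrable lborel (\<lambda>w. LINT t|lborel. f t w)"
    using lborel_pair.integrable_snd[OF int2] .
  hence "integrable lborel (\<lambda>w. 2 * pi * (indicator {0..} w * (exp (- (\<beta> * w)) * qtri \<delta> u w)))"
    unfolding outer by (simp only: complex_of_real_integrable_eq)
  from integrable_mult_right[OF this, of "1 / (2 * pi)"]
  show int3: "integrable lborel (\<lambda>w. indicator {0..} w * (exp (- (\<beta> * w)) * qtri \<delta> u w))" by simp
  have "integrable lborel (\<lambda>t. LINT w|lborel. f t w)"
    using lborel_pair.integrable_fst[OF int2] .
  hence int4: "integrable lborel (\<lambda>t. qkern \<delta> u (Complex c t) / (Complex c t + of_real \<beta>))"
    using inner by (simp add: has_bochner_integral_iff)
  have "(LINT t|lborel. qkern \<delta> u (Complex c t) / (Complex c t + of_real \<beta>)) = (LINT t|lborel. LINT w|lborel. f t w)"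
    using inner by (simp add: has_bochner_integral_iff)
  also have "\<dots> = (LINT w|lborel. LINT t|lborel. f t w)"
    by (rule lborel_pair.Fubini_integral[OF int2, symmetric])
  also have "\<dots> = of_real (LINT w|lborel. 2 * pi * (indicator {0..} w * (exp (- (\<beta> * w)) * qtri \<delta> u w)))"
    unfolding outer by (rule integral_complex_of_real)
  also have "(LINT w|lborel. 2 * pi * (indicator {0..} w * (exp (- (\<beta> * w)) * qtri \<delta> u w))) =
      2 * pi * (LINT w|lborel. indicator {0..} w * (exp (- (\<beta> * w)) * qtri \<delta> u w))"
    by (simp only: integral_mult_right_zero)
  finally show "has_bochner_integral lborel (\<lambda>t. qkern \<delta> u (Complex c t) / (Complex c t + of_real \<beta>))
    (of_real (2 * pi * (LINT w|lborel. indicator {0..} w * (exp (- (\<beta> * w)) * qtri \<delta> u w))))"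
    using int4 by (simp only: has_bochner_integral_iff)
qed

section \<open>The logarithmic derivative\<close>

lemma ln_le_powr_divide: "n \<ge> 1 \<Longrightarrow> a > 0 \<Longrightarrow> ln (real n) \<le> real n powr a / a"
  by (rule ln_powr_bound) auto

lemma mangoldt_powr_summable:
  assumes "r < - 1"
  shows "summable (\<lambda>n. mangoldt n * real n powr r)"
proof -
  define a where "a = (- 1 - r) / 2"
  have a: "a > 0" "r + a < - 1" using assms by (auto simp: a_def field_simps)
  have "summable (\<lambda>n. real n powr (r + a) / a)"
    using a by (intro summable_divide) (simp add: summable_real_powr_iff)
  thus ?thesis
  proof (rule summable_comparison_test')
    fix n :: nat assume n: "n \<ge> 1"
    have "mangoldt n * real n powr r \<le> real n powr a / a * real n powr r"
      using mangoldt_le[of n] ln_le_powr_divide[OF n a(1)] n by (intro mult_right_mono) auto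
    also have "\<dots> = real n powr (r + a) / a" by (simp add: powr_add)
    finally show "norm (mangoldt n * real n powr r) \<le> real n powr (r + a) / a"
      using mangoldt_nonneg[of n] by simp
  qed
qed

lemma norm_nat_powr: "n \<ge> 1 \<Longrightarrow> norm (of_nat n powr z :: complex) = real n powr Re z"
  using norm_powr_real_powr[of "of_nat n" z] by simp

text \<open>Multiplying the two absolutely convergent series and collecting the pairs
  \<open>(m, d)\<close> by their product \<open>n = m * d\<close> leaves the sum of
  \<open>mangoldt d\<close> over the divisors of \<open>n\<close>, which is
  \<open>ln n\<close>.\<close>

lemma zeta_times_mangoldt:
  assumes p: "Re p > 1"
  obtains L where "(\<lambda>n. mangoldt n * of_nat n powr (- p)) sums (L :: complex)"
    "(\<lambda>n. of_real (ln (real n)) * of_nat n powr (- p)) sums (riemann_zeta p * L)"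
proof -
  define a where "a = (\<lambda>n. of_nat n powr (- p) :: complex)"
  define b where "b = (\<lambda>n. mangoldt n * of_nat n powr (- p) :: complex)"
  have a0: "a 0 = 0" "b 0 = 0" by (simp_all add: a_def b_def)
  have na: "norm (a n) = real n powr (- Re p)" for n
    using norm_nat_powr[of n "- p"] by (cases "n = 0") (auto simp: a_def)
  have nb: "norm (b n) = mangoldt n * real n powr (- Re p)" for n
  proof -
    have "norm (mangoldt n :: complex) = mangoldt n"
      using mangoldt_nonneg[of n] norm_of_real[of "mangoldt n :: real", where 'a = complex] by (simp del: norm_of_real)
    thus ?thesis using na[of n] by (simp add: b_def a_def norm_mult)
  qed
  have sa: "summable (\<lambda>n. norm (a n))" unfolding na using p by (simp add: summable_real_powr_iff)
  have sb: "summable (\<lambda>n. norm (b n))" unfolding nb using p by (intro mangoldt_powr_summable) auto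
  have za: "a sums riemann_zeta p"
    using riemann_zeta_Dirichlet[OF p] sums_Suc_iff[of a "riemann_zeta p"] a0 by (simp add: a_def)
  define L where "L = (\<Sum>n. b n)"
  have sL: "b sums L" unfolding L_def using sb summable_norm_cancel summable_sums by blast
  have ha: "(a has_sum riemann_zeta p) UNIV"
    using norm_summable_imp_has_sum[OF sa za] .
  have hb: "(b has_sum L) UNIV"
    using norm_summable_imp_has_sum[OF sb sL] .
  \<comment> \<open>The terms at 0 vanish, but the index 0 has to go before the regrouping: it has
    infinitely many divisors.\<close>
  define N where "N = {n::nat. n \<ge> 1}"
  have ha': "(a has_sum riemann_zeta p) N"
    by (rule has_sum_cong_neutral[THEN iffD1, OF _ _ _ ha]) (auto simp: N_def a0 not_less_eq_eq)
  have hb': "(b has_sum L) N"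
    by (rule has_sum_cong_neutral[THEN iffD1, OF _ _ _ hb]) (auto simp: N_def a0 not_less_eq_eq)
  have aa: "(\<lambda>n. norm (a n)) summable_on N" "(\<lambda>n. norm (b n)) summable_on N"
  proof -
    have "(\<lambda>n. norm (a n)) summable_on UNIV" "(\<lambda>n. norm (b n)) summable_on UNIV"
      using sa sb by (simp_all add: summable_on_UNIV_nonneg_real_iff)
    thus "(\<lambda>n. norm (a n)) summable_on N" "(\<lambda>n. norm (b n)) summable_on N"
      using summable_on_subset_banach[of _ UNIV N] by blast+
  qed
  define f where "f = (\<lambda>(m, d). a m * b d)"
  have fabs: "(\<lambda>x. norm (f x)) summable_on N \<times> N"
    unfolding Infinite_Sum.abs_summable_on_Sigma_iff
  proof (intro conjI ballI)
    fix m assume "m \<in> N"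
    show "(\<lambda>d. norm (f (m, d))) summable_on N"
      unfolding f_def using aa(2) by (simp add: norm_mult summable_on_cmult_right)
  next
    define c where "c = (\<Sum>\<^sub>\<infinity>d\<in>N. norm (b d))"
    have c0: "c \<ge> 0" unfolding c_def by (rule infsum_nonneg) simp
    have "(\<Sum>\<^sub>\<infinity>d\<in>N. norm (f (m, d))) = norm (a m) * c" for m
      unfolding f_def c_def using aa(2) by (simp add: norm_mult infsum_cmult_right)
    hence "norm (\<Sum>\<^sub>\<infinity>d\<in>N. norm (f (m, d))) = norm (a m) * c" for m
      using c0 by (simp add: abs_mult)
    thus "(\<lambda>m. norm (\<Sum>\<^sub>\<infinity>d\<in>N. norm (f (m, d)))) summable_on N"
      using aa(1) by (simp only: summable_on_cmult_left)
  qed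
  have hf: "(f has_sum (riemann_zeta p * L)) (N \<times> N)"
  proof (rule has_sum_SigmaI)
    show "((\<lambda>d. f (m, d)) has_sum a m * L) N" for m
      unfolding f_def using has_sum_cmult_right[OF hb', of "a m"] by simp
    show "((\<lambda>m. a m * L) has_sum riemann_zeta p * L) N"
      by (rule has_sum_cmult_left[OF ha'])
    show "f summable_on N \<times> N" using fabs abs_summable_summable by blast
  qed
  define h where "h = (\<lambda>(n, d). mangoldt d * of_nat n powr (- p) :: complex)"
  have "(f has_sum (riemann_zeta p * L)) (N \<times> N) \<longleftrightarrow> (h has_sum (riemann_zeta p * L)) (Sigma N (\<lambda>n. {d. d dvd n}))"
  proof (rule has_sum_reindex_bij_witness[where j = "\<lambda>(m, d). (m * d, d)" and i = "\<lambda>(n, d). (n div d, d)"])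
    fix x assume "x \<in> N \<times> N"
    then obtain m d where md: "x = (m, d)" "m \<ge> 1" "d \<ge> 1" by (auto simp: N_def)
    show "(case (case x of (m, d) \<Rightarrow> (m * d, d)) of (n, d) \<Rightarrow> (n div d, d)) = x" using md by simp
    show "(case x of (m, d) \<Rightarrow> (m * d, d)) \<in> Sigma N (\<lambda>n. {d. d dvd n})" using md by (simp add: N_def)
    have "(complex_of_nat m * of_nat d) powr (- p) = of_nat m powr (- p) * of_nat d powr (- p)"
      by (rule powr_times_real) auto
    thus "h (case x of (m, d) \<Rightarrow> (m * d, d)) = f x" using md by (simp add: h_def f_def a_def b_def)
  next
    fix y assume "y \<in> Sigma N (\<lambda>n. {d. d dvd n})"
    then obtain n d where nd: "y = (n, d)" "n \<ge> 1" "d dvd n" by (auto simp: N_def)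
    have "d > 0" using nd by (auto intro: Nat.gr0I)
    moreover have "d \<le> n" using nd by (intro dvd_imp_le) auto
    ultimately show "(case y of (n, d) \<Rightarrow> (n div d, d)) \<in> N \<times> N"
      using nd by (auto simp: N_def Suc_le_eq div_greater_zero_iff)
    show "(case (case y of (n, d) \<Rightarrow> (n div d, d)) of (m, d) \<Rightarrow> (m * d, d)) = y" using nd by simp
  qed auto
  hence "(h has_sum (riemann_zeta p * L)) (Sigma N (\<lambda>n. {d. d dvd n}))" using hf by simp
  hence "((\<lambda>n. of_real (ln (real n)) * of_nat n powr (- p)) has_sum (riemann_zeta p * L)) N"
  proof (rule has_sum_SigmaD)
    fix n assume "n \<in> N"
    hence n: "n \<noteq> 0" by (auto simp: N_def)
    hence fin: "finite {d. d dvd n}" by simp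
    have "(\<Sum>d | d dvd n. h (n, d)) = of_real (ln (real n)) * of_nat n powr (- p)"
      unfolding h_def using mangoldt_sum[OF n, where 'a = complex] by (simp flip: sum_distrib_right)
    thus "((\<lambda>d. h (n, d)) has_sum of_real (ln (real n)) * of_nat n powr (- p)) {d. d dvd n}"
      using has_sum_finite[OF fin, of "\<lambda>d. h (n, d)"] by simp
  qed
  hence "((\<lambda>n. of_real (ln (real n)) * of_nat n powr (- p)) has_sum (riemann_zeta p * L)) UNIV"
    by (rule has_sum_cong_neutral[THEN iffD1, rotated -1]) (auto simp: N_def not_less_eq_eq)
  hence "(\<lambda>n. of_real (ln (real n)) * of_nat n powr (- p)) sums (riemann_zeta p * L)"
    by (rule has_sum_imp_sums)
  thus ?thesis using that sL by (simp add: b_def)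
qed

lemma riemann_zeta_deriv:
  assumes p: "Re p > 1"
  obtains D where "(\<lambda>n. - (of_real (ln (real n)) * of_nat n powr (- p))) sums D"
    "(riemann_zeta has_field_derivative D) (at p)"
proof -
  define S where "S = {s. Re s > 1}"
  define f where "f = (\<lambda>n s. of_nat n powr (- s) :: complex)"
  define f' where "f' = (\<lambda>n s. - (of_real (ln (real n)) * of_nat n powr (- s)) :: complex)"
  have "\<exists>g g'. \<forall>x\<in>S. (\<lambda>n. f n x) sums g x \<and> (\<lambda>n. f' n x) sums g' x \<and> (g has_field_derivative g' x) (at x)"
  proof (rule series_and_derivative_comparison_complex[of S f f'])
    show "open S" by (simp add: S_def)
    fix n x assume "x \<in> S"
    show "(f n has_field_derivative f' n x) (at x)"
    proof (cases "n = 0")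
      case False
      hence e: "complex_of_nat n powr w = exp (w * of_real (ln (real n)))" for w
        by (simp add: powr_def Ln_of_nat)
      show ?thesis unfolding f_def f'_def e
        by (auto intro!: derivative_eq_intros)
    qed (simp add: f_def f'_def)
  next
    fix x assume "x \<in> S"
    then obtain d where d: "d > 0" "d \<le> 1" "\<And>s. s \<in> ball x d \<Longrightarrow> Re s > 1 + d"
      using local_halfplane_bound[of 1 x] by (auto simp: S_def)
    have b: "norm (f n y) \<le> real n powr (- (1 + d))" if "y \<in> ball x d" for n y
    proof (cases "n = 0")
      case False
      have "norm (f n y) = real n powr (- Re y)" using False norm_nat_powr[of n "- y"] by (simp add: f_def)
      also have "\<dots> \<le> real n powr (- (1 + d))" using d(3)[OF that] False by (intro powr_mono) auto
      finally show ?thesis .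
    qed (simp add: f_def)
    have sm: "summable (\<lambda>n. complex_of_real (real n powr (- (1 + d))))"
      using d by (intro summable_of_real) (simp add: summable_real_powr_iff)
    show "\<exists>d h. 0 < d \<and> summable h \<and> range h \<subseteq> \<real>\<^sub>\<ge>\<^sub>0 \<and>
        (\<forall>\<^sub>F n in sequentially. \<forall>y\<in>ball x d \<inter> S. norm (f n y) \<le> norm (h n :: complex))"
      using d(1) sm b
      by (intro exI[of _ d] exI[of _ "\<lambda>n. complex_of_real (real n powr (- (1 + d)))"] conjI always_eventually) auto
  qed
  then obtain g g' where g: "\<forall>x\<in>S. (\<lambda>n. f n x) sums g x \<and> (\<lambda>n. f' n x) sums g' x \<and> (g has_field_derivative g' x) (at x)"
    by blast
  have gz: "g s = riemann_zeta s" if "s \<in> S" for s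
  proof -
    have "(\<lambda>n. f (Suc n) s) sums riemann_zeta s"
      using that riemann_zeta_Dirichlet[of s] by (simp add: S_def f_def del: of_nat_Suc)
    moreover have "f 0 s = 0" by (simp add: f_def)
    ultimately have "(\<lambda>n. f n s) sums riemann_zeta s" using sums_Suc_iff[of "\<lambda>n. f n s"] by simp
    thus ?thesis using g that sums_unique2 by blast
  qed
  have pS: "p \<in> S" using p by (simp add: S_def)
  show ?thesis
  proof (rule that[of "g' p"])
    show "(\<lambda>n. - (of_real (ln (real n)) * of_nat n powr (- p))) sums g' p"
      using g pS by (simp add: f'_def)
    show "(riemann_zeta has_field_derivative g' p) (at p)"
      by (rule has_field_derivative_transform_within_open[of g _ _ S]) (use g pS gz in \<open>auto simp: S_def\<close>)
  qed
qed

text \<open>Here \<open>1 / (p - 1)\<close> is the logarithmic derivative of the factor by which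
  \<open>zeta_reg\<close> differs from zeta; it becomes the main term of the explicit
  inequality.\<close>

lemma RH_logderiv_zeta_reg:
  assumes RH: "riemann_hypothesis" and p: "Re p > 1"
  shows "(\<lambda>n. mangoldt n * of_nat n powr (- p)) sums (1 / (p - 1) - deriv zeta_reg p / zeta_reg p)"
proof -
  have p1: "p \<noteq> 1" using p by auto
  obtain L where L: "(\<lambda>n. mangoldt n * of_nat n powr (- p)) sums L"
    "(\<lambda>n. of_real (ln (real n)) * of_nat n powr (- p)) sums (riemann_zeta p * L)"
    using zeta_times_mangoldt[OF p] by blast
  obtain D where D: "(\<lambda>n. - (of_real (ln (real n)) * of_nat n powr (- p))) sums D"
    "(riemann_zeta has_field_derivative D) (at p)"
    using riemann_zeta_deriv[OF p] by blast
  have DL: "D = - (riemann_zeta p * L)" using sums_unique2[OF D(1) sums_minus[OF L(2)]] .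
  have W: "zeta_reg p = (p - 1) * riemann_zeta p" using p1 by (simp add: zeta_reg_def)
  have z0: "riemann_zeta p \<noteq> 0" using RH_zeta_reg_nonzero[OF RH, of p] p W by auto
  have "((\<lambda>s. (s - 1) * riemann_zeta s) has_field_derivative (1 * riemann_zeta p + D * (p - 1))) (at p)"
    by (rule DERIV_mult) (auto intro!: derivative_eq_intros D(2))
  hence "(zeta_reg has_field_derivative (1 * riemann_zeta p + D * (p - 1))) (at p)"
    by (rule has_field_derivative_transform_within_open[of _ _ _ "{s. Re s > 1}"]) (use p in \<open>auto simp: zeta_reg_def\<close>)
  hence "deriv zeta_reg p = riemann_zeta p - riemann_zeta p * L * (p - 1)"
    using DERIV_imp_deriv DL by fastforce
  hence "deriv zeta_reg p / zeta_reg p = 1 / (p - 1) - L"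
    unfolding W using z0 p1 by (simp add: diff_divide_distrib)
  thus ?thesis using L(1) by simp
qed

text \<open>The terms of the series for \<open>Digamma (5/4 + s/2) / 2\<close>.\<close>

definition dterm :: "nat \<Rightarrow> complex \<Rightarrow> complex" where
  "dterm n s = of_real (1 / (2 * real (Suc n))) - 1 / (s + of_real (2 * real n + 5 / 2))"

text \<open>The denominator \<open>|s + 2 * n + 5 / 2|\<close> exceeds both
  \<open>|s + 1 / 2|\<close> and \<open>n + 1\<close>, hence their geometric mean. The bound then
  grows only like a square root in \<open>s\<close> and is still summable in \<open>n\<close>, as
  the termwise integration against the kernel requires.\<close>

lemma norm_dterm_le:
  assumes s: "Re s \<ge> 0"
  shows "norm (dterm n s) \<le> sqrt (norm (s + 1 / 2)) * real (Suc n) powr (- 3 / 2)"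
proof -
  define N where "N = real (Suc n)"
  define A where "A = norm (s + 1 / 2)"
  define B where "B = norm (s + of_real (2 * real n + 5 / 2))"
  have N: "N \<ge> 1" by (simp add: N_def)
  have A0: "A > 0"
  proof -
    have "Re (s + 1 / 2) > 0" using s by simp
    hence "s + 1 / 2 \<noteq> 0" by (metis less_irrefl zero_complex.simps(1))
    thus ?thesis by (simp add: A_def)
  qed
  have "Re s + (2 * real n + 5 / 2) \<le> B" using complex_Re_le_cmod[of "s + of_real (2 * real n + 5 / 2)"] by (simp add: B_def)
  hence BN: "B \<ge> N" using s by (simp add: N_def)
  have BA: "B \<ge> A"
  proof -
    have "(Re (s + 1 / 2))\<^sup>2 \<le> (Re (s + of_real (2 * real n + 5 / 2)))\<^sup>2" using s by (intro power_mono) auto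
    thus ?thesis unfolding A_def B_def cmod_def by (intro real_sqrt_le_mono) simp
  qed
  have nz: "s + of_real (2 * real n + 5 / 2) \<noteq> 0" using BN N by (auto simp: B_def)
  have "dterm n s = (s + 1 / 2) / (of_real (2 * N) * (s + of_real (2 * real n + 5 / 2)))"
  proof -
    have "1 / X - 1 / Y = (Y - X) / (X * Y)" if "X \<noteq> 0" "Y \<noteq> 0" for X Y :: complex
      using that by (simp add: divide_simps)
    from this[of "of_real (2 * N)", OF _ nz] N
    have "1 / of_real (2 * N) - 1 / (s + of_real (2 * real n + 5 / 2)) =
      (s + of_real (2 * real n + 5 / 2) - of_real (2 * N)) / (of_real (2 * N) * (s + of_real (2 * real n + 5 / 2)))" by simp
    also have "s + of_real (2 * real n + 5 / 2) - of_real (2 * N) = s + 1 / 2" by (simp add: N_def)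
    finally show ?thesis by (simp add: dterm_def N_def)
  qed
  hence "norm (dterm n s) = A / (2 * N * B)"
    using N by (simp add: norm_divide norm_mult A_def B_def)
  also have "\<dots> \<le> A / (N * (sqrt A * sqrt N))"
  proof (intro divide_left_mono mult_pos_pos)
    have "sqrt A * sqrt N \<le> sqrt B * sqrt B" using BA BN A0 N by (intro mult_mono) auto
    also have "\<dots> = B" using BN N by simp
    finally have "N * (sqrt A * sqrt N) \<le> N * B" using N by (intro mult_left_mono) auto
    also have "\<dots> \<le> 2 * N * B" using BN N by simp
    finally show "N * (sqrt A * sqrt N) \<le> 2 * N * B" .
  qed (use A0 N BN in auto)
  also have "\<dots> = sqrt A * (1 / (N * sqrt N))"
    using A0 N by (simp add: real_div_sqrt field_simps)
  also have "1 / (N * sqrt N) = N powr (- 3 / 2)"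
  proof -
    have "N powr (3 / 2) = N powr (1 + 1 / 2)" by simp
    also have "\<dots> = N * sqrt N" using N by (subst powr_add) (simp add: powr_half_sqrt)
    finally have "N powr (3 / 2) = N * sqrt N" .
    moreover have "N powr (- 3 / 2) = inverse (N powr (3 / 2))" using powr_minus[of N "3 / 2"] by simp
    ultimately show ?thesis by (simp add: inverse_eq_divide)
  qed
  finally show ?thesis by (simp only: A_def N_def)
qed

lemma summable_Suc_three_halves: "summable (\<lambda>n. real (Suc n) powr (- 3 / 2))"
  by (rule summable_Suc_powr) simp

lemma dterm_sums:
  assumes s: "Re s \<ge> 0"
  shows "(\<lambda>n. dterm n s) sums ((Digamma (5 / 4 + s / 2) + of_real euler_mascheroni) / 2)"
proof -
  define z where "z = 5 / 4 + s / 2"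
  have z0: "z \<noteq> 0" using s by (auto simp: z_def complex_eq_iff)
  have "(\<lambda>k. inverse (of_nat (Suc k)) - inverse (z + of_nat k)) sums (Digamma z + euler_mascheroni)"
    using summable_sums[OF summable_Digamma[OF z0]] by (simp add: Digamma_def)
  hence "(\<lambda>k. (inverse (of_nat (Suc k)) - inverse (z + of_nat k)) / 2) sums ((Digamma z + euler_mascheroni) / 2)"
    by (rule sums_divide)
  moreover have "(inverse (of_nat (Suc k)) - inverse (z + of_nat k)) / 2 = dterm k s" for k
  proof -
    have e: "s + of_real (2 * real k + 5 / 2) = 2 * (z + of_nat k)" by (simp add: z_def algebra_simps)
    show ?thesis unfolding dterm_def e
      by (simp add: diff_divide_distrib inverse_eq_divide mult.commute del: of_nat_Suc distrib_left_numeral)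
  qed
  ultimately show ?thesis by (simp add: z_def)
qed

text \<open>Logarithmic derivative of the product that defines \<open>xi\<close>, at
  \<open>p = 1 / 2 + s\<close>, with the Digamma value from the Gamma factor expanded into a
  series.\<close>

lemma logderiv_xi_decomposition:
  assumes RH: "riemann_hypothesis" and s: "Re s > 0"
  shows "(\<lambda>n. dterm n s) sums (logderiv_xi s - deriv zeta_reg (1 / 2 + s) / zeta_reg (1 / 2 + s)
     + of_real ((ln pi + euler_mascheroni) / 2))"
proof -
  define p where "p = 1 / 2 + s"
  have Rep: "Re p > 1 / 2" using s by (simp add: p_def)
  have nzW: "zeta_reg p \<noteq> 0" by (rule RH_zeta_reg_nonzero[OF RH Rep])
  have pG: "1 + p / 2 \<notin> \<int>\<^sub>\<le>\<^sub>0" using Rep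
    by (auto simp: complex_nonpos_Reals_iff dest!: nonpos_Ints_subset_nonpos_Reals[THEN subsetD])
  have nzG: "Gamma (1 + p / 2) \<noteq> 0" using pG by (simp add: Gamma_eq_zero_iff)
  have dW: "(zeta_reg has_field_derivative deriv zeta_reg p) (at p)"
    by (rule holomorphic_derivI[OF zeta_reg_holomorphic]) (use Rep in auto)
  have dP: "((\<lambda>z. complex_of_real pi powr (- z / 2)) has_field_derivative
      of_real pi powr (- p / 2) * (- of_real (ln pi) / 2)) (at p)"
  proof -
    have e: "complex_of_real pi powr w = exp (w * of_real (ln pi))" for w
      by (simp add: powr_def Ln_of_real)
    show ?thesis unfolding e by (auto intro!: derivative_eq_intros)
  qed
  have "((\<lambda>z. 1 + z / 2) has_field_derivative 1 / 2) (at p)" by (auto intro!: derivative_eq_intros)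
  from DERIV_chain2[OF has_field_derivative_Gamma[OF pG] this]
  have dG: "((\<lambda>z. Gamma (1 + z / 2)) has_field_derivative Gamma (1 + p / 2) * Digamma (1 + p / 2) * (1 / 2)) (at p)" .
  have "(xi has_field_derivative ((deriv zeta_reg p * of_real pi powr (- p / 2) + of_real pi powr (- p / 2) * (- of_real (ln pi) / 2) * zeta_reg p) * Gamma (1 + p / 2)
      + Gamma (1 + p / 2) * Digamma (1 + p / 2) * (1 / 2) * (zeta_reg p * of_real pi powr (- p / 2)))) (at p)"
    unfolding xi_def[abs_def] by (rule DERIV_mult[OF DERIV_mult[OF dW dP] dG])
  hence dx: "deriv xi p = (deriv zeta_reg p * of_real pi powr (- p / 2) + of_real pi powr (- p / 2) * (- of_real (ln pi) / 2) * zeta_reg p) * Gamma (1 + p / 2)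
      + Gamma (1 + p / 2) * Digamma (1 + p / 2) * (1 / 2) * (zeta_reg p * of_real pi powr (- p / 2))"
    by (rule DERIV_imp_deriv)
  have gen: "((W' * P + P * (- l / 2) * W) * G + G * D * (1 / 2) * (W * P)) / (W * P * G) = W' / W - l / 2 + D / 2"
    if "W \<noteq> 0" "P \<noteq> 0" "G \<noteq> 0" for W W' P G l D :: complex
    using that by (simp add: field_simps)
  have "logderiv_xi s = deriv zeta_reg p / zeta_reg p - of_real (ln pi) / 2 + Digamma (1 + p / 2) / 2"
    unfolding logderiv_xi_def p_def[symmetric] dx xi_def
    by (rule gen) (use nzW nzG in auto)
  moreover have "1 + p / 2 = 5 / 4 + s / 2" by (simp add: p_def field_simps)
  moreover have "(\<lambda>n. dterm n s) sums ((Digamma (5 / 4 + s / 2) + of_real euler_mascheroni) / 2)"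
    by (rule dterm_sums) (use s in simp)
  ultimately show ?thesis by (simp add: p_def add_divide_distrib)
qed

lemma norm_half_shift_le: "0 \<le> Re s \<Longrightarrow> Re s \<le> 1 \<Longrightarrow> norm (s + 1 / 2) \<le> 5 + \<bar>Im s\<bar>"
  using cmod_le[of "s + 1 / 2"] by simp

text \<open>Makes the contour shift possible. The constant depends on the distance \<sigma> to the
  critical line, which is why \<sigma> is sent to 0 only after the integrals have been
  evaluated.\<close>

lemma RH_logderiv_xi_growth:
  assumes RH: "riemann_hypothesis" and \<sigma>: "0 < \<sigma>" "\<sigma> \<le> 1"
  obtains C where "C \<ge> 0" "\<And>s. \<sigma> \<le> Re s \<Longrightarrow> Re s \<le> 1 \<Longrightarrow> norm (logderiv_xi s) \<le> C * sqrt (5 + \<bar>Im s\<bar>)"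
proof -
  obtain K where K: "K > 0"
    "\<And>z. 1 / 2 + \<sigma> \<le> Re z \<Longrightarrow> Re z \<le> 2 \<Longrightarrow> norm (deriv zeta_reg z / zeta_reg z) \<le> K * sqrt (5 + \<bar>Im z\<bar>)"
  proof (rule RH_zeta_reg_bounds[OF RH \<sigma>])
    fix K assume "K > 0"
      "\<And>z. 1 / 2 + \<sigma> \<le> Re z \<Longrightarrow> Re z \<le> 2 \<Longrightarrow> norm (deriv zeta_reg z / zeta_reg z) \<le> K * sqrt (5 + \<bar>Im z\<bar>)"
    thus ?thesis by (rule that)
  qed
  define S where "S = (\<Sum>n. real (Suc n) powr (- 3 / 2))"
  have S0: "S \<ge> 0" unfolding S_def by (rule suminf_nonneg[OF summable_Suc_three_halves]) simp
  define c where "c = norm (complex_of_real ((ln pi + euler_mascheroni) / 2))"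
  show ?thesis
  proof (rule that[of "K + S + c"])
    show "K + S + c \<ge> 0" using K S0 by (simp add: c_def)
    fix s assume s: "\<sigma> \<le> Re s" "Re s \<le> 1"
    define q where "q = sqrt (5 + \<bar>Im s\<bar>)"
    have q1: "q \<ge> 1" by (simp add: q_def)
    have sm: "summable (\<lambda>n. q * real (Suc n) powr (- 3 / 2))" by (intro summable_mult summable_Suc_three_halves)
    have le: "norm (dterm n s) \<le> q * real (Suc n) powr (- 3 / 2)" for n
    proof -
      have "norm (dterm n s) \<le> sqrt (norm (s + 1 / 2)) * real (Suc n) powr (- 3 / 2)"
        by (rule norm_dterm_le) (use s \<sigma> in auto)
      also have "\<dots> \<le> q * real (Suc n) powr (- 3 / 2)"
        unfolding q_def using norm_half_shift_le[of s] s \<sigma> by (intro mult_right_mono real_sqrt_le_mono) auto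
      finally show ?thesis .
    qed
    have "logderiv_xi s = (\<Sum>n. dterm n s) + deriv zeta_reg (1 / 2 + s) / zeta_reg (1 / 2 + s) - of_real ((ln pi + euler_mascheroni) / 2)"
      using logderiv_xi_decomposition[OF RH, of s] s \<sigma> by (simp add: sums_iff)
    also have "norm \<dots> \<le> norm (\<Sum>n. dterm n s) + norm (deriv zeta_reg (1 / 2 + s) / zeta_reg (1 / 2 + s)) + c"
      unfolding c_def by (intro order_trans[OF norm_triangle_ineq4] add_mono norm_triangle_ineq order.refl)
    also have "norm (\<Sum>n. dterm n s) \<le> q * S"
    proof -
      have "norm (\<Sum>n. dterm n s) \<le> (\<Sum>n. q * real (Suc n) powr (- 3 / 2))" by (rule norm_suminf_le[OF le sm])
      also have "\<dots> = q * S" unfolding S_def by (rule suminf_mult[OF summable_Suc_three_halves])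
      finally show ?thesis .
    qed
    also have "norm (deriv zeta_reg (1 / 2 + s) / zeta_reg (1 / 2 + s)) \<le> K * q"
      using K(2)[of "1 / 2 + s"] s by (simp add: q_def)
    also have "q * S + K * q + c \<le> (K + S + c) * q"
      using q1 mult_left_mono[of 1 q c] by (simp add: c_def algebra_simps)
    finally show "norm (logderiv_xi s) \<le> (K + S + c) * sqrt (5 + \<bar>Im s\<bar>)" by (simp add: q_def)
  qed
qed

section \<open>The explicit inequality\<close>

text \<open>Termwise integration under a majorant that separates into a summable factor in
  \<open>n\<close> and an integrable factor in \<open>t\<close>; it serves for both the Gamma series
  and the Dirichlet series.\<close>

lemma has_bochner_integral_series:
  fixes f :: "nat \<Rightarrow> real \<Rightarrow> complex"
  assumes f: "\<And>n. has_bochner_integral lborel (f n) (x n)"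
    and g: "integrable lborel g" and b: "\<And>n t. norm (f n t) \<le> a n * g t" and a: "summable a"
    and s: "\<And>t. (\<lambda>n. f n t) sums F t"
  shows "has_bochner_integral lborel F (\<Sum>n. x n)" "x sums (\<Sum>n. x n)"
proof -
  have int: "integrable lborel (f n)" and x: "x n = (LINT t|lborel. f n t)" for n
    using f[of n] by (auto simp: has_bochner_integral_iff)
  have 1: "AE t in lborel. summable (\<lambda>n. norm (f n t))"
  proof (intro AE_I2)
    fix t
    have "summable (\<lambda>n. a n * g t)" by (intro summable_mult2 a)
    thus "summable (\<lambda>n. norm (f n t))" by (rule summable_comparison_test[rotated]) (use b in auto)
  qed
  have 2: "summable (\<lambda>n. LINT t|lborel. norm (f n t))"
  proof (rule summable_comparison_test[OF _ summable_mult2[OF a, of "LINT t|lborel. g t"]])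
    have "(LINT t|lborel. norm (f n t)) \<le> a n * (LINT t|lborel. g t)" for n
    proof -
      have "(LINT t|lborel. norm (f n t)) \<le> (LINT t|lborel. a n * g t)"
        by (intro integral_mono integrable_norm int integrable_mult_right g b)
      thus ?thesis by simp
    qed
    thus "\<exists>N. \<forall>n\<ge>N. norm (LINT t|lborel. norm (f n t)) \<le> a n * (LINT t|lborel. g t)" by simp
  qed
  have F: "F = (\<lambda>t. \<Sum>n. f n t)" using s by (auto simp: sums_iff)
  have "x sums (LINT t|lborel. F t)" unfolding F x by (rule sums_integral[OF int 1 2])
  hence eq: "(LINT t|lborel. F t) = (\<Sum>n. x n)" "x sums (\<Sum>n. x n)" by (auto simp: sums_iff)
  thus "x sums (\<Sum>n. x n)" by simp
  have "integrable lborel F" unfolding F by (rule integrable_suminf[OF int 1 2])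
  thus "has_bochner_integral lborel F (\<Sum>n. x n)" using eq by (simp add: has_bochner_integral_iff)
qed

text \<open>Laplace transform of \<open>qtri\<close> on the half-line; times \<open>2 * pi\<close>
  it is the integral of the kernel against \<open>1 / (s + \<beta>)\<close>.\<close>

definition Lap :: "real \<Rightarrow> real \<Rightarrow> real \<Rightarrow> real" where
  "Lap \<delta> u \<beta> = (LINT w|lborel. indicator {0..} w * (exp (- (\<beta> * w)) * qtri \<delta> u w))"

lemma logderiv_xi_holomorphic:
  assumes RH: "riemann_hypothesis"
  shows "logderiv_xi holomorphic_on {s. Re s > 0}"
proof -
  have "((\<lambda>z. deriv xi z / xi z) \<circ> (\<lambda>s. 1 / 2 + s)) holomorphic_on {s. Re s > 0}"
  proof (rule holomorphic_on_compose_gen)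
    have "xi holomorphic_on {s. Re s > 1 / 2}"
      by (rule holomorphic_on_subset[OF xi_holomorphic]) auto
    thus "(\<lambda>z. deriv xi z / xi z) holomorphic_on {s. Re s > 1 / 2}"
      by (intro holomorphic_on_divide holomorphic_deriv open_halfspace_Re_gt) (use xi_nonzero[OF RH] in auto)
  qed (auto intro!: holomorphic_intros)
  moreover have "(\<lambda>z. deriv xi z / xi z) \<circ> (\<lambda>s. 1 / 2 + s) = logderiv_xi"
    by (auto simp: logderiv_xi_def)
  ultimately show ?thesis by simp
qed

text \<open>The integral over \<open>Re s = \<sigma>\<close> has nonnegative real part and equals
  the one over \<open>Re s = 1\<close>, where the Dirichlet series at \<open>1 / 2 + s\<close>
  converges absolutely and each constituent of \<open>logderiv_xi\<close> is integrated separately.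
  The pole of zeta gives \<open>Lap \<delta> u (\<sigma> - 1 / 2)\<close>, the Gamma factor and the
  power of pi give \<open>D\<close> and the multiple of \<open>qtri \<delta> u 0\<close>, the prime
  powers give \<open>S\<close>. A positive \<sigma> keeps the contour off the zeros.\<close>

theorem RH_explicit_inequality:
  assumes RH: "riemann_hypothesis" and \<sigma>: "0 < \<sigma>" "\<sigma> < 1 / 2" and \<delta>: "\<delta> > 0" and u: "u \<ge> 0"
  obtains D S where
    "(\<lambda>n. qtri \<delta> u 0 / (2 * real (Suc n)) - Lap \<delta> u (\<sigma> + (2 * real n + 5 / 2))) sums D"
    "(\<lambda>n. mangoldt n * (real n powr (- 1 / 2 - \<sigma>) * qtri \<delta> u (ln (real n)))) sums S"
    "0 \<le> Lap \<delta> u (\<sigma> - 1 / 2) - (ln pi + euler_mascheroni) / 2 * qtri \<delta> u 0 + D - S"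
proof -
  \<comment> \<open>The kernel is translated by \<sigma> so that its imaginary axis, where it is
    nonnegative, lies over \<open>Re s = \<sigma>\<close>; on \<open>Re s = 1\<close> its argument
    then has real part \<open>1 - \<sigma>\<close>.\<close>
  define c where "c = 1 - \<sigma>"
  have c: "0 < c" "c \<le> 1" using \<sigma> by (auto simp: c_def)
  define U where "U = {s. Re s > 0}"
  define \<phi> where "\<phi> = (\<lambda>s. logderiv_xi s * qkern \<delta> u (s - of_real \<sigma>))"
  have opU: "open U" by (simp add: U_def)
  have hol: "\<phi> holomorphic_on U"
  proof -
    have "(qkern \<delta> u \<circ> (\<lambda>s. s - of_real \<sigma>)) holomorphic_on U"
      by (rule holomorphic_on_compose_gen[OF _ qkern_holomorphic[of _ _ UNIV]]) (auto intro!: holomorphic_intros)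
    thus ?thesis unfolding \<phi>_def U_def
      by (intro holomorphic_intros logderiv_xi_holomorphic RH) (auto simp: o_def U_def)
  qed
  have stripU: "{s. \<sigma> \<le> Re s \<and> Re s \<le> 1} \<subseteq> U" using \<sigma> by (auto simp: U_def)
  obtain C where C: "C \<ge> 0" "\<And>s. \<sigma> \<le> Re s \<Longrightarrow> Re s \<le> 1 \<Longrightarrow> norm (logderiv_xi s) \<le> C * sqrt (5 + \<bar>Im s\<bar>)"
    using RH_logderiv_xi_growth[OF RH, of \<sigma>] \<sigma> by auto
  obtain D0 where D0: "D0 \<ge> 0" "\<And>s. 0 \<le> Re s \<Longrightarrow> Re s \<le> 1 \<Longrightarrow> \<bar>Im s\<bar> \<ge> 1 \<Longrightarrow> norm (qkern \<delta> u s) \<le> D0 / (Im s)\<^sup>2"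
    using qkern_bound[OF \<delta> u] by blast
  have \<phi>b: "norm (\<phi> s) \<le> (C * D0 * 8) * dec (Im s)" if s: "\<sigma> \<le> Re s" "Re s \<le> 1" "\<bar>Im s\<bar> \<ge> 1" for s
  proof -
    have "norm (\<phi> s) \<le> (C * sqrt (5 + \<bar>Im s\<bar>)) * (D0 / (Im s)\<^sup>2)"
      unfolding \<phi>_def norm_mult using C s D0(1) D0(2)[of "s - of_real \<sigma>"] \<sigma> by (intro mult_mono) auto
    also have "\<dots> = C * D0 * (sqrt (5 + \<bar>Im s\<bar>) / (Im s)\<^sup>2)" by simp
    also have "\<dots> \<le> C * D0 * (8 * dec (Im s))"
      by (intro mult_left_mono sqrt_over_square_le_dec s mult_nonneg_nonneg C D0)
    finally show ?thesis by simp
  qed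
  have cont: "continuous_on {s. \<sigma> \<le> Re s \<and> Re s \<le> 1} \<phi>"
    by (rule continuous_on_subset[OF holomorphic_on_imp_continuous_on[OF hol] stripU])
  obtain C' where C': "\<And>s. \<sigma> \<le> Re s \<Longrightarrow> Re s \<le> 1 \<Longrightarrow> norm (\<phi> s) \<le> C' * dec (Im s)"
    using strip_decay_extend[OF cont \<phi>b] by blast
  have shift: "(LINT t|lborel. \<phi> (Complex \<sigma> t)) = (LINT t|lborel. \<phi> (Complex 1 t))"
    by (rule vertical_line_shift[OF hol opU stripU _ C']) (use \<sigma> in auto)
  have pos: "Re (LINT t|lborel. \<phi> (Complex \<sigma> t)) \<ge> 0"
  proof -
    have int: "integrable lborel (\<lambda>t. \<phi> (Complex \<sigma> t))"
      by (rule vertical_integrable[OF continuous_on_subset[OF cont] C']) (use \<sigma> in auto)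
    have "Re (\<phi> (Complex \<sigma> t)) \<ge> 0" for t
    proof -
      have "Complex \<sigma> t - of_real \<sigma> = Complex 0 t" by (simp add: complex_eq_iff)
      moreover obtain r where r: "qkern \<delta> u (Complex 0 t) = of_real r" "r \<ge> 0" by (rule qkern_imaginary)
      moreover have "Re (logderiv_xi (Complex \<sigma> t)) \<ge> 0" by (rule RH_Re_logderiv_xi_nonneg[OF RH]) (use \<sigma> in simp)
      ultimately show ?thesis by (simp add: \<phi>_def)
    qed
    hence "0 \<le> (LINT t|lborel. Re (\<phi> (Complex \<sigma> t)))" by (intro integral_nonneg_AE) auto
    also have "\<dots> = Re (LINT t|lborel. \<phi> (Complex \<sigma> t))"
      by (rule integral_bounded_linear[OF bounded_linear_Re int])
    finally show ?thesis .
  qed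
  define K where "K = (\<lambda>t. qkern \<delta> u (Complex c t))"
  have e1: "Complex 1 t - of_real \<sigma> = Complex c t" for t by (simp add: complex_eq_iff c_def)
  have e2: "Complex 1 t + of_real \<beta> = Complex c t + of_real (\<sigma> + \<beta>)" for t \<beta> by (simp add: complex_eq_iff c_def)
  have H0: "has_bochner_integral lborel K (of_real (2 * pi * qtri \<delta> u 0))"
    using qkern_transform[OF c(1) \<delta>, of u 0] by (simp add: K_def)
  hence K0: "integrable lborel K" by (simp add: has_bochner_integral_iff)
  have H1: "has_bochner_integral lborel (\<lambda>t. K t / (Complex 1 t + of_real \<beta>)) (of_real (2 * pi * Lap \<delta> u (\<sigma> + \<beta>)))"
    if "\<beta> > - 1" for \<beta>
    unfolding e2 K_def Lap_def
    by (rule qkern_partial_fraction_transform(1)[OF \<delta> u c]) (use that in \<open>simp add: c_def\<close>)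
  define x2 where "x2 = (\<lambda>n. qtri \<delta> u 0 / (2 * real (Suc n)) - Lap \<delta> u (\<sigma> + (2 * real n + 5 / 2)))"
  have H2n: "has_bochner_integral lborel (\<lambda>t. dterm n (Complex 1 t) * K t) (of_real (2 * pi * x2 n))" for n
  proof -
    have "has_bochner_integral lborel (\<lambda>t. of_real (1 / (2 * real (Suc n))) * K t - K t / (Complex 1 t + of_real (2 * real n + 5 / 2)))
      (of_real (1 / (2 * real (Suc n))) * of_real (2 * pi * qtri \<delta> u 0) - of_real (2 * pi * Lap \<delta> u (\<sigma> + (2 * real n + 5 / 2))))"
      by (intro has_bochner_integral_diff has_bochner_integral_mult_right H0 H1) simp
    also have "of_real (1 / (2 * real (Suc n))) * of_real (2 * pi * qtri \<delta> u 0) - of_real (2 * pi * Lap \<delta> u (\<sigma> + (2 * real n + 5 / 2))) =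
        complex_of_real (2 * pi * x2 n)"
      by (simp only: of_real_mult[symmetric] of_real_diff[symmetric]) (simp add: x2_def right_diff_distrib)
    also have "(\<lambda>t. of_real (1 / (2 * real (Suc n))) * K t - K t / (Complex 1 t + of_real (2 * real n + 5 / 2))) =
        (\<lambda>t. dterm n (Complex 1 t) * K t)"
      by (simp only: dterm_def left_diff_distrib) simp
    finally show ?thesis .
  qed
  have g2: "integrable lborel (\<lambda>t. sqrt (5 + \<bar>t\<bar>) * norm (K t))"
  proof -
    have "integrable lborel (\<lambda>t. complex_of_real (sqrt (5 + \<bar>Im (Complex c t)\<bar>)) * qkern \<delta> u (Complex c t))"
      by (rule qkern_line_integrable[OF \<delta> u c, of "\<lambda>s. of_real (sqrt (5 + \<bar>Im s\<bar>))" 1])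
         (auto intro!: continuous_intros)
    from integrable_norm[OF this] show ?thesis by (simp add: K_def norm_mult)
  qed
  define F2 where "F2 = (\<lambda>t. \<Sum>n. dterm n (Complex 1 t))"
  have dsum: "(\<lambda>n. dterm n (Complex 1 t)) sums F2 t" for t
    unfolding F2_def using dterm_sums[of "Complex 1 t"] by (simp add: sums_iff)
  have H2: "has_bochner_integral lborel (\<lambda>t. F2 t * K t) (\<Sum>n. of_real (2 * pi * x2 n))"
      "(\<lambda>n. complex_of_real (2 * pi * x2 n)) sums (\<Sum>n. of_real (2 * pi * x2 n))"
  proof -
    have b: "norm (dterm n (Complex 1 t) * K t) \<le> real (Suc n) powr (- 3 / 2) * (sqrt (5 + \<bar>t\<bar>) * norm (K t))" for n t
    proof -
      have "norm (dterm n (Complex 1 t)) \<le> sqrt (norm (Complex 1 t + 1 / 2)) * real (Suc n) powr (- 3 / 2)"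
        by (rule norm_dterm_le) simp
      also have "\<dots> \<le> sqrt (5 + \<bar>t\<bar>) * real (Suc n) powr (- 3 / 2)"
        using norm_half_shift_le[of "Complex 1 t"] by (intro mult_right_mono real_sqrt_le_mono) auto
      finally have "norm (dterm n (Complex 1 t)) * norm (K t) \<le> sqrt (5 + \<bar>t\<bar>) * real (Suc n) powr (- 3 / 2) * norm (K t)"
        by (rule mult_right_mono) simp
      thus ?thesis by (simp only: norm_mult mult_ac)
    qed
    show "has_bochner_integral lborel (\<lambda>t. F2 t * K t) (\<Sum>n. of_real (2 * pi * x2 n))"
      "(\<lambda>n. complex_of_real (2 * pi * x2 n)) sums (\<Sum>n. of_real (2 * pi * x2 n))"
      using has_bochner_integral_series[OF H2n g2 b summable_Suc_three_halves sums_mult2[OF dsum]] by auto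
  qed
  define x3 where "x3 = (\<lambda>n. mangoldt n * (real n powr (- 1 / 2 - \<sigma>) * qtri \<delta> u (ln (real n))))"
  define f3 where "f3 = (\<lambda>n t. mangoldt n * of_nat n powr (- (1 / 2 + Complex 1 t)) :: complex)"
  have H3n: "has_bochner_integral lborel (\<lambda>t. f3 n t * K t) (of_real (2 * pi * x3 n))" for n
  proof (cases "n = 0")
    case True
    thus ?thesis by (simp add: f3_def x3_def has_bochner_integral_zero)
  next
    case False
    define k where "k = complex_of_real (mangoldt n * real n powr (- 1 / 2 - \<sigma>))"
    have "has_bochner_integral lborel (\<lambda>t. k * (qkern \<delta> u (Complex c t) * exp (- (Complex c t * of_real (ln (real n))))))
       (k * of_real (2 * pi * qtri \<delta> u (ln (real n))))"
      by (intro has_bochner_integral_mult_right qkern_transform c \<delta>)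
    also have "k * of_real (2 * pi * qtri \<delta> u (ln (real n))) = of_real (2 * pi * x3 n)"
      unfolding k_def x3_def by (simp only: of_real_mult[symmetric]) (simp only: mult_ac)
    also have "(\<lambda>t. k * (qkern \<delta> u (Complex c t) * exp (- (Complex c t * of_real (ln (real n)))))) = (\<lambda>t. f3 n t * K t)"
    proof
      fix t
      have "- (1 / 2 + Complex 1 t) * of_real (ln (real n)) =
          of_real ((- 1 / 2 - \<sigma>) * ln (real n)) + - (Complex c t * of_real (ln (real n)))"
        by (simp add: complex_eq_iff c_def algebra_simps)
      hence "of_nat n powr (- (1 / 2 + Complex 1 t)) = of_real (exp ((- 1 / 2 - \<sigma>) * ln (real n))) * exp (- (Complex c t * of_real (ln (real n))))"
        using False by (simp only: powr_def Ln_of_nat exp_add exp_of_real) (simp add: Ln_of_nat)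
      also have "exp ((- 1 / 2 - \<sigma>) * ln (real n)) = real n powr (- 1 / 2 - \<sigma>)" using False by (simp add: powr_def)
      finally have "f3 n t = k * exp (- (Complex c t * of_real (ln (real n))))"
        unfolding f3_def k_def of_real_mult of_real_mangoldt by (simp only: mult.assoc)
      thus "k * (qkern \<delta> u (Complex c t) * exp (- (Complex c t * of_real (ln (real n))))) = f3 n t * K t"
        by (simp only: K_def mult_ac)
    qed
    finally show ?thesis .
  qed
  define F3 where "F3 = (\<lambda>t. 1 / (1 / 2 + Complex 1 t - 1) - deriv zeta_reg (1 / 2 + Complex 1 t) / zeta_reg (1 / 2 + Complex 1 t))"
  have fsum: "(\<lambda>n. f3 n t) sums F3 t" for t
    unfolding f3_def F3_def by (rule RH_logderiv_zeta_reg[OF RH]) simp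
  have H3: "has_bochner_integral lborel (\<lambda>t. F3 t * K t) (\<Sum>n. of_real (2 * pi * x3 n))"
      "(\<lambda>n. complex_of_real (2 * pi * x3 n)) sums (\<Sum>n. of_real (2 * pi * x3 n))"
  proof -
    have sm: "summable (\<lambda>n. mangoldt n * real n powr (- 3 / 2))" by (rule mangoldt_powr_summable) simp
    have b: "norm (f3 n t * K t) \<le> mangoldt n * real n powr (- 3 / 2) * norm (K t)" for n t
    proof (cases "n = 0")
      case False
      have "norm (mangoldt n :: complex) = mangoldt n"
        using mangoldt_nonneg[of n] norm_of_real[of "mangoldt n :: real", where 'a = complex] by (simp del: norm_of_real)
      moreover have "norm (of_nat n powr (- (1 / 2 + Complex 1 t)) :: complex) = real n powr (- 3 / 2)"
        using norm_nat_powr[of n "- (1 / 2 + Complex 1 t)"] False by simp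
      ultimately show ?thesis by (simp add: f3_def norm_mult)
    qed (simp add: f3_def)
    show "has_bochner_integral lborel (\<lambda>t. F3 t * K t) (\<Sum>n. of_real (2 * pi * x3 n))"
      "(\<lambda>n. complex_of_real (2 * pi * x3 n)) sums (\<Sum>n. of_real (2 * pi * x3 n))"
      using has_bochner_integral_series[OF H3n integrable_norm[OF K0] b sm sums_mult2[OF fsum]] by auto
  qed
  define C0 where "C0 = (ln pi + euler_mascheroni) / (2::real)"
  have \<phi>1: "\<phi> (Complex 1 t) = F2 t * K t + K t / (Complex 1 t + of_real (- 1 / 2)) - F3 t * K t - of_real C0 * K t" for t
  proof -
    define z where "z = deriv zeta_reg (1 / 2 + Complex 1 t) / zeta_reg (1 / 2 + Complex 1 t)"
    have "F2 t = logderiv_xi (Complex 1 t) - z + of_real C0"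
      using sums_unique2[OF dsum logderiv_xi_decomposition[OF RH, of "Complex 1 t"]] by (simp add: C0_def z_def)
    moreover have "1 / 2 + Complex 1 t - 1 = Complex 1 t + of_real (- 1 / 2)" by (simp add: complex_eq_iff)
    hence "F3 t = 1 / (Complex 1 t + of_real (- 1 / 2)) - z" by (simp only: F3_def z_def)
    ultimately have "logderiv_xi (Complex 1 t) = F2 t + 1 / (Complex 1 t + of_real (- 1 / 2)) - F3 t - of_real C0" by simp
    moreover have "\<phi> (Complex 1 t) = logderiv_xi (Complex 1 t) * K t" by (simp add: \<phi>_def e1 K_def)
    ultimately have "\<phi> (Complex 1 t) = (F2 t + 1 / (Complex 1 t + of_real (- 1 / 2)) - F3 t - of_real C0) * K t"
      by (simp only:)
    thus ?thesis by (simp only: left_diff_distrib distrib_right times_divide_eq_left mult_1_left)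
  qed
  have "has_bochner_integral lborel (\<lambda>t. \<phi> (Complex 1 t))
     ((\<Sum>n. of_real (2 * pi * x2 n)) + of_real (2 * pi * Lap \<delta> u (\<sigma> + (- 1 / 2))) - (\<Sum>n. of_real (2 * pi * x3 n))
       - of_real C0 * of_real (2 * pi * qtri \<delta> u 0))"
    unfolding \<phi>1
    by (intro has_bochner_integral_diff has_bochner_integral_add has_bochner_integral_mult_right H0 H1 H2 H3) simp
  hence val: "(LINT t|lborel. \<phi> (Complex 1 t)) =
     (\<Sum>n. of_real (2 * pi * x2 n)) + of_real (2 * pi * Lap \<delta> u (\<sigma> + (- 1 / 2))) - (\<Sum>n. of_real (2 * pi * x3 n))
       - of_real C0 * of_real (2 * pi * qtri \<delta> u 0)"
    by (simp add: has_bochner_integral_iff)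
  have s2: "x2 sums (Re (\<Sum>n. of_real (2 * pi * x2 n)) / (2 * pi))"
    using sums_divide[OF sums_Re[OF H2(2)], of "2 * pi"] by simp
  have s3: "x3 sums (Re (\<Sum>n. of_real (2 * pi * x3 n)) / (2 * pi))"
    using sums_divide[OF sums_Re[OF H3(2)], of "2 * pi"] by simp
  define D where "D = Re (\<Sum>n. of_real (2 * pi * x2 n)) / (2 * pi)"
  define S where "S = Re (\<Sum>n. of_real (2 * pi * x3 n)) / (2 * pi)"
  have DS: "Re (\<Sum>n. of_real (2 * pi * x2 n)) = 2 * pi * D" "Re (\<Sum>n. of_real (2 * pi * x3 n)) = 2 * pi * S"
    by (simp_all add: D_def S_def)
  have "0 \<le> Re ((\<Sum>n. of_real (2 * pi * x2 n)) + of_real (2 * pi * Lap \<delta> u (\<sigma> + (- 1 / 2))) - (\<Sum>n. of_real (2 * pi * x3 n))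
       - of_real (C0 * (2 * pi * qtri \<delta> u 0)))"
    using pos unfolding shift val by simp
  also have "\<dots> = 2 * pi * D + 2 * pi * Lap \<delta> u (\<sigma> + (- 1 / 2)) - 2 * pi * S - C0 * (2 * pi * qtri \<delta> u 0)"
    by (simp only: minus_complex.sel plus_complex.sel DS Re_complex_of_real)
  also have "\<dots> = 2 * pi * (Lap \<delta> u (\<sigma> - 1 / 2) - C0 * qtri \<delta> u 0 + D - S)" by (simp add: algebra_simps)
  finally have "2 * pi * 0 \<le> 2 * pi * (Lap \<delta> u (\<sigma> - 1 / 2) - C0 * qtri \<delta> u 0 + D - S)" by simp
  hence "0 \<le> Lap \<delta> u (\<sigma> - 1 / 2) - C0 * qtri \<delta> u 0 + D - S" by (rule mult_left_le_imp_le) simp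
  with s2 s3 show ?thesis using that[of D S] by (simp add: D_def S_def x2_def x3_def C0_def)
qed

section \<open>Estimates for large x\<close>

lemma tri_integral:
  fixes f :: "real \<Rightarrow> real"
  assumes \<delta>: "\<delta> > 0" and f: "continuous_on UNIV f"
  shows "(LINT v|lborel. tri \<delta> v * f v) = integral {0..\<delta>} (\<lambda>v. (\<delta> - v) * (f v + f (- v)))"
proof -
  define h where "h = (\<lambda>v. tri \<delta> v * f v)"
  have ch: "continuous_on A h" for A
    unfolding h_def by (intro continuous_intros continuous_on_subset[OF f]) auto
  have "(LINT v|lborel. h v) = (LINT v:{-\<delta>..\<delta>}|lborel. h v)"
    unfolding set_lebesgue_integral_def
    by (intro Bochner_Integration.integral_cong) (auto simp: h_def tri_def indicator_def)
  also have "\<dots> = integral {-\<delta>..\<delta>} h"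
    by (intro set_borel_integral_eq_integral borel_integrable_atLeastAtMost' ch)
  also have "\<dots> = integral {-\<delta>..0} h + integral {0..\<delta>} h"
    by (rule Henstock_Kurzweil_Integration.integral_combine[symmetric])
       (use \<delta> in \<open>auto intro!: integrable_continuous_interval ch\<close>)
  also have "integral {-\<delta>..0} h = integral {0..\<delta>} (\<lambda>v. h (- v))"
    using Henstock_Kurzweil_Integration.integral_reflect_real[of "\<delta>" 0 "\<lambda>v. h (- v)"] by simp
  also have "integral {0..\<delta>} (\<lambda>v. h (- v)) + integral {0..\<delta>} h = integral {0..\<delta>} (\<lambda>v. h (- v) + h v)"
    by (intro Henstock_Kurzweil_Integration.integral_add[symmetric] integrable_continuous_interval ch
          continuous_on_compose2[OF ch[of UNIV]] continuous_intros) auto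
  also have "\<dots> = integral {0..\<delta>} (\<lambda>v. (\<delta> - v) * (f v + f (- v)))"
    by (rule integral_cong) (auto simp: h_def tri_def algebra_simps)
  finally show ?thesis by (simp add: h_def)
qed

definition Mint :: "real \<Rightarrow> real \<Rightarrow> real" where
  "Mint \<delta> \<beta> = integral {0..\<delta>} (\<lambda>w. (\<delta> - w) * exp (- (\<beta> * w)))"

definition Nint :: "real \<Rightarrow> real \<Rightarrow> real \<Rightarrow> real" where
  "Nint \<delta> u \<beta> = integral {0..\<delta>} (\<lambda>v. (\<delta> - v) * (exp (- (\<beta> * (u + v))) + exp (- (\<beta> * (u - v)))))"

text \<open>As \<open>u \<ge> \<delta>\<close>, the half-line carries half of the tent at 0
  (\<open>Mint\<close>), all of the tent at \<open>u\<close> (\<open>Nint\<close>, folded about its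
  centre), and nothing of the tent at \<open>- u\<close>.\<close>

lemma Lap_eq:
  assumes \<delta>: "0 < \<delta>" "\<delta> \<le> u"
  shows "Lap \<delta> u \<beta> = 2 * Mint \<delta> \<beta> - Nint \<delta> u \<beta>"
proof -
  have i0: "integrable lborel (\<lambda>v. tri \<delta> v * f v)" if f: "continuous_on UNIV f" for f :: "real \<Rightarrow> real"
  proof -
    have "set_integrable lborel {-\<delta>..\<delta>} (\<lambda>v. tri \<delta> v * f v)"
      by (intro borel_integrable_atLeastAtMost' continuous_intros continuous_on_subset[OF f]) auto
    moreover have "(\<lambda>v. indicator {-\<delta>..\<delta>} v *\<^sub>R (tri \<delta> v * f v)) = (\<lambda>v. tri \<delta> v * f v)"
    proof
      fix v :: real
      show "indicator {-\<delta>..\<delta>} v *\<^sub>R (tri \<delta> v * f v) = tri \<delta> v * f v"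
        by (cases "v \<in> {-\<delta>..\<delta>}") (auto simp: tri_def max_def)
    qed
    ultimately show ?thesis by (simp add: set_integrable_def)
  qed
  define f1 where "f1 = (\<lambda>w. indicator {0..} w * (exp (- (\<beta> * w)) * tri \<delta> w))"
  define f2 where "f2 = (\<lambda>w. tri \<delta> (w - u) * exp (- (\<beta> * w)))"
  have "set_integrable lborel {0..\<delta>} (\<lambda>w. (\<delta> - w) * exp (- (\<beta> * w)))"
    by (intro borel_integrable_atLeastAtMost' continuous_intros)
  moreover have "(\<lambda>w. indicator {0..\<delta>} w *\<^sub>R ((\<delta> - w) * exp (- (\<beta> * w)))) = f1"
    by (auto simp: f1_def tri_def indicator_def)
  ultimately have i1: "integrable lborel f1" "(LINT w|lborel. f1 w) = Mint \<delta> \<beta>"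
    using set_borel_integral_eq_integral(2)[of "{0..\<delta>}" "\<lambda>w. (\<delta> - w) * exp (- (\<beta> * w))"]
    by (simp_all add: set_integrable_def set_lebesgue_integral_def Mint_def)
  have cf: "continuous_on UNIV (\<lambda>v. exp (- (\<beta> * (u + v))))" by (intro continuous_intros)
  have i2': "integrable lborel (\<lambda>v. f2 (u + 1 * v))" using i0[OF cf] by (simp add: f2_def)
  hence i2: "integrable lborel f2" using lborel_integrable_real_affine_iff[of 1 f2 u] by simp
  have "(LINT w|lborel. f2 w) = \<bar>1\<bar> *\<^sub>R (LINT v|lborel. f2 (u + 1 * v))" by (rule lborel_integral_real_affine) simp
  also have "\<dots> = (LINT v|lborel. tri \<delta> v * exp (- (\<beta> * (u + v))))" by (simp add: f2_def)
  also have "\<dots> = Nint \<delta> u \<beta>" unfolding tri_integral[OF \<delta>(1) cf] by (simp add: Nint_def)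
  finally have v2: "(LINT w|lborel. f2 w) = Nint \<delta> u \<beta>" .
  have "Lap \<delta> u \<beta> = (LINT w|lborel. 2 * f1 w - f2 w)"
    unfolding Lap_def
    by (intro Bochner_Integration.integral_cong) (use \<delta> in \<open>auto simp: f1_def f2_def qtri_def tri_def indicator_def algebra_simps\<close>)
  also have "\<dots> = 2 * Mint \<delta> \<beta> - Nint \<delta> u \<beta>"
    using i1 i2 v2 by simp
  finally show ?thesis .
qed

lemma integral_ramp:
  assumes "\<delta> \<ge> (0::real)"
  shows "((\<lambda>v. \<delta> - v) has_integral \<delta>\<^sup>2 / 2) {0..\<delta>}"
proof -
  have "((\<lambda>v. \<delta> - v) has_integral ((\<delta> * \<delta> - \<delta>\<^sup>2 / 2) - (\<delta> * 0 - 0\<^sup>2 / 2))) {0..\<delta>}"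
    by (rule fundamental_theorem_of_calculus[OF assms])
       (auto intro!: derivative_eq_intros simp: has_real_derivative_iff_has_vector_derivative[symmetric])
  thus ?thesis by (simp add: power2_eq_square)
qed

lemma Mint_eq:
  assumes "\<beta> > 0" "\<delta> > 0"
  shows "Mint \<delta> \<beta> = \<delta> / \<beta> - (1 - exp (- (\<beta> * \<delta>))) / \<beta>\<^sup>2"
proof -
  define F where "F = (\<lambda>w. (1 / \<beta>\<^sup>2 - (\<delta> - w) / \<beta>) * exp (- (\<beta> * w)))"
  have "((\<lambda>w. (\<delta> - w) * exp (- (\<beta> * w))) has_integral (F \<delta> - F 0)) {0..\<delta>}"
  proof (rule fundamental_theorem_of_calculus)
    fix w assume "w \<in> {0..\<delta>}"
    have "(F has_real_derivative (1 / \<beta> * exp (- (\<beta> * w)) + (1 / \<beta>\<^sup>2 - (\<delta> - w) / \<beta>) * (exp (- (\<beta> * w)) * (- \<beta>)))) (at w within {0..\<delta>})"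
    proof -
      have "((\<lambda>w. 1 / \<beta>\<^sup>2 - (\<delta> - w) / \<beta>) has_real_derivative (0 - (0 - 1) / \<beta>)) (at w within {0..\<delta>})"
        by (intro DERIV_diff DERIV_const DERIV_ident DERIV_cdivide)
      moreover have "((\<lambda>w. exp (- (\<beta> * w))) has_real_derivative (exp (- (\<beta> * w)) * (- (\<beta> * 1)))) (at w within {0..\<delta>})"
        by (auto intro!: derivative_eq_intros)
      ultimately show ?thesis unfolding F_def by (auto dest: DERIV_mult simp: algebra_simps)
    qed
    also have "1 / \<beta> * exp (- (\<beta> * w)) + (1 / \<beta>\<^sup>2 - (\<delta> - w) / \<beta>) * (exp (- (\<beta> * w)) * (- \<beta>)) = (\<delta> - w) * exp (- (\<beta> * w))"
      using assms by (simp add: power2_eq_square field_simps)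
    finally show "(F has_vector_derivative (\<delta> - w) * exp (- (\<beta> * w))) (at w within {0..\<delta>})"
      by (simp add: has_real_derivative_iff_has_vector_derivative)
  qed (use assms in simp)
  hence "Mint \<delta> \<beta> = F \<delta> - F 0" unfolding Mint_def by (rule integral_unique)
  thus ?thesis using assms by (simp add: F_def diff_divide_distrib)
qed

lemma Mint_le:
  assumes "\<beta> \<ge> - 1 / 2" "\<delta> > 0"
  shows "Mint \<delta> \<beta> \<le> exp (\<delta> / 2) * (\<delta>\<^sup>2 / 2)"
proof -
  have "Mint \<delta> \<beta> \<le> integral {0..\<delta>} (\<lambda>w. exp (\<delta> / 2) * (\<delta> - w))"
    unfolding Mint_def
  proof (rule integral_le)
    show "(\<lambda>w. (\<delta> - w) * exp (- (\<beta> * w))) integrable_on {0..\<delta>}"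
      by (intro integrable_continuous_interval continuous_intros)
    show "(\<lambda>w. exp (\<delta> / 2) * (\<delta> - w)) integrable_on {0..\<delta>}"
      by (intro integrable_continuous_interval continuous_intros)
    fix w assume w: "w \<in> {0..\<delta>}"
    have "- (\<beta> * w) \<le> 1 / 2 * w" using assms w mult_right_mono[of "- 1 / 2" \<beta> w] by simp
    also have "\<dots> \<le> \<delta> / 2" using w by simp
    finally show "(\<delta> - w) * exp (- (\<beta> * w)) \<le> exp (\<delta> / 2) * (\<delta> - w)"
      using w by (simp add: mult.commute mult_left_mono)
  qed
  also have "\<dots> = exp (\<delta> / 2) * (\<delta>\<^sup>2 / 2)"
    by (intro integral_unique has_integral_mult_right integral_ramp) (use assms in simp)
  finally show ?thesis .
qed

lemma Nint_le:
  assumes "\<beta> \<ge> 0" "\<delta> > 0" "\<delta> \<le> u"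
  shows "Nint \<delta> u \<beta> \<le> exp (- (\<beta> * (u - \<delta>))) * \<delta>\<^sup>2"
proof -
  have "Nint \<delta> u \<beta> \<le> integral {0..\<delta>} (\<lambda>v. 2 * exp (- (\<beta> * (u - \<delta>))) * (\<delta> - v))"
    unfolding Nint_def
  proof (rule integral_le)
    show "(\<lambda>v. (\<delta> - v) * (exp (- (\<beta> * (u + v))) + exp (- (\<beta> * (u - v))))) integrable_on {0..\<delta>}"
      by (intro integrable_continuous_interval continuous_intros)
    show "(\<lambda>v. 2 * exp (- (\<beta> * (u - \<delta>))) * (\<delta> - v)) integrable_on {0..\<delta>}"
      by (intro integrable_continuous_interval continuous_intros)
    fix v assume v: "v \<in> {0..\<delta>}"
    have "exp (- (\<beta> * (u + v))) \<le> exp (- (\<beta> * (u - \<delta>)))" "exp (- (\<beta> * (u - v))) \<le> exp (- (\<beta> * (u - \<delta>)))"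
      using v assms by (auto intro!: mult_left_mono)
    hence "exp (- (\<beta> * (u + v))) + exp (- (\<beta> * (u - v))) \<le> 2 * exp (- (\<beta> * (u - \<delta>)))" by argo
    hence "(\<delta> - v) * (exp (- (\<beta> * (u + v))) + exp (- (\<beta> * (u - v)))) \<le> (\<delta> - v) * (2 * exp (- (\<beta> * (u - \<delta>))))"
      using v by (intro mult_left_mono) auto
    thus "(\<delta> - v) * (exp (- (\<beta> * (u + v))) + exp (- (\<beta> * (u - v)))) \<le> 2 * exp (- (\<beta> * (u - \<delta>))) * (\<delta> - v)"
      by (simp only: mult.commute)
  qed
  also have "\<dots> = 2 * exp (- (\<beta> * (u - \<delta>))) * (\<delta>\<^sup>2 / 2)"
    by (intro integral_unique has_integral_mult_right integral_ramp) (use assms in simp)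
  finally show ?thesis by simp
qed

text \<open>The tent is symmetric about \<open>u\<close>, and
  \<open>exp (\<beta> * v) + exp (- (\<beta> * v)) \<ge> 2\<close>, so averaging never falls below
  the value at the centre. For \<open>\<beta> = \<sigma> - 1 / 2\<close> this is the main term of
  the whole estimate.\<close>

lemma Nint_ge:
  assumes "\<delta> > 0"
  shows "Nint \<delta> u \<beta> \<ge> exp (- (\<beta> * u)) * \<delta>\<^sup>2"
proof -
  have "2 * exp (- (\<beta> * u)) * (\<delta>\<^sup>2 / 2) = integral {0..\<delta>} (\<lambda>v. 2 * exp (- (\<beta> * u)) * (\<delta> - v))"
    by (intro integral_unique[symmetric] has_integral_mult_right integral_ramp) (use assms in simp)
  also have "\<dots> \<le> Nint \<delta> u \<beta>"
    unfolding Nint_def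
  proof (rule integral_le)
    show "(\<lambda>v. (\<delta> - v) * (exp (- (\<beta> * (u + v))) + exp (- (\<beta> * (u - v))))) integrable_on {0..\<delta>}"
      by (intro integrable_continuous_interval continuous_intros)
    show "(\<lambda>v. 2 * exp (- (\<beta> * u)) * (\<delta> - v)) integrable_on {0..\<delta>}"
      by (intro integrable_continuous_interval continuous_intros)
    fix v assume v: "v \<in> {0..\<delta>}"
    have "exp (- (\<beta> * (u + v))) + exp (- (\<beta> * (u - v))) = exp (- (\<beta> * u)) * (exp (- (\<beta> * v)) + exp (\<beta> * v))"
      by (simp add: distrib_left exp_add[symmetric] algebra_simps)
    also have "exp (- (\<beta> * v)) + exp (\<beta> * v) \<ge> 2"
      using exp_ge_add_one_self[of "\<beta> * v"] exp_ge_add_one_self[of "- (\<beta> * v)"] by linarith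
    hence "exp (- (\<beta> * u)) * (exp (- (\<beta> * v)) + exp (\<beta> * v)) \<ge> exp (- (\<beta> * u)) * 2" by (intro mult_left_mono) auto
    finally have "(\<delta> - v) * (exp (- (\<beta> * u)) * 2) \<le> (\<delta> - v) * (exp (- (\<beta> * (u + v))) + exp (- (\<beta> * (u - v))))"
      using v by (intro mult_left_mono) auto
    thus "2 * exp (- (\<beta> * u)) * (\<delta> - v) \<le> (\<delta> - v) * (exp (- (\<beta> * (u + v))) + exp (- (\<beta> * (u - v))))"
      by (simp only: mult_ac)
  qed
  finally show ?thesis by simp
qed

section \<open>The contribution of the Gamma factor\<close>

lemma two_times_le_ln_ratio:
  assumes "0 \<le> z" "z < (1::real)"
  shows "2 * z \<le> ln (1 + z) - ln (1 - z)"
proof -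
  define f where "f = (\<lambda>z::real. ln (1 + z) - ln (1 - z) - 2 * z)"
  have "f 0 \<le> f z"
  proof (rule DERIV_nonneg_imp_nondecreasing[OF assms(1)])
    fix y assume y: "0 \<le> y" "y \<le> z"
    have p: "1 + y > 0" "1 - y > 0" using y assms by auto
    have "(f has_real_derivative (1 / (1 + y) + 1 / (1 - y) - 2)) (at y)"
      unfolding f_def using p by (auto intro!: derivative_eq_intros)
    moreover have "1 / (1 + y) + 1 / (1 - y) - 2 = 2 * y\<^sup>2 / ((1 + y) * (1 - y))"
      using p by (simp add: divide_simps) (simp add: power2_eq_square algebra_simps)
    moreover have "2 * y\<^sup>2 / ((1 + y) * (1 - y)) \<ge> 0" using p by (intro divide_nonneg_nonneg mult_nonneg_nonneg) auto
    ultimately show "\<exists>d. (f has_real_derivative d) (at y) \<and> 0 \<le> d" by metis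
  qed
  thus ?thesis by (simp add: f_def)
qed

text \<open>The function \<open>1 / t\<close> is convex, so its value at the midpoint is at most its
  mean over an interval of length 1. The right-hand side telescopes in \<open>n\<close>.\<close>

lemma midpoint_ln: "1 / (real n + 5 / 4) \<le> ln (real n + 7 / 4) - ln (real n + 3 / 4)"
proof -
  define a where "a = real n + 5 / 4"
  define z where "z = (1 / 2) / a"
  have a: "a > 1" by (simp add: a_def)
  have z: "0 \<le> z" "z < 1" using a by (auto simp: z_def)
  have az: "a * z = 1 / 2" using a by (simp add: z_def)
  have "2 * z \<le> ln (1 + z) - ln (1 - z)" by (rule two_times_le_ln_ratio[OF z])
  moreover have "real n + 7 / 4 = a * (1 + z)" "real n + 3 / 4 = a * (1 - z)"
    unfolding distrib_left right_diff_distrib az by (simp_all add: a_def)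
  moreover have "ln (a * (1 + z)) = ln a + ln (1 + z)" "ln (a * (1 - z)) = ln a + ln (1 - z)"
    using a z by (simp_all add: ln_mult)
  moreover have "2 * z = 1 / a" unfolding z_def by (simp only: times_divide_eq_right mult_1_right nonzero_mult_div_cancel_left)
  ultimately have "1 / a \<le> ln (real n + 7 / 4) - ln (real n + 3 / 4)" by (simp only: )
  thus ?thesis by (simp only: a_def)
qed

lemma arch_majorant_sums:
  fixes \<delta> :: real and N :: nat
  defines "c \<equiv> \<lambda>n. if n < N then \<delta> * (ln (real n + 7 / 4) - ln (real n + 3 / 4))
      else (1 / 2) * (1 / (real n + 3 / 4) - 1 / (real n + 7 / 4))"
  shows "c sums (\<delta> * (ln (real N + 3 / 4) - ln (3 / 4)) + 1 / 2 * (1 / (real N + 3 / 4)))"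
proof -
  have "(\<lambda>n. 1 / (real n + real N + 3 / 4)) \<longlonglongrightarrow> 0" by real_asymp
  from telescope_sums'[OF this]
  have "(\<lambda>n. 1 / (real n + real N + 3 / 4) - 1 / (real (Suc n) + real N + 3 / 4)) sums (1 / (real N + 3 / 4) - 0)"
    by simp
  from sums_mult[OF this, of "1 / 2"]
  have "(\<lambda>n. c (n + N)) sums (1 / 2 * (1 / (real N + 3 / 4)))"
    by (simp add: c_def add_ac)
  moreover have "(\<Sum>n<N. c n) = \<delta> * (ln (real N + 3 / 4) - ln (3 / 4))"
  proof -
    have "(\<Sum>n<N. c n) = (\<Sum>n<N. \<delta> * ln (real (Suc n) + 3 / 4) - \<delta> * ln (real n + 3 / 4))"
      by (intro sum.cong refl) (simp add: c_def right_diff_distrib add_ac)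
    also have "\<dots> = \<delta> * ln (real N + 3 / 4) - \<delta> * ln (real 0 + 3 / 4)"
      by (rule sum_lessThan_telescope)
    finally show ?thesis by (simp add: right_diff_distrib)
  qed
  ultimately have "c sums (1 / 2 * (1 / (real N + 3 / 4)) + \<delta> * (ln (real N + 3 / 4) - ln (3 / 4)))"
    using sums_iff_shift[of c N "1 / 2 * (1 / (real N + 3 / 4))"] by metis
  thus ?thesis by (simp only: add.commute)
qed

text \<open>Equivalent to \<open>exp 9 \<le> pi ^ 8\<close>. Together with
  \<open>euler_mascheroni > 19 / 33\<close> it yields
  \<open>ln pi + euler_mascheroni \<ge> 1.7\<close>.\<close>

lemma ln_pi_ge: "ln pi \<ge> 9 / 8"
proof -
  have "exp (1::real) < 272 / 100" by (rule e_less_272)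
  hence "exp (1::real) ^ 9 \<le> (272 / 100) ^ 9" by (intro power_mono) auto
  also have "(272 / 100 :: real) ^ 9 \<le> 3.14 ^ 8" by (simp add: eval_nat_numeral)
  also have "(3.14 :: real) ^ 8 \<le> pi ^ 8" using pi_approx by (intro power_mono) auto
  finally have "exp (9::real) \<le> pi ^ 8" by (simp flip: exp_of_nat_mult)
  hence "ln (exp (9::real)) \<le> ln (pi ^ 8)" by (subst ln_le_cancel_iff) auto
  thus ?thesis by (simp add: ln_realpow)
qed

lemma exp_minus_le: "y > 0 \<Longrightarrow> exp (- y) \<le> 2 / (y::real)\<^sup>2"
proof -
  assume y: "y > 0"
  have "y\<^sup>2 / 2 \<le> exp y" using exp_lower_Taylor_quadratic[of y] y by simp
  thus ?thesis using y by (simp add: exp_minus field_simps)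
qed

text \<open>Majorant for \<open>2 * (1 - exp (- (b * \<delta>))) / b^2\<close>, where
  \<open>b\<close> is at least \<open>2 * n + 5 / 2\<close>. While \<open>b * \<delta>\<close> is
  small, the numerator is bounded through \<open>b * \<delta>\<close>, afterwards through 1;
  \<open>N\<close> is the switching point. Both branches are differences, so the sum
  telescopes.\<close>

definition arch_majorant :: "real \<Rightarrow> nat \<Rightarrow> nat \<Rightarrow> real" where
  "arch_majorant \<delta> N n = (if n < N then \<delta> * (ln (real n + 7 / 4) - ln (real n + 3 / 4))
      else (1 / 2) * (1 / (real n + 3 / 4) - 1 / (real n + 7 / 4)))"

text \<open>Written out, the term consists of \<open>\<delta> / m - 2 * (\<delta> / b)\<close>, the
  quantity bounded by \<open>arch_majorant\<close>, and \<open>Nint\<close>. The first and the last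
  are of order \<open>1 / m^2\<close>; for the last, \<open>u - \<delta> \<ge> 3\<close> gives
  \<open>exp (- (6 * m)) \<le> 1 / (18 * m^2)\<close>.\<close>

lemma arch_term_le:
  fixes n :: nat
  assumes \<delta>: "0 < \<delta>" and u: "u \<ge> \<delta> + 3" and \<sigma>: "\<sigma> > 0"
  shows "qtri \<delta> u 0 / (2 * real (Suc n)) - Lap \<delta> u (\<sigma> + (2 * real n + 5 / 2))
    \<le> (\<delta> * (1 + 2 * \<sigma>) / 4 + \<delta>\<^sup>2 / 18) * (1 / (real n + 1)\<^sup>2) + arch_majorant \<delta> N n"
proof -
  define b where "b = \<sigma> + (2 * real n + 5 / 2)"
  define m where "m = real n + 1"
  have m: "m \<ge> 1" by (simp add: m_def)
  have b: "b > 0" "b \<ge> 2 * m" "b = 2 * m + (1 / 2 + \<sigma>)" using \<sigma> by (auto simp: b_def m_def)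
  have q: "qtri \<delta> u 0 = 2 * \<delta>" using \<delta> u by (simp add: qtri_def tri_def)
  have "Lap \<delta> u b = 2 * Mint \<delta> b - Nint \<delta> u b" by (rule Lap_eq) (use \<delta> u in auto)
  also have "Mint \<delta> b = \<delta> / b - (1 - exp (- (b * \<delta>))) / b\<^sup>2" by (rule Mint_eq) (use b \<delta> in auto)
  finally have L: "Lap \<delta> u b = 2 * (\<delta> / b) - 2 * ((1 - exp (- (b * \<delta>))) / b\<^sup>2) - Nint \<delta> u b" by simp
  have 1: "\<delta> / m - 2 * (\<delta> / b) \<le> \<delta> * (1 + 2 * \<sigma>) / 4 * (1 / m\<^sup>2)"
  proof -
    have "\<delta> / m - 2 * (\<delta> / b) = \<delta> * (1 / 2 + \<sigma>) / (m * b)"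
      using m b by (simp add: divide_simps) (simp add: b(3) algebra_simps)
    also have "\<dots> \<le> \<delta> * (1 / 2 + \<sigma>) / (m * (2 * m))"
      using m b \<delta> \<sigma> by (intro divide_left_mono mult_left_mono mult_pos_pos) auto
    also have "\<dots> = \<delta> * (1 + 2 * \<sigma>) / 4 * (1 / m\<^sup>2)"
      using m by (simp add: field_simps power2_eq_square)
    finally show ?thesis .
  qed
  have 2: "2 * ((1 - exp (- (b * \<delta>))) / b\<^sup>2) \<le> arch_majorant \<delta> N n"
  proof (cases "n < N")
    case True
    have "(1 - exp (- (b * \<delta>))) / b\<^sup>2 \<le> b * \<delta> / b\<^sup>2"
      using exp_ge_add_one_self[of "- (b * \<delta>)"] by (intro divide_right_mono) auto
    also have "b * \<delta> / b\<^sup>2 = \<delta> * (1 / b)" using b by (simp add: power2_eq_square)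
    also have "\<dots> \<le> \<delta> * (1 / (2 * (real n + 5 / 4)))"
      using \<delta> \<sigma> by (intro mult_left_mono divide_left_mono) (auto simp: b_def)
    also have "\<delta> * (1 / (2 * (real n + 5 / 4))) = \<delta> * (1 / (real n + 5 / 4)) / 2"
      by (simp only: times_divide_eq_right divide_divide_eq_left mult.commute mult_1_right)
    finally have "2 * ((1 - exp (- (b * \<delta>))) / b\<^sup>2) \<le> \<delta> * (1 / (real n + 5 / 4))"
      by (simp only: le_divide_eq_numeral1 mult.commute)
    also have "\<dots> \<le> \<delta> * (ln (real n + 7 / 4) - ln (real n + 3 / 4))"
      by (intro mult_left_mono midpoint_ln) (use \<delta> in simp)
    finally show ?thesis using True by (simp add: arch_majorant_def)
  next
    case False
    define a where "a = real n + 5 / 4"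
    have a: "a > 1" by (simp add: a_def)
    have "(1 - exp (- (b * \<delta>))) / b\<^sup>2 \<le> 1 / (2 * a)\<^sup>2"
      using \<sigma> a by (intro frac_le power_mono) (auto simp: b_def a_def)
    also have "1 / (2 * a)\<^sup>2 = 1 / 2 * (1 / a\<^sup>2) / 2" by (simp add: power_mult_distrib)
    finally have "2 * ((1 - exp (- (b * \<delta>))) / b\<^sup>2) \<le> 1 / 2 * (1 / a\<^sup>2)"
      by (simp only: le_divide_eq_numeral1 mult.commute)
    also have "1 / a\<^sup>2 \<le> 1 / ((a - 1 / 2) * (a + 1 / 2))"
      using a by (intro divide_left_mono mult_pos_pos) (auto simp: algebra_simps power2_eq_square)
    also have "\<dots> = 1 / (a - 1 / 2) - 1 / (a + 1 / 2)"
    proof -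
      have "1 / (a - 1 / 2) - 1 / (a + 1 / 2) = ((a + 1 / 2) - (a - 1 / 2)) / ((a - 1 / 2) * (a + 1 / 2))"
        by (subst diff_frac_eq) (use a in auto)
      also have "(a + 1 / 2) - (a - 1 / 2) = 1" by simp
      finally show ?thesis by simp
    qed
    also have "a - 1 / 2 = real n + 3 / 4" by (simp add: a_def)
    also have "a + 1 / 2 = real n + 7 / 4" by (simp add: a_def)
    finally show ?thesis using False by (simp add: arch_majorant_def)
  qed
  have 3: "Nint \<delta> u b \<le> \<delta>\<^sup>2 / 18 * (1 / m\<^sup>2)"
  proof -
    have "Nint \<delta> u b \<le> exp (- (b * (u - \<delta>))) * \<delta>\<^sup>2" by (rule Nint_le) (use b \<delta> u in auto)
    also have "exp (- (b * (u - \<delta>))) * \<delta>\<^sup>2 \<le> exp (- ((2 * m) * 3)) * \<delta>\<^sup>2"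
    proof -
      have "(2 * m) * 3 \<le> b * (u - \<delta>)" by (rule mult_mono) (use b m u in auto)
      thus ?thesis by (intro mult_right_mono) auto
    qed
    also have "\<dots> \<le> 2 / ((2 * m) * 3)\<^sup>2 * \<delta>\<^sup>2"
      by (intro mult_right_mono exp_minus_le) (use m in auto)
    finally show ?thesis by (simp add: power_mult_distrib mult_ac)
  qed
  have "2 * \<delta> / (2 * real (Suc n)) = \<delta> / real (Suc n)" by (rule mult_divide_mult_cancel_left) simp
  hence "qtri \<delta> u 0 / (2 * real (Suc n)) = \<delta> / m" by (simp only: q m_def of_nat_Suc add.commute)
  hence "qtri \<delta> u 0 / (2 * real (Suc n)) - Lap \<delta> u b =
      (\<delta> / m - 2 * (\<delta> / b)) + 2 * ((1 - exp (- (b * \<delta>))) / b\<^sup>2) + Nint \<delta> u b"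
    unfolding L by argo
  also have "\<dots> \<le> \<delta> * (1 + 2 * \<sigma>) / 4 * (1 / m\<^sup>2) + arch_majorant \<delta> N n + \<delta>\<^sup>2 / 18 * (1 / m\<^sup>2)"
    by (intro add_mono 1 2 3)
  finally show ?thesis by (simp only: b_def m_def distrib_right add_ac)
qed

lemma arch_sum_le:
  assumes \<delta>: "0 < \<delta>" "\<delta> \<le> 1 / 3" and u: "u \<ge> \<delta> + 3" and \<sigma>: "\<sigma> > 0"
    and D: "(\<lambda>n. qtri \<delta> u 0 / (2 * real (Suc n)) - Lap \<delta> u (\<sigma> + (2 * real n + 5 / 2))) sums D"
  shows "D \<le> \<delta> * (1.012 + \<sigma> + 2.1 * \<delta> - ln \<delta>)"
proof -
  \<comment> \<open>The bounds switch where \<open>2 * (n + 3 / 4)\<close> reaches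
    \<open>1 / \<delta>\<close>. The logarithm accumulated up to there produces
    \<open>- ln \<delta>\<close>.\<close>
  define N where "N = nat \<lceil>1 / (2 * \<delta>) - 3 / 4\<rceil>"
  define y where "y = real N + 3 / 4"
  have d: "1 / (2 * \<delta>) \<ge> 3 / 2" using \<delta> by (simp add: field_simps)
  have y: "y \<ge> 1 / (2 * \<delta>)" "y \<le> 1 / (2 * \<delta>) + 1"
    using d unfolding y_def N_def by linarith+
  have y0: "y > 0" using y d by linarith
  have "(\<lambda>n. (\<delta> * (1 + 2 * \<sigma>) / 4 + \<delta>\<^sup>2 / 18) * (1 / (real n + 1)\<^sup>2) + arch_majorant \<delta> N n) sums
     ((\<delta> * (1 + 2 * \<sigma>) / 4 + \<delta>\<^sup>2 / 18) * (pi\<^sup>2 / 6) + (\<delta> * (ln y - ln (3 / 4)) + 1 / 2 * (1 / y)))"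
    unfolding y_def arch_majorant_def using inverse_squares_sums
    by (intro sums_add sums_mult arch_majorant_sums) (simp add: add_ac)
  hence "D \<le> (\<delta> * (1 + 2 * \<sigma>) / 4 + \<delta>\<^sup>2 / 18) * (pi\<^sup>2 / 6) + (\<delta> * (ln y - ln (3 / 4)) + 1 / 2 * (1 / y))"
    using arch_term_le[OF \<delta>(1) u \<sigma>] by (rule sums_le[OF _ D, rotated])
  also have "(\<delta> * (1 + 2 * \<sigma>) / 4 + \<delta>\<^sup>2 / 18) * (pi\<^sup>2 / 6) \<le> (\<delta> * (1 + 2 * \<sigma>) / 4 + \<delta>\<^sup>2 / 18) * 1.646"
  proof (intro mult_left_mono)
    have "pi\<^sup>2 \<le> 3.142\<^sup>2" using pi_approx pi_gt_zero by (intro power_mono) auto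
    thus "pi\<^sup>2 / 6 \<le> 1.646" by (simp add: power2_eq_square)
  qed (use \<delta> \<sigma> in auto)
  also have "1 / 2 * (1 / y) \<le> \<delta>"
    using y y0 \<delta> by (simp add: field_simps)
  also have "\<delta> * (ln y - ln (3 / 4)) \<le> \<delta> * (2 * \<delta> - ln \<delta> - 2 / 5)"
  proof (intro mult_left_mono)
    have "ln y \<le> ln (1 / (2 * \<delta>) + 1)" using y y0 by (subst ln_le_cancel_iff) auto
    also have "1 / (2 * \<delta>) + 1 = (1 / 2) * (1 / \<delta>) * (1 + 2 * \<delta>)" using \<delta> by (simp add: field_simps)
    also have "ln \<dots> = ln (1 / 2) + ln (1 / \<delta>) + ln (1 + 2 * \<delta>)"
      using \<delta> by (simp only: ln_mult mult_pos_pos zero_less_divide_iff) (simp add: ln_mult)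
    also have "ln (1 / \<delta>) = - ln \<delta>" using \<delta> by (simp add: ln_div)
    also have "ln (1 + 2 * \<delta>) \<le> 2 * \<delta>" using \<delta> by (intro ln_add_one_self_le_self) auto
    finally have A: "ln y \<le> ln (1 / 2) - ln \<delta> + 2 * \<delta>" by simp
    have "2 / 5 \<le> ln (6 / 5) - ln (4 / 5 :: real)"
      using two_times_le_ln_ratio[of "1 / 5"] by simp
    also have "\<dots> = ln (6 / 5 / (4 / 5) :: real)" by (subst ln_div) auto
    also have "6 / 5 / (4 / 5) = 3 / 4 / (1 / 2 :: real)" by simp
    also have "ln \<dots> = ln (3 / 4) - ln (1 / 2)" by (subst ln_div) auto
    finally show "ln y - ln (3 / 4) \<le> 2 * \<delta> - ln \<delta> - 2 / 5" using A by argo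
  qed (use \<delta> in auto)
  finally have "D \<le> (\<delta> * (1 + 2 * \<sigma>) / 4 + \<delta>\<^sup>2 / 18) * 1.646 + (\<delta> * (2 * \<delta> - ln \<delta> - 2 / 5) + \<delta>)" by simp
  \<comment> \<open>With 1.646 for \<open>pi^2 / 6\<close>: 0.823 is 1.646 / 2, and 1.0115 is 1.646
    / 4 + 1 - 2 / 5.\<close>
  also have "\<dots> = \<delta> * (1.0115 + 0.823 * \<sigma> + (2 + 1.646 / 18) * \<delta> - ln \<delta>)"
    by (simp add: power2_eq_square algebra_simps add_divide_distrib)
  also have "\<dots> \<le> \<delta> * (1.012 + \<sigma> + 2.1 * \<delta> - ln \<delta>)"
  proof (intro mult_left_mono)
    show "1.0115 + 0.823 * \<sigma> + (2 + 1.646 / 18) * \<delta> - ln \<delta> \<le> 1.012 + \<sigma> + 2.1 * \<delta> - ln \<delta>"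
      using \<delta> \<sigma> by simp
  qed (use \<delta> in auto)
  finally show ?thesis .
qed

text \<open>Everything in the explicit inequality except the prime powers near \<open>exp u\<close>
  is estimated, then \<sigma> tends to 0. Of the constants, 0.688 is 1.7 - 1.012, lowered to 0.68 at
  the end, and 3.3 is 1.2 + 2.1.\<close>

theorem RH_weighted_sum_lower_bound:
  assumes RH: riemann_hypothesis and \<delta>: "0 < \<delta>" "\<delta> \<le> 1 / 3" and u: "u \<ge> \<delta> + 3"
  shows "(\<Sum>n\<in>{1..nat \<lfloor>exp (u + \<delta>)\<rfloor>}. mangoldt n / sqrt (real n) * tri \<delta> (ln (real n) - u))
    \<ge> \<delta> * (\<delta> * exp (u / 2) + ln \<delta> + 0.68 - 3.3 * \<delta>)"
proof -
  define I where "I = {1..nat \<lfloor>exp (u + \<delta>)\<rfloor>}"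
  define p :: "nat \<Rightarrow> real" where "p = (\<lambda>n. mangoldt n / sqrt (real n) * tri \<delta> (ln (real n) - u))"
  have p0: "p n = 0" if "n \<notin> I" for n
  proof (cases "n = 0")
    case False
    have "real n > exp (u + \<delta>)"
    proof -
      have "n > nat \<lfloor>exp (u + \<delta>)\<rfloor>" using that False by (auto simp: I_def)
      thus ?thesis by linarith
    qed
    hence "ln (real n) > u + \<delta>" using False by (subst ln_exp[symmetric], subst ln_less_cancel_iff) auto
    thus ?thesis by (simp add: p_def tri_def max_def)
  qed (simp add: p_def)
  have ps: "p sums (\<Sum>n\<in>I. p n)" by (rule sums_finite) (use p0 in \<open>auto simp: I_def\<close>)
  have main: "\<delta> * (\<delta> * exp ((1 / 2 - \<sigma>) * u) + ln \<delta> + 0.688 - \<sigma> - 3.3 * \<delta>) \<le> (\<Sum>n\<in>I. p n)" if \<sigma>: "0 < \<sigma>" "\<sigma> < 1 / 2" for \<sigma>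
  proof -
    obtain D S where D: "(\<lambda>n. qtri \<delta> u 0 / (2 * real (Suc n)) - Lap \<delta> u (\<sigma> + (2 * real n + 5 / 2))) sums D"
      and S: "(\<lambda>n. mangoldt n * (real n powr (- 1 / 2 - \<sigma>) * qtri \<delta> u (ln (real n)))) sums S"
      and ineq: "0 \<le> Lap \<delta> u (\<sigma> - 1 / 2) - (ln pi + euler_mascheroni) / 2 * qtri \<delta> u 0 + D - S"
      using RH_explicit_inequality[OF RH \<sigma> \<delta>(1), of u] u \<delta> by auto
    have SP: "- S \<le> (\<Sum>n\<in>I. p n)"
    proof (rule sums_le[OF _ sums_minus[OF S] ps])
      fix n :: nat
      show "- (mangoldt n * (real n powr (- 1 / 2 - \<sigma>) * qtri \<delta> u (ln (real n)))) \<le> p n"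
      proof (cases "n = 0")
        case False
        have "ln (real n) \<ge> 0" using False by simp
        hence "tri \<delta> (ln (real n) + u) = 0" using u by (simp add: tri_def)
        \<comment> \<open>Dropping the tent at 0 costs nothing: for \<open>n \<ge> 2\<close> it
          vanishes at \<open>ln n\<close> since \<open>\<delta> \<le> 1 / 3\<close>, and
          \<open>mangoldt 1\<close> is 0.\<close>
        hence q: "- qtri \<delta> u (ln (real n)) \<le> tri \<delta> (ln (real n) - u)"
          using tri_nonneg[of \<delta> "ln (real n)"] unfolding qtri_def by argo
        have "real n powr (- 1 / 2 - \<sigma>) * (- qtri \<delta> u (ln (real n))) \<le> real n powr (- 1 / 2 - \<sigma>) * tri \<delta> (ln (real n) - u)"
          by (intro mult_left_mono q) auto
        also have "\<dots> \<le> 1 / sqrt (real n) * tri \<delta> (ln (real n) - u)"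
        proof (intro mult_right_mono)
          have "real n powr (- 1 / 2 - \<sigma>) \<le> real n powr (- (1 / 2))"
            using False \<sigma> by (intro powr_mono) auto
          also have "\<dots> = 1 / sqrt (real n)" by (simp add: powr_minus powr_half_sqrt inverse_eq_divide)
          finally show "real n powr (- 1 / 2 - \<sigma>) \<le> 1 / sqrt (real n)" .
        qed simp
        finally have "mangoldt n * (real n powr (- 1 / 2 - \<sigma>) * (- qtri \<delta> u (ln (real n)))) \<le> mangoldt n * (1 / sqrt (real n) * tri \<delta> (ln (real n) - u))"
          by (intro mult_left_mono mangoldt_nonneg)
        thus ?thesis by (simp add: p_def)
      qed (simp add: p_def)
    qed
    have D': "D \<le> \<delta> * (1.012 + \<sigma> + 2.1 * \<delta> - ln \<delta>)"
      by (rule arch_sum_le[OF \<delta> u \<sigma>(1) D])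
    have q: "qtri \<delta> u 0 = 2 * \<delta>" using \<delta> u by (simp add: qtri_def tri_def)
    have L1: "Lap \<delta> u (\<sigma> - 1 / 2) = 2 * Mint \<delta> (\<sigma> - 1 / 2) - Nint \<delta> u (\<sigma> - 1 / 2)"
      by (rule Lap_eq) (use \<delta> u in auto)
    have "Mint \<delta> (\<sigma> - 1 / 2) \<le> exp (\<delta> / 2) * (\<delta>\<^sup>2 / 2)" by (rule Mint_le) (use \<sigma> \<delta> in auto)
    \<comment> \<open>1.2 is a bound for 1 + 1 / 6 + (1 / 6)^2, taken at the largest
      \<delta>.\<close>
    also have "exp (\<delta> / 2) * (\<delta>\<^sup>2 / 2) \<le> 1.2 * (\<delta>\<^sup>2 / 2)"
    proof (intro mult_right_mono)
      have "exp (\<delta> / 2) \<le> 1 + \<delta> / 2 + (\<delta> / 2)\<^sup>2" by (rule exp_bound) (use \<delta> in auto)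
      also have "(\<delta> / 2)\<^sup>2 \<le> (1 / 6)\<^sup>2" using \<delta> by (intro power_mono) auto
      finally show "exp (\<delta> / 2) \<le> 1.2" using \<delta> by (simp add: power2_eq_square)
    qed simp
    finally have L2: "Mint \<delta> (\<sigma> - 1 / 2) \<le> 1.2 * (\<delta>\<^sup>2 / 2)" .
    have "Nint \<delta> u (\<sigma> - 1 / 2) \<ge> exp (- ((\<sigma> - 1 / 2) * u)) * \<delta>\<^sup>2" by (rule Nint_ge) (use \<delta> in simp)
    also have "- ((\<sigma> - 1 / 2) * u) = (1 / 2 - \<sigma>) * u" by (simp add: algebra_simps)
    finally have L: "Lap \<delta> u (\<sigma> - 1 / 2) \<le> 1.2 * \<delta>\<^sup>2 - exp ((1 / 2 - \<sigma>) * u) * \<delta>\<^sup>2"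
      using L1 L2 by linarith
    have "(ln pi + euler_mascheroni) / 2 * (2 * \<delta>) \<ge> 1.7 / 2 * (2 * \<delta>)"
      using ln_pi_ge euler_mascheroni_gt_19_over_33 \<delta> by (intro mult_right_mono) auto
    hence "1.7 * \<delta> \<le> 1.2 * \<delta>\<^sup>2 - exp ((1 / 2 - \<sigma>) * u) * \<delta>\<^sup>2 + \<delta> * (1.012 + \<sigma> + 2.1 * \<delta> - ln \<delta>) + (\<Sum>n\<in>I. p n)"
      using ineq L D' SP unfolding q by argo
    thus ?thesis by (simp add: algebra_simps power2_eq_square)
  qed
  have "((\<lambda>\<sigma>. \<delta> * (\<delta> * exp ((1 / 2 - \<sigma>) * u) + ln \<delta> + 0.688 - \<sigma> - 3.3 * \<delta>)) \<longlongrightarrow>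
     \<delta> * (\<delta> * exp ((1 / 2 - 0) * u) + ln \<delta> + 0.688 - 0 - 3.3 * \<delta>)) (at_right 0)"
    by (intro tendsto_intros)
  moreover have "\<forall>\<^sub>F \<sigma> in at_right 0. \<delta> * (\<delta> * exp ((1 / 2 - \<sigma>) * u) + ln \<delta> + 0.688 - \<sigma> - 3.3 * \<delta>) \<le> (\<Sum>n\<in>I. p n)"
    using main unfolding eventually_at_right_field by (intro exI[of _ "1 / 2"]) auto
  ultimately have "\<delta> * (\<delta> * exp ((1 / 2 - 0) * u) + ln \<delta> + 0.688 - 0 - 3.3 * \<delta>) \<le> (\<Sum>n\<in>I. p n)"
    by (intro tendsto_upperbound[of _ _ "at_right 0"]) auto
  moreover have "\<delta> * (\<delta> * exp (u / 2) + ln \<delta> + 0.68 - 3.3 * \<delta>) \<le> \<delta> * (\<delta> * exp ((1 / 2 - 0) * u) + ln \<delta> + 0.688 - 0 - 3.3 * \<delta>)"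
    using \<delta> by (intro mult_left_mono) auto
  ultimately show ?thesis unfolding I_def p_def by linarith
qed

section \<open>Prime powers and single primes in the weighted sum\<close>

lemma card_nat_le_real:
  assumes "c \<ge> 0"
  shows "finite {q::nat. 0 < q \<and> real q \<le> c}" "real (card {q::nat. 0 < q \<and> real q \<le> c}) \<le> c"
proof -
  have "{q::nat. 0 < q \<and> real q \<le> c} \<subseteq> {1..nat \<lfloor>c\<rfloor>}" using assms by (auto simp: le_nat_floor)
  hence "finite {q::nat. 0 < q \<and> real q \<le> c}" "card {q::nat. 0 < q \<and> real q \<le> c} \<le> card {1..nat \<lfloor>c\<rfloor>}"
    by (auto intro: finite_subset dest: card_mono[rotated])
  moreover have "real (card {1..nat \<lfloor>c\<rfloor>}) \<le> c" using assms by simp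
  ultimately show "finite {q::nat. 0 < q \<and> real q \<le> c}" "real (card {q::nat. 0 < q \<and> real q \<le> c}) \<le> c"
    by linarith+
qed

lemma card_nat_between:
  fixes a b :: real
  assumes "0 \<le> a" "a \<le> b"
  shows "finite {q::nat. a < real q \<and> real q < b}" "real (card {q::nat. a < real q \<and> real q < b}) \<le> b - a + 1"
proof -
  have sub: "{q::nat. a < real q \<and> real q < b} \<subseteq> {nat \<lfloor>a\<rfloor> + 1..nat \<lfloor>b\<rfloor>}"
  proof
    fix q assume "q \<in> {q::nat. a < real q \<and> real q < b}"
    hence q: "a < real q" "real q < b" by auto
    show "q \<in> {nat \<lfloor>a\<rfloor> + 1..nat \<lfloor>b\<rfloor>}" using q assms by (simp add: le_nat_floor Suc_le_eq nat_less_iff floor_less_iff)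
  qed
  show "finite {q::nat. a < real q \<and> real q < b}" by (rule finite_subset[OF sub]) simp
  have "card {q::nat. a < real q \<and> real q < b} \<le> card {nat \<lfloor>a\<rfloor> + 1..nat \<lfloor>b\<rfloor>}" by (rule card_mono[OF _ sub]) simp
  hence "real (card {q::nat. a < real q \<and> real q < b}) \<le> real (nat \<lfloor>b\<rfloor> - nat \<lfloor>a\<rfloor>)" by simp
  also have "\<dots> \<le> b - a + 1"
  proof -
    have "nat \<lfloor>a\<rfloor> \<le> nat \<lfloor>b\<rfloor>" using assms by (intro nat_mono floor_mono)
    hence "real (nat \<lfloor>b\<rfloor> - nat \<lfloor>a\<rfloor>) = real (nat \<lfloor>b\<rfloor>) - real (nat \<lfloor>a\<rfloor>)" by (rule of_nat_diff)
    also have "\<dots> \<le> b - a + 1" using assms by linarith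
    finally show ?thesis .
  qed
  finally show "real (card {q::nat. a < real q \<and> real q < b}) \<le> b - a + 1" .
qed

text \<open>Squares have their base between \<open>sqrt A\<close> and \<open>sqrt B\<close> and
  weigh at most \<open>ln B / 2\<close> each. For higher powers the base is at most
  \<open>c\<close>, a bound for the cube root of \<open>B\<close>; a base \<open>q\<close> has at
  most \<open>ln B / ln q\<close> such powers below \<open>B\<close>, so together they weigh at most
  \<open>ln B\<close>.\<close>

lemma sum_mangoldt_prime_powers_le:
  fixes A B c :: real
  assumes A: "1 \<le> A" "A \<le> B" and c: "c \<ge> 0" "B \<le> c ^ 3"
  shows "(\<Sum>n | A < real n \<and> real n < B \<and> \<not> prime n. mangoldt n :: real) \<le> ln B * ((sqrt B - sqrt A + 1) / 2 + c)"
proof -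
  define J where "J = {n. A < real n \<and> real n < B \<and> \<not> prime n}"
  define Q where "Q = {q::nat. prime q \<and> real q \<le> c}"
  define K where "K = (\<lambda>q::nat. {k::nat. 3 \<le> k \<and> real q ^ k < B})"
  define Q2 where "Q2 = {q::nat. prime q \<and> sqrt A < real q \<and> real q < sqrt B}"
  have B: "B \<ge> 1" "ln B \<ge> 0" using A by auto
  have "Q \<subseteq> {q. 0 < q \<and> real q \<le> c}" by (auto simp: Q_def prime_gt_0_nat)
  hence Q: "finite Q" "real (card Q) \<le> c"
    using card_nat_le_real[OF c(1)] card_mono[of "{q. 0 < q \<and> real q \<le> c}" Q] by (auto intro: finite_subset)
  have "0 \<le> sqrt A" "sqrt A \<le> sqrt B" using A by auto
  note cb = card_nat_between[OF this]
  have "Q2 \<subseteq> {q. sqrt A < real q \<and> real q < sqrt B}" by (auto simp: Q2_def)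
  hence Q2: "finite Q2" "real (card Q2) \<le> sqrt B - sqrt A + 1"
    using cb card_mono[of "{q. sqrt A < real q \<and> real q < sqrt B}" Q2] by (auto intro: finite_subset)
  have K: "finite (K q)" "real (card (K q)) * ln (real q) \<le> ln B" if "prime q" for q
  proof -
    have q: "real q > 1" using prime_gt_1_nat[OF that] by simp
    hence l: "ln (real q) > 0" by simp
    have "K q \<subseteq> {k. 0 < k \<and> real k \<le> ln B / ln (real q)}"
    proof
      fix k assume "k \<in> K q"
      hence k: "3 \<le> k" "real q ^ k < B" by (auto simp: K_def)
      have "ln (real q ^ k) \<le> ln B" using k q B by (subst ln_le_cancel_iff) auto
      hence "real k * ln (real q) \<le> ln B" using q by (simp add: ln_realpow)
      thus "k \<in> {k. 0 < k \<and> real k \<le> ln B / ln (real q)}" using k l by (simp add: pos_le_divide_eq)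
    qed
    moreover have "ln B / ln (real q) \<ge> 0" using l B by simp
    note cl = card_nat_le_real[OF this]
    ultimately have "finite (K q)" "card (K q) \<le> card {k::nat. 0 < k \<and> real k \<le> ln B / ln (real q)}"
      using cl by (auto intro: finite_subset card_mono)
    moreover from this have "real (card (K q)) \<le> ln B / ln (real q)" using cl(2) by linarith
    ultimately show "finite (K q)" "real (card (K q)) * ln (real q) \<le> ln B" using l by (auto simp: pos_le_divide_eq)
  qed
  define J' where "J' = {n \<in> J. primepow n}"
  have finJ: "finite J"
    by (rule finite_subset[OF _ card_nat_between(1)[of A B]]) (use A in \<open>auto simp: J_def\<close>)
  have "J' \<subseteq> (\<lambda>q. q ^ 2) ` Q2 \<union> (\<lambda>(q, k). q ^ k) ` Sigma Q K"
  proof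
    fix n assume "n \<in> J'"
    hence n: "A < real n" "real n < B" "\<not> prime n" "primepow n" by (auto simp: J'_def J_def)
    from n(4) obtain q k where qk: "prime q" "k > 0" "n = q ^ k" by (auto simp: primepow_def)
    have "k \<noteq> 1" using n qk by auto
    hence k: "k \<ge> 2" using qk by auto
    have q: "real q > 1" using prime_gt_1_nat[OF qk(1)] by simp
    have qB: "real q ^ k < B" "A < real q ^ k" using n qk by auto
    show "n \<in> (\<lambda>q. q ^ 2) ` Q2 \<union> (\<lambda>(q, k). q ^ k) ` Sigma Q K"
    proof (cases "k = 2")
      case True
      have "sqrt A < real q" "real q < sqrt B" using qB q A unfolding True
        by (auto intro!: real_less_rsqrt real_less_lsqrt)
      thus ?thesis using qk True by (auto simp: Q2_def)
    next
      case False
      hence k3: "k \<ge> 3" using k by simp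
      have "real q ^ 3 \<le> real q ^ k" using q k3 by (intro power_increasing) auto
      also have "\<dots> \<le> c ^ 3" using qB c by simp
      finally have "real q \<le> c" using c by (simp add: power_mono_iff)
      hence "(q, k) \<in> Sigma Q K" using qk k3 qB by (auto simp: Q_def K_def)
      thus ?thesis using qk by force
    qed
  qed
  hence "sum mangoldt J' \<le> (\<Sum>n\<in>(\<lambda>q. q ^ 2) ` Q2 \<union> (\<lambda>(q, k). q ^ k) ` Sigma Q K. mangoldt n :: real)"
    using Q(1) Q2(1) K by (intro sum_mono2) (auto simp: Q_def mangoldt_nonneg intro!: finite_SigmaI)
  also have "\<dots> \<le> sum mangoldt ((\<lambda>q. q ^ 2) ` Q2) + sum mangoldt ((\<lambda>(q, k). q ^ k) ` Sigma Q K)"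
  proof -
    have f: "finite ((\<lambda>q. q ^ 2) ` Q2)" "finite ((\<lambda>(q, k). q ^ k) ` Sigma Q K)"
      using Q(1) Q2(1) K by (auto simp: Q_def intro!: finite_SigmaI)
    have "0 \<le> (\<Sum>n\<in>(\<lambda>q. q ^ 2) ` Q2 \<inter> (\<lambda>(q, k). q ^ k) ` Sigma Q K. mangoldt n :: real)"
      by (intro sum_nonneg mangoldt_nonneg)
    thus ?thesis using sum.union_inter[OF f, of "mangoldt :: nat \<Rightarrow> real"] by linarith
  qed
  also have "sum mangoldt ((\<lambda>q. q ^ 2) ` Q2) \<le> (\<Sum>q\<in>Q2. mangoldt (q ^ 2) :: real)"
    using sum_image_le[OF Q2(1), of "mangoldt :: nat \<Rightarrow> real" "\<lambda>q. q ^ 2"] by (simp add: mangoldt_nonneg o_def)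
  also have "\<dots> \<le> (\<Sum>q\<in>Q2. ln B / 2)"
  proof (rule sum_mono)
    fix q assume "q \<in> Q2"
    hence q: "prime q" "real q < sqrt B" by (auto simp: Q2_def)
    hence "ln (real q) \<le> ln (sqrt B)" using B prime_gt_0_nat[of q] by (subst ln_le_cancel_iff) auto
    thus "mangoldt (q ^ 2) \<le> ln B / 2" using q B by (simp add: ln_sqrt)
  qed
  also have "\<dots> \<le> (sqrt B - sqrt A + 1) * (ln B / 2)"
    using Q2(2) B by (simp add: mult_right_mono)
  also have "sum mangoldt ((\<lambda>(q, k). q ^ k) ` Sigma Q K) \<le> (\<Sum>(q, k)\<in>Sigma Q K. mangoldt (q ^ k) :: real)"
    using sum_image_le[of "Sigma Q K" "mangoldt :: nat \<Rightarrow> real" "\<lambda>(q, k). q ^ k"]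
      finite_SigmaI[of Q K] Q(1) K(1)
    by (simp add: mangoldt_nonneg o_def split_def Q_def)
  also have "\<dots> = (\<Sum>q\<in>Q. \<Sum>k\<in>K q. mangoldt (q ^ k))"
    by (rule sum.Sigma[symmetric]) (use Q K in \<open>auto simp: Q_def\<close>)
  also have "\<dots> = (\<Sum>q\<in>Q. real (card (K q)) * ln (real q))"
  proof (rule sum.cong[OF refl])
    fix q assume "q \<in> Q"
    hence "(\<Sum>k\<in>K q. mangoldt (q ^ k)) = (\<Sum>k\<in>K q. ln (real q))"
      by (intro sum.cong refl) (auto simp: Q_def K_def)
    thus "(\<Sum>k\<in>K q. mangoldt (q ^ k)) = real (card (K q)) * ln (real q)" by simp
  qed
  also have "\<dots> \<le> (\<Sum>q\<in>Q. ln B)" by (rule sum_mono) (use K in \<open>auto simp: Q_def\<close>)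
  also have "\<dots> \<le> c * ln B" using Q(2) B by (simp add: mult_right_mono)
  also have "sum mangoldt J' = (sum mangoldt J :: real)"
    by (rule sum.mono_neutral_left) (use finJ in \<open>auto simp: J'_def mangoldt_def\<close>)
  finally have "sum mangoldt J \<le> (sqrt B - sqrt A + 1) * (ln B / 2) + c * ln B" by simp
  also have "\<dots> = ln B * ((sqrt B - sqrt A + 1) / 2 + c)" by (simp add: field_simps)
  finally show ?thesis unfolding J_def .
qed

text \<open>The bound is the value at \<open>ln y = L\<close>, so no prime weighs more than one at
  the centre of the tent. With \<open>t = ln y - L\<close>: to the right, the growth
  \<open>1 + t / L\<close> of the logarithm is beaten by \<open>exp (t / 2)\<close> because
  \<open>L \<ge> 2\<close>; to the left, the descent of the tent outweighs the growth of
  \<open>1 / sqrt y\<close> because \<open>\<delta> \<le> 1\<close>.\<close>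

lemma prime_weight_le:
  fixes L \<delta> y :: real
  assumes L: "L \<ge> 2" and \<delta>: "0 < \<delta>" "\<delta> \<le> 1" and y: "y > 0" "ln y \<ge> 0"
  shows "ln y / sqrt y * tri \<delta> (ln y - L) \<le> \<delta> * (L / exp (L / 2))"
proof (cases "\<bar>ln y - L\<bar> < \<delta>")
  case True
  define t where "t = ln y - L"
  have sy: "sqrt y = exp (L / 2) * exp (t / 2)"
  proof -
    have "sqrt y = exp (ln y / 2)" using y by (simp add: powr_half_sqrt[symmetric] powr_def)
    also have "ln y / 2 = L / 2 + t / 2" unfolding t_def by argo
    finally show ?thesis by (simp add: exp_add)
  qed
  have "ln y * tri \<delta> t \<le> \<delta> * L * exp (t / 2)"
  proof (cases "t \<ge> 0")
    case True
    have "ln y = L * (1 + t / L)" using L by (simp add: t_def field_simps)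
    also have "\<dots> \<le> L * exp (t / 2)"
    proof (intro mult_left_mono)
      have "t / L \<le> t / 2" using True L by (intro divide_left_mono) auto
      thus "1 + t / L \<le> exp (t / 2)" using exp_ge_add_one_self[of "t / 2"] by linarith
    qed (use L in auto)
    finally have "ln y * tri \<delta> t \<le> L * exp (t / 2) * \<delta>"
      using tri_le[of \<delta> t] \<delta> y L by (intro mult_mono) auto
    thus ?thesis by (simp only: mult_ac)
  next
    case False
    have "tri \<delta> t = \<delta> + t" using True False by (simp add: tri_def t_def)
    also have "\<dots> \<le> \<delta> * exp (t / 2)"
    proof -
      have "\<delta> + t = \<delta> * (1 + t / \<delta>)" using \<delta> by (simp add: field_simps)
      also have "\<dots> \<le> \<delta> * exp (t / 2)"
      proof (intro mult_left_mono)
        have "t / \<delta> \<le> t / 2" using False \<delta> by (intro divide_left_mono_neg) auto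
        thus "1 + t / \<delta> \<le> exp (t / 2)" using exp_ge_add_one_self[of "t / 2"] by linarith
      qed (use \<delta> in auto)
      finally show ?thesis .
    qed
    finally have "ln y * tri \<delta> t \<le> L * (\<delta> * exp (t / 2))"
      using False y L by (intro mult_mono) (auto simp: t_def)
    thus ?thesis by (simp only: mult_ac)
  qed
  hence "ln y * tri \<delta> t / (exp (L / 2) * exp (t / 2)) \<le> \<delta> * L * exp (t / 2) / (exp (L / 2) * exp (t / 2))"
    by (intro divide_right_mono) auto
  thus ?thesis unfolding sy t_def[symmetric] by simp
next
  case False
  hence "tri \<delta> (ln y - L) = 0" by (simp add: tri_def)
  thus ?thesis using L \<delta> by simp
qed

text \<open>The upper bound rests on \<open>10 ^ 12 \<le> 2 ^ 40\<close>, the lower one on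
  \<open>exp 1 < 2.72\<close>.\<close>

lemma ln_ten_thousand: "9 \<le> ln (10 ^ 4 :: real)" "ln (10 ^ 4 :: real) \<le> 9.26"
proof -
  have "exp (9::real) = exp 1 ^ 9" by (simp flip: exp_of_nat_mult)
  also have "\<dots> \<le> (272 / 100) ^ 9" using e_less_272 by (intro power_mono) auto
  also have "\<dots> \<le> (10 ^ 4 :: real)" by (simp add: eval_nat_numeral)
  finally show "9 \<le> ln (10 ^ 4 :: real)" by (subst ln_ge_iff) auto
  have "3 * ln (10 ^ 4 :: real) = ln ((10 ^ 4) ^ 3)" by (subst ln_realpow) auto
  also have "\<dots> \<le> ln (2 ^ 40)" by (subst ln_le_cancel_iff) auto
  also have "\<dots> = 40 * ln (2::real)" by (subst ln_realpow) auto
  also have "\<dots> \<le> 40 * (25 / 36)" using ln2_le_25_over_36 by simp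
  finally show "ln (10 ^ 4 :: real) \<le> 9.26" by simp
qed

section \<open>Prime counts for x \<ge> 10000\<close>

abbreviation primes_near :: "real \<Rightarrow> real \<Rightarrow> nat set" where
  "primes_near x h \<equiv> {p. prime p \<and> x - h < real p \<and> real p < x + h}"

text \<open>The weighted lower bound at \<open>u = ln x\<close>, divided by \<delta> and expressed
  through the half length \<open>H * s\<close>. Each prime is given the maximal weight, and the last
  summand pays for the prime powers; \<open>c\<close> bounds the cube root of the right end of the
  interval.\<close>

lemma RH_prime_count_lower_bound:
  fixes x H c :: real
  defines "L \<equiv> ln x" and "s \<equiv> sqrt x" and "r \<equiv> H / sqrt x"
  assumes RH: riemann_hypothesis and x: "x \<ge> 10 ^ 4" and H: "H > 0" "4 * H \<le> sqrt x"
    and c: "c \<ge> 0" "x + H * sqrt x \<le> c ^ 3"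
  shows "real (card (primes_near x (H * s))) * L \<ge>
     s * (H - H\<^sup>2 / (2 * s) + ln H - L / 2 + 0.68 - 4 * r - (1 + r / 2) / s * ((L + r) * ((H + 1) / 2 + c)))"
proof -
  have s: "s \<ge> 100" using x by (simp add: s_def real_le_rsqrt)
  have xs: "x = s * s" using x by (simp add: s_def)
  have sx: "sqrt x > 0" using s unfolding s_def by linarith
  have r: "0 < r" "r \<le> 1 / 4" unfolding r_def
  proof -
    show "0 < H / sqrt x" by (rule divide_pos_pos[OF H(1) sx])
    show "H / sqrt x \<le> 1 / 4" unfolding pos_divide_le_eq[OF sx] using H(2) by argo
  qed
  have Hr: "H = r * s" using sx unfolding r_def s_def by (metis less_irrefl nonzero_eq_divide_eq)
  \<comment> \<open>For this \<delta> the tent lives exactly between \<open>A\<close> and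
    \<open>B\<close>, with \<open>B = x + H * s\<close>; and \<open>A\<close> is not below
    \<open>x - H * s\<close> because \<open>(1 - r) * (1 + r) \<le> 1\<close>.\<close>
  define \<delta> where "\<delta> = ln (1 + r)"
  define A B where "A = x / (1 + r)" and "B = x * (1 + r)"
  have \<delta>r: "\<delta> \<le> r" unfolding \<delta>_def using r by (intro ln_add_one_self_le_self) auto
  have \<delta>l: "\<delta> \<ge> r - r\<^sup>2 / 2"
  proof -
    define z where "z = r / (2 + r)"
    have z: "0 \<le> z" "z < 1" using r by (auto simp: z_def divide_less_eq)
    have "r - r\<^sup>2 / 2 \<le> 2 * z"
    proof -
      have "(r - r\<^sup>2 / 2) * (2 + r) \<le> 2 * r"
        using r by (simp add: power2_eq_square algebra_simps)
      thus ?thesis using r by (simp add: z_def pos_le_divide_eq)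
    qed
    also have "\<dots> \<le> ln (1 + z) - ln (1 - z)" using z by (intro two_times_le_ln_ratio)
    also have "\<dots> = ln ((1 + z) / (1 - z))" using z by (subst ln_div) auto
    also have "(1 + z) / (1 - z) = 1 + r"
    proof -
      have "1 + z = (2 + 2 * r) / (2 + r)" "1 - z = 2 / (2 + r)" using r by (simp_all add: z_def field_simps)
      thus ?thesis using r by simp
    qed
    finally show ?thesis by (simp only: \<delta>_def)
  qed
  have \<delta>: "0 < \<delta>" "\<delta> \<le> 1 / 3" using r \<delta>r by (auto simp: \<delta>_def)
  have "ln (10 ^ 4) \<le> L" unfolding L_def using x by (subst ln_le_cancel_iff) auto
  hence L9: "L \<ge> 9" using ln_ten_thousand(1) by linarith
  have expL: "exp L = x" "exp (L / 2) = s"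
    using x by (simp_all add: L_def s_def powr_half_sqrt[symmetric] powr_def)
  have lnB: "ln B = L + \<delta>" using x r by (simp add: B_def L_def \<delta>_def ln_mult)
  have lnA: "ln A = L - \<delta>" using x r by (simp add: A_def L_def \<delta>_def ln_div)
  have eB: "exp (L + \<delta>) = B" using r by (simp add: exp_add expL \<delta>_def B_def)
  have AB: "1 \<le> A" "A \<le> B" "A > 0" "B > 0"
  proof -
    have "1 + r \<le> x" using r x by simp
    thus "1 \<le> A" using r by (simp add: A_def pos_le_divide_eq)
    have "A \<le> x / 1" unfolding A_def using r x by (intro divide_left_mono) auto
    also have "\<dots> \<le> B" using r x by (simp add: B_def)
    finally show "A \<le> B" .
    show "A > 0" "B > 0" using r x by (auto simp: A_def B_def)
  qed
  define I where "I = {1..nat \<lfloor>exp (L + \<delta>)\<rfloor>}"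
  define I' where "I' = {n. A < real n \<and> real n < B}"
  define p :: "nat \<Rightarrow> real" where "p = (\<lambda>n. mangoldt n / sqrt (real n) * tri \<delta> (ln (real n) - L))"
  have fI': "finite I'" unfolding I'_def by (rule card_nat_between) (use AB in auto)
  have "\<delta> * (\<delta> * s + ln \<delta> + 0.68 - 3.3 * \<delta>) \<le> sum p I"
    using RH_weighted_sum_lower_bound[OF RH \<delta>, of L] L9 \<delta> unfolding I_def p_def expL by simp
  also have "sum p I = sum p I'"
  proof (rule sum.mono_neutral_right)
    show "finite I" by (simp add: I_def)
    show "I' \<subseteq> I" using AB by (auto simp: I'_def I_def eB le_nat_floor)
    show "\<forall>n\<in>I - I'. p n = 0"
    proof
      fix n assume n: "n \<in> I - I'"
      hence n1: "n \<ge> 1" by (auto simp: I_def)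
      have "real n \<le> A \<or> real n \<ge> B" using n by (auto simp: I'_def)
      hence "ln (real n) \<le> ln A \<or> ln (real n) \<ge> ln B" using n1 AB by (auto simp: ln_le_cancel_iff)
      hence "tri \<delta> (ln (real n) - L) = 0" unfolding lnA lnB tri_def by auto
      thus "p n = 0" by (simp add: p_def)
    qed
  qed
  also have "I' = {n\<in>I'. prime n} \<union> {n\<in>I'. \<not> prime n}" by auto
  also have "sum p \<dots> = sum p {n\<in>I'. prime n} + sum p {n\<in>I'. \<not> prime n}"
    by (rule sum.union_disjoint) (use fI' in auto)
  also have "sum p {n\<in>I'. prime n} \<le> (\<Sum>n\<in>{n\<in>I'. prime n}. \<delta> * (L / s))"
  proof (rule sum_mono)
    fix n assume "n \<in> {n\<in>I'. prime n}"
    hence "prime n" by simp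
    thus "p n \<le> \<delta> * (L / s)"
      using prime_weight_le[of L \<delta> "real n"] L9 \<delta> prime_gt_0_nat[of n] by (simp add: p_def expL)
  qed
  also have "\<dots> = \<delta> * (real (card {n\<in>I'. prime n}) * L / s)" by simp
  also have "sum p {n\<in>I'. \<not> prime n} \<le> (\<Sum>n\<in>{n\<in>I'. \<not> prime n}. mangoldt n * (\<delta> / sqrt A))"
  proof (rule sum_mono)
    fix n assume "n \<in> {n\<in>I'. \<not> prime n}"
    hence n: "A < real n" by (auto simp: I'_def)
    have "1 / sqrt (real n) * tri \<delta> (ln (real n) - L) \<le> 1 / sqrt A * \<delta>"
      using n AB \<delta> by (intro mult_mono tri_le frac_le) auto
    hence "mangoldt n * (1 / sqrt (real n) * tri \<delta> (ln (real n) - L)) \<le> mangoldt n * (1 / sqrt A * \<delta>)"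
      by (intro mult_left_mono mangoldt_nonneg)
    thus "p n \<le> mangoldt n * (\<delta> / sqrt A)" by (simp add: p_def)
  qed
  also have "\<dots> = (\<Sum>n | A < real n \<and> real n < B \<and> \<not> prime n. mangoldt n) * (\<delta> / sqrt A)"
    unfolding sum_distrib_right by (rule sum.cong) (auto simp: I'_def)
  also have "\<dots> \<le> (ln B * ((sqrt B - sqrt A + 1) / 2 + c)) * (\<delta> / sqrt A)"
  proof (intro mult_right_mono sum_mangoldt_prime_powers_le AB c)
    have "B = x + H * s" by (simp add: B_def Hr xs algebra_simps)
    thus "B \<le> c ^ 3" using c(2) by (simp add: s_def)
  qed (use \<delta> AB in auto)
  also have "\<dots> = \<delta> * (1 / sqrt A * (ln B * ((sqrt B - sqrt A + 1) / 2 + c)))" by simp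
  finally have "\<delta> * (\<delta> * s + ln \<delta> + 0.68 - 3.3 * \<delta>) \<le>
     \<delta> * (real (card {n\<in>I'. prime n}) * L / s + 1 / sqrt A * (ln B * ((sqrt B - sqrt A + 1) / 2 + c)))"
    by (simp add: distrib_left)
  hence ineq: "\<delta> * s + ln \<delta> + 0.68 - 3.3 * \<delta> \<le>
     real (card {n\<in>I'. prime n}) * L / s + 1 / sqrt A * (ln B * ((sqrt B - sqrt A + 1) / 2 + c))"
    using \<delta> by (simp only: mult_le_cancel_left_pos)
  have PP: "1 / sqrt A * (ln B * ((sqrt B - sqrt A + 1) / 2 + c)) \<le> (1 + r / 2) / s * ((L + r) * ((H + 1) / 2 + c))"
  proof -
    \<comment> \<open>\<open>sqrt A = s / q\<close> and \<open>sqrt B = s * q\<close>, and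
      \<open>q - 1 / q \<le> r\<close>; so the bases of the squares range over an interval of length
      at most \<open>s * r = H\<close>.\<close>
    define q where "q = sqrt (1 + r)"
    have q: "q \<ge> 1" "q \<le> 1 + r / 2" "q * q = 1 + r" using r
      by (auto simp: q_def power2_eq_square algebra_simps intro!: real_le_lsqrt)
    have sA: "sqrt A = s / q" by (simp add: A_def real_sqrt_divide s_def q_def)
    have sB: "sqrt B = s * q" by (simp add: B_def real_sqrt_mult s_def q_def)
    have "sqrt B - sqrt A \<le> H"
    proof -
      have "q - 1 / q = (q * q - 1) / q" using q by (simp add: field_simps)
      also have "\<dots> \<le> r" using q r by (simp add: divide_le_eq mult_left_le)
      finally have "s * (q - 1 / q) \<le> s * r" using s by (intro mult_left_mono) auto
      thus ?thesis by (simp add: sA sB Hr algebra_simps)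
    qed
    moreover have "sqrt A \<le> sqrt B" using AB by simp
    ultimately have *: "ln B * ((sqrt B - sqrt A + 1) / 2 + c) \<le> (L + r) * ((H + 1) / 2 + c)"
      unfolding lnB using \<delta>r L9 \<delta> r c by (intro mult_mono) auto
    have "1 / sqrt A = q / s" using s q by (simp add: sA)
    also have "\<dots> \<le> (1 + r / 2) / s" using q s by (intro divide_right_mono) auto
    finally have **: "1 / sqrt A \<le> (1 + r / 2) / s" .
    have "0 \<le> ln B * ((sqrt B - sqrt A + 1) / 2 + c)"
      using \<open>sqrt A \<le> sqrt B\<close> AB c by (intro mult_nonneg_nonneg add_nonneg_nonneg) auto
    moreover have "0 \<le> (1 + r / 2) / s" using r s by (intro divide_nonneg_nonneg) auto
    ultimately show ?thesis by (intro mult_mono * **)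
  qed
  have "\<delta> * s \<ge> H - H\<^sup>2 / (2 * s)"
  proof -
    have "(r - r\<^sup>2 / 2) * s \<le> \<delta> * s" using \<delta>l s by (intro mult_right_mono) auto
    moreover have "(r - r\<^sup>2 / 2) * s = H - H\<^sup>2 / (2 * s)" using s by (simp add: Hr power2_eq_square field_simps)
    ultimately show ?thesis by simp
  qed
  moreover have "ln \<delta> \<ge> ln H - L / 2 - 0.7 * r"
  proof -
    have "ln (r * (1 - r / 2)) \<le> ln \<delta>"
      using r \<delta> \<delta>l by (subst ln_le_cancel_iff) (auto simp: power2_eq_square algebra_simps intro!: mult_pos_pos)
    moreover have "ln (r * (1 - r / 2)) = ln r + ln (1 - r / 2)" using r by (intro ln_mult_pos) auto
    moreover have "ln (1 - r / 2) \<ge> - (r / 2) - 2 * (r / 2)\<^sup>2" using r by (intro ln_one_minus_pos_lower_bound) auto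
    moreover have "2 * (r / 2)\<^sup>2 \<le> 0.2 * r" using r by (simp add: power2_eq_square)
    moreover have "ln r = ln H - L / 2" using H x by (simp add: r_def ln_div ln_sqrt L_def)
    ultimately show ?thesis by argo
  qed
  \<comment> \<open>The \<open>4 * r\<close> collects \<open>3.3 * \<delta> \<le> 3.3 * r\<close>
    and the \<open>0.7 * r\<close> lost in \<open>ln \<delta>\<close>.\<close>
  ultimately have "H - H\<^sup>2 / (2 * s) + ln H - L / 2 + 0.68 - 4 * r - (1 + r / 2) / s * ((L + r) * ((H + 1) / 2 + c))
     \<le> real (card {n\<in>I'. prime n}) * L / s"
    using ineq PP \<delta>r by argo
  hence "s * (H - H\<^sup>2 / (2 * s) + ln H - L / 2 + 0.68 - 4 * r - (1 + r / 2) / s * ((L + r) * ((H + 1) / 2 + c)))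
     \<le> s * (real (card {n\<in>I'. prime n}) * L / s)" using s by (intro mult_left_mono) auto
  also have "\<dots> = real (card {n\<in>I'. prime n}) * L" using s by simp
  also have "\<dots> \<le> real (card (primes_near x (H * s))) * L"
  proof -
    have "{n\<in>I'. prime n} \<subseteq> primes_near x (H * s)"
    proof -
      have "x - H * s = x * (1 - r)" by (simp add: Hr xs algebra_simps)
      also have "\<dots> \<le> A"
      proof -
        have "(x * (1 - r)) * (1 + r) \<le> x" using x r by (simp add: algebra_simps)
        thus ?thesis using r by (simp add: A_def pos_le_divide_eq)
      qed
      finally have "x - H * s \<le> A" .
      moreover have "B = x + H * s" by (simp add: B_def Hr xs algebra_simps)
      ultimately show ?thesis by (auto simp: I'_def)
    qed
    moreover have "finite (primes_near x (H * s))"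
      by (rule finite_subset[of _ "{..nat \<lfloor>x + H * s\<rfloor>}"]) (auto simp: le_nat_floor)
    ultimately have "card {n\<in>I'. prime n} \<le> card (primes_near x (H * s))"
      by (intro card_mono)
    thus ?thesis using L9 by (intro mult_right_mono) auto
  qed
  finally show ?thesis .
qed

text \<open>A common scale: \<open>sqrt x\<close>, the cube root of \<open>x\<close> and
  \<open>ln x\<close> are at most multiples of \<open>w ^ 9\<close>, \<open>w ^ 6\<close> and
  \<open>w^2\<close>. Comparisons between them follow from the exponents, so that numbers have to be
  computed only for \<open>w = 1\<close>, that is \<open>x = 10 ^ 4\<close>.\<close>

lemma large_scale:
  fixes x :: real
  assumes x: "x \<ge> 10 ^ 4"
  obtains w where "w \<ge> 1" "sqrt x = 100 * w ^ 9" "x = 10 ^ 4 * w ^ 18" "ln x \<le> 9.26 * w\<^sup>2" "ln x \<ge> 9"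
proof -
  define M where "M = ln (10 ^ 4 :: real)"
  \<comment> \<open>The 18 makes \<open>w^2 = exp ((ln x - M) / 9)\<close>, which dominates
    \<open>ln x / M\<close> because \<open>M \<ge> 9\<close>; it is also divisible by 2 and 3, for
    the square and the cube root.\<close>
  define w where "w = exp ((ln x - M) / 18)"
  have M: "9 \<le> M" "M \<le> 9.26" using ln_ten_thousand by (auto simp: M_def)
  have L: "ln x \<ge> M" using x unfolding M_def by (subst ln_le_cancel_iff) auto
  have 1: "w \<ge> 1" using L by (simp add: w_def)
  have "w ^ 18 = exp (ln x - M)" by (simp add: w_def flip: exp_of_nat_mult)
  hence 3: "x = 10 ^ 4 * w ^ 18" using x by (simp add: exp_diff M_def)
  have 2: "sqrt x = 100 * w ^ 9"
    by (rule real_sqrt_unique) (use 1 in \<open>simp_all add: 3 power_mult_distrib flip: power_mult\<close>)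
  have "ln x = M * (1 + (ln x - M) / M)" using M by (simp add: field_simps)
  also have "\<dots> \<le> M * w\<^sup>2"
  proof (intro mult_left_mono)
    have "(ln x - M) / M \<le> (ln x - M) / 9" using L M by (intro divide_left_mono) auto
    hence "1 + (ln x - M) / M \<le> exp ((ln x - M) / 9)" using exp_ge_add_one_self[of "(ln x - M) / 9"] by linarith
    also have "\<dots> = w\<^sup>2" by (simp add: w_def flip: exp_of_nat_mult)
    finally show "1 + (ln x - M) / M \<le> w\<^sup>2" .
  qed (use M in auto)
  also have "\<dots> \<le> 9.26 * w\<^sup>2" using M by (intro mult_right_mono) auto
  finally have 4: "ln x \<le> 9.26 * w\<^sup>2" .
  show ?thesis by (rule that[OF 1 2 3 4]) (use L M in linarith)
qed

text \<open>\<open>K\<close> and \<open>l\<close> control \<open>H\<close> and \<open>ln H\<close>,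
  and \<open>num\<close> says that the margin 2, the constant 0.68 and \<open>l\<close> together
  cover all error terms at \<open>w = 1\<close>. Larger \<open>w\<close> only helps: the prime
  powers, for instance, have relative size \<open>w^2 * w ^ 6 / w ^ 9\<close>.\<close>

lemma RH_prime_count_large:
  fixes x H K l w :: real
  assumes RH: riemann_hypothesis and x: "x \<ge> 10 ^ 4"
    and w: "w \<ge> 1" "sqrt x = 100 * w ^ 9" "x = 10 ^ 4 * w ^ 18" "ln x \<le> 9.26 * w\<^sup>2" "ln x \<ge> 9"
    and H: "0 < H" "H \<le> K * w\<^sup>2" "l \<le> ln H" and K: "0 < K" "K \<le> 16"
    and num: "0 < 2.68 + l - K\<^sup>2 / 200 - 4 * (K / 100) - (1 + K / 200) / 100 * ((9.26 + K / 100) * ((K + 1) / 2 + 22.7))"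
  shows "sqrt x * (H - ln x / 2 - 2) < real (card (primes_near x (H * sqrt x))) * ln x"
proof -
  \<comment> \<open>\<open>22.7 ^ 3\<close> exceeds 11600 = 10 ^ 4 + 16 * 100, which bounds
    \<open>x + H * sqrt x\<close> in units of \<open>w ^ 18\<close>; the 16 is the bound for
    \<open>K\<close>.\<close>
  define c where "c = 22.7 * w ^ 6"
  define r where "r = H / sqrt x"
  define R where "R = (1 + r / 2) / sqrt x * ((ln x + r) * ((H + 1) / 2 + c))"
  have w0: "w > 0" "w ^ n > 0" for n using w by auto
  have wp: "w ^ m \<le> w ^ n" if "m \<le> n" for m n using w that by (intro power_increasing) auto
  have Hw: "H \<le> K * w ^ n" if "2 \<le> n" for n
    by (rule order.trans[OF H(2)]) (intro mult_left_mono wp that, use K in simp)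
  have s: "sqrt x > 0" using w0 w by simp
  have r: "r \<ge> 0" "r \<le> K / 100"
  proof -
    show "r \<ge> 0" using H s by (simp add: r_def)
    have "H \<le> K * w ^ 9" by (rule Hw) simp
    thus "r \<le> K / 100" using s w0(2)[of 9] unfolding r_def w(2) by (simp add: divide_le_eq)
  qed
  have main: "sqrt x * (H - H\<^sup>2 / (2 * sqrt x) + ln H - ln x / 2 + 0.68 - 4 * r - R) \<le>
     real (card (primes_near x (H * sqrt x))) * ln x"
    unfolding R_def r_def
  proof (rule RH_prime_count_lower_bound[OF RH x H(1)])
    have "4 * H \<le> 4 * (K * w ^ 9)" using Hw[of 9] by simp
    also have "\<dots> \<le> 4 * (16 * w ^ 9)" using K w0 by (intro mult_left_mono mult_right_mono) auto
    also have "\<dots> \<le> sqrt x" using w0(2)[of 9] unfolding w(2) by simp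
    finally show "4 * H \<le> sqrt x" .
    show "c \<ge> 0" using w by (simp add: c_def)
    have "H * sqrt x \<le> (16 * w\<^sup>2) * (100 * w ^ 9)"
    proof -
      have "K * w\<^sup>2 \<le> 16 * w\<^sup>2" using K by (intro mult_right_mono) auto
      hence "H \<le> 16 * w\<^sup>2" using H(2) by linarith
      thus ?thesis unfolding w(2) using w0 by (intro mult_right_mono) auto
    qed
    also have "\<dots> = 1600 * w ^ 11" by (simp flip: power_add)
    also have "\<dots> \<le> 1600 * w ^ 18" by (intro mult_left_mono wp) auto
    finally have "x + H * sqrt x \<le> 11600 * w ^ 18" unfolding w(3) by simp
    also have "\<dots> \<le> 22.7 ^ 3 * w ^ 18" using w0 by (intro mult_right_mono) (auto simp: eval_nat_numeral)
    also have "\<dots> = c ^ 3" unfolding c_def power_mult_distrib by (simp flip: power_mult)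
    finally show "x + H * sqrt x \<le> c ^ 3" .
  qed
  have H2: "H\<^sup>2 / (2 * sqrt x) \<le> K\<^sup>2 / 200"
  proof -
    have "H\<^sup>2 \<le> (K * w\<^sup>2)\<^sup>2" using H by (intro power_mono) auto
    also have "\<dots> = K\<^sup>2 * w ^ 4" by (simp add: power_mult_distrib flip: power_mult)
    also have "\<dots> \<le> K\<^sup>2 * w ^ 9" by (intro mult_left_mono wp) auto
    finally show ?thesis using w0(2)[of 9] unfolding w(2) by (simp add: divide_le_eq)
  qed
  have R: "R \<le> (1 + K / 200) / 100 * ((9.26 + K / 100) * ((K + 1) / 2 + 22.7))"
  proof -
    have "(ln x + r) * ((H + 1) / 2 + c) \<le> ((9.26 + K / 100) * w\<^sup>2) * (((K + 1) / 2 + 22.7) * w ^ 6)"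
    proof (rule mult_mono)
      have "K / 100 * 1 \<le> K / 100 * w\<^sup>2" using K w(1) by (intro mult_left_mono) auto
      hence "r \<le> K / 100 * w\<^sup>2" using r(2) by linarith
      thus "ln x + r \<le> (9.26 + K / 100) * w\<^sup>2" using w(4) unfolding distrib_right by (rule add_mono[rotated])
      have "H \<le> K * w ^ 6" by (rule Hw) simp
      moreover have "1 \<le> w ^ 6" using wp[of 0 6] by simp
      ultimately show "(H + 1) / 2 + c \<le> ((K + 1) / 2 + 22.7) * w ^ 6" unfolding c_def by (simp add: algebra_simps)
    qed (use H K w0 in \<open>auto simp: c_def\<close>)
    also have "\<dots> = ((9.26 + K / 100) * ((K + 1) / 2 + 22.7)) * w ^ 8"
      by (simp only: mult_ac flip: power_add) simp
    also have "\<dots> \<le> ((9.26 + K / 100) * ((K + 1) / 2 + 22.7)) * w ^ 9"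
      using K by (intro mult_left_mono wp) auto
    finally have *: "(ln x + r) * ((H + 1) / 2 + c) \<le> ((9.26 + K / 100) * ((K + 1) / 2 + 22.7)) * w ^ 9" .
    have "R \<le> (1 + K / 200) / sqrt x * (((9.26 + K / 100) * ((K + 1) / 2 + 22.7)) * w ^ 9)"
      unfolding R_def
    proof (rule mult_mono[OF _ *])
      show "(1 + r / 2) / sqrt x \<le> (1 + K / 200) / sqrt x" using r s by (intro divide_right_mono) auto
      show "0 \<le> (1 + K / 200) / sqrt x" using K s by (intro divide_nonneg_nonneg) auto
      show "0 \<le> (ln x + r) * ((H + 1) / 2 + c)"
        using r H w(5) w0 by (intro mult_nonneg_nonneg) (auto simp: c_def)
    qed
    also have "\<dots> = (1 + K / 200) / 100 * ((9.26 + K / 100) * ((K + 1) / 2 + 22.7))"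
      using w0(1) unfolding w(2) by simp
    finally show ?thesis .
  qed
  have "0 < 2.68 + l - H\<^sup>2 / (2 * sqrt x) - 4 * r - R"
  proof (rule order.strict_trans2[OF num])
    show "2.68 + l - K\<^sup>2 / 200 - 4 * (K / 100) - (1 + K / 200) / 100 * ((9.26 + K / 100) * ((K + 1) / 2 + 22.7))
      \<le> 2.68 + l - H\<^sup>2 / (2 * sqrt x) - 4 * r - R"
      by (intro diff_mono mult_left_mono H2 R r order.refl) simp
  qed
  hence "H - ln x / 2 - 2 < H - H\<^sup>2 / (2 * sqrt x) + ln H - ln x / 2 + 0.68 - 4 * r - R"
    using H(3) by simp
  hence "sqrt x * (H - ln x / 2 - 2) < sqrt x * (H - H\<^sup>2 / (2 * sqrt x) + ln H - ln x / 2 + 0.68 - 4 * r - R)"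
    using s by (intro mult_strict_left_mono)
  thus ?thesis using main by (rule order.strict_trans2)
qed

lemma RH_primes_large:
  fixes x :: real
  assumes RH: riemann_hypothesis and x: "x \<ge> 10 ^ 4"
  shows "\<exists>p::nat. prime p \<and> x - (ln x / 2 + 2) * sqrt x < real p \<and> real p < x + (ln x / 2 + 2) * sqrt x" (is ?one)
    and "sqrt x \<le> real (card (primes_near x ((3 * ln x / 2 + 2) * sqrt x)))" (is ?many)
proof -
  obtain w where w: "w \<ge> 1" "sqrt x = 100 * w ^ 9" "x = 10 ^ 4 * w ^ 18" "ln x \<le> 9.26 * w\<^sup>2" "ln x \<ge> 9"
    using large_scale[OF x] by blast
  have w2: "1 \<le> w\<^sup>2" using w(1) by simp
  \<comment> \<open>With this \<open>H\<close> the left-hand side is 0, so the count is positive.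
    6.63 is 9.26 / 2 + 2.\<close>
  have "sqrt x * ((ln x / 2 + 2) - ln x / 2 - 2) < real (card (primes_near x ((ln x / 2 + 2) * sqrt x))) * ln x"
  proof (rule RH_prime_count_large[OF RH x w, where K = "6.63" and l = 1])
    show "ln x / 2 + 2 \<le> 6.63 * w\<^sup>2" using w(4) w2 by simp
    have "ln (exp 1) \<le> ln (ln x / 2 + 2)" using w(5) e_less_272 by (subst ln_le_cancel_iff) auto
    thus "1 \<le> ln (ln x / 2 + 2)" by simp
  qed (use w(5) in \<open>auto simp: power2_eq_square\<close>)
  hence "card (primes_near x ((ln x / 2 + 2) * sqrt x)) \<noteq> 0"
    by (intro notI) simp
  thus ?one by (metis (mono_tags, lifting) card.empty empty_Collect_eq)
  \<comment> \<open>With this \<open>H\<close> the left-hand side is \<open>sqrt x * ln x\<close>.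
    15.89 is 3 * 9.26 / 2 + 2, and 2.7 is a lower bound for \<open>ln 15.5\<close>, where
    \<open>ln x \<ge> 9\<close> gives \<open>H \<ge> 15.5\<close>.\<close>
  have "sqrt x * ((3 * ln x / 2 + 2) - ln x / 2 - 2) < real (card (primes_near x ((3 * ln x / 2 + 2) * sqrt x))) * ln x"
  proof (rule RH_prime_count_large[OF RH x w, where K = "15.89" and l = "2.7"])
    show "3 * ln x / 2 + 2 \<le> 15.89 * w\<^sup>2" using w(4) w2 by simp
    have "exp (27::real) = exp 1 ^ 27" by (simp flip: exp_of_nat_mult)
    also have "\<dots> \<le> (272 / 100) ^ 27" using e_less_272 by (intro power_mono) auto
    also have "\<dots> \<le> (15.5 ^ 10 :: real)" by (simp add: power_divide)
    also have "\<dots> \<le> (3 * ln x / 2 + 2) ^ 10" using w(5) by (intro power_mono) auto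
    finally have "27 \<le> ln ((3 * ln x / 2 + 2) ^ 10)" using w(5) by (subst ln_ge_iff) auto
    thus "2.7 \<le> ln (3 * ln x / 2 + 2)" using w(5) by (subst (asm) ln_realpow) auto
  qed (use w(5) in \<open>auto simp: power2_eq_square\<close>)
  also have "sqrt x * ((3 * ln x / 2 + 2) - ln x / 2 - 2) = sqrt x * ln x" by simp
  finally show ?many using w(5) by simp
qed

section \<open>Numerical verification for small x\<close>

definition small_primes :: "nat list" where
  "small_primes = [2, 3, 5, 7, 11, 13, 17, 19, 23, 29, 31, 37, 41, 43, 47, 53, 59, 61, 67, 71, 73, 79, 83, 89,
    97, 101, 103]"

text \<open>Trial division by 2, 3, 5 and 7 sieves the whole range, as 107 is below the square of
  11.\<close>

lemma prime_less_107:
  assumes q: "prime q" "q < 107"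
  shows "q \<in> set small_primes"
proof -
  have "list_all (\<lambda>q. q \<in> set small_primes \<or>
      (2 dvd q \<and> q > 2) \<or> (3 dvd q \<and> q > 3) \<or> (5 dvd q \<and> q > 5) \<or> (7 dvd q \<and> q > 7)) [2..<107]"
    by (simp add: small_primes_def upt_rec_numeral)
  moreover have "q \<in> set [2..<107]"
    unfolding set_upt using q prime_ge_2_nat[of q] by (simp only: atLeastLessThan_iff)
  ultimately have "q \<in> set small_primes \<or>
      (2 dvd q \<and> q > 2) \<or> (3 dvd q \<and> q > 3) \<or> (5 dvd q \<and> q > 5) \<or> (7 dvd q \<and> q > 7)"
    unfolding list_all_iff by (rule bspec)
  moreover have "\<not> (d dvd q \<and> q > d)" if "d \<ge> 2" for d
    using q(1) that prime_nat_iff[of q] by auto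
  ultimately show ?thesis by force
qed

text \<open>The Bezout identity says that no entry of the list has a prime factor below 107.\<close>

lemma prime_by_certificate:
  fixes a b :: nat
  assumes bez: "a * prod_list ns = 1 + b * prod_list small_primes"
    and n: "n \<in> set ns" "1 < n" "n < 107\<^sup>2"
  shows "prime n"
proof (rule ccontr)
  assume np: "\<not> prime n"
  define q where "q = (LEAST q. prime q \<and> q dvd n)"
  obtain q0 where "prime q0 \<and> q0 dvd n" using prime_factor_nat[of n] n by auto
  hence "prime q \<and> q dvd n" unfolding q_def by (rule LeastI)
  hence q: "prime q" "q dvd n" by auto
  obtain m where m: "n = q * m" using q by (elim dvdE)
  have "m \<noteq> 1" using m q np by auto
  then obtain p where p: "prime p" "p dvd m" using prime_factor_nat by blast
  have "p dvd n" using p m by simp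
  hence "q \<le> p" unfolding q_def using p by (intro Least_le) auto
  also have "p \<le> m" using p m n by (intro dvd_imp_le) (auto intro: Nat.gr0I)
  finally have "q\<^sup>2 \<le> n" using m by (simp add: power2_eq_square)
  hence "q\<^sup>2 < 107\<^sup>2" using n by simp
  hence "q < 107" by (rule power_less_imp_less_base) simp
  hence "q dvd prod_list small_primes" using prime_less_107[OF q(1)] by (intro prod_list_dvd)
  moreover have "q dvd prod_list ns" using q(2) prod_list_dvd[OF n(1)] by (rule dvd_trans)
  hence "q dvd 1 + b * prod_list small_primes" unfolding bez[symmetric] by simp
  ultimately have "q dvd 1" by (metis dvd_add_left_iff dvd_mult)
  thus False using q by simp
qed

text \<open>Bezout coefficients \<open>a\<close> and \<open>b\<close> with the primes they certify,
  cut into blocks of at most ten so that the numerals stay moderate. The list is a selection of the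
  primes in its range and goes beyond 10 ^ 4, because the intervals around \<open>x\<close> just
  below that extend to the right.\<close>

definition certified_blocks :: "(nat \<times> nat \<times> nat list) list" where
  "certified_blocks =
    [(15165662243154208831603572343041758686793,
      2114935375505666433244,
      [107, 109, 113, 127, 151, 157, 163, 167, 173, 179]),
     (13841845571630445960081676331695353728659,
      251151634742445038424825,
      [181, 191, 193, 197, 199, 257, 269, 277, 283, 307]),
     (3985847396036265597176496260273548899133,
      11589678137580379220006743,
      [331, 347, 353, 367, 379, 389, 401, 419, 431, 439]),
     (11681786154264702254264116634449245064649,
      617643674073772431587458956,
      [449, 461, 467, 487, 499, 523, 547, 563, 571, 587]),
     (23895865921515482269022184291577353640093,
      15548932091010317018795864329,
      [599, 617, 631, 643, 653, 661, 677, 691, 709, 727]),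
     (9522500036105351170624024914541493972891,
      41883090284628641252097742124,
      [739, 751, 761, 773, 797, 811, 823, 829, 853, 859]),
     (7032024762135808040047885847577423175193,
      187821656769524606276337351495,
      [877, 883, 907, 919, 967, 977, 991, 1009, 1019, 1031]),
     (11391475322241099211426132056353218377599,
      1230137081674543253210630768415,
      [1039, 1051, 1063, 1087, 1093, 1103, 1117, 1129, 1153, 1171]),
     (14633424345043535842513963274173340486563,
      6199414833858070750359788655666,
      [1187, 1217, 1229, 1237, 1259, 1279, 1289, 1297, 1303, 1319]),
     (5009640131974197491525064503378947931609,
      8699308173430034974403783081985,
      [1327, 1367, 1381, 1453, 1471, 1483, 1489, 1499, 1523, 1543]),
     (19960655917113867296042198931383858059633,
      97498133919502557858319495610064,
      [1553, 1567, 1579, 1597, 1607, 1613, 1621, 1637, 1663, 1669]),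
     (20645256604487003662546765131715658604587,
      252785922493828013412064044996305,
      [1697, 1709, 1723, 1741, 1753, 1777, 1787, 1801, 1823, 1847]),
     (7239340143749440452114175511570844590051,
      253558125288471350265408645572981,
      [1867, 1873, 1879, 1951, 1979, 1993, 1999, 2011, 2027, 2039]),
     (18557600032735928968191884796771835448537,
      1452428244981462547821410226935740,
      [2063, 2081, 2087, 2099, 2113, 2131, 2141, 2153, 2179, 2207]),
     (17226695065311437398774642204014035539481,
      2828786275912759198556927221643773,
      [2221, 2239, 2251, 2269, 2281, 2293, 2309, 2333, 2341, 2351]),
     (5771968855230120600346574056235415626561,
      1857180914744266828240896147853482,
      [2371, 2381, 2389, 2399, 2417, 2437, 2447, 2539, 2549, 2557]),
     (22731349804479890197365825903446994214091,
      16664306871327853925297829206391002,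
      [2591, 2609, 2621, 2647, 2659, 2671, 2683, 2689, 2699, 2711]),
     (9778659774504349907709607938641377797169,
      11586582769652204383154910533576715,
      [2719, 2731, 2749, 2767, 2789, 2797, 2803, 2833, 2843, 2857]),
     (15033615311583332918345720302152287549687,
      31838687770976875602901683081798498,
      [2879, 2897, 2909, 2927, 2953, 2963, 2971, 3001, 3019, 3037]),
     (21995368619178487687024444987906863919189,
      84443344761324804556619151811389469,
      [3049, 3067, 3083, 3109, 3121, 3163, 3169, 3187, 3203, 3217]),
     (3294277020726450930080300668309152862507,
      21453726963025248624271386142707754,
      [3229, 3253, 3259, 3299, 3307, 3319, 3329, 3343, 3359, 3371]),
     (16407171777526178224717981076922958685057,
      177574751293605519595529246388903039,
      [3389, 3407, 3433, 3463, 3469, 3499, 3517, 3529, 3539, 3547]),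
     (2311554558872166600911681568971527285403,
      38572981765876451466623183535041857,
      [3559, 3581, 3593, 3613, 3623, 3637, 3659, 3673, 3691, 3701]),
     (17841067175940734408385301250371964140751,
      471913115764311175172838058257917048,
      [3719, 3733, 3761, 3769, 3793, 3803, 3847, 3853, 3877, 3889]),
     (7547343268454137744385356415810375752691,
      311559812765557767922596452269290507,
      [3911, 3919, 3929, 3943, 3967, 4001, 4007, 4019, 4027, 4051]),
     (10743277939171090904590572234676453318273,
      675253408851774316926376081835236676,
      [4073, 4091, 4099, 4127, 4133, 4153, 4159, 4201, 4217, 4229]),
     (5315512542982484728322198955437164836761,
      490990169100797690620349509223752520,
      [4241, 4253, 4261, 4273, 4289, 4327, 4339, 4357, 4373, 4397]),
     (15519838506593667369494900036802731589959,
      2164294537322199286258046346600641709,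
      [4421, 4441, 4451, 4463, 4483, 4507, 4517, 4523, 4549, 4567]),
     (4103045941180560820804454405468450376079,
      1032934685034663286153317091021347732,
      [4679, 4703, 4723, 4733, 4759, 4787, 4793, 4801, 4817, 4861]),
     (5073196649459209015426439657674769961121,
      1865949213454317831230517198209827647,
      [4877, 4903, 4919, 4933, 4943, 4957, 4969, 4987, 4999, 5009]),
     (12972095333805302260300389683630290989719,
      6483005777164317870280321919085923491,
      [5021, 5039, 5059, 5081, 5099, 5107, 5119, 5153, 5171, 5189]),
     (7297239522054443824152872204708611588291,
      5295407108416212170277457102984133737,
      [5209, 5231, 5237, 5273, 5281, 5303, 5323, 5347, 5381, 5393]),
     (22651451759278244599063748789503515356609,
      22452278173894229356982151490542943484,
      [5407, 5417, 5431, 5441, 5449, 5477, 5483, 5503, 5519, 5527]),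
     (1662443814770783903688907925576710304027,
      2231871503995227189806355091798533171,
      [5557, 5569, 5581, 5623, 5641, 5651, 5657, 5669, 5689, 5701]),
     (5631118679310439229355863940345216313471,
      12286667638402325085114369518400199571,
      [5717, 5861, 5869, 5881, 5903, 5927, 5953, 5987, 6011, 6037]),
     (7715023443905749481353497806695133819563,
      23832911559112497865714831184255738205,
      [6047, 6067, 6079, 6091, 6113, 6131, 6143, 6163, 6197, 6203]),
     (18827346995363945375447388617431087962541,
      75739752909644699879944943471206371911,
      [6217, 6229, 6257, 6269, 6277, 6299, 6311, 6323, 6337, 6353]),
     (23855391833434223955116882101230231878063,
      125118969173113832918228559354916310586,
      [6361, 6373, 6389, 6421, 6449, 6469, 6481, 6521, 6547, 6553]),
     (23325763430344040294117944848425503646983,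
      163693050990572125956864602968005456679,
      [6569, 6577, 6599, 6619, 6653, 6661, 6679, 6691, 6703, 6719]),
     (11773298015359749350797741127816368502093,
      106830453126694647272435018201392083149,
      [6737, 6763, 6781, 6793, 6823, 6829, 6841, 6863, 6871, 6899]),
     (23107329683253793629360983249200034939989,
      274662494622250253636402748491344903813,
      [6911, 6947, 6959, 6967, 6977, 6991, 7001, 7079, 7109, 7127]),
     (10110252091817433082781554245268831705261,
      165521509063037297657603924947551965772,
      [7151, 7177, 7193, 7211, 7219, 7237, 7247, 7283, 7307, 7321]),
     (22727872257882500926710493178213210098727,
      492533164502100367796370814862176223246,
      [7333, 7351, 7393, 7417, 7451, 7459, 7481, 7489, 7507, 7523]),
     (23461785638399707790649415932061754917429,
      625301593305122697915338920642492028882,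
      [7537, 7547, 7559, 7573, 7583, 7591, 7607, 7639, 7649, 7673]),
     (305418868156007578128835053161677720003,
      10165859320998217632128525471575714239,
      [7687, 7699, 7717, 7727, 7753, 7759, 7793, 7823, 7841, 7867]),
     (2513104939875711153067001821839371188529,
      106759105991484740340445483085025340517,
      [7877, 7883, 7907, 7927, 7937, 7951, 7993, 8011, 8039, 8059]),
     (15376705579584712805626172206519156276061,
      833209841859750683390845906523469915839,
      [8081, 8089, 8101, 8117, 8147, 8167, 8179, 8209, 8221, 8233]),
     (11148588994622892168461062340031474633739,
      755325049038376519140365368611197824328,
      [8243, 8269, 8287, 8293, 8311, 8329, 8363, 8377, 8389, 8527]),
     (19400508014687326982763773698313622079919,
      1836911090607840311128497374039173002632,
      [8539, 8563, 8581, 8599, 8623, 8629, 8647, 8669, 8681, 8693]),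
     (13576976527037517162280336527055997908301,
      1535198918146416532643214169033932634589,
      [8707, 8719, 8737, 8747, 8761, 8783, 8807, 8821, 8837, 8849]),
     (16952181110810702650269174723454062705059,
      2352930225057544084241809452045452997107,
      [8863, 8887, 8923, 8933, 8951, 8969, 8999, 9007, 9013, 9041]),
     (22651297542553272753891839031558608022827,
      3909244813603542257701875712144827731086,
      [9049, 9067, 9103, 9127, 9137, 9157, 9203, 9221, 9239, 9257]),
     (3379412746465462736127639979459159801259,
      726181525274951126653786467158016273298,
      [9281, 9293, 9319, 9337, 9343, 9371, 9391, 9403, 9419, 9431]),
     (20442818442201384993131675954284152196483,
      5195378986849791740328939363393015678316,
      [9437, 9461, 9467, 9479, 9497, 9521, 9539, 9551, 9601, 9619]),
     (15291005670425096684287791039373519862887,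
      4736613192353602745038134958708539640671,
      [9629, 9643, 9661, 9679, 9697, 9721, 9739, 9749, 9769, 9787]),
     (23058085476930597959302714822318083057193,
      8476313205631841694900725449512881735164,
      [9803, 9817, 9833, 9851, 9859, 9883, 9901, 9923, 9931, 9949]),
     (22897912312910511119421350863758395079673,
      13621500207186434720811829846394040613291,
      [10273, 10301, 10313, 10331, 10337, 10357, 10391, 10427, 10433, 10457]),
     (16047755022670178763307360919881546227133,
      11561928406035028306548436717557005212825,
      [10463, 10487, 10501, 10529, 10559, 10589, 10601, 10613, 10631, 10651]),
     (15919726861709322924829829456885159824567,
      1002421338870795927038406,
      [10663, 10687, 10709, 10723, 10733, 10753])]"

text \<open>The entries written out here are below 107. They divide the product of
  \<open>small_primes\<close>, so the certificate cannot cover them, and their primality is checked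
  directly.\<close>

definition sample_primes :: "nat list" where
  "sample_primes = [5, 7, 11, 17, 19, 23, 29, 31, 37, 53, 59, 61, 67, 71, 97, 101, 103] @ concat (map (snd \<circ> snd) certified_blocks)"

lemma certified_blocks_bezout:
  "list_all (\<lambda>(a, b, ns). a * prod_list ns = 1 + b * prod_list small_primes) certified_blocks"
  by (simp add: certified_blocks_def small_primes_def)

lemma certified_blocks_range: "list_all (\<lambda>(a, b, ns). list_all (\<lambda>n. 1 < n \<and> n < 11449) ns) certified_blocks"
  by (simp add: certified_blocks_def)

lemma sorted_sample_primes: "sorted_wrt (<) sample_primes"
  by (simp add: sample_primes_def certified_blocks_def sorted_wrt2 sorted_wrt1 del: sorted_wrt.simps)

lemma prime_sample_primes: "p \<in> set sample_primes \<Longrightarrow> prime p"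
proof -
  assume "p \<in> set sample_primes"
  then consider "p \<in> set [5, 7, 11, 17, 19, 23, 29, 31, 37, 53, 59, 61, 67, 71, 97, 101, 103]" | a b ns where "(a, b, ns) \<in> set certified_blocks" "p \<in> set ns"
    unfolding sample_primes_def by fastforce
  thus "prime p"
  proof cases
    case 1
    thus ?thesis by auto
  next
    case 2
    have "a * prod_list ns = 1 + b * prod_list small_primes"
      using certified_blocks_bezout 2(1) by (auto simp: list_all_iff)
    moreover have "1 < p" "p < 107\<^sup>2" using certified_blocks_range 2 by (fastforce simp: list_all_iff)+
    ultimately show ?thesis using prime_by_certificate 2(2) by blast
  qed
qed

text \<open>An entry \<open>(k, m, m', i)\<close> covers \<open>m\<^sup>2 \<le> x < (m' + 1)\<^sup>2\<close>. Since \<open>2 ^ k \<le> m\<close>, the half length of the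
  interval is at least \<open>(2 * k + 2) * m\<close>, and it contains the \<open>m' + 1\<close> sample primes from index \<open>i\<close> on.\<close>

definition sample_ranges :: "(nat \<times> nat \<times> nat \<times> nat) list" where
  "sample_ranges = [(1, 2, 2, 0), (1, 3, 3, 0), (2, 4, 5, 3), (2, 6, 7, 6), (3, 8, 10, 10), (3, 11, 13, 18), (3,
    14, 15, 21), (4, 16, 17, 24), (4, 18, 19, 32), (4, 20, 21, 36), (4, 22, 23, 40), (4, 24, 25,
    46), (4, 26, 27, 53), (4, 28, 29, 59), (4, 30, 31, 66), (5, 32, 34, 75), (5, 35, 37, 86), (5,
    38, 40, 99), (5, 41, 43, 110), (5, 44, 46, 127), (5, 47, 49, 140), (5, 50, 52, 157), (5, 53,
    55, 174), (5, 56, 58, 194), (5, 59, 61, 212), (5, 62, 64, 232), (6, 65, 68, 254), (6, 69, 72,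
    285), (6, 73, 76, 309), (6, 77, 80, 343), (6, 81, 84, 370), (6, 85, 88, 407), (6, 89, 92, 440),
    (6, 93, 96, 480), (6, 97, 99, 503)]"

lemma sample_ranges_correct:
  "list_all (\<lambda>(k, m, m', i). 0 < m \<and> 2 ^ k \<le> m \<and> i + m' < 603 \<and> (m' + 1)\<^sup>2 \<le> sample_primes ! i + (2 * k + 2) * m \<and>
     sample_primes ! (i + m') < m\<^sup>2 + (2 * k + 2) * m) sample_ranges"
  by (simp add: sample_primes_def certified_blocks_def sample_ranges_def)

lemma length_sample_primes: "length sample_primes = 603"
  by (simp add: sample_primes_def certified_blocks_def)

lemma sample_ranges_cover:
  assumes "2 \<le> n" "n < 100"
  shows "\<exists>(k, m, m', i)\<in>set sample_ranges. m \<le> n \<and> n \<le> m'"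
proof -
  have "list_all (\<lambda>n. list_ex (\<lambda>(k, m, m', i). m \<le> n \<and> n \<le> m') sample_ranges) [2..<100]"
    by (simp add: sample_ranges_def upt_rec_numeral)
  moreover have "n \<in> set [2..<100]" unfolding set_upt using assms by (simp only: atLeastLessThan_iff)
  ultimately show ?thesis unfolding list_all_iff list_ex_iff by (rule bspec)
qed

text \<open>The analogue for the shorter interval, whose half length is at least \<open>(2 * k + 6) * m / 3\<close>; one prime suffices.\<close>

definition single_ranges :: "(nat \<times> nat \<times> nat \<times> nat) list" where
  "single_ranges = [(1, 2, 2, 1), (1, 3, 3, 2), (2, 4, 5, 6), (2, 6, 7, 9), (3, 8, 9, 13), (3, 10, 11, 19), (3,
    12, 14, 27), (3, 15, 17, 34), (4, 18, 21, 43), (4, 22, 24, 54), (4, 25, 28, 67), (4, 29, 32,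
    81), (5, 33, 36, 100), (5, 37, 40, 115), (5, 41, 44, 137), (5, 45, 48, 157), (5, 49, 53, 181),
    (5, 54, 58, 215), (5, 59, 63, 251), (6, 64, 68, 288), (6, 69, 73, 323), (6, 74, 78, 360), (6,
    79, 83, 402), (6, 84, 88, 445), (6, 89, 93, 493), (6, 94, 98, 539), (6, 99, 99, 564)]"

lemma single_ranges_correct:
  "list_all (\<lambda>(k, m, m', i). 2 ^ k \<le> m \<and> i < 603 \<and> 3 * (m' + 1)\<^sup>2 \<le> 3 * sample_primes ! i + (2 * k + 6) * m \<and>
     3 * sample_primes ! i < 3 * m\<^sup>2 + (2 * k + 6) * m) single_ranges"
  by (simp add: sample_primes_def certified_blocks_def single_ranges_def)

lemma single_ranges_cover:
  assumes "2 \<le> n" "n < 100"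
  shows "\<exists>(k, m, m', i)\<in>set single_ranges. m \<le> n \<and> n \<le> m'"
proof -
  have "list_all (\<lambda>n. list_ex (\<lambda>(k, m, m', i). m \<le> n \<and> n \<le> m') single_ranges) [2..<100]"
    by (simp add: single_ranges_def upt_rec_numeral)
  moreover have "n \<in> set [2..<100]" unfolding set_upt using assms by (simp only: atLeastLessThan_iff)
  ultimately show ?thesis unfolding list_all_iff list_ex_iff by (rule bspec)
qed

section \<open>The main theorem\<close>

lemma ln_ge_of_power_of_two_le: "2 ^ k \<le> (m::nat) \<Longrightarrow> 2 * real k / 3 \<le> ln (real m)"
proof -
  assume "2 ^ k \<le> m"
  hence "real (2 ^ k) \<le> real m" by (simp only: of_nat_le_iff)
  hence "ln (2 ^ k) \<le> ln (real m)" by (subst ln_le_cancel_iff) (auto intro: less_le_trans[of 0 "2 ^ k"])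
  moreover have "ln (2 ^ k :: real) = real k * ln 2" by (subst ln_realpow) auto
  moreover have "real k * (2 / 3) \<le> real k * ln 2" by (intro mult_left_mono ln2_ge_two_thirds) auto
  ultimately show ?thesis by simp
qed

text \<open>\<open>2 ^ k \<le> m\<close> gives \<open>ln x \<ge> 2 * ln m \<ge> 4 * k / 3\<close>.
  The values \<open>a = 1 / 2\<close> and \<open>a = 3 / 2\<close> belong to the two intervals of
  the theorem and yield the half lengths \<open>(2 * k + 6) * m / 3\<close> and
  \<open>(2 * k + 2) * m\<close> of the tables.\<close>

lemma half_length_ge:
  fixes x a :: real and m k :: nat
  assumes m: "0 < m" "2 ^ k \<le> m" "real (m\<^sup>2) \<le> x" and a: "a \<ge> 0"
  shows "(4 * a * real k / 3 + 2) * real m \<le> (a * ln x + 2) * sqrt x"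
proof (rule mult_mono)
  have "ln (real (m\<^sup>2)) \<le> ln x" using m by (subst ln_le_cancel_iff) (auto intro: less_le_trans[of 0 "real (m\<^sup>2)"])
  moreover have "ln (real (m\<^sup>2)) = 2 * ln (real m)" using m by (simp add: ln_realpow)
  ultimately have l: "4 * real k / 3 \<le> ln x" using ln_ge_of_power_of_two_le[OF m(2)] by linarith
  hence "a * (4 * real k / 3) \<le> a * ln x" using a by (intro mult_left_mono)
  thus "4 * a * real k / 3 + 2 \<le> a * ln x + 2" by simp
  show "real m \<le> sqrt x" using m by (intro real_le_rsqrt) simp
  show "0 \<le> a * ln x + 2" using a l by (intro add_nonneg_nonneg mult_nonneg_nonneg) auto
qed simp

lemma nat_sqrt_bounds:
  fixes x :: real
  assumes "4 \<le> x" "x < 10 ^ 4"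
  obtains n :: nat where "2 \<le> n" "n < 100" "real (n\<^sup>2) \<le> x" "x < real ((n + 1)\<^sup>2)"
proof -
  define n where "n = nat \<lfloor>sqrt x\<rfloor>"
  have s: "sqrt x \<ge> 2" "sqrt x < 100" using assms by (auto intro!: real_le_rsqrt real_less_lsqrt)
  have n: "real n \<le> sqrt x" "sqrt x < real n + 1" using s unfolding n_def by linarith+
  have "real n ^ 2 \<le> (sqrt x)\<^sup>2" using n by (intro power_mono) auto
  moreover have "(sqrt x)\<^sup>2 < (real n + 1) ^ 2" using n assms by (intro power_strict_mono) auto
  ultimately have "real (n\<^sup>2) \<le> x" "x < real ((n + 1)\<^sup>2)" using assms by (simp_all add: add.commute)
  moreover have "2 \<le> n" "n < 100" using s n unfolding n_def by linarith+
  ultimately show ?thesis using that by blast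
qed

lemma finite_primes_interval: "finite {p::nat. prime p \<and> a < real p \<and> real p < b}"
  by (rule finite_subset[of _ "{..nat \<lfloor>b\<rfloor>}"]) (auto simp: le_nat_floor)

text \<open>Only the integer part \<open>n\<close> of \<open>sqrt x\<close> selects the table row. A
  row treats all \<open>x\<close> from \<open>m^2\<close> to \<open>(m' + 1)^2\<close> at once: the
  half length is estimated at the left end, and the primes must be within reach from both
  ends.\<close>

lemma primes_medium:
  fixes x :: real
  assumes x: "4 \<le> x" "x < 10 ^ 4"
  shows "\<exists>p::nat. prime p \<and> x - (ln x / 2 + 2) * sqrt x < real p \<and> real p < x + (ln x / 2 + 2) * sqrt x" (is ?one)
    and "sqrt x \<le> real (card (primes_near x ((3 * ln x / 2 + 2) * sqrt x)))" (is ?many)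
proof -
  obtain n where n: "2 \<le> n" "n < 100" "real (n\<^sup>2) \<le> x" "x < real ((n + 1)\<^sup>2)"
    using nat_sqrt_bounds[OF x] by blast
  have lower: "real (m\<^sup>2) \<le> x" if "m \<le> n" for m
  proof -
    have "real (m\<^sup>2) \<le> real (n\<^sup>2)" using that by (intro of_nat_mono power_mono) auto
    thus ?thesis using n(3) by linarith
  qed
  have upper: "x < real ((m + 1)\<^sup>2)" if "n \<le> m" for m
  proof -
    have "real ((n + 1)\<^sup>2) \<le> real ((m + 1)\<^sup>2)" using that by (intro of_nat_mono power_mono) auto
    thus ?thesis using n(4) by linarith
  qed
  show ?one
  proof -
    obtain k m m' i where r: "(k, m, m', i) \<in> set single_ranges" "m \<le> n" "n \<le> m'"
      using single_ranges_cover[OF n(1,2)] by auto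
    define p where "p = sample_primes ! i"
    have c: "2 ^ k \<le> m" "i < 603" "3 * (m' + 1)\<^sup>2 \<le> 3 * p + (2 * k + 6) * m" "3 * p < 3 * m\<^sup>2 + (2 * k + 6) * m"
      using bspec[OF single_ranges_correct[unfolded list_all_iff] r(1)] unfolding p_def by simp_all
    have m0: "0 < m" using c(1) by (rule less_le_trans[rotated]) simp
    have "(4 * (1 / 2) * real k / 3 + 2) * real m \<le> (1 / 2 * ln x + 2) * sqrt x"
      by (rule half_length_ge[OF m0 c(1) lower[OF r(2)]]) simp
    hence h: "(2 * real k + 6) * real m \<le> 3 * ((ln x / 2 + 2) * sqrt x)" by (simp add: algebra_simps)
    have "real (3 * (m' + 1)\<^sup>2) \<le> real (3 * p + (2 * k + 6) * m)" using c(3) by (simp only: of_nat_le_iff)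
    hence 1: "3 * real ((m' + 1)\<^sup>2) \<le> 3 * real p + (2 * real k + 6) * real m" by (simp add: distrib_right)
    have "real (3 * p) < real (3 * m\<^sup>2 + (2 * k + 6) * m)" using c(4) by (simp only: of_nat_less_iff)
    hence 2: "3 * real p < 3 * real (m\<^sup>2) + (2 * real k + 6) * real m" by (simp add: distrib_right)
    have "prime p" unfolding p_def using c(2) length_sample_primes by (intro prime_sample_primes nth_mem) simp
    moreover have "x - (ln x / 2 + 2) * sqrt x < real p" "real p < x + (ln x / 2 + 2) * sqrt x"
      using 1 2 h upper[OF r(3)] lower[OF r(2)] by argo+
    ultimately show ?thesis by blast
  qed
  show ?many
  proof -
    obtain k m m' i where r: "(k, m, m', i) \<in> set sample_ranges" "m \<le> n" "n \<le> m'"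
      using sample_ranges_cover[OF n(1,2)] by auto
    have c: "0 < m" "2 ^ k \<le> m" "i + m' < 603" "(m' + 1)\<^sup>2 \<le> sample_primes ! i + (2 * k + 2) * m"
        "sample_primes ! (i + m') < m\<^sup>2 + (2 * k + 2) * m"
      using bspec[OF sample_ranges_correct[unfolded list_all_iff] r(1)] by simp_all
    define h where "h = (3 * ln x / 2 + 2) * sqrt x"
    have "(4 * (3 / 2) * real k / 3 + 2) * real m \<le> (3 / 2 * ln x + 2) * sqrt x"
      by (rule half_length_ge[OF c(1,2) lower[OF r(2)]]) simp
    hence h: "(2 * real k + 2) * real m \<le> h" by (simp add: h_def algebra_simps)
    have "real ((m' + 1)\<^sup>2) \<le> real (sample_primes ! i + (2 * k + 2) * m)" using c(4) by (simp only: of_nat_le_iff)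
    hence 1: "real ((m' + 1)\<^sup>2) \<le> real (sample_primes ! i) + (2 * real k + 2) * real m" by (simp add: distrib_right)
    have "real (sample_primes ! (i + m')) < real (m\<^sup>2 + (2 * k + 2) * m)" using c(5) by (simp only: of_nat_less_iff)
    hence 2: "real (sample_primes ! (i + m')) < real (m\<^sup>2) + (2 * real k + 2) * real m" by (simp add: distrib_right)
    have mono: "sample_primes ! a \<le> sample_primes ! b" if "a \<le> b" "b < 603" for a b
      using sorted_wrt_nth_less[OF sorted_sample_primes, of a b] that length_sample_primes by (cases "a = b") auto
    have inj: "inj_on ((!) sample_primes) {i..i + m'}"
    proof (rule linorder_inj_onI)
      fix a b assume "a < b" "a \<in> {i..i + m'}" "b \<in> {i..i + m'}"
      thus "sample_primes ! a \<noteq> sample_primes ! b"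
        using sorted_wrt_nth_less[OF sorted_sample_primes, of a b] c(3) length_sample_primes by auto
    qed auto
    have "(!) sample_primes ` {i..i + m'} \<subseteq> primes_near x h"
    proof safe
      fix j assume j: "j \<in> {i..i + m'}"
      show "prime (sample_primes ! j)"
        using j c(3) length_sample_primes by (intro prime_sample_primes nth_mem) simp
      have "real (sample_primes ! i) \<le> real (sample_primes ! j)" "real (sample_primes ! j) \<le> real (sample_primes ! (i + m'))"
        using mono[of i j] mono[of j "i + m'"] j c(3) by auto
      thus "x - h < real (sample_primes ! j)" "real (sample_primes ! j) < x + h"
        using 1 2 h upper[OF r(3)] lower[OF r(2)] by linarith+
    qed
    hence "card ((!) sample_primes ` {i..i + m'}) \<le> card (primes_near x h)"
      by (intro card_mono finite_primes_interval)
    hence "m' + 1 \<le> card (primes_near x h)"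
      unfolding card_image[OF inj] by simp
    moreover have "sqrt x \<le> real (m' + 1)"
      using upper[OF r(3)] by (intro real_le_lsqrt) (use x in \<open>auto simp: add.commute\<close>)
    ultimately show ?thesis unfolding h_def by linarith
  qed
qed

text \<open>\<open>sqrt x \<ge> 1.4\<close> and \<open>ln x \<ge> 2 / 3\<close> give half lengths of
  at least 2.8 and 4.2. The first reaches 3, the second 3 and 5, and two primes are enough as
  \<open>sqrt x < 2\<close>.\<close>

lemma primes_tiny:
  fixes x :: real
  assumes x: "2 \<le> x" "x < 4"
  shows "\<exists>p::nat. prime p \<and> x - (ln x / 2 + 2) * sqrt x < real p \<and> real p < x + (ln x / 2 + 2) * sqrt x" (is ?one)
    and "sqrt x \<le> real (card (primes_near x ((3 * ln x / 2 + 2) * sqrt x)))" (is ?many)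
proof -
  have "(14 / 10)\<^sup>2 \<le> x" using x by (simp add: power2_eq_square)
  hence "14 / 10 \<le> sqrt x" by (rule real_le_rsqrt)
  moreover have "sqrt x < 2" using x by (auto intro!: real_less_lsqrt)
  ultimately have s: "1.4 \<le> sqrt x" "sqrt x < 2" by simp_all
  have "ln 2 \<le> ln x" using x by (subst ln_le_cancel_iff) auto
  hence l: "2 / 3 \<le> ln x" using ln2_ge_two_thirds by linarith
  have "2 * 1.4 \<le> (ln x / 2 + 2) * sqrt x" using s l by (intro mult_mono) auto
  hence "x - (ln x / 2 + 2) * sqrt x < real 3" "real 3 < x + (ln x / 2 + 2) * sqrt x" using x by linarith+
  moreover have "prime (3::nat)" by simp
  ultimately show ?one by blast
  have "3 * 1.4 \<le> (3 * ln x / 2 + 2) * sqrt x" using s l by (intro mult_mono) auto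
  hence "{3, 5} \<subseteq> primes_near x ((3 * ln x / 2 + 2) * sqrt x)"
    using x by auto
  hence "card {3, 5::nat} \<le> card (primes_near x ((3 * ln x / 2 + 2) * sqrt x))"
    by (intro card_mono finite_primes_interval)
  thus ?many using s by simp
qed

theorem theorem1p1:
  fixes x c :: real
  assumes RH: "riemann_hypothesis"
    and x: "x \<ge> 2"
    and c: "c = 1 / 2 + 2 / ln x"
  shows "(\<exists>p::nat. prime p \<and> real p \<in> {x - c * sqrt x * ln x <..< x + c * sqrt x * ln x}) \<and>
    real (card {p::nat. prime p \<and>
      real p \<in> {x - (c + 1) * sqrt x * ln x <..< x + (c + 1) * sqrt x * ln x}}) \<ge> sqrt x"
proof -
  have l: "ln x > 0" using x by simp
  \<comment> \<open>Multiplying by \<open>ln x\<close> clears the denominator in \<open>c\<close>;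
    both half lengths become \<open>sqrt x\<close> times an affine function of
    \<open>ln x\<close>.\<close>
  have h1: "c * sqrt x * ln x = (ln x / 2 + 2) * sqrt x" and h2: "(c + 1) * sqrt x * ln x = (3 * ln x / 2 + 2) * sqrt x"
    using l by (simp_all add: c field_simps)
  consider "x < 4" | "4 \<le> x" "x < 10 ^ 4" | "10 ^ 4 \<le> x" by linarith
  thus ?thesis unfolding h1 h2 greaterThanLessThan_iff
    using primes_tiny[OF x] primes_medium RH_primes_large[OF RH] by cases blast+
qed

end
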